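(* Let $R$ be a commutative ring containing $\mathbb{Q}$, let $\mathfrak g$ be a Lie algebra over $R$, free of finite rank as an $R$-module, let $r\in\Lambda^2\mathfrak g$ be a non-degenerate classical $r$-matrix, let $\nabla$ be a symplectic torsion-free covariant derivative on $\mathfrak g$, let $s\in\mathrm S^2\mathfrak g$ satisfy $\nabla_Xs=0$ for all $X\in\mathfrak g$, put $\pi=r+s$, and let $\Omega\in t\Lambda^2\mathfrak g^*[[t]]$ be $\delta_{CE}$-closed. Let $\star$ be the associated Fedosov star product on $\mathrm T^\bullet(\mathscr U(\mathfrak g))[[t]]$, and let $1\in\mathscr U(\mathfrak g)$ be the unit of the universal enveloping algebra. Then $\mathcal F=1\star1\in(\mathscr U(\mathfrak g)\otimes\mathscr U(\mathfrak g))[[t]]$ is a twist, and $$1\star1=1\otimes1+\frac t2\,\pi+\mathcal O(t^2).$$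
   Context: Twist: an invertible $\mathcal F\in(\mathscr U(\mathfrak g)\otimes\mathscr U(\mathfrak g))[[t]]$ with $(\Delta\otimes\mathrm{id})(\mathcal F)(\mathcal F\otimes1)=(\mathrm{id}\otimes\Delta)(\mathcal F)(1\otimes\mathcal F)$, $(\epsilon\otimes\mathrm{id})\mathcal F=1=(\mathrm{id}\otimes\epsilon)\mathcal F$, and $\mathcal F=1\otimes1+\mathcal O(t)$, where $\Delta,\epsilon$ are the coproduct and counit of $\mathscr U(\mathfrak g)$. Setting. $e_1,\dots,e_n$ is a basis of $\mathfrak g$, $e^1,\dots,e^n$ the dual basis; summation convention is used. $r=r^{ij}e_i\otimes e_j$ (antisymmetric) is a classical $r$-matrix if $[[r,r]]=0$ for the extension of the Lie bracket to a Gerstenhaber bracket on $\Lambda^\bullet\mathfrak g$; non-degenerate means the matrix $(r^{ij})$ is invertible over $R$. $\omega=\frac12\omega_{ij}e^i\wedge e^j$ with $r^{ij}\omega_{jk}=\delta^i_k$ is the inverse of $r$. $\delta_{CE}$ is the Chevalley-Eilenberg differential on $\Lambda^\bullet\mathfrak g^*$ (trivial coefficients). Covariant derivative: a bilinear map $\nabla:\mathfrak g\times\mathfrak g\to\mathfrak g$; torsion-free: $\nabla_XY-\nabla_YX=[X,Y]$. $\nabla_X$ is extended to $\mathfrak g^*$ by $(\nabla_X\alpha)(Y)=-\alpha(\nabla_XY)$ and to all tensors as a derivation; symplectic: $\nabla_X\omega=0$ for all $X$. Curvature: $\tilde R(X,Y)=\nabla_X\nabla_Y-\nabla_Y\nabla_X-\nabla_{[X,Y]}$,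 and $\mathsf R=\frac14\omega(e_k,\tilde R(e_i,e_j)e_l)\,e^k\vee e^l\otimes e^i\wedge e^j\in \mathrm S^2\mathfrak g^*\otimes\Lambda^2\mathfrak g^*$. Formal Weyl algebra: $\mathcal W\otimes\Lambda^\bullet=\bigl(\prod_{k\ge0}\mathrm S^k\mathfrak g^*\otimes\Lambda^\bullet\mathfrak g^*\bigr)[[t]]$ with product $\mu$: $(f\otimes\alpha)(g\otimes\beta)=f\vee g\otimes\alpha\wedge\beta$. Total degree of $t^m\,\mathrm S^k\mathfrak g^*\otimes\Lambda^\ell\mathfrak g^*$ is $k+2m$; $\mathcal W_k\otimes\Lambda^\ell$ denotes elements of antisymmetric degree $\ell$ all of whose homogeneous components have total degree $\ge k$. $i_s(X)$, $i_a(X)$ are the symmetric and antisymmetric insertion derivations. $\delta=e^i\wedge i_s(e_i)$; $\delta^{-1}=\frac1{k+\ell}\,e^i\vee i_a(e_i)$ on $\mathrm S^k\mathfrak g^*\otimes\Lambda^\ell\mathfrak g^*$ if $k+\ell>0$ and $\delta^{-1}=0$ if $k=\ell=0$; $\sigma$ is the projection onto symmetric and antisymmetric degree $0$. With $\pi^{ij}=r^{ij}+s^{ij}$, $a\circ_\pi b=\mu\circ e^{\frac t2\mathcal P}(a\otimes b)$, $\mathcal P=\pi^{ij}i_s(e_i)\otimes i_s(e_j)$; $\mathrm{ad}(a)b=[a,b]$ is the graded $\circ_\pi$-commutator w.r.t. the antisymmetric degree. $D(f\otimes\alpha)=\nabla_{e_i}f\otimes e^i\wedge\alpha+f\otimes\delta_{CE}\alpha$.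 Given $\Omega$, there is a unique $\varrho\in\mathcal W_2\otimes\Lambda^1$ with $\delta\varrho=\mathsf R+D\varrho+\frac1t\varrho\circ_\pi\varrho+\Omega$ and $\delta^{-1}\varrho=0$. Star product on the tensor algebra: $\mathcal A=\mathrm T^\bullet(\mathscr U(\mathfrak g))$ is the tensor algebra over $R$ of the $R$-module $\mathscr U(\mathfrak g)$, with product $\otimes$; $X\in\mathfrak g$ acts on it by $L_X$, left multiplication by $X$ on $\mathscr U(\mathfrak g)$ extended as a derivation of $\otimes$. On $\mathcal A\otimes\mathcal W\otimes\Lambda^\bullet=\prod_k(\mathcal A\otimes \mathrm S^k\mathfrak g^*\otimes\Lambda^\bullet\mathfrak g^* )[[t]]$ (all operators above acting on the last two factors) put $m_\pi(\xi_1\otimes a_1,\xi_2\otimes a_2)=(\xi_1\otimes\xi_2)\otimes(a_1\circ_\pi a_2)$, $L(\xi\otimes f\otimes\alpha)=L_{e_i}\xi\otimes f\otimes e^i\wedge\alpha$, and $\tau(\xi)=\sum_{k\ge0}[\delta^{-1},D+L+\frac1t\mathrm{ad}(\varrho)]^k(\xi)$ for $\xi\in\mathcal A[[t]]$ (supercommutator w.r.t. antisymmetric degree, here an anticommutator). The Fedosov star product is $\xi\star\eta=\sigma(m_\pi(\tau(\xi),\tau(\eta)))$, an associative product on $\mathcal A[[t]]$. *)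

theory Defs
  imports Complex_Main
    "HOL-Library.Multiset"
    "HOL-Library.Poly_Mapping"
    "HOL-Library.Function_Algebras"
    "HOL-Computational_Algebra.Formal_Power_Series"
begin

unbundle fps_syntax

section \<open>Ground ring\<close>

text \<open>Commutative rings containing the rationals.  Since \<open>1 \<noteq> 0\<close> in \<open>comm_ring_1\<close>, a unital
  homomorphism out of the field of rationals is automatically injective; it is also unique.\<close>

class ring_containing_rat = comm_ring_1 +
  assumes ex_rat_hom: "\<exists>h :: rat \<Rightarrow> 'a. h 1 = 1 \<and>
    (\<forall>x y. h (x + y) = h x + h y) \<and> (\<forall>x y. h (x * y) = h x * h y)"

definition rat_const :: "rat \<Rightarrow> 'r::ring_containing_rat" where
  "rat_const = (THE h. h 1 = 1 \<and>
    (\<forall>x y. h (x + y) = h x + h y) \<and> (\<forall>x y. h (x * y) = h x * h y))"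

section \<open>Modules, Lie algebras, bases\<close>

definition bilinear_map ::
  "('r::comm_ring_1 \<Rightarrow> 'x::ab_group_add \<Rightarrow> 'x) \<Rightarrow> ('r \<Rightarrow> 'y::ab_group_add \<Rightarrow> 'y) \<Rightarrow>
   ('r \<Rightarrow> 'z::ab_group_add \<Rightarrow> 'z) \<Rightarrow> ('x \<Rightarrow> 'y \<Rightarrow> 'z) \<Rightarrow> bool" where
  "bilinear_map scX scY scZ b \<longleftrightarrow>
     (\<forall>x. module_hom scY scZ (b x)) \<and> (\<forall>y. module_hom scX scZ (\<lambda>x. b x y))"

definition lie_algebra ::
  "('r::comm_ring_1 \<Rightarrow> 'g::ab_group_add \<Rightarrow> 'g) \<Rightarrow> ('g \<Rightarrow> 'g \<Rightarrow> 'g) \<Rightarrow> bool" where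
  "lie_algebra sc br \<longleftrightarrow> module sc \<and> bilinear_map sc sc sc br \<and> (\<forall>x. br x x = 0) \<and>
     (\<forall>x y z. br x (br y z) + br y (br z x) + br z (br x y) = 0)"

text \<open>\<open>e 0, \<dots>, e (n - 1)\<close> is a basis; all indices below run over \<open>{..<n}\<close>, and \<open>n = 0\<close> is allowed.\<close>

definition is_basis ::
  "('r::comm_ring_1 \<Rightarrow> 'g::ab_group_add \<Rightarrow> 'g) \<Rightarrow> nat \<Rightarrow> (nat \<Rightarrow> 'g) \<Rightarrow> bool" where
  "is_basis sc n e \<longleftrightarrow> inj_on e {..<n} \<and> \<not> module.dependent sc (e ` {..<n}) \<and>
     module.span sc (e ` {..<n}) = UNIV"

definition dual_basis ::
  "('r::comm_ring_1 \<Rightarrow> 'g::ab_group_add \<Rightarrow> 'g) \<Rightarrow> nat \<Rightarrow> (nat \<Rightarrow> 'g) \<Rightarrow> nat \<Rightarrow> 'g \<Rightarrow> 'r" where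
  "dual_basis sc n e k x = module.representation sc (e ` {..<n}) x (e k)"

text \<open>\<open>coeffs sc n e b i j k\<close> is the coefficient of \<open>e k\<close> in \<open>b (e i) (e j)\<close>.  Applied to the Lie
  bracket it gives the structure constants, applied to \<open>nabla\<close> the Christoffel symbols.\<close>

definition coeffs ::
  "('r::comm_ring_1 \<Rightarrow> 'g::ab_group_add \<Rightarrow> 'g) \<Rightarrow> nat \<Rightarrow> (nat \<Rightarrow> 'g) \<Rightarrow> ('g \<Rightarrow> 'g \<Rightarrow> 'g) \<Rightarrow>
   nat \<Rightarrow> nat \<Rightarrow> nat \<Rightarrow> 'r" where
  "coeffs sc n e b i j k = dual_basis sc n e k (b (e i) (e j))"

section \<open>Universal enveloping algebra and tensor algebra\<close>

text \<open>Neither algebra can be a HOL type built from the bracket, which is a term.  Instead an arbitrary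
  model is characterised literally as a quotient: a surjection from a free algebra whose kernel is the
  ideal generated by the defining relations.  This determines it up to unique isomorphism.\<close>

text \<open>The free \<open>R\<close>-algebra on a set \<open>X\<close> is the monoid algebra of the free monoid on \<open>X\<close>.\<close>

datatype 'x fword = FWord (letters: "'x list")

instantiation fword :: (type) monoid_add
begin
definition "0 = FWord []"
definition "u + v = FWord (letters u @ letters v)"
instance by standard (simp_all add: zero_fword_def plus_fword_def)
end

type_synonym ('x, 'r) free_alg = "'x fword \<Rightarrow>\<^sub>0 'r"

definition free_gen :: "'x \<Rightarrow> ('x, 'r::comm_ring_1) free_alg" where
  "free_gen x = Poly_Mapping.single (FWord [x]) 1"

definition free_const :: "'r::comm_ring_1 \<Rightarrow> ('x, 'r) free_alg" where
  "free_const c = Poly_Mapping.single 0 c"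

definition free_eval ::
  "('r::comm_ring_1 \<Rightarrow> 'b::ring_1 \<Rightarrow> 'b) \<Rightarrow> ('x \<Rightarrow> 'b) \<Rightarrow> ('x, 'r) free_alg \<Rightarrow> 'b" where
  "free_eval sc f p =
     (\<Sum>w\<in>Poly_Mapping.keys p. sc (Poly_Mapping.lookup p w) (prod_list (map f (letters w))))"

inductive_set ideal_generated :: "'b::ring_1 set \<Rightarrow> 'b set" for S where
  gen: "x \<in> S \<Longrightarrow> x \<in> ideal_generated S"
| zero: "0 \<in> ideal_generated S"
| add: "x \<in> ideal_generated S \<Longrightarrow> y \<in> ideal_generated S \<Longrightarrow> x + y \<in> ideal_generated S"
| left: "x \<in> ideal_generated S \<Longrightarrow> a * x \<in> ideal_generated S"
| right: "x \<in> ideal_generated S \<Longrightarrow> x * a \<in> ideal_generated S"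

definition assoc_algebra :: "('r::comm_ring_1 \<Rightarrow> 'b::ring_1 \<Rightarrow> 'b) \<Rightarrow> bool" where
  "assoc_algebra sc \<longleftrightarrow> module sc \<and>
     (\<forall>c x y. sc c (x * y) = sc c x * y \<and> sc c (x * y) = x * sc c y)"

text \<open>\<open>B\<close> is the quotient of the free algebra on \<open>X\<close> by the two-sided ideal generated by \<open>Rel\<close>,
  \<open>f x\<close> being the class of the generator \<open>x\<close>.\<close>

definition is_quotient_of_free ::
  "('r::comm_ring_1 \<Rightarrow> 'b::ring_1 \<Rightarrow> 'b) \<Rightarrow> ('x \<Rightarrow> 'b) \<Rightarrow> ('x, 'r) free_alg set \<Rightarrow> bool" where
  "is_quotient_of_free sc f Rel \<longleftrightarrow> assoc_algebra sc \<and> surj (free_eval sc f) \<and>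
     {p. free_eval sc f p = 0} = ideal_generated Rel"

definition linearity_rels ::
  "('r::comm_ring_1 \<Rightarrow> 'x::ab_group_add \<Rightarrow> 'x) \<Rightarrow> ('x, 'r) free_alg set" where
  "linearity_rels sc =
     {free_gen (x + y) - free_gen x - free_gen y | x y. True} \<union>
     {free_gen (sc c x) - free_const c * free_gen x | c x. True}"

text \<open>\<open>(A, j)\<close> is the tensor algebra of the module \<open>M\<close>: the product of \<open>A\<close> is the tensor product
  and \<open>j\<close> is the inclusion of \<open>M\<close> as tensors of degree 1.\<close>

definition is_tensor_algebra ::
  "('r::comm_ring_1 \<Rightarrow> 'm::ab_group_add \<Rightarrow> 'm) \<Rightarrow> ('r \<Rightarrow> 'a::ring_1 \<Rightarrow> 'a) \<Rightarrow> ('m \<Rightarrow> 'a) \<Rightarrow> bool" where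
  "is_tensor_algebra scM scA j \<longleftrightarrow> is_quotient_of_free scA j (linearity_rels scM)"

text \<open>\<open>(U, \<iota>)\<close> is the tensor algebra of \<open>\<gg>\<close> modulo \<open>x \<otimes> y - y \<otimes> x - [x, y]\<close>.\<close>

definition is_enveloping_algebra ::
  "('r::comm_ring_1 \<Rightarrow> 'g::ab_group_add \<Rightarrow> 'g) \<Rightarrow> ('g \<Rightarrow> 'g \<Rightarrow> 'g) \<Rightarrow>
   ('r \<Rightarrow> 'u::ring_1 \<Rightarrow> 'u) \<Rightarrow> ('g \<Rightarrow> 'u) \<Rightarrow> bool" where
  "is_enveloping_algebra scG br scU \<iota> \<longleftrightarrow>
     is_quotient_of_free scU \<iota> (linearity_rels scG \<union>
       {free_gen x * free_gen y - free_gen y * free_gen x - free_gen (br x y) | x y. True})"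

section \<open>Twists\<close>

definition fps_bilin ::
  "('x \<Rightarrow> 'y \<Rightarrow> 'z::comm_monoid_add) \<Rightarrow> 'x fps \<Rightarrow> 'y fps \<Rightarrow> 'z fps" where
  "fps_bilin p f g = Abs_fps (\<lambda>m. \<Sum>i\<le>m. p (f $ i) (g $ (m - i)))"

definition fps_map :: "('x \<Rightarrow> 'y) \<Rightarrow> 'x fps \<Rightarrow> 'y fps" where
  "fps_map h f = Abs_fps (\<lambda>m. h (f $ m))"

text \<open>The parameters are the enveloping algebra \<open>(U, \<iota>)\<close> of \<open>\<gg>\<close> and the tensor algebra \<open>(A, j)\<close> of
  \<open>U\<close>.  The \<open>k\<close>-fold tensor power of \<open>U\<close> is the degree-\<open>k\<close> part of \<open>A\<close>.\<close>

context
  fixes scU :: "'r::ring_containing_rat \<Rightarrow> 'u::ring_1 \<Rightarrow> 'u"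
    and \<iota> :: "'g \<Rightarrow> 'u"
    and scA :: "'r \<Rightarrow> 'a::ring_1 \<Rightarrow> 'a"
    and j :: "'u \<Rightarrow> 'a"
begin

definition pure_tensor :: "'u list \<Rightarrow> 'a" where
  "pure_tensor us = prod_list (map j us)"

definition tensor_power :: "nat \<Rightarrow> 'a set" where
  "tensor_power k = module.span scA {pure_tensor us | us. length us = k}"

text \<open>The factorwise product of the algebras \<open>U \<otimes> \<dots> \<otimes> U\<close>, for all tensor powers at once
  (elements of different degrees multiply to 0).  Not to be confused with the product of \<open>A\<close>.\<close>

definition factorwise_mult :: "'a \<Rightarrow> 'a \<Rightarrow> 'a" where
  "factorwise_mult = (THE m. bilinear_map scA scA scA m \<and>
     (\<forall>us vs. m (pure_tensor us) (pure_tensor vs) =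
        (if length us = length vs then pure_tensor (map2 (*) us vs) else 0)))"

definition coproduct :: "'u \<Rightarrow> 'a" where
  "coproduct = (THE d. module_hom scU scA d \<and> range d \<subseteq> tensor_power 2 \<and>
     d 1 = j 1 * j 1 \<and> (\<forall>u v. d (u * v) = factorwise_mult (d u) (d v)) \<and>
     (\<forall>x. d (\<iota> x) = j (\<iota> x) * j 1 + j 1 * j (\<iota> x)))"

definition counit :: "'u \<Rightarrow> 'r" where
  "counit = (THE c. module_hom scU (*) c \<and> c 1 = 1 \<and> (\<forall>u v. c (u * v) = c u * c v) \<and>
     (\<forall>x. c (\<iota> x) = 0))"

text \<open>The linear map with \<open>u \<otimes> v \<mapsto> b u v\<close>, for bilinear \<open>b\<close>; it is extended by 0 to the other
  tensor degrees.\<close>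

definition on_tensors2 :: "('u \<Rightarrow> 'u \<Rightarrow> 'a) \<Rightarrow> 'a \<Rightarrow> 'a" where
  "on_tensors2 b = (THE h. module_hom scA scA h \<and>
     (\<forall>us. h (pure_tensor us) = (if length us = 2 then b (us ! 0) (us ! 1) else 0)))"

text \<open>In the counit conditions \<open>R \<otimes> U\<close> and \<open>U \<otimes> R\<close> are identified with \<open>U\<close>, i.e. with the
  degree-1 part of \<open>A\<close>.\<close>

definition is_twist :: "'a fps \<Rightarrow> bool" where
  "is_twist F \<longleftrightarrow>
     (\<forall>m. F $ m \<in> tensor_power 2) \<and>
     (\<exists>G. (\<forall>m. G $ m \<in> tensor_power 2) \<and>
        fps_bilin factorwise_mult F G = fps_const (j 1 * j 1) \<and>
        fps_bilin factorwise_mult G F = fps_const (j 1 * j 1)) \<and>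
     fps_bilin factorwise_mult (fps_map (on_tensors2 (\<lambda>u v. coproduct u * j v)) F) (F * fps_const (j 1)) =
     fps_bilin factorwise_mult (fps_map (on_tensors2 (\<lambda>u v. j u * coproduct v)) F) (fps_const (j 1) * F) \<and>
     fps_map (on_tensors2 (\<lambda>u v. j (scU (counit u) v))) F = fps_const (j 1) \<and>
     fps_map (on_tensors2 (\<lambda>u v. j (scU (counit v) u))) F = fps_const (j 1) \<and>
     F $ 0 = j 1 * j 1"

text \<open>\<open>L\<^sub>X\<close>\<close>

definition left_action :: "'g \<Rightarrow> 'a \<Rightarrow> 'a" where
  "left_action x = (THE d. module_hom scA scA d \<and> (\<forall>a b. d (a * b) = d a * b + a * d b) \<and>
     (\<forall>u. d (j u) = j (\<iota> x * u)))"

end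

section \<open>Exterior algebras in coordinates\<close>

text \<open>An element of \<open>V \<otimes> \<Lambda>\<close>, for the exterior algebra \<open>\<Lambda>\<close> of \<open>\<gg>\<close> or of its dual, is given by its
  coefficients: for \<open>J = {j\<^sub>1 < \<dots> < j\<^sub>l}\<close>, \<open>\<alpha> J\<close> is the coefficient of
  \<open>e\<^sup>j\<^sup>1 \<and> \<dots> \<and> e\<^sup>j\<^sup>l\<close>.  Genuine elements are supported on \<open>J \<subseteq> {..<n}\<close>.\<close>

type_synonym 'v ext = "nat set \<Rightarrow> 'v"

definition alt_sign :: "nat \<Rightarrow> 'v::ab_group_add \<Rightarrow> 'v" where
  "alt_sign k v = (if even k then v else - v)"

definition ext_one :: "'v::{zero, one} ext" where
  "ext_one J = (if J = {} then 1 else 0)"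

text \<open>\<open>e\<^sup>i \<and> \<alpha>\<close>\<close>

definition ext_mul :: "nat \<Rightarrow> 'v::ab_group_add ext \<Rightarrow> 'v ext" where
  "ext_mul i \<alpha> J = (if i \<in> J then alt_sign (card {k \<in> J. k < i}) (\<alpha> (J - {i})) else 0)"

text \<open>\<open>i\<^sub>a(e\<^sub>i) \<alpha>\<close>\<close>

definition ext_ins :: "nat \<Rightarrow> 'v::ab_group_add ext \<Rightarrow> 'v ext" where
  "ext_ins i \<alpha> J = (if i \<in> J then 0 else alt_sign (card {k \<in> J. k < i}) (\<alpha> (insert i J)))"

definition ext_wedge ::
  "('x \<Rightarrow> 'y \<Rightarrow> 'z::ab_group_add) \<Rightarrow> 'x ext \<Rightarrow> 'y ext \<Rightarrow> 'z ext" where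
  "ext_wedge p \<alpha> \<beta> J = (\<Sum>K\<in>Pow J. alt_sign (card {(k, l). k \<in> K \<and> l \<in> J - K \<and> l < k})
     (p (\<alpha> K) (\<beta> (J - K))))"

definition ext_scale :: "('r \<Rightarrow> 'v \<Rightarrow> 'v) \<Rightarrow> 'r \<Rightarrow> 'v ext \<Rightarrow> 'v ext" where
  "ext_scale sc c \<alpha> = (\<lambda>J. sc c (\<alpha> J))"

text \<open>Chevalley--Eilenberg differential: the antiderivation with
  \<open>\<delta>\<^sub>C\<^sub>E e\<^sup>k = - 1/2 C i j k e\<^sup>i \<and> e\<^sup>j\<close>, i.e. \<open>(\<delta>\<^sub>C\<^sub>E \<alpha>)(X, Y) = - \<alpha>([X, Y])\<close> on 1-forms.\<close>

definition chevalley_eilenberg ::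
  "nat \<Rightarrow> (nat \<Rightarrow> nat \<Rightarrow> nat \<Rightarrow> 'r::ring_containing_rat) \<Rightarrow> ('r \<Rightarrow> 'v::ab_group_add \<Rightarrow> 'v) \<Rightarrow>
   'v ext \<Rightarrow> 'v ext" where
  "chevalley_eilenberg n C sc \<alpha> =
     - (\<Sum>i<n. \<Sum>j<n. \<Sum>k<n. ext_scale sc (rat_const (1/2) * C i j k)
          (ext_mul i (ext_mul j (ext_ins k \<alpha>))))"

text \<open>Gerstenhaber bracket on the exterior algebra of \<open>\<gg>\<close>:
  \<open>[[X\<^sub>1 \<and> \<dots> \<and> X\<^sub>p, Y\<^sub>1 \<and> \<dots> \<and> Y\<^sub>q]]\<close> is the sum over \<open>a\<close>, \<open>b\<close> of \<open>(-1)\<^sup>a\<^sup>+\<^sup>b [X\<^sub>a, Y\<^sub>b] \<and> X' \<and> Y'\<close>, where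
  \<open>X'\<close> and \<open>Y'\<close> are the products without \<open>X\<^sub>a\<close> and \<open>Y\<^sub>b\<close>.\<close>

definition gerstenhaber ::
  "nat \<Rightarrow> (nat \<Rightarrow> nat \<Rightarrow> nat \<Rightarrow> 'r::comm_ring_1) \<Rightarrow> 'r ext \<Rightarrow> 'r ext \<Rightarrow> 'r ext" where
  "gerstenhaber n C P Q = (\<Sum>i<n. \<Sum>j<n. \<Sum>k<n. ext_scale (*) (C i j k)
     (ext_mul k (ext_wedge (*) (ext_ins i P) (ext_ins j Q))))"

text \<open>The element \<open>r i j e\<^sub>i \<otimes> e\<^sub>j = 1/2 r i j e\<^sub>i \<and> e\<^sub>j\<close> of \<open>\<Lambda>\<^sup>2 \<gg>\<close>.\<close>

definition bivector :: "nat \<Rightarrow> (nat \<Rightarrow> nat \<Rightarrow> 'r::ring_containing_rat) \<Rightarrow> 'r ext" where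
  "bivector n r = (\<Sum>i<n. \<Sum>j<n. ext_scale (*) (rat_const (1/2) * r i j)
     (ext_mul i (ext_mul j ext_one)))"

definition classical_r_matrix ::
  "('r::ring_containing_rat \<Rightarrow> 'g::ab_group_add \<Rightarrow> 'g) \<Rightarrow> ('g \<Rightarrow> 'g \<Rightarrow> 'g) \<Rightarrow> nat \<Rightarrow> (nat \<Rightarrow> 'g) \<Rightarrow>
   (nat \<Rightarrow> nat \<Rightarrow> 'r) \<Rightarrow> bool" where
  "classical_r_matrix scG br n e r \<longleftrightarrow>
     (\<forall>i<n. \<forall>j<n. r i j = - r j i) \<and>
     gerstenhaber n (coeffs scG n e br) (bivector n r) (bivector n r) = 0"

definition inverse_matrices ::
  "nat \<Rightarrow> (nat \<Rightarrow> nat \<Rightarrow> 'r::comm_ring_1) \<Rightarrow> (nat \<Rightarrow> nat \<Rightarrow> 'r) \<Rightarrow> bool" where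
  "inverse_matrices n r w \<longleftrightarrow> (\<forall>i<n. \<forall>k<n.
     (\<Sum>j<n. r i j * w j k) = (if i = k then 1 else 0) \<and>
     (\<Sum>j<n. w i j * r j k) = (if i = k then 1 else 0))"

section \<open>Covariant derivatives\<close>

text \<open>\<open>(1/2 w i j e\<^sup>i \<and> e\<^sup>j)(x, y)\<close>, for antisymmetric \<open>w\<close>\<close>

definition two_form ::
  "('r::comm_ring_1 \<Rightarrow> 'g::ab_group_add \<Rightarrow> 'g) \<Rightarrow> nat \<Rightarrow> (nat \<Rightarrow> 'g) \<Rightarrow> (nat \<Rightarrow> nat \<Rightarrow> 'r) \<Rightarrow>
   'g \<Rightarrow> 'g \<Rightarrow> 'r" where
  "two_form scG n e w x y =
     (\<Sum>i<n. \<Sum>j<n. w i j * dual_basis scG n e i x * dual_basis scG n e j y)"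

definition torsion_free :: "('g \<Rightarrow> 'g \<Rightarrow> 'g) \<Rightarrow> ('g \<Rightarrow> 'g \<Rightarrow> 'g::ab_group_add) \<Rightarrow> bool" where
  "torsion_free br nabla \<longleftrightarrow> (\<forall>x y. nabla x y - nabla y x = br x y)"

definition nabla_form ::
  "('g \<Rightarrow> 'g \<Rightarrow> 'g) \<Rightarrow> 'g \<Rightarrow> ('g \<Rightarrow> 'g \<Rightarrow> 'r::comm_ring_1) \<Rightarrow> 'g \<Rightarrow> 'g \<Rightarrow> 'r" where
  "nabla_form nabla x w y z = - w (nabla x y) z - w y (nabla x z)"

text \<open>The coefficients of \<open>\<nabla>\<^sub>x (s i j e\<^sub>i \<otimes> e\<^sub>j)\<close>.\<close>

definition nabla_tensor ::
  "('r::comm_ring_1 \<Rightarrow> 'g::ab_group_add \<Rightarrow> 'g) \<Rightarrow> nat \<Rightarrow> (nat \<Rightarrow> 'g) \<Rightarrow> ('g \<Rightarrow> 'g \<Rightarrow> 'g) \<Rightarrow> 'g \<Rightarrow>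
   (nat \<Rightarrow> nat \<Rightarrow> 'r) \<Rightarrow> nat \<Rightarrow> nat \<Rightarrow> 'r" where
  "nabla_tensor scG n e nabla x s i j =
     (\<Sum>k<n. s k j * dual_basis scG n e i (nabla x (e k)) +
             s i k * dual_basis scG n e j (nabla x (e k)))"

definition curvature ::
  "('g \<Rightarrow> 'g \<Rightarrow> 'g) \<Rightarrow> ('g \<Rightarrow> 'g \<Rightarrow> 'g::ab_group_add) \<Rightarrow> 'g \<Rightarrow> 'g \<Rightarrow> 'g \<Rightarrow> 'g" where
  "curvature br nabla x y z = nabla x (nabla y z) - nabla y (nabla x z) - nabla (br x y) z"

section \<open>Formal Weyl algebra\<close>

text \<open>An element of \<open>V \<otimes> \<W> \<otimes> \<Lambda>\<close> is likewise given by its coefficients: \<open>a M J $ m\<close> is the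
  coefficient of \<open>t\<^sup>m e\<^sup>i\<^sup>1 \<or> \<dots> \<or> e\<^sup>i\<^sup>k \<otimes> e\<^sup>j\<^sup>1 \<and> \<dots> \<and> e\<^sup>j\<^sup>l\<close>, with \<open>M\<close> the multiset
  of the \<open>i\<close>'s and \<open>J\<close> the set of the \<open>j\<close>'s.  Genuine elements are supported on indices below \<open>n\<close>; no
  other finiteness condition is needed, since for fixed \<open>m\<close> and \<open>k\<close> there are finitely many such
  monomials.  Here \<open>V\<close> is either \<open>R\<close> or the tensor algebra \<open>A\<close>, with scalar multiplication \<open>sc\<close>.\<close>

type_synonym 'v weyl = "nat multiset \<Rightarrow> 'v fps ext"

definition weyl_embed :: "'v::zero fps \<Rightarrow> 'v weyl" where
  "weyl_embed \<xi> M J = (if M = {#} \<and> J = {} then \<xi> else 0)"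

text \<open>the projection \<open>\<sigma>\<close>\<close>

definition weyl_proj :: "'v weyl \<Rightarrow> 'v fps" where
  "weyl_proj a = a {#} {}"

definition fps_scale :: "('r \<Rightarrow> 'v \<Rightarrow> 'v) \<Rightarrow> 'r \<Rightarrow> 'v fps \<Rightarrow> 'v fps" where
  "fps_scale sc c = fps_map (sc c)"

definition weyl_scale :: "('r \<Rightarrow> 'v \<Rightarrow> 'v) \<Rightarrow> 'r \<Rightarrow> 'v weyl \<Rightarrow> 'v weyl" where
  "weyl_scale sc c a = (\<lambda>M J. fps_scale sc c (a M J))"

text \<open>\<open>1/t\<close>; only applied to elements divisible by \<open>t\<close>\<close>

definition weyl_divide_t :: "'v::zero weyl \<Rightarrow> 'v weyl" where
  "weyl_divide_t a = (\<lambda>M J. fps_shift 1 (a M J))"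

text \<open>\<open>e\<^sup>i \<or>\<close>, \<open>i\<^sub>s(e\<^sub>i)\<close>, \<open>e\<^sup>i \<and>\<close>, \<open>i\<^sub>a(e\<^sub>i)\<close>\<close>

definition sym_mul :: "nat \<Rightarrow> 'v::zero weyl \<Rightarrow> 'v weyl" where
  "sym_mul i a = (\<lambda>M J. if i \<in># M then a (M - {#i#}) J else 0)"

definition sym_ins :: "nat \<Rightarrow> 'v::ring_1 weyl \<Rightarrow> 'v weyl" where
  "sym_ins i a = (\<lambda>M J. of_nat (count M i + 1) * a (add_mset i M) J)"

definition alt_mul :: "nat \<Rightarrow> 'v::ring_1 weyl \<Rightarrow> 'v weyl" where
  "alt_mul i a = (\<lambda>M. ext_mul i (a M))"

definition alt_ins :: "nat \<Rightarrow> 'v::ring_1 weyl \<Rightarrow> 'v weyl" where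
  "alt_ins i a = (\<lambda>M. ext_ins i (a M))"

text \<open>The product \<open>\<mu>\<close>, with \<open>p\<close> used to multiply the coefficients.\<close>

definition weyl_mu ::
  "('x \<Rightarrow> 'y \<Rightarrow> 'z::ring_1) \<Rightarrow> 'x weyl \<Rightarrow> 'y weyl \<Rightarrow> 'z weyl" where
  "weyl_mu p a b = (\<lambda>M. \<Sum>N | N \<subseteq># M. ext_wedge (fps_bilin p) (a N) (b (M - N)))"

definition alt_part :: "nat \<Rightarrow> 'v::zero weyl \<Rightarrow> 'v weyl" where
  "alt_part l a = (\<lambda>M J. if card J = l then a M J else 0)"

text \<open>\<open>\<W>\<^sub>k \<otimes> \<Lambda>\<^sup>l\<close>\<close>

definition weyl_space :: "nat \<Rightarrow> nat \<Rightarrow> nat \<Rightarrow> 'v::zero weyl set" where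
  "weyl_space n k l = {a. \<forall>M J m. a M J $ m \<noteq> 0 \<longrightarrow>
     set_mset M \<subseteq> {..<n} \<and> J \<subseteq> {..<n} \<and> card J = l \<and> k \<le> size M + 2 * m}"

text \<open>\<open>\<Omega> \<in> t \<Lambda>\<^sup>l \<gg>\<^sup>*[[t]]\<close>\<close>

definition formal_forms :: "nat \<Rightarrow> nat \<Rightarrow> 'v::zero fps ext set" where
  "formal_forms n l = {\<alpha>. \<forall>J. (\<alpha> J \<noteq> 0 \<longrightarrow> J \<subseteq> {..<n} \<and> card J = l) \<and> \<alpha> J $ 0 = 0}"

definition weyl_of_form :: "'v::zero fps ext \<Rightarrow> 'v weyl" where
  "weyl_of_form \<alpha> M J = (if M = {#} then \<alpha> J else 0)"

definition weyl_curvature ::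
  "('r::ring_containing_rat \<Rightarrow> 'g::ab_group_add \<Rightarrow> 'g) \<Rightarrow> ('g \<Rightarrow> 'g \<Rightarrow> 'g) \<Rightarrow> nat \<Rightarrow> (nat \<Rightarrow> 'g) \<Rightarrow>
   ('g \<Rightarrow> 'g \<Rightarrow> 'g) \<Rightarrow> (nat \<Rightarrow> nat \<Rightarrow> 'r) \<Rightarrow> 'r weyl" where
  "weyl_curvature scG br n e nabla w =
     (\<Sum>i<n. \<Sum>j<n. \<Sum>k<n. \<Sum>l<n.
        weyl_scale (*) (rat_const (1/4) *
            two_form scG n e w (e k) (curvature br nabla (e i) (e j) (e l)))
          (sym_mul k (sym_mul l (alt_mul i (alt_mul j (weyl_embed 1))))))"

section \<open>Fedosov construction\<close>

text \<open>\<open>C\<close>, \<open>\<Gamma>\<close>, \<open>\<pi>\<close> are the structure constants, the Christoffel symbols and the coefficients of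
  \<open>\<pi> = r + s\<close>.\<close>

context
  fixes n :: nat
    and C :: "nat \<Rightarrow> nat \<Rightarrow> nat \<Rightarrow> 'r::ring_containing_rat"
    and \<Gamma> :: "nat \<Rightarrow> nat \<Rightarrow> nat \<Rightarrow> 'r"
    and \<pi> :: "nat \<Rightarrow> nat \<Rightarrow> 'r"
begin

definition delta :: "'v::ring_1 weyl \<Rightarrow> 'v weyl" where
  "delta a = (\<Sum>i<n. alt_mul i (sym_ins i a))"

definition delta_inv :: "('r \<Rightarrow> 'v \<Rightarrow> 'v) \<Rightarrow> 'v::ring_1 weyl \<Rightarrow> 'v weyl" where
  "delta_inv sc a = (\<lambda>M J. if size M + card J = 0 then 0 else
     fps_scale sc (rat_const (1 / of_nat (size M + card J)))
       ((\<Sum>i<n. sym_mul i (alt_ins i a)) M J))"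

text \<open>\<open>mu_P p sc k a b = \<mu> (\<P>\<^sup>k (a \<otimes> b))\<close>\<close>

primrec mu_P ::
  "('x::ring_1 \<Rightarrow> 'y::ring_1 \<Rightarrow> 'z::ring_1) \<Rightarrow> ('r \<Rightarrow> 'z \<Rightarrow> 'z) \<Rightarrow> nat \<Rightarrow>
   'x weyl \<Rightarrow> 'y weyl \<Rightarrow> 'z weyl" where
  "mu_P p sc 0 a b = weyl_mu p a b"
| "mu_P p sc (Suc k) a b =
     (\<Sum>i<n. \<Sum>j<n. weyl_scale sc (\<pi> i j) (mu_P p sc k (sym_ins i a) (sym_ins j b)))"

text \<open>\<open>a \<circ>\<^sub>\<pi> b\<close>, the sum over \<open>k\<close> of \<open>t\<^sup>k / (2\<^sup>k k!) \<mu> (\<P>\<^sup>k (a \<otimes> b))\<close>.  For \<open>p\<close> the product of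
  \<open>A\<close> this is \<open>m\<^sub>\<pi>\<close>.\<close>

definition weyl_circ ::
  "('x::ring_1 \<Rightarrow> 'y::ring_1 \<Rightarrow> 'z::ring_1) \<Rightarrow> ('r \<Rightarrow> 'z \<Rightarrow> 'z) \<Rightarrow>
   'x weyl \<Rightarrow> 'y weyl \<Rightarrow> 'z weyl" where
  "weyl_circ p sc a b = (\<lambda>M J. Abs_fps (\<lambda>m. \<Sum>k\<le>m.
     sc (rat_const (1 / (2 ^ k * fact k))) (mu_P p sc k a b M J $ (m - k))))"

text \<open>Graded commutator of an element of \<open>\<W> \<otimes> \<Lambda>\<close> and one of \<open>V \<otimes> \<W> \<otimes> \<Lambda>\<close>.\<close>

definition weyl_ad :: "('r \<Rightarrow> 'v \<Rightarrow> 'v) \<Rightarrow> 'r weyl \<Rightarrow> 'v::ring_1 weyl \<Rightarrow> 'v weyl" where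
  "weyl_ad sc a b = (\<Sum>k\<le>n. \<Sum>l\<le>n.
     weyl_circ sc sc (alt_part k a) (alt_part l b) -
     alt_sign (k * l) (weyl_circ (\<lambda>v c. sc c v) sc (alt_part l b) (alt_part k a)))"

text \<open>\<open>\<nabla>\<close> along \<open>e\<^sub>i\<close> on the symmetric factor: the derivation with
  \<open>e\<^sup>k \<mapsto> - \<Gamma> i j k e\<^sup>j\<close>.\<close>

definition nabla_sym :: "('r \<Rightarrow> 'v \<Rightarrow> 'v) \<Rightarrow> nat \<Rightarrow> 'v::ring_1 weyl \<Rightarrow> 'v weyl" where
  "nabla_sym sc i a = - (\<Sum>j<n. \<Sum>k<n. weyl_scale sc (\<Gamma> i j k) (sym_mul j (sym_ins k a)))"

definition weyl_D :: "('r \<Rightarrow> 'v \<Rightarrow> 'v) \<Rightarrow> 'v::ring_1 weyl \<Rightarrow> 'v weyl" where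
  "weyl_D sc a = (\<Sum>i<n. alt_mul i (nabla_sym sc i a)) +
     (\<lambda>M. chevalley_eilenberg n C (fps_scale sc) (a M))"

definition weyl_L :: "(nat \<Rightarrow> 'v \<Rightarrow> 'v) \<Rightarrow> 'v::ring_1 weyl \<Rightarrow> 'v weyl" where
  "weyl_L act a = (\<Sum>i<n. alt_mul i (\<lambda>M J. fps_map (act i) (a M J)))"

text \<open>the element \<open>\<rho>\<close> determined by the curvature \<open>Rc\<close> and by \<open>\<Omega>\<close>\<close>

definition fedosov_rho :: "'r weyl \<Rightarrow> 'r fps ext \<Rightarrow> 'r weyl" where
  "fedosov_rho Rc \<Omega> = (THE \<rho>. \<rho> \<in> weyl_space n 2 1 \<and>
     delta \<rho> = Rc + weyl_D (*) \<rho> + weyl_divide_t (weyl_circ (*) (*) \<rho> \<rho>) + weyl_of_form \<Omega> \<and>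
     delta_inv (*) \<rho> = 0)"

definition fedosov_op ::
  "('r \<Rightarrow> 'v \<Rightarrow> 'v) \<Rightarrow> (nat \<Rightarrow> 'v \<Rightarrow> 'v) \<Rightarrow> 'r weyl \<Rightarrow> 'v::ring_1 weyl \<Rightarrow> 'v weyl" where
  "fedosov_op sc act \<rho> a = weyl_D sc a + weyl_L act a + weyl_divide_t (weyl_ad sc \<rho> a)"

text \<open>\<open>Sum_any\<close> sums the nonzero terms.  In each coefficient there are finitely many of them, since the
  anticommutator below raises the total degree.\<close>

definition fedosov_tau ::
  "('r \<Rightarrow> 'v \<Rightarrow> 'v) \<Rightarrow> (nat \<Rightarrow> 'v \<Rightarrow> 'v) \<Rightarrow> 'r weyl \<Rightarrow> 'v::ring_1 fps \<Rightarrow> 'v weyl" where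
  "fedosov_tau sc act \<rho> \<xi> = (\<lambda>M J. Abs_fps (\<lambda>m. Sum_any (\<lambda>k.
     (((\<lambda>a. delta_inv sc (fedosov_op sc act \<rho> a) + fedosov_op sc act \<rho> (delta_inv sc a)) ^^ k)
        (weyl_embed \<xi>)) M J $ m)))"

definition fedosov_star ::
  "('r \<Rightarrow> 'v \<Rightarrow> 'v) \<Rightarrow> (nat \<Rightarrow> 'v \<Rightarrow> 'v) \<Rightarrow> 'r weyl \<Rightarrow> 'v::ring_1 fps \<Rightarrow> 'v fps \<Rightarrow> 'v fps" where
  "fedosov_star sc act \<rho> \<xi> \<eta> =
     weyl_proj (weyl_circ (*) sc (fedosov_tau sc act \<rho> \<xi>) (fedosov_tau sc act \<rho> \<eta>))"

end

text \<open>The Fedosov star product on \<open>T(U(\<gg>))[[t]]\<close>; \<open>w\<close> is the inverse of \<open>r\<close>.\<close>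

definition tensor_star ::
  "('r::ring_containing_rat \<Rightarrow> 'g::ab_group_add \<Rightarrow> 'g) \<Rightarrow> ('g \<Rightarrow> 'g \<Rightarrow> 'g) \<Rightarrow> nat \<Rightarrow> (nat \<Rightarrow> 'g) \<Rightarrow>
   (nat \<Rightarrow> nat \<Rightarrow> 'r) \<Rightarrow> (nat \<Rightarrow> nat \<Rightarrow> 'r) \<Rightarrow> ('g \<Rightarrow> 'g \<Rightarrow> 'g) \<Rightarrow> (nat \<Rightarrow> nat \<Rightarrow> 'r) \<Rightarrow>
   'r fps ext \<Rightarrow> ('g \<Rightarrow> 'u::ring_1) \<Rightarrow> ('r \<Rightarrow> 'a::ring_1 \<Rightarrow> 'a) \<Rightarrow> ('u \<Rightarrow> 'a) \<Rightarrow>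
   'a fps \<Rightarrow> 'a fps \<Rightarrow> 'a fps" where
  "tensor_star scG br n e r w nabla s \<Omega> \<iota> scA j =
     (let C = coeffs scG n e br;
          \<Gamma> = coeffs scG n e nabla;
          \<pi> = (\<lambda>i k. r i k + s i k)
      in fedosov_star n C \<Gamma> \<pi> scA (\<lambda>i. left_action \<iota> scA j (e i))
           (fedosov_rho n C \<Gamma> \<pi> (weyl_curvature scG br n e nabla w) \<Omega>))"

end

theory Submission imports Defs begin

text \<open>The operator \<open>D + L + (1/t) ad(\<rho>) - \<delta>\<close> is a \<open>\<bullet>\<close>-derivation of square zero, and \<open>\<tau>\<close> is
  the bijection from \<open>A[[t]]\<close> onto its kernel in antisymmetric degree 0, inverse to the projection.
  Hence \<open>\<tau>(\<xi> \<star> \<eta>) = \<tau>(\<xi>) \<bullet> \<tau>(\<eta>)\<close>, and \<open>\<star>\<close> is associative.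

  All ingredients are natural in the coefficients. Write \<open>\<tau>\<^sub>U\<close> for the same series with coefficients
  in \<open>U(g)\<close> and initial value 1. For \<open>a\<close> in the tensor algebra let \<open>ev a : U(g) \<rightarrow> A\<close> be \<open>u \<mapsto> u a\<close>,
  for the action by derivations; then \<open>\<tau>(a) = (ev a)(\<tau>\<^sub>U)\<close>, so that \<open>a \<star> b\<close> is the image of
  \<open>F = 1 \<star> 1\<close> under \<open>ev a \<otimes> ev b\<close>. On tensors of degree 2, \<open>ev a u = \<Delta>(u) a\<close>: therefore
  \<open>F \<star> 1\<close> and \<open>1 \<star> F\<close> are the two sides of the twist equation, which is thus the associativity
  \<open>(1 \<star> 1) \<star> 1 = 1 \<star> (1 \<star> 1)\<close>. The counit maps \<open>\<tau>\<^sub>U\<close> to the flat section \<open>\<tau>(1) = 1\<close> with scalar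
  coefficients, which gives the normalisation. Invertibility follows from \<open>F = 1 \<otimes> 1 + O(t)\<close>.\<close>

section \<open>Rational scalars\<close>

text \<open>The unit of \<open>U\<close> is the tensor \<open>j 1\<close> of degree 1, and
  \<open>LA x\<close> sends it to \<open>j (\<iota> x)\<close>; the derivations kill only the empty
  tensor, the unit of \<open>A\<close>. Hence \<open>1 \<star> 1\<close> carries information
  although \<open>\<tau>(1) = 1\<close> for the empty tensor. Left multiplication is not a
  derivation of \<open>U\<close>, so the theory of flat sections does not apply to coefficients in
  \<open>U\<close>. It is developed for algebras with acting derivations and used twice: for
  \<open>A\<close>, and for the ground ring with zero action. Over \<open>U\<close> only the series
  \<open>tauU\<close> occurs, which needs linearity alone. The element \<rho> is found over the
  ground ring, where coefficients commute, and carried to \<open>A\<close>. Its image has central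
  coefficients, so its graded commutators are divisible by \<open>t\<close> although
  \<open>A\<close> is noncommutative. Identities between products avoid sums over triple splittings:
  the insertions are derivations, so applying them to both sides lowers the degree down to 0. Going
  back means cancelling positive integers, for which the rationals are available.\<close>

lemma rat_hom_unique:
  fixes h g :: "rat \<Rightarrow> 'r::comm_ring_1"
  assumes h: "h 1 = 1" "\<forall>x y. h (x + y) = h x + h y" "\<forall>x y. h (x * y) = h x * h y"
    and g: "g 1 = 1" "\<forall>x y. g (x + y) = g x + g y" "\<forall>x y. g (x * y) = g x * g y"
  shows "h = g"
proof -
  have of_int: "f (of_int k) = of_int k"
    if f: "f 1 = 1" "\<forall>x y. f (x + y) = f x + f y" for f :: "rat \<Rightarrow> 'r" and k
  proof -
    interpret additive f using f by unfold_locales auto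
    have "f (of_nat m) = of_nat m" for m
      by (induction m) (simp_all add: zero add f(1))
    then show ?thesis by (cases k rule: int_cases2) (simp_all add: minus)
  qed
  show ?thesis
  proof
    fix q :: rat
    obtain a b where b: "b \<noteq> 0" and q: "q = of_int a / of_int b"
      by (metis Fract_of_int_quotient Rat_cases less_irrefl)
    \<comment> \<open>Compatibility with inverses is not assumed, so \<open>g (1 / of_int b)\<close>
      is brought in as an explicit inverse of \<open>of_int b\<close> in the target ring.\<close>
    have "of_int b * g (1 / of_int b) = g (of_int b * (1 / of_int b))"
      using g of_int[OF g(1,2), of b] by metis
    then have inv: "of_int b * g (1 / of_int b) = 1" using b g(1) by simp
    have "h q = h q * (of_int b * g (1 / of_int b))" by (simp add: inv)
    also have "\<dots> = h (q * of_int b) * g (1 / of_int b)"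
      using h of_int[OF h(1,2), of b] by (metis mult.assoc)
    also have "q * of_int b = of_int a" using b q by simp
    also have "h (of_int a) * g (1 / of_int b) = g (of_int a * (1 / of_int b))"
      using g of_int[OF g(1,2), of a] of_int[OF h(1,2), of a] by metis
    also have "\<dots> = g q" by (simp add: q)
    finally show "h q = g q" .
  qed
qed

lemma rat_const_hom:
  fixes h :: "rat \<Rightarrow> 'r::ring_containing_rat"
  defines "h \<equiv> rat_const"
  shows "h 1 = 1 \<and> (\<forall>x y. h (x + y) = h x + h y) \<and> (\<forall>x y. h (x * y) = h x * h y)"
proof -
  let ?P = "\<lambda>h :: rat \<Rightarrow> 'r. h 1 = 1 \<and>
    (\<forall>x y. h (x + y) = h x + h y) \<and> (\<forall>x y. h (x * y) = h x * h y)"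
  obtain h where h: "?P h" using ex_rat_hom by blast
  then have "\<exists>!h. ?P h"
    by (intro ex1I[of ?P h]) (simp, intro rat_hom_unique, simp_all)
  then have "?P (THE h. ?P h)" by (rule theI')
  then show ?thesis unfolding h_def rat_const_def .
qed

lemma rat_const_1 [simp]: "rat_const 1 = 1"
  and rat_const_add: "rat_const (x + y) = rat_const x + rat_const y"
  and rat_const_mult: "rat_const (x * y) = rat_const x * rat_const y"
  using rat_const_hom by auto

lemma rat_const_0 [simp]: "rat_const 0 = 0"
  using rat_const_add[of 0 0] by simp

lemma rat_const_of_nat: "rat_const (of_nat k) = of_nat k"
  by (induction k) (simp_all add: rat_const_add)

text \<open>This lets positive integers be cancelled in every module over the ground ring.\<close>

lemma rat_const_inverse_nat:
  assumes "k > 0" shows "rat_const (1 / of_nat k) * of_nat k = 1"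
  using rat_const_mult[of "1 / of_nat k" "of_nat k"] assms by (simp add: rat_const_of_nat)

lemma rat_const_half: "rat_const (1/2) + rat_const (1/2) = 1"
  using rat_const_add[of "1/2" "1/2"] by simp

section \<open>Creation and annihilation operators\<close>

lemma alt_sign_0 [simp]: "alt_sign 0 v = v" by (simp add: alt_sign_def)

lemma alt_sign_Suc [simp]: "alt_sign (Suc k) v = - alt_sign k v"
  by (simp add: alt_sign_def)

lemma alt_sign_alt_sign: "alt_sign k (alt_sign l v) = alt_sign (k + l) v"
  by (auto simp: alt_sign_def)

lemma alt_sign_cong_parity: "even k = even l \<Longrightarrow> alt_sign k v = alt_sign l v"
  by (simp add: alt_sign_def)

interpretation alt_sign: additive "alt_sign k :: 'v::ab_group_add \<Rightarrow> 'v" for k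
  by unfold_locales (simp add: alt_sign_def)

declare alt_sign.zero [simp] alt_sign.add [simp] alt_sign.minus [simp] alt_sign.diff [simp]

lemma fun_additive_sum: "(\<Sum>i\<in>A. f i :: 'x \<Rightarrow> 'y::comm_monoid_add) x = (\<Sum>i\<in>A. f i x)"
  by (induction A rule: infinite_finite_induct) auto

text \<open>The number of transpositions that bring a factor with index \<open>i\<close> from the
  front to its sorted place, hence the exponent of the sign.\<close>

definition below :: "nat \<Rightarrow> nat set \<Rightarrow> nat" where
  "below i J = card {k \<in> J. k < i}"

lemma below_insert: "i \<notin> J \<Longrightarrow> below j (insert i J) = below j J + (if i < j then 1 else 0)"
proof -
  assume "i \<notin> J"
  moreover have "{k \<in> insert i J. k < j} =
    (if i < j then insert i {k \<in> J. k < j} else {k \<in> J. k < j})" by auto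
  ultimately show ?thesis unfolding below_def by simp
qed

lemma below_remove: "i \<in> J \<Longrightarrow> below j J = below j (J - {i}) + (if i < j then 1 else 0)"
  using below_insert[of i "J - {i}" j] by (simp add: insert_absorb)

lemma ext_mul_below: "ext_mul i \<alpha> J = (if i \<in> J then alt_sign (below i J) (\<alpha> (J - {i})) else 0)"
  by (simp add: ext_mul_def below_def)

lemma ext_ins_below: "ext_ins i \<alpha> J = (if i \<in> J then 0 else alt_sign (below i J) (\<alpha> (insert i J)))"
  by (simp add: ext_ins_def below_def)

lemma alt_mul_apply: "alt_mul i a M J = (if i \<in> J then alt_sign (below i J) (a M (J - {i})) else 0)"
  by (simp add: alt_mul_def ext_mul_below)

lemma alt_ins_apply: "alt_ins i a M J = (if i \<in> J then 0 else alt_sign (below i J) (a M (insert i J)))"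
  by (simp add: alt_ins_def ext_ins_below)

interpretation sym_mul: additive "sym_mul i :: 'v::ring_1 weyl \<Rightarrow> _" for i
  by unfold_locales (simp add: sym_mul_def fun_eq_iff)

interpretation sym_ins: additive "sym_ins i :: 'v::ring_1 weyl \<Rightarrow> _" for i
  by unfold_locales (simp add: sym_ins_def fun_eq_iff algebra_simps)

interpretation alt_mul: additive "alt_mul i :: 'v::ring_1 weyl \<Rightarrow> _" for i
  by unfold_locales (simp add: alt_mul_apply fun_eq_iff alt_sign.add)

interpretation alt_ins: additive "alt_ins i :: 'v::ring_1 weyl \<Rightarrow> _" for i
  by unfold_locales (simp add: alt_ins_apply fun_eq_iff alt_sign.add)

section \<open>Commutation and anticommutation relations\<close>

lemma sym_mul_commute: "sym_mul i (sym_mul j a) = sym_mul j (sym_mul i a)"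
proof -
  have *: "(i \<in># M \<and> j \<in># M - {#i#}) = (j \<in># M \<and> i \<in># M - {#j#})" for M
    by (cases "i = j") (auto simp: in_diff_count)
  have **: "sym_mul i (sym_mul j a) M J =
    (if i \<in># M \<and> j \<in># M - {#i#} then a (M - {#i#} - {#j#}) J else 0)" for i j M J
    by (simp add: sym_mul_def)
  show ?thesis by (intro ext) (simp only: ** * diff_right_commute)
qed

lemma sym_ins_commute: "sym_ins i (sym_ins j a) = sym_ins j (sym_ins i (a :: 'v::ring_1 weyl))"
proof (cases "i = j")
  case False
  have "of_nat k * (of_nat l * x) = of_nat l * (of_nat k * x)" for k l and x :: "'v fps"
    by (metis mult.assoc mult_of_nat_commute)
  then show ?thesis using False
    unfolding sym_ins_def fun_eq_iff by (simp add: add_mset_commute del: of_nat_add of_nat_Suc)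
qed simp

text \<open>The weight \<open>count M i + 1\<close> makes \<open>sym_ins\<close> a partial
  derivative, so this is the canonical commutation relation.\<close>

lemma sym_ins_sym_mul:
  "sym_ins i (sym_mul j a) = sym_mul j (sym_ins i a) + (if i = j then (a :: 'v::ring_1 weyl) else 0)"
proof (intro ext)
  fix M J
  show "sym_ins i (sym_mul j a) M J = (sym_mul j (sym_ins i a) + (if i = j then a else 0)) M J"
  proof (cases "i = j")
    case True
    show ?thesis
    proof (cases "j \<in># M")
      case True
      then obtain N where "M = add_mset j N" by (blast dest: multi_member_split)
      then show ?thesis using \<open>i = j\<close> by (simp add: sym_ins_def sym_mul_def algebra_simps)
    next
      case False
      then have "count M j = 0" by (simp add: not_in_iff)
      with False show ?thesis using \<open>i = j\<close> by (simp add: sym_ins_def sym_mul_def)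
    qed
  next
    case False
    then show ?thesis
      by (auto simp: sym_ins_def sym_mul_def)
  qed
qed

text \<open>Taking out the smaller index changes the number of elements below the larger one, but
  not conversely; so exactly one of the two orders picks up an extra sign.\<close>

lemma alt_mul_anticommute: "alt_mul i (alt_mul j a) = - alt_mul j (alt_mul i (a :: 'v::ring_1 weyl))"
proof -
  have less: "alt_mul i (alt_mul j a) M J = - alt_mul j (alt_mul i a) M J"
    if "i < j" for i j :: nat and a :: "'v weyl" and M J
  proof (cases "i \<in> J \<and> j \<in> J")
    case True
    have "below j J = below j (J - {i}) + 1" "below i (J - {j}) = below i J"
      using True that below_remove[of i J j] below_remove[of j J i] by auto
    moreover have "J - {i} - {j} = J - {i, j}" "J - {j} - {i} = J - {i, j}" by auto
    ultimately show ?thesis using True that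
      by (simp add: alt_mul_apply alt_sign_alt_sign add.commute)
  qed (auto simp: alt_mul_apply)
  have eq: "alt_mul k (alt_mul k a) M J = 0" for k M J
    by (simp add: alt_mul_apply)
  show ?thesis
  proof (intro ext)
    fix M J
    show "alt_mul i (alt_mul j a) M J = (- alt_mul j (alt_mul i a)) M J"
    proof (cases i j rule: linorder_cases)
      case equal
      then show ?thesis by (simp add: eq)
    qed (simp_all add: less[of i j] less[of j i])
  qed
qed

lemma alt_ins_anticommute: "alt_ins i (alt_ins j a) = - alt_ins j (alt_ins i (a :: 'v::ring_1 weyl))"
proof -
  have less: "alt_ins i (alt_ins j a) M J = - alt_ins j (alt_ins i a) M J"
    if "i < j" for i j :: nat and a :: "'v weyl" and M J
  proof (cases "i \<notin> J \<and> j \<notin> J")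
    case True
    have "below j (insert i J) = below j J + 1" "below i (insert j J) = below i J"
      using True that below_insert[of i J j] below_insert[of j J i] by auto
    then show ?thesis using True that
      by (simp add: alt_ins_apply alt_sign_alt_sign add.commute insert_commute)
  qed (auto simp: alt_ins_apply)
  have eq: "alt_ins k (alt_ins k a) M J = 0" for k M J
    by (simp add: alt_ins_apply)
  show ?thesis
  proof (intro ext)
    fix M J
    show "alt_ins i (alt_ins j a) M J = (- alt_ins j (alt_ins i a)) M J"
    proof (cases i j rule: linorder_cases)
      case equal
      then show ?thesis by (simp add: eq)
    qed (simp_all add: less[of i j] less[of j i])
  qed
qed

lemma alt_ins_alt_mul:
  "alt_ins i (alt_mul j a) = - alt_mul j (alt_ins i a) + (if i = j then (a :: 'v::ring_1 weyl) else 0)"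
proof (intro ext)
  fix M J
  show "alt_ins i (alt_mul j a) M J =
    (- alt_mul j (alt_ins i a) + (if i = j then a else 0)) M J"
  proof (cases "i = j")
    case True
    have "{k \<in> J - {j}. k < j} = {k \<in> J. k < j}" "{k \<in> insert j J. k < j} = {k \<in> J. k < j}"
      by auto
    then have "below j (J - {j}) = below j J" "below j (insert j J) = below j J"
      unfolding below_def by presburger+
    then have "alt_sign (below j J + below j (J - {j})) v = v"
      "alt_sign (below j J + below j (insert j J)) v = v" for v :: "'v fps"
      by (simp_all add: alt_sign_def)
    then show ?thesis using True
      by (auto simp: alt_ins_apply alt_mul_apply alt_sign_alt_sign insert_absorb)
  next
    case False
    have "insert i (J - {j}) = insert i J - {j}" using False by auto
    \<comment> \<open>For distinct indices exactly one of \<open>i < j\<close> and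
      \<open>j < i\<close> holds, and the four exponents add up to an even number plus one.\<close>
    moreover have "odd (below i J + below j (insert i J) + (below j J + below i (J - {j})))"
      if "i \<notin> J" "j \<in> J"
      using below_insert[of i J j] below_remove[of j J i] that False by auto
    ultimately show ?thesis using False
      by (cases "i \<in> J"; cases "j \<in> J")
        (simp_all add: alt_ins_apply alt_mul_apply alt_sign_alt_sign, auto simp: alt_sign_def)
  qed
qed

lemma sym_mul_alt_mul: "sym_mul i (alt_mul j a) = alt_mul j (sym_mul i (a :: 'v::ring_1 weyl))"
  by (auto simp: fun_eq_iff sym_mul_def alt_mul_apply alt_sign.zero)

lemma sym_mul_alt_ins: "sym_mul i (alt_ins j a) = alt_ins j (sym_mul i (a :: 'v::ring_1 weyl))"
  by (auto simp: fun_eq_iff sym_mul_def alt_ins_apply alt_sign.zero)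

lemma sym_ins_alt_mul: "sym_ins i (alt_mul j a) = alt_mul j (sym_ins i (a :: 'v::ring_1 weyl))"
  by (auto simp: fun_eq_iff sym_ins_def alt_mul_apply alt_sign_def)

lemma sym_ins_alt_ins: "sym_ins i (alt_ins j a) = alt_ins j (sym_ins i (a :: 'v::ring_1 weyl))"
  by (auto simp: fun_eq_iff sym_ins_def alt_ins_apply alt_sign_def)

section \<open>The undeformed product\<close>

lemma subseteq_add_mset_eq:
  "{N. N \<subseteq># add_mset i M} = {N. N \<subseteq># M} \<union> add_mset i ` {N. N \<subseteq># M}"
proof (intro equalityI subsetI)
  fix N assume "N \<in> {N. N \<subseteq># add_mset i M}"
  then have N: "N \<subseteq># add_mset i M" by simp
  show "N \<in> {N. N \<subseteq># M} \<union> add_mset i ` {N. N \<subseteq># M}"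
  proof (cases "i \<in># N")
    case True
    then obtain N' where "N = add_mset i N'" by (blast dest: multi_member_split)
    with N show ?thesis by auto
  next
    case False
    have "N \<subseteq># M"
    proof (rule mset_subset_eqI)
      fix k show "count N k \<le> count M k"
        using mset_subset_eq_count[OF N, of k] False by (cases "k = i") (auto simp: not_in_iff)
    qed
    then show ?thesis by simp
  qed
qed (auto intro: subset_mset.order_trans)

lemma finite_submultisets [simp]: "finite {N. N \<subseteq># M}"
  by (induction M) (simp_all add: subseteq_add_mset_eq)

text \<open>Splittings of \<open>add_mset i M\<close> whose left part contains \<open>i\<close>; the
  next lemma treats the right part. Together they give the Leibniz rule for
  \<open>mu\<close>.\<close>

lemma sum_submultisets_mem:
  fixes f :: "'a multiset \<Rightarrow> 'b::comm_monoid_add"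
  shows "(\<Sum>N | N \<subseteq># add_mset i M. if i \<in># N then f N else 0) = (\<Sum>N | N \<subseteq># M. f (add_mset i N))"
proof -
  have "(\<Sum>N | N \<subseteq># add_mset i M. if i \<in># N then f N else 0) =
    (\<Sum>N \<in> add_mset i ` {N. N \<subseteq># M}. f N)"
    by (rule sum.mono_neutral_cong_right)
      (auto simp: subseteq_add_mset_eq dest!: multi_member_split
        dest: mset_subset_eq_insertD[THEN conjunct2] subset_mset.less_imp_le)
  also have "\<dots> = (\<Sum>N | N \<subseteq># M. f (add_mset i N))"
    by (subst sum.reindex) (auto simp: inj_on_def)
  finally show ?thesis .
qed

lemma sum_submultisets_not_mem:
  fixes f :: "'a multiset \<Rightarrow> 'b::comm_monoid_add"
  shows "(\<Sum>N | N \<subseteq># add_mset i M. if i \<in># add_mset i M - N then f N else 0) = (\<Sum>N | N \<subseteq># M. f N)"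
proof (rule sum.mono_neutral_cong_right)
  show "\<forall>N\<in>{N. N \<subseteq># add_mset i M} - {N. N \<subseteq># M}. (if i \<in># add_mset i M - N then f N else 0) = 0"
  proof
    fix N assume N: "N \<in> {N. N \<subseteq># add_mset i M} - {N. N \<subseteq># M}"
    then obtain N' where N': "N = add_mset i N'" "N' \<subseteq># M" by (auto simp: subseteq_add_mset_eq)
    with N have "\<not> add_mset i N' \<subseteq># M" by simp
    \<comment> \<open>\<open>N\<close> lies below \<open>add_mset i M\<close> but not below
      \<open>M\<close>, so it uses up all copies of \<open>i\<close> and its complement has
      none.\<close>
    have "i \<notin># M - N'"
    proof
      assume "i \<in># M - N'"
      then have "add_mset i N' \<subseteq># M"
        using N'(2) by (auto simp: in_diff_count subseteq_mset_def Suc_le_eq)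
      with \<open>\<not> add_mset i N' \<subseteq># M\<close> show False by simp
    qed
    then show "(if i \<in># add_mset i M - N then f N else 0) = 0" using N' by simp
  qed
next
  have "i \<in># add_mset i M - N" if "N \<subseteq># M" for N
    using mset_subset_eq_count[OF that, of i] by (simp add: in_diff_count)
  then show "\<And>N. N \<in> {N. N \<subseteq># M} \<Longrightarrow> (if i \<in># add_mset i M - N then f N else 0) = f N" by simp
qed (auto simp: subseteq_add_mset_eq)

lemma sum_Pow_insert:
  fixes f :: "'b set \<Rightarrow> 'c::comm_monoid_add"
  assumes "i \<notin> J" "finite J"
  shows "(\<Sum>K\<in>Pow (insert i J). f K) = (\<Sum>K\<in>Pow J. f K + f (insert i K))"
proof -
  have "inj_on (insert i) (Pow J)"
    using assms(1) by (intro inj_onI) (metis PowD insert_ident subsetD)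
  moreover have "Pow J \<inter> insert i ` Pow J = {}" using assms(1) by auto
  ultimately show ?thesis using assms(2)
    by (simp add: Pow_insert sum.union_disjoint sum.reindex sum.distrib)
qed

text \<open>The length of the shuffle that sorts the increasing product over \<open>K\<close>
  followed by the one over \<open>L\<close>; its parity is the sign in the wedge product.\<close>

definition inversions :: "nat set \<Rightarrow> nat set \<Rightarrow> nat" where
  "inversions K L = card {(k, l). k \<in> K \<and> l \<in> L \<and> l < k}"

lemma finite_inversions: "finite K \<Longrightarrow> finite L \<Longrightarrow> finite {(k, l). k \<in> K \<and> l \<in> L \<and> l < (k::nat)}"
  by (rule finite_subset[of _ "K \<times> L"]) auto

lemma inversions_insert_left:
  assumes "finite K" "finite L" "i \<notin> K"
  shows "inversions (insert i K) L = inversions K L + below i L"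
proof -
  have "{(k, l). k \<in> insert i K \<and> l \<in> L \<and> l < k} =
    {(k, l). k \<in> K \<and> l \<in> L \<and> l < k} \<union> Pair i ` {l \<in> L. l < i}" by auto
  moreover have "card (Pair i ` {l \<in> L. l < i}) = below i L"
    unfolding below_def by (rule card_image) (auto simp: inj_on_def)
  moreover have "{(k, l). k \<in> K \<and> l \<in> L \<and> l < k} \<inter> Pair i ` {l \<in> L. l < i} = {}"
    using assms(3) by auto
  ultimately show ?thesis
    using card_Un_disjoint[OF finite_inversions[OF assms(1,2)], of "Pair i ` {l \<in> L. l < i}"] assms(2)
    unfolding inversions_def by simp
qed

text \<open>The new inversions are the elements of \<open>K\<close> above \<open>i\<close>, that is
  all of \<open>K\<close> except those below \<open>i\<close>; the additive form avoids subtraction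
  of naturals.\<close>

lemma inversions_insert_right:
  assumes "finite K" "finite L" "i \<notin> L" "i \<notin> K"
  shows "inversions K (insert i L) + below i K = inversions K L + card K"
proof -
  have "{(k, l). k \<in> K \<and> l \<in> insert i L \<and> l < k} =
    {(k, l). k \<in> K \<and> l \<in> L \<and> l < k} \<union> (\<lambda>k. (k, i)) ` {k \<in> K. i < k}" by auto
  moreover have "card ((\<lambda>k. (k, i)) ` {k \<in> K. i < k}) = card {k \<in> K. i < k}"
    by (rule card_image) (auto simp: inj_on_def)
  moreover have "{(k, l). k \<in> K \<and> l \<in> L \<and> l < k} \<inter> (\<lambda>k. (k, i)) ` {k \<in> K. i < k} = {}"
    using assms(3) by auto
  ultimately have "inversions K (insert i L) = inversions K L + card {k \<in> K. i < k}"
    using card_Un_disjoint[OF finite_inversions[OF assms(1,2)], of "(\<lambda>k. (k, i)) ` {k \<in> K. i < k}"]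
      assms(1)
    unfolding inversions_def by simp
  moreover have "card K = card {k \<in> K. i < k} + card {k \<in> K. k < i}"
  proof -
    have "K = {k \<in> K. i < k} \<union> {k \<in> K. k < i}" using assms(4) by (auto simp: not_less order_le_less)
    then have "card K = card ({k \<in> K. i < k} \<union> {k \<in> K. k < i})" by simp
    also have "\<dots> = card {k \<in> K. i < k} + card {k \<in> K. k < i}"
      using assms(1) by (intro card_Un_disjoint) auto
    finally show ?thesis .
  qed
  ultimately show ?thesis by (simp add: below_def)
qed

text \<open>Each pair in \<open>K \<times> L\<close> is an inversion in exactly one of the two
  orders. Modulo 2 this is the sign of graded commutativity.\<close>

lemma inversions_swap:
  assumes "finite K" "finite L" "K \<inter> L = {}"
  shows "inversions K L + inversions L K = card K * card L"
proof -
  define A where "A = {(k, l). k \<in> K \<and> l \<in> L \<and> l < k}"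
  define B where "B = {(l, k). l \<in> L \<and> k \<in> K \<and> k < l}"
  have "A \<union> prod.swap ` B = K \<times> L"
  proof
    show "K \<times> L \<subseteq> A \<union> prod.swap ` B"
    proof
      fix p assume "p \<in> K \<times> L"
      moreover obtain k l where "p = (k, l)" by (cases p)
      ultimately have "p = prod.swap (l, k)" "k \<in> K" "l \<in> L" "k \<noteq> l" "p = (k, l)"
        using assms(3) by auto
      then show "p \<in> A \<union> prod.swap ` B"
        unfolding A_def B_def by (cases "l < k") (auto intro!: image_eqI[of _ _ "(l, k)"])
    qed
  qed (auto simp: A_def B_def)
  moreover have "finite A" "finite B"
    unfolding A_def B_def using assms(1,2) by (simp_all add: finite_inversions)
  moreover have "A \<inter> prod.swap ` B = {}" by (auto simp: A_def B_def)
  moreover have "card (prod.swap ` B) = card B" by (rule card_image) simp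
  ultimately have "card A + card B = card (K \<times> L)"
    using card_Un_disjoint[of A "prod.swap ` B"] by simp
  then show ?thesis by (simp add: A_def B_def inversions_def card_cartesian_product)
qed

lemma below_split:
  assumes "K \<subseteq> J" shows "below i J = below i K + below i (J - K)"
proof -
  have "{k \<in> J. k < i} = {k \<in> K. k < i} \<union> {k \<in> J - K. k < i}" using assms by auto
  then show ?thesis unfolding below_def by (simp add: card_Un_disjoint disjoint_iff)
qed

section \<open>The wedge product with ring coefficients\<close>

abbreviation mu :: "'v::ring_1 weyl \<Rightarrow> 'v weyl \<Rightarrow> 'v weyl" where
  "mu \<equiv> weyl_mu (*)"

definition gam :: "'v::ring_1 weyl \<Rightarrow> 'v weyl" where
  "gam a = (\<lambda>M J. alt_sign (card J) (a M J))"

interpretation gam: additive "gam :: 'v::ring_1 weyl \<Rightarrow> _"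
  by unfold_locales (simp add: gam_def fun_eq_iff)

lemma gam_gam [simp]: "gam (gam a) = a"
  by (simp add: gam_def fun_eq_iff alt_sign_alt_sign) (simp add: alt_sign_def)

lemma gam_sym_ins: "gam (sym_ins i a) = sym_ins i (gam a)"
  by (simp add: gam_def sym_ins_def fun_eq_iff) (simp add: alt_sign_def)

lemma fps_bilin_times: "fps_bilin (*) f g = (f * g :: 'v::ring_1 fps)"
  by (rule fps_ext) (simp add: fps_bilin_def fps_mult_nth atLeast0AtMost)

text \<open>\<open>ext_wedge\<close> over an arbitrary ring, with the exponent named. For infinite
  \<open>J\<close> the sum over \<open>Pow J\<close> is 0 by convention, a case the lemmas below
  treat apart.\<close>

definition wedge :: "'k::ring ext \<Rightarrow> 'k ext \<Rightarrow> 'k ext" where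
  "wedge \<alpha> \<beta> J = (\<Sum>K\<in>Pow J. alt_sign (inversions K (J - K)) (\<alpha> K * \<beta> (J - K)))"

lemma mu_wedge: "mu a b M J = (\<Sum>N | N \<subseteq># M. wedge (a N) (b (M - N)) J)"
  by (simp add: weyl_mu_def fun_additive_sum ext_wedge_def inversions_def fps_bilin_times wedge_def)

lemma wedge_add_left: "wedge (\<alpha> + \<alpha>') \<beta> = wedge \<alpha> \<beta> + wedge \<alpha>' \<beta>"
  by (simp add: fun_eq_iff wedge_def distrib_right sum.distrib)

lemma wedge_add_right: "wedge \<alpha> (\<beta> + \<beta>') = wedge \<alpha> \<beta> + wedge \<alpha> \<beta>'"
  by (simp add: fun_eq_iff wedge_def distrib_left sum.distrib)

lemma alt_sign_mult_left: "alt_sign k (x * y) = alt_sign k x * (y :: 'k::ring)"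
  and alt_sign_mult_right: "alt_sign k (x * y) = x * (alt_sign k y :: 'k::ring)"
  by (simp_all add: alt_sign_def)

lemma wedge_of_nat_left:
  "wedge (\<lambda>J. of_nat c * \<alpha> J) \<beta> J = of_nat c * wedge \<alpha> \<beta> (J :: nat set)"
  for \<alpha> :: "'k::ring_1 ext"
  by (simp add: wedge_def sum_distrib_left mult.assoc alt_sign_def if_distrib cong: if_cong)

lemma wedge_of_nat_right:
  "wedge \<alpha> (\<lambda>J. of_nat c * \<beta> J) J = of_nat c * wedge \<alpha> \<beta> (J :: nat set)"
  for \<alpha> :: "'k::ring_1 ext"
proof -
  have "x * (of_nat c * y) = of_nat c * (x * y)" for x y :: 'k
    by (metis mult.assoc mult_of_nat_commute)
  then show ?thesis
    by (simp add: wedge_def sum_distrib_left mult.assoc alt_sign_def if_distrib cong: if_cong)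
qed

lemma wedge_infinite: "infinite J \<Longrightarrow> wedge \<alpha> \<beta> J = 0"
  by (simp add: wedge_def)

text \<open>Only the subsets that contain \<open>i\<close> contribute. The exponent
  \<open>below i\<close> splits into its parts in \<open>K\<close> and in the complement, and the
  second part is the change of \<open>inversions\<close>.\<close>

lemma ext_mul_wedge: "ext_mul i (wedge \<alpha> \<beta>) = wedge (ext_mul i \<alpha>) \<beta>"
proof
  fix J show "ext_mul i (wedge \<alpha> \<beta>) J = wedge (ext_mul i \<alpha>) \<beta> J"
  proof (cases "finite J \<and> i \<in> J")
    case False
    then show ?thesis
      by (auto simp: ext_mul_below wedge_infinite) (auto simp: wedge_def ext_mul_below intro!: sum.neutral)
  next
    case True
    define J' where "J' = J - {i}"
    have J: "J = insert i J'" "i \<notin> J'" "finite J'" using True by (auto simp: J'_def)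
    have "wedge (ext_mul i \<alpha>) \<beta> J = (\<Sum>K\<in>Pow J'. alt_sign (below i J')
      (alt_sign (inversions K (J' - K)) (\<alpha> K * \<beta> (J' - K))))"
      unfolding wedge_def J(1) sum_Pow_insert[OF J(2,3)]
    proof (rule sum.cong[OF refl])
      fix K assume K: "K \<in> Pow J'"
      have fin: "finite K" "finite (J' - K)" "i \<notin> K" using K J(2,3) by (auto intro: finite_subset)
      have "insert i J' - insert i K = J' - K" "insert i K - {i} = K" using K J(2) by auto
      moreover have "below i (insert i K) = below i K" using fin(3) below_insert by simp
      moreover note inversions_insert_left[OF fin] below_split[of K J' i]
      ultimately show "alt_sign (inversions K (insert i J' - K)) (ext_mul i \<alpha> K * \<beta> (insert i J' - K)) +
         alt_sign (inversions (insert i K) (insert i J' - insert i K))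
          (ext_mul i \<alpha> (insert i K) * \<beta> (insert i J' - insert i K)) =
         alt_sign (below i J') (alt_sign (inversions K (J' - K)) (\<alpha> K * \<beta> (J' - K)))"
        using K fin(3) by (simp add: ext_mul_below alt_sign_mult_left[symmetric] alt_sign_alt_sign)
          (auto simp: alt_sign_def)
    qed
    moreover have "below i J = below i J'" using J below_insert by simp
    ultimately show ?thesis using J
      by (simp add: ext_mul_below wedge_def alt_sign.sum)
  qed
qed

text \<open>The parity automorphism. An odd operator that passes the first factor turns it into its
  image, so the Leibniz rules need no homogeneity assumption.\<close>

definition ext_gam :: "'k::ab_group_add ext \<Rightarrow> 'k ext" where
  "ext_gam \<alpha> J = alt_sign (card J) (\<alpha> J)"

lemma wedge_ext_mul: "wedge \<alpha> (ext_mul i \<beta>) = ext_mul i (wedge (ext_gam \<alpha>) \<beta>)"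
proof
  fix J show "wedge \<alpha> (ext_mul i \<beta>) J = ext_mul i (wedge (ext_gam \<alpha>) \<beta>) J"
  proof (cases "finite J \<and> i \<in> J")
    case False
    then show ?thesis
      by (auto simp: ext_mul_below wedge_infinite) (auto simp: wedge_def ext_mul_below intro!: sum.neutral)
  next
    case True
    define J' where "J' = J - {i}"
    have J: "J = insert i J'" "i \<notin> J'" "finite J'" using True by (auto simp: J'_def)
    have "wedge \<alpha> (ext_mul i \<beta>) J = (\<Sum>K\<in>Pow J'. alt_sign (below i J')
      (alt_sign (inversions K (J' - K)) (ext_gam \<alpha> K * \<beta> (J' - K))))"
      unfolding wedge_def J(1) sum_Pow_insert[OF J(2,3)]
    proof (rule sum.cong[OF refl])
      fix K assume K: "K \<in> Pow J'"
      have fin: "finite K" "finite (J' - K)" "i \<notin> J' - K" "i \<notin> K" using K J(2,3) by (auto intro: finite_subset)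
      have KJ: "K \<subseteq> J'" using K by simp
      have e: "insert i J' - insert i K = J' - K" "insert i J' - K = insert i (J' - K)" using K J(2) by auto
      have "below i (insert i (J' - K)) = below i (J' - K)" using fin(3) below_insert by simp
      moreover have "even (inversions K (insert i (J' - K)) + below i (J' - K)) =
        even (below i J' + (inversions K (J' - K) + card K))"
        using inversions_insert_right[OF fin] below_split[OF KJ, of i] by presburger
      moreover have "i \<notin> J' - K" "insert i (J' - K) - {i} = J' - K" using J(2) by auto
      ultimately show "alt_sign (inversions K (insert i J' - K)) (\<alpha> K * ext_mul i \<beta> (insert i J' - K)) +
         alt_sign (inversions (insert i K) (insert i J' - insert i K))
          (\<alpha> (insert i K) * ext_mul i \<beta> (insert i J' - insert i K)) =
         alt_sign (below i J') (alt_sign (inversions K (J' - K)) (ext_gam \<alpha> K * \<beta> (J' - K)))"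
        unfolding e
        by (simp add: ext_gam_def ext_mul_below alt_sign_mult_left[symmetric]
              alt_sign_mult_right[symmetric] alt_sign_alt_sign)
            (auto simp: alt_sign_def)
    qed
    moreover have "below i J = below i J'" using J below_insert by simp
    ultimately show ?thesis using J
      by (simp add: ext_mul_below wedge_def alt_sign.sum)
  qed
qed

lemma ext_ins_wedge:
  "ext_ins i (wedge \<alpha> \<beta>) = wedge (ext_ins i \<alpha>) \<beta> + wedge (ext_gam \<alpha>) (ext_ins i \<beta>)"
proof
  fix J show "ext_ins i (wedge \<alpha> \<beta>) J = (wedge (ext_ins i \<alpha>) \<beta> + wedge (ext_gam \<alpha>) (ext_ins i \<beta>)) J"
  proof (cases "finite J")
    case False
    then show ?thesis by (simp add: ext_ins_below wedge_infinite)
  next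
    case fin_J: True
    define J' where "J' = J - {i}"
    have J: "i \<notin> J'" "finite J'" using fin_J by (auto simp: J'_def)
    have key: "i \<notin> K" "finite K" "finite (J' - K)" "i \<notin> J' - K" "K \<subseteq> J'"
      "insert i J' - insert i K = J' - K" "insert i J' - K = insert i (J' - K)" "J' - insert i K = J' - K"
      "below i (insert i K) = below i K" "inversions (insert i K) (J' - K) = inversions K (J' - K) + below i (J' - K)"
      "inversions K (insert i (J' - K)) + below i K = inversions K (J' - K) + card K"
      "below i J' = below i K + below i (J' - K)"
      if "K \<in> Pow J'" for K
    proof -
      show 1: "i \<notin> K" and 2: "finite K" and 3: "finite (J' - K)" and 4: "i \<notin> J' - K" and 5: "K \<subseteq> J'"
        and "insert i J' - insert i K = J' - K" "insert i J' - K = insert i (J' - K)"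
          "J' - insert i K = J' - K"
        using that J by (auto intro: finite_subset)
      show "below i (insert i K) = below i K" using below_insert[OF 1, of i] by simp
      show "inversions (insert i K) (J' - K) = inversions K (J' - K) + below i (J' - K)"
        by (rule inversions_insert_left[OF 2 3 1])
      show "inversions K (insert i (J' - K)) + below i K = inversions K (J' - K) + card K"
        by (rule inversions_insert_right[OF 2 3 4 1])
      show "below i J' = below i K + below i (J' - K)" by (rule below_split[OF 5])
    qed
    show ?thesis
    proof (cases "i \<in> J")
      case True
      then have Ji: "J = insert i J'" by (auto simp: J'_def)
      \<comment> \<open>For \<open>i \<in> J\<close> the left side is 0. On the right each
        \<open>K\<close> leaves two terms with the same product
        \<open>\<alpha> (insert i K) * \<beta> (insert i (J' - K))\<close> and opposite
        signs.\<close>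
      have "wedge (ext_ins i \<alpha>) \<beta> J + wedge (ext_gam \<alpha>) (ext_ins i \<beta>) J = 0"
        unfolding wedge_def Ji sum_Pow_insert[OF J] sum.distrib[symmetric]
      proof (rule sum.neutral, rule ballI)
        fix K assume "K \<in> Pow J'"
        note k = key[OF this]
        have "even (inversions K (insert i (J' - K)) + below i K) \<longleftrightarrow>
           odd (inversions K (J' - K) + below i (J' - K) + (Suc (card K) + below i (J' - K)))"
          using k(11) by presburger
        then show "alt_sign (inversions K (insert i J' - K)) (ext_ins i \<alpha> K * \<beta> (insert i J' - K)) +
         alt_sign (inversions (insert i K) (insert i J' - insert i K))
          (ext_ins i \<alpha> (insert i K) * \<beta> (insert i J' - insert i K)) +
         (alt_sign (inversions K (insert i J' - K)) (ext_gam \<alpha> K * ext_ins i \<beta> (insert i J' - K)) +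
          alt_sign (inversions (insert i K) (insert i J' - insert i K))
           (ext_gam \<alpha> (insert i K) * ext_ins i \<beta> (insert i J' - insert i K))) = 0"
          using k(1,2,4) unfolding k(6,7,10)
          by (simp add: ext_gam_def ext_ins_below alt_sign_mult_left[symmetric]
              alt_sign_mult_right[symmetric] alt_sign_alt_sign del: alt_sign_Suc)
            (auto simp: alt_sign_def)
      qed
      then show ?thesis using True by (simp add: ext_ins_below)
    next
      case False
      then have Ji: "J = J'" by (auto simp: J'_def)
      have "alt_sign (below i J') (wedge \<alpha> \<beta> (insert i J')) =
        wedge (ext_ins i \<alpha>) \<beta> J' + wedge (ext_gam \<alpha>) (ext_ins i \<beta>) J'"
        unfolding wedge_def sum_Pow_insert[OF J] sum.distrib[symmetric] alt_sign.sum
      proof (rule sum.cong[OF refl])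
        fix K assume "K \<in> Pow J'"
        note k = key[OF this]
        have "even (below i J' + inversions K (insert i (J' - K))) =
             even (inversions K (J' - K) + (card K + below i (J' - K)))"
          "even (below i J' + (inversions K (J' - K) + below i (J' - K))) =
             even (inversions K (J' - K) + below i K)"
          using k(11,12) by presburger+
        then show "alt_sign (below i J')
          (alt_sign (inversions K (insert i J' - K)) (\<alpha> K * \<beta> (insert i J' - K)) +
           alt_sign (inversions (insert i K) (insert i J' - insert i K))
            (\<alpha> (insert i K) * \<beta> (insert i J' - insert i K))) =
         alt_sign (inversions K (J' - K)) (ext_ins i \<alpha> K * \<beta> (J' - K)) +
         alt_sign (inversions K (J' - K)) (ext_gam \<alpha> K * ext_ins i \<beta> (J' - K))"
          using k(1,2,4) unfolding k(6,7,10)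
          by (simp add: ext_gam_def ext_ins_below alt_sign_mult_left[symmetric]
              alt_sign_mult_right[symmetric] alt_sign_alt_sign add.assoc)
            (auto simp: alt_sign_def)
      qed
      then show ?thesis using False Ji by (simp add: ext_ins_below)
    qed
  qed
qed

lemma ext_gam_wedge: "ext_gam (wedge \<alpha> \<beta>) = wedge (ext_gam \<alpha>) (ext_gam \<beta>)"
proof
  fix J show "ext_gam (wedge \<alpha> \<beta>) J = wedge (ext_gam \<alpha>) (ext_gam \<beta>) J"
  proof (cases "finite J")
    case True
    have "card J = card K + card (J - K)" if "K \<in> Pow J" for K
      using that True by (metis PowD card_Diff_subset card_mono finite_subset le_add_diff_inverse)
    then show ?thesis
      by (auto simp: ext_gam_def wedge_def alt_sign.sum alt_sign_mult_left[symmetric]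
          alt_sign_mult_right[symmetric] alt_sign_alt_sign intro!: sum.cong alt_sign_cong_parity)
  qed (simp add: ext_gam_def wedge_infinite)
qed

section \<open>The undeformed product and the operators acting on it\<close>

lemma mu_add_left: "mu (a + a') b = mu a b + mu a' b"
  by (simp add: fun_eq_iff mu_wedge wedge_add_left sum.distrib)

lemma mu_add_right: "mu a (b + b') = mu a b + mu a b'"
  by (simp add: fun_eq_iff mu_wedge wedge_add_right sum.distrib)

lemma gam_ext_gam: "gam a M = ext_gam (a M)"
  by (simp add: gam_def ext_gam_def fun_eq_iff)

lemma wedge_0_left [simp]: "wedge (\<lambda>J. 0) \<beta> = (\<lambda>J. 0)" and wedge_0_right [simp]: "wedge \<alpha> (\<lambda>J. 0) = (\<lambda>J. 0)"
  by (simp_all add: fun_eq_iff wedge_def)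

lemma mu_alt_mul_left: "mu (alt_mul i a) b = alt_mul i (mu a b)"
proof (intro ext)
  fix M J
  have "alt_mul i (mu a b) M J = ext_mul i (\<Sum>N | N \<subseteq># M. wedge (a N) (b (M - N))) J"
    by (simp add: alt_mul_def ext_mul_below mu_wedge fun_additive_sum)
  also have "\<dots> = (\<Sum>N | N \<subseteq># M. ext_mul i (wedge (a N) (b (M - N))) J)"
    by (simp add: ext_mul_below fun_additive_sum alt_sign.sum)
  finally show "mu (alt_mul i a) b M J = alt_mul i (mu a b) M J"
    by (simp add: mu_wedge alt_mul_def ext_mul_wedge)
qed

lemma mu_alt_mul_right: "mu a (alt_mul i b) = alt_mul i (mu (gam a) b)"
proof (intro ext)
  fix M J
  have "alt_mul i (mu (gam a) b) M J = (\<Sum>N | N \<subseteq># M. ext_mul i (wedge (gam a N) (b (M - N))) J)"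
    by (simp add: alt_mul_def ext_mul_below mu_wedge alt_sign.sum)
  then show "mu a (alt_mul i b) M J = alt_mul i (mu (gam a) b) M J"
    by (simp add: mu_wedge alt_mul_def wedge_ext_mul gam_ext_gam)
qed

lemma mu_alt_ins: "alt_ins i (mu a b) = mu (alt_ins i a) b + mu (gam a) (alt_ins i b)"
proof (intro ext)
  fix M J
  have "alt_ins i (mu a b) M J = (\<Sum>N | N \<subseteq># M. ext_ins i (wedge (a N) (b (M - N))) J)"
    by (simp add: alt_ins_def ext_ins_below mu_wedge alt_sign.sum)
  then show "alt_ins i (mu a b) M J = (mu (alt_ins i a) b + mu (gam a) (alt_ins i b)) M J"
    by (simp add: mu_wedge alt_ins_def ext_ins_wedge gam_ext_gam sum.distrib)
qed

lemma gam_mu: "gam (mu a b) = mu (gam a) (gam b)"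
proof (intro ext)
  fix M J
  have "gam (mu a b) M J = (\<Sum>N | N \<subseteq># M. ext_gam (wedge (a N) (b (M - N))) J)"
    by (simp add: gam_def ext_gam_def mu_wedge alt_sign.sum)
  then show "gam (mu a b) M J = mu (gam a) (gam b) M J"
    by (simp add: mu_wedge ext_gam_wedge gam_ext_gam)
qed

lemma mu_sym_mul_left: "mu (sym_mul i a) b = sym_mul i (mu a b)"
proof (intro ext)
  fix M J
  show "mu (sym_mul i a) b M J = sym_mul i (mu a b) M J"
  proof (cases "i \<in># M")
    case True
    then obtain M' where M: "M = add_mset i M'" by (blast dest: multi_member_split)
    have "mu (sym_mul i a) b M J = (\<Sum>N | N \<subseteq># add_mset i M'. if i \<in># N
        then wedge (a (N - {#i#})) (b (add_mset i M' - N)) J else 0)"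
      unfolding mu_wedge M by (rule sum.cong) (simp_all add: sym_mul_def)
    also have "\<dots> = mu a b M' J" by (simp add: sum_submultisets_mem mu_wedge)
    finally show ?thesis by (simp add: M sym_mul_def)
  next
    case False
    then have "i \<notin># N" if "N \<subseteq># M" for N using that by (meson mset_subset_eqD)
    then show ?thesis using False by (simp add: sym_mul_def mu_wedge)
  qed
qed

lemma mu_sym_mul_right: "mu a (sym_mul i b) = sym_mul i (mu a b)"
proof (intro ext)
  fix M J
  show "mu a (sym_mul i b) M J = sym_mul i (mu a b) M J"
  proof (cases "i \<in># M")
    case True
    then obtain M' where M: "M = add_mset i M'" by (blast dest: multi_member_split)
    have "mu a (sym_mul i b) M J = (\<Sum>N | N \<subseteq># add_mset i M'. if i \<in># add_mset i M' - N
        then wedge (a N) (b (add_mset i M' - N - {#i#})) J else 0)"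
      unfolding mu_wedge M by (rule sum.cong) (simp_all add: sym_mul_def)
    also have "\<dots> = (\<Sum>N | N \<subseteq># M'. wedge (a N) (b (add_mset i M' - N - {#i#})) J)"
      by (rule sum_submultisets_not_mem)
    also have "\<dots> = mu a b M' J"
      unfolding mu_wedge by (rule sum.cong) (simp_all add: multiset_diff_union_assoc diff_right_commute)
    finally show ?thesis by (simp add: M sym_mul_def)
  next
    case False
    then have "i \<notin># M - N" for N by (meson in_diffD)
    then show ?thesis using False by (simp add: sym_mul_def mu_wedge)
  qed
qed

lemma if_mem_count: "(if i \<in># N then of_nat (count N i) * x else 0) = of_nat (count N i) * (x :: 'k::ring_1)"
  by (cases "i \<in># N") (simp_all add: not_in_iff)

text \<open>Leibniz rule: the multiplicity of \<open>i\<close> in a monomial is the sum of its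
  multiplicities in the two factors.\<close>

lemma mu_sym_ins: "sym_ins i (mu a b) = mu (sym_ins i a) b + mu a (sym_ins i b)"
proof (intro ext)
  fix M J
  let ?f = "\<lambda>N. wedge (a N) (b (add_mset i M - N)) J"
  have "sym_ins i (mu a b) M J = (\<Sum>N | N \<subseteq># add_mset i M. of_nat (count M i + 1) * ?f N)"
    by (simp add: sym_ins_def mu_wedge sum_distrib_left)
  also have "\<dots> = (\<Sum>N | N \<subseteq># add_mset i M.
     (if i \<in># N then of_nat (count N i) * ?f N else 0) +
     (if i \<in># add_mset i M - N then of_nat (count (add_mset i M - N) i) * ?f N else 0))"
  proof (rule sum.cong[OF refl])
    fix N assume "N \<in> {N. N \<subseteq># add_mset i M}"
    then have "count M i + 1 = count N i + count (add_mset i M - N) i"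
      using mset_subset_eq_count[of N "add_mset i M" i] by simp
    then have "of_nat (count M i + 1) * ?f N =
      of_nat (count N i) * ?f N + of_nat (count (add_mset i M - N) i) * ?f N"
      by (simp only: of_nat_add distrib_right)
    then show "of_nat (count M i + 1) * ?f N =
     (if i \<in># N then of_nat (count N i) * ?f N else 0) +
     (if i \<in># add_mset i M - N then of_nat (count (add_mset i M - N) i) * ?f N else 0)"
      by (simp only: if_mem_count)
  qed
  also have "\<dots> = (\<Sum>N | N \<subseteq># M. of_nat (count N i + 1) * wedge (a (add_mset i N)) (b (M - N)) J) +
      (\<Sum>N | N \<subseteq># M. of_nat (count (add_mset i M - N) i) * ?f N)"
    unfolding sum.distrib sum_submultisets_mem sum_submultisets_not_mem by simp
  also have "(\<Sum>N | N \<subseteq># M. of_nat (count (add_mset i M - N) i) * ?f N) =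
    (\<Sum>N | N \<subseteq># M. of_nat (count (M - N) i + 1) * wedge (a N) (b (add_mset i (M - N))) J)"
  proof (rule sum.cong[OF refl])
    fix N assume "N \<in> {N. N \<subseteq># M}"
    then have "add_mset i M - N = add_mset i (M - N)"
      using multiset_diff_union_assoc[of N M "{#i#}"] by simp
    then show "of_nat (count (add_mset i M - N) i) * ?f N =
      of_nat (count (M - N) i + 1) * wedge (a N) (b (add_mset i (M - N))) J" by simp
  qed
  also have "(\<Sum>N | N \<subseteq># M. of_nat (count N i + 1) * wedge (a (add_mset i N)) (b (M - N)) J) =
    mu (sym_ins i a) b M J"
    by (simp only: mu_wedge sym_ins_def wedge_of_nat_left)
  also have "(\<Sum>N | N \<subseteq># M. of_nat (count (M - N) i + 1) * wedge (a N) (b (add_mset i (M - N))) J) =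
    mu a (sym_ins i b) M J"
    by (simp only: mu_wedge sym_ins_def wedge_of_nat_right)
  finally show "sym_ins i (mu a b) M J = (mu (sym_ins i a) b + mu a (sym_ins i b)) M J" by simp
qed

lemma mu_proj: "mu a b {#} {} = a {#} {} * b {#} {}"
  by (simp add: mu_wedge wedge_def inversions_def)

lemma mu_infinite: "infinite J \<Longrightarrow> mu a b M J = 0"
  by (simp add: mu_wedge wedge_infinite)

lemma inversions_empty [simp]: "inversions {} L = 0" "inversions K {} = 0"
  by (simp_all add: inversions_def)

lemma mu_one_left: "finite J \<Longrightarrow> mu (weyl_embed 1) a M J = a M J"
proof -
  assume J: "finite J"
  have "wedge (weyl_embed 1 N) (a (M - N)) J = (if N = {#} then a M J else 0)" for N
  proof -
    have "wedge (weyl_embed 1 N) (a (M - N)) J = (\<Sum>K\<in>Pow J. if K = {} then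
        (if N = {#} then a M J else 0) else 0)"
      unfolding wedge_def by (rule sum.cong) (auto simp: weyl_embed_def)
    then show ?thesis using J by simp
  qed
  then show ?thesis by (simp add: mu_wedge)
qed

lemma mu_one_right: "finite J \<Longrightarrow> mu a (weyl_embed 1) M J = a M J"
proof -
  assume J: "finite J"
  have "wedge (a N) (weyl_embed 1 (M - N)) J = (if N = M then a M J else 0)" if "N \<subseteq># M" for N
  proof -
    have "M - N = {#} \<longleftrightarrow> N = M" using that by (metis Diff_eq_empty_iff_mset subset_mset.antisym subset_mset.order_refl)
    then have "wedge (a N) (weyl_embed 1 (M - N)) J = (\<Sum>K\<in>Pow J. if K = J then
        (if N = M then a M J else 0) else 0)"
      unfolding wedge_def by (intro sum.cong) (auto simp: weyl_embed_def)
    then show ?thesis using J by simp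
  qed
  then have "mu a (weyl_embed 1) M J = (\<Sum>N | N \<subseteq># M. if N = M then a M J else 0)"
    unfolding mu_wedge by (intro sum.cong) simp_all
  then show ?thesis by simp
qed

section \<open>Linear operators over an algebra of coefficients\<close>

lemma fps_nth_of_nat_mult: "(of_nat c * f) $ m = of_nat c * f $ m" for f :: "'v::ring_1 fps"
  by (simp flip: fps_of_nat)

section \<open>Powers of \<open>t\<close>, and operators acting coefficientwise in
  \<open>t\<close>\<close>

definition slice :: "nat \<Rightarrow> 'v::zero weyl \<Rightarrow> 'v weyl" where
  "slice m a = (\<lambda>M J. fps_const (a M J $ m))"

lemma weyl_eq_slice: "(\<And>m. slice m a = slice m b) \<Longrightarrow> a = b"
proof (intro ext fps_ext)
  fix M J m
  assume "\<And>m. slice m a = slice m b"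
  then have "slice m a M J $ 0 = slice m b M J $ 0" by simp
  then show "a M J $ m = b M J $ m" by (simp add: slice_def)
qed

interpretation slice: additive "slice m :: 'v::ring_1 weyl \<Rightarrow> _" for m
  by unfold_locales (simp add: slice_def fun_eq_iff)

definition tpow :: "nat \<Rightarrow> 'v::ring_1 weyl \<Rightarrow> 'v weyl" where
  "tpow k a = (\<lambda>M J. fps_X ^ k * a M J)"

interpretation tpow: additive "tpow k :: 'v::ring_1 weyl \<Rightarrow> _" for k
  by unfold_locales (simp add: tpow_def fun_eq_iff distrib_left)

lemma tpow_nth: "tpow k a M J $ m = (if m < k then 0 else a M J $ (m - k))"
  by (simp add: tpow_def fps_X_power_mult_nth)

lemma tpow_tpow: "tpow k (tpow l a) = tpow (k + l) a"
  by (simp add: tpow_def power_add mult.assoc)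

lemma divide_tpow [simp]: "weyl_divide_t (tpow 1 a) = a"
  by (intro ext fps_ext) (simp add: weyl_divide_t_def tpow_nth)

lemma tpow_divide: "(\<And>M J. a M J $ 0 = 0) \<Longrightarrow> tpow 1 (weyl_divide_t a) = a"
  by (intro ext fps_ext) (simp add: weyl_divide_t_def tpow_nth)

interpretation divide_t: additive "weyl_divide_t :: 'v::ring_1 weyl \<Rightarrow> _"
  by unfold_locales (intro ext fps_ext, simp add: weyl_divide_t_def)

locale alg =
  fixes sc :: "'r::ring_containing_rat \<Rightarrow> 'v::ring_1 \<Rightarrow> 'v"
  assumes assoc_algebra: "assoc_algebra sc"
begin

sublocale module sc
  using assoc_algebra by (simp add: assoc_algebra_def)

lemma sc_mult_left: "sc c x * y = sc c (x * y)"
  and sc_mult_right: "x * sc c y = sc c (x * y)"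
  using assoc_algebra unfolding assoc_algebra_def by metis+

lemma sc_of_nat: "sc (of_nat k) x = of_nat k * x"
  by (induction k) (simp_all add: scale_left_distrib algebra_simps)

lemma of_nat_cancel:
  assumes "of_nat k * x = of_nat k * (y :: 'v)" "k > 0" shows "x = y"
proof -
  have "sc (rat_const (1 / of_nat k)) (sc (of_nat k) x) = sc (rat_const (1 / of_nat k)) (sc (of_nat k) y)"
    using assms(1) by (simp add: sc_of_nat)
  then show ?thesis using rat_const_inverse_nat[OF assms(2), where 'a = 'r] by simp
qed

lemma double_eq_0: "x + x = 0 \<Longrightarrow> x = (0 :: 'v)"
  using of_nat_cancel[of 2 x 0] by (simp add: algebra_simps mult_2)

abbreviation wsc :: "'r \<Rightarrow> 'v weyl \<Rightarrow> 'v weyl" where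
  "wsc \<equiv> weyl_scale sc"

lemma wsc_nth: "wsc c a M J $ m = sc c (a M J $ m)"
  by (simp add: weyl_scale_def fps_scale_def fps_map_def)

sublocale wsc: module wsc
  by unfold_locales (intro ext fps_ext, simp add: wsc_nth algebra_simps scale_left_distrib)+

lemma weyl_double_eq_0: "a + a = 0 \<Longrightarrow> a = (0 :: 'v weyl)"
proof (intro ext fps_ext)
  fix M J m
  assume "a + a = 0"
  then have "(a + a) M J $ m = 0" by simp
  then show "a M J $ m = 0 M J $ m" using double_eq_0[of "a M J $ m"] by simp
qed

text \<open>Commuting with all slices means acting on each power of \<open>t\<close> separately. It
  yields commutation with multiplication by \<open>t\<close> and with \<open>1/t\<close> alike,
  without any divisibility assumption.\<close>

definition lin :: "('v weyl \<Rightarrow> 'v weyl) \<Rightarrow> bool" where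
  "lin T \<longleftrightarrow> (\<forall>a b. T (a + b) = T a + T b) \<and> (\<forall>c a. T (wsc c a) = wsc c (T a)) \<and>
     (\<forall>m a. T (slice m a) = slice m (T a))"

lemma lin_additive: "lin T \<Longrightarrow> additive T"
  by (simp add: lin_def additive_def)

lemma lin_add: "lin T \<Longrightarrow> T (a + b) = T a + T b"
  and lin_wsc: "lin T \<Longrightarrow> T (wsc c a) = wsc c (T a)"
  and lin_slice: "lin T \<Longrightarrow> T (slice m a) = slice m (T a)"
  by (simp_all add: lin_def)

lemma lin_zero: "lin T \<Longrightarrow> T 0 = 0"
  and lin_minus: "lin T \<Longrightarrow> T (- a) = - T a"
  and lin_diff: "lin T \<Longrightarrow> T (a - b) = T a - T b"
  and lin_sum: "lin T \<Longrightarrow> T (sum f A) = (\<Sum>x\<in>A. T (f x))"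
  using lin_additive additive.zero additive.minus additive.diff additive.sum by blast+

lemma lin_sym_mul [intro!]: "lin (sym_mul i)"
  unfolding lin_def
  by (intro conjI allI ext fps_ext) (simp_all add: sym_mul_def slice_def wsc_nth)

lemma lin_sym_ins [intro!]: "lin (sym_ins i)"
proof -
  have "of_nat k * sc c x = sc c (of_nat k * x)" for k c x
    by (rule sc_mult_right)
  then show ?thesis
    unfolding lin_def
    by (intro conjI allI ext fps_ext)
      (simp_all add: sym_ins_def slice_def wsc_nth distrib_left fps_nth_of_nat_mult
        del: of_nat_add of_nat_Suc)
qed

lemma lin_alt_mul [intro!]: "lin (alt_mul i)"
  unfolding lin_def
  by (intro conjI allI ext fps_ext)
    (simp_all add: alt_mul_apply slice_def wsc_nth, simp_all add: alt_sign_def wsc_nth)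

lemma lin_alt_ins [intro!]: "lin (alt_ins i)"
  unfolding lin_def
  by (intro conjI allI ext fps_ext)
    (simp_all add: alt_ins_apply slice_def wsc_nth, simp_all add: alt_sign_def wsc_nth)

lemma lin_gam [intro!]: "lin gam"
  unfolding lin_def
  by (intro conjI allI ext fps_ext)
    (simp_all add: gam_def slice_def wsc_nth, simp_all add: alt_sign_def wsc_nth)

lemma lin_wsc' [intro!]: "lin (wsc c)"
  unfolding lin_def
  by (intro conjI allI ext fps_ext) (simp_all add: slice_def wsc_nth mult.commute scale_right_distrib)

lemma lin_comp [intro]: "lin S \<Longrightarrow> lin T \<Longrightarrow> lin (\<lambda>a. S (T a))"
  by (simp add: lin_def)

lemma lin_id [intro!]: "lin (\<lambda>a. a)" and lin_0 [intro!]: "lin (\<lambda>a. 0)"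
  by (simp_all add: lin_def slice.zero)

lemma lin_plus [intro]: "lin S \<Longrightarrow> lin T \<Longrightarrow> lin (\<lambda>a. S a + T a)"
  by (simp add: lin_def slice.add algebra_simps)

lemma lin_minus' [intro]: "lin S \<Longrightarrow> lin T \<Longrightarrow> lin (\<lambda>a. S a - T a)"
  by (simp add: lin_def slice.diff algebra_simps)

lemma lin_setsum [intro]: "(\<And>i. i \<in> A \<Longrightarrow> lin (T i)) \<Longrightarrow> lin (\<lambda>a. \<Sum>i\<in>A. T i a)"
  by (induction A rule: infinite_finite_induct) (simp_all add: lin_0 lin_plus)

lemma lin_divide_t: "lin T \<Longrightarrow> T (weyl_divide_t a) = weyl_divide_t (T a)"
proof (rule weyl_eq_slice)
  fix m
  have *: "slice m (weyl_divide_t b) = slice (Suc m) b" for b :: "'v weyl"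
    by (simp add: slice_def weyl_divide_t_def)
  assume "lin T"
  then show "slice m (T (weyl_divide_t a)) = slice m (weyl_divide_t (T a))"
    unfolding * by (simp flip: lin_slice add: *)
qed

lemma lin_tpow: "lin T \<Longrightarrow> T (tpow k a) = tpow k (T a)"
proof (rule weyl_eq_slice)
  fix m
  have *: "slice m (tpow k b) = (if m < k then 0 else slice (m - k) b)" for b :: "'v weyl"
    by (intro ext) (simp add: slice_def tpow_nth)
  assume T: "lin T"
  have "slice m (T (tpow k a)) = T (if m < k then 0 else slice (m - k) a)"
    unfolding *[symmetric] using T by (simp only: lin_slice)
  also have "\<dots> = (if m < k then 0 else slice (m - k) (T a))"
    using lin_zero[OF T] lin_slice[OF T] by presburger
  finally show "slice m (T (tpow k a)) = slice m (tpow k (T a))" unfolding * .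
qed

text \<open>A coefficient can be recovered from a derivative because positive integers cancel. With
  the next lemma this reduces identities to lower degree.\<close>

lemma sym_ins_cancel:
  assumes "sym_ins i a M J = sym_ins i b M (J :: nat set)"
  shows "a (add_mset i M) J = (b :: 'v weyl) (add_mset i M) J"
proof (rule fps_ext)
  fix m
  have "of_nat (count M i + 1) * a (add_mset i M) J $ m = of_nat (count M i + 1) * b (add_mset i M) J $ m"
    using assms by (simp only: sym_ins_def flip: fps_nth_of_nat_mult)
  then show "a (add_mset i M) J $ m = b (add_mset i M) J $ m" by (rule of_nat_cancel) simp
qed

lemma alt_ins_cancel:
  assumes "alt_ins i a M J = alt_ins i b M (J :: nat set)" "i \<notin> J"
  shows "a M (insert i J) = (b :: 'v weyl) M (insert i J)"
  using assms by (auto simp: alt_ins_apply alt_sign_def split: if_splits)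

text \<open>Both sides obey the same Leibniz rules for \<open>sym_ins\<close> and
  \<open>alt_ins\<close>, so the claim descends to the coefficient of the empty monomial, where it
  is associativity in the ring.\<close>

lemma mu_assoc: "mu (mu a b) c = mu a (mu b (c :: 'v weyl))"
proof (intro ext)
  fix M J
  show "mu (mu a b) c M J = mu a (mu b c) M J"
  proof (cases "finite J")
    case True
    then show ?thesis
    proof (induction M arbitrary: a b c)
      case empty
      then show ?case
      proof (induction J arbitrary: a b c rule: finite_induct)
        case empty
        then show ?case by (simp add: mu_proj mult.assoc)
      next
        case (insert i J)
        show ?case
          by (rule alt_ins_cancel[OF _ insert.hyps(2)])
            (simp add: insert.IH mu_alt_ins mu_add_left mu_add_right gam_mu add.assoc)
      qed
    next
      case (add i M)
      show ?case
        by (rule sym_ins_cancel) (simp add: add.IH[OF add.prems] mu_sym_ins mu_add_left mu_add_right)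
    qed
  qed (simp add: mu_infinite)
qed

lemma fps_scale_mult_left: "fps_scale sc c f * g = fps_scale sc c (f * g)"
  and fps_scale_mult_right: "f * fps_scale sc c g = fps_scale sc c (f * g)"
  by (rule fps_ext; simp add: fps_scale_def fps_map_def fps_mult_nth sc_mult_left sc_mult_right
      scale_sum_right)+

lemma fps_scale_sum: "fps_scale sc c (sum f A) = (\<Sum>x\<in>A. fps_scale sc c (f x))"
  by (rule fps_ext) (simp add: fps_scale_def fps_map_def fps_sum_nth scale_sum_right)

lemma alt_sign_fps_scale: "alt_sign k (fps_scale sc c f) = fps_scale sc c (alt_sign k f)"
  by (rule fps_ext) (simp add: fps_scale_def fps_map_def alt_sign_def)

lemma mu_wsc_left: "mu (wsc c a) b = wsc c (mu a b)"
  and mu_wsc_right: "mu a (wsc c b) = wsc c (mu a b)"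
  by (intro ext; simp add: weyl_scale_def mu_wedge wedge_def fps_scale_sum fps_scale_mult_left
      fps_scale_mult_right alt_sign_fps_scale)+

end

section \<open>The deformed product\<close>

definition circ_coeff :: "nat \<Rightarrow> 'r::ring_containing_rat" where
  "circ_coeff k = rat_const (1 / (2 ^ k * fact k))"

lemma circ_coeff_0 [simp]: "circ_coeff 0 = 1"
  by (simp add: circ_coeff_def)

text \<open>The recursion for the coefficients of \<open>exp (z/2)\<close>; it drives the proof that
  the deformed product is associative.\<close>

lemma circ_coeff_Suc: "of_nat (2 * Suc k) * circ_coeff (Suc k) = circ_coeff k"
proof -
  have "of_nat (2 * Suc k) * (1 / (2 ^ Suc k * fact (Suc k))) = (1 / (2 ^ k * fact k) :: rat)"
    by (simp add: divide_simps del: of_nat_Suc) (simp add: algebra_simps)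
  then show ?thesis
    unfolding circ_coeff_def rat_const_of_nat[symmetric] rat_const_mult[symmetric] by simp
qed

text \<open>Congruence modulo \<open>t^(N+1)\<close>, under which the exponential series becomes a
  finite sum.\<close>

definition teq :: "nat \<Rightarrow> 'v::zero weyl \<Rightarrow> 'v weyl \<Rightarrow> bool" where
  "teq N a b \<longleftrightarrow> (\<forall>M J m. m \<le> N \<longrightarrow> a M J $ m = b M J $ m)"

lemma teq_refl [simp]: "teq N a a"
  and teq_sym: "teq N a b \<Longrightarrow> teq N b a"
  and teq_trans [trans]: "teq N a b \<Longrightarrow> teq N b c \<Longrightarrow> teq N a c"
  by (simp_all add: teq_def)

lemma teq_all: "(\<And>N. teq N a b) \<Longrightarrow> a = b"
  by (intro ext fps_ext) (auto simp: teq_def)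

lemma teq_add: "teq N a b \<Longrightarrow> teq N a' b' \<Longrightarrow> teq N (a + a') (b + b' :: 'v::ring_1 weyl)"
  by (simp add: teq_def)

lemma teq_sum: "(\<And>x. x \<in> A \<Longrightarrow> teq N (f x) (g x)) \<Longrightarrow> teq N (\<Sum>x\<in>A. f x) (\<Sum>x\<in>A. g x :: 'v::ring_1 weyl)"
  by (induction A rule: infinite_finite_induct) (simp_all add: teq_add)

lemma teq_tpow: "teq N a b \<Longrightarrow> teq N (tpow k a) (tpow k b)"
  by (simp add: teq_def tpow_nth)

lemma teq_sym_ins: "teq N a b \<Longrightarrow> teq N (sym_ins i a) (sym_ins i b)"
  by (simp add: teq_def sym_ins_def fps_nth_of_nat_mult del: of_nat_add of_nat_Suc)

lemma teq_mu: "teq N a a' \<Longrightarrow> teq N b b' \<Longrightarrow> teq N (mu a b) (mu a' b')"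
proof -
  assume *: "teq N a a'" "teq N b b'"
  have **: "(\<alpha> * \<beta>) $ m = (\<alpha>' * \<beta>') $ m"
    if "m \<le> N" "\<forall>m\<le>N. \<alpha> $ m = \<alpha>' $ m" "\<forall>m\<le>N. \<beta> $ m = \<beta>' $ m" for \<alpha> \<beta> \<alpha>' \<beta>' :: "'a fps" and m
    using that unfolding fps_mult_nth by (intro sum.cong) auto
  show ?thesis
    unfolding teq_def mu_wedge wedge_def fps_sum_nth
  proof (intro allI impI sum.cong refl)
    fix M J m N' K assume "m \<le> N"
    from **[OF this, of "a N' K" "a' N' K" "b (M - N') (J - K)" "b' (M - N') (J - K)"] *
    show "alt_sign (inversions K (J - K)) (a N' K * b (M - N') (J - K)) $ m =
      alt_sign (inversions K (J - K)) (a' N' K * b' (M - N') (J - K)) $ m"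
      by (simp add: teq_def alt_sign_def)
  qed
qed

lemma mu_tpow_left: "mu (tpow k a) b = tpow k (mu a b)"
proof -
  have "alt_sign l (fps_X ^ k * x) = fps_X ^ k * alt_sign l x" for l and x :: "'a fps"
    by (simp add: alt_sign_def)
  then show ?thesis
    by (simp add: fun_eq_iff tpow_def mu_wedge wedge_def sum_distrib_left mult.assoc)
qed

lemma mu_tpow_right: "mu a (tpow k b) = tpow k (mu a b)"
proof -
  have "alt_sign l (fps_X ^ k * x) = fps_X ^ k * alt_sign l x" for l and x :: "'a fps"
    by (simp add: alt_sign_def)
  moreover have "y * (fps_X ^ k * x) = fps_X ^ k * (y * x)" for x y :: "'a fps"
    by (metis fps_mult_fps_X_power_commute mult.assoc)
  ultimately show ?thesis
    by (simp add: fun_eq_iff tpow_def mu_wedge wedge_def sum_distrib_left)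
qed

locale moyal = alg sc for sc :: "'r::ring_containing_rat \<Rightarrow> 'v::ring_1 \<Rightarrow> 'v" +
  fixes n :: nat and \<pi> :: "nat \<Rightarrow> nat \<Rightarrow> 'r"
begin

abbreviation muP :: "nat \<Rightarrow> 'v weyl \<Rightarrow> 'v weyl \<Rightarrow> 'v weyl" where
  "muP \<equiv> mu_P n \<pi> (*) sc"

abbreviation circ :: "'v weyl \<Rightarrow> 'v weyl \<Rightarrow> 'v weyl" (infixl "\<bullet>" 70) where
  "circ \<equiv> weyl_circ n \<pi> (*) sc"

lemmas lin_sym_ins_wsc = lin_wsc[OF lin_sym_ins]

section \<open>The bidifferential operators of the deformed product\<close>

lemma muP_add_left: "muP k (a + a') b = muP k a b + muP k a' b"
  by (induction k arbitrary: a a' b)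
    (simp_all add: mu_add_left sym_ins.add wsc.scale_right_distrib sum.distrib)

lemma muP_add_right: "muP k a (b + b') = muP k a b + muP k a b'"
  by (induction k arbitrary: a b b')
    (simp_all add: mu_add_right sym_ins.add wsc.scale_right_distrib sum.distrib)

lemma muP_wsc_left: "muP k (wsc c a) b = wsc c (muP k a b)"
  by (induction k arbitrary: a b)
    (simp_all add: mu_wsc_left lin_sym_ins_wsc wsc.scale_sum_right mult.commute)

lemma muP_wsc_right: "muP k a (wsc c b) = wsc c (muP k a b)"
  by (induction k arbitrary: a b)
    (simp_all add: mu_wsc_right lin_sym_ins_wsc wsc.scale_sum_right mult.commute)

lemma additive_muP_left: "additive (\<lambda>a. muP k a b)"
  and additive_muP_right: "additive (muP k a)"
  by (simp_all add: additive_def muP_add_left muP_add_right)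

lemmas muP_sum_left = additive.sum[OF additive_muP_left]
lemmas muP_sum_right = additive.sum[OF additive_muP_right]
lemmas muP_zero_left = additive.zero[OF additive_muP_left]
lemmas muP_zero_right = additive.zero[OF additive_muP_right]
lemma muP_tpow_left: "muP k (tpow j a) b = tpow j (muP k a b)"
  by (induction k arbitrary: a b)
    (simp_all add: mu_tpow_left lin_tpow[OF lin_sym_ins] tpow.sum lin_tpow[OF lin_wsc'])

lemma muP_tpow_right: "muP k a (tpow j b) = tpow j (muP k a b)"
  by (induction k arbitrary: a b)
    (simp_all add: mu_tpow_right lin_tpow[OF lin_sym_ins] tpow.sum lin_tpow[OF lin_wsc'])

lemma muP_alt_mul_left: "muP k (alt_mul i a) b = alt_mul i (muP k a b)"
  by (induction k arbitrary: a b)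
    (simp_all add: mu_alt_mul_left sym_ins_alt_mul alt_mul.sum lin_wsc[OF lin_alt_mul])

lemma muP_alt_mul_right: "muP k a (alt_mul i b) = alt_mul i (muP k (gam a) b)"
  by (induction k arbitrary: a b)
    (simp_all add: mu_alt_mul_right sym_ins_alt_mul alt_mul.sum lin_wsc[OF lin_alt_mul] gam_sym_ins)

lemma gam_muP: "gam (muP k a b) = muP k (gam a) (gam b)"
  by (induction k arbitrary: a b)
    (simp_all add: gam_mu gam_sym_ins gam.sum lin_wsc[OF lin_gam])

lemma muP_alt_ins: "alt_ins i (muP k a b) = muP k (alt_ins i a) b + muP k (gam a) (alt_ins i b)"
  by (induction k arbitrary: a b)
    (simp_all add: mu_alt_ins sym_ins_alt_ins alt_ins.sum lin_wsc[OF lin_alt_ins] gam_sym_ins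
      wsc.scale_right_distrib sum.distrib)

lemma muP_sym_ins: "sym_ins i (muP k a b) = muP k (sym_ins i a) b + muP k a (sym_ins i b)"
  by (induction k arbitrary: a b)
    (simp_all add: mu_sym_ins sym_ins_commute[of i] sym_ins.sum lin_wsc[OF lin_sym_ins]
      wsc.scale_right_distrib sum.distrib)

text \<open>A derivation of the undeformed product that satisfies the hypothesis \<open>inv\<close> annihilates the
  bivector \<open>\<pi>\<close>, hence is a derivation of all the bidifferential operators.\<close>

lemma muP_derivation:
  assumes T: "lin T"
    and mu: "\<And>a b. T (mu a b) = mu (T a) b + mu a (T b)"
    and comm: "\<And>i a. i < n \<Longrightarrow> sym_ins i (T a) = T (sym_ins i a) + (\<Sum>l<n. wsc (G i l) (sym_ins l a))"
    and inv: "\<And>l j. l < n \<Longrightarrow> j < n \<Longrightarrow> (\<Sum>i<n. \<pi> i j * G i l + \<pi> l i * G i j) = 0"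
  shows "T (muP k a b) = muP k (T a) b + muP k a (T b)"
proof (induction k arbitrary: a b)
  case (Suc k)
  define m where "m = (\<lambda>i j. muP k (sym_ins i a) (sym_ins j b))"
  let ?E1 = "\<Sum>i<n. \<Sum>j<n. \<Sum>l<n. wsc (\<pi> i j * G i l) (m l j)"
  let ?E2 = "\<Sum>i<n. \<Sum>j<n. \<Sum>l<n. wsc (\<pi> i j * G j l) (m i l)"
  have 1: "muP (Suc k) (T a) b =
    (\<Sum>i<n. \<Sum>j<n. wsc (\<pi> i j) (muP k (T (sym_ins i a)) (sym_ins j b))) + ?E1"
    by (simp add: m_def comm muP_add_left muP_sum_left muP_wsc_left wsc.scale_right_distrib
        wsc.scale_sum_right sum.distrib)
  have 2: "muP (Suc k) a (T b) =
    (\<Sum>i<n. \<Sum>j<n. wsc (\<pi> i j) (muP k (sym_ins i a) (T (sym_ins j b)))) + ?E2"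
    by (simp add: m_def comm muP_add_right muP_sum_right muP_wsc_right wsc.scale_right_distrib
        wsc.scale_sum_right sum.distrib)
  have "?E1 = (\<Sum>l<n. \<Sum>j<n. \<Sum>i<n. wsc (\<pi> i j * G i l) (m l j))"
    by (subst sum.swap, subst (2) sum.swap, subst sum.swap) (rule refl)
  moreover have "?E2 = (\<Sum>l<n. \<Sum>j<n. \<Sum>i<n. wsc (\<pi> l i * G i j) (m l j))"
    by (subst (2) sum.swap) (rule refl)
  ultimately have "?E1 + ?E2 = (\<Sum>l<n. \<Sum>j<n. wsc (\<Sum>i<n. \<pi> i j * G i l + \<pi> l i * G i j) (m l j))"
    by (simp add: wsc.scale_sum_left wsc.scale_left_distrib sum.distrib)
  also have "\<dots> = 0" by (simp add: inv)
  finally have 3: "?E1 + ?E2 = 0" .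
  have "T (muP (Suc k) a b) =
    (\<Sum>i<n. \<Sum>j<n. wsc (\<pi> i j) (muP k (T (sym_ins i a)) (sym_ins j b))) +
    (\<Sum>i<n. \<Sum>j<n. wsc (\<pi> i j) (muP k (sym_ins i a) (T (sym_ins j b))))"
    unfolding mu_P.simps lin_sum[OF T] lin_wsc[OF T] Suc.IH wsc.scale_right_distrib sum.distrib ..
  then show ?case unfolding 1 2 using 3 by (simp add: algebra_simps add_eq_0_iff)
qed (simp add: mu)

section \<open>The exponential series of the bidifferential operators\<close>

lemma circ_slice:
  "slice m (a \<bullet> b) = (\<Sum>k\<le>m. wsc (circ_coeff k) (slice (m - k) (muP k a b)))"
  by (intro ext fps_ext)
    (simp add: slice_def weyl_circ_def fun_additive_sum fps_sum_nth wsc_nth circ_coeff_def)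

lemma circ_nth: "(a \<bullet> b) M J $ m = (\<Sum>k\<le>m. sc (circ_coeff k) (muP k a b M J $ (m - k)))"
  by (simp add: weyl_circ_def circ_coeff_def)

text \<open>Since \<open>T\<close> passes through slices, a rule valid for every
  \<open>muP k\<close> separately passes to the series. The derivation rules for the product are
  obtained this way.\<close>

lemma circ_lin2:
  assumes "lin T" "\<And>k. T (muP k a b) = muP k a1 b1 + muP k a2 b2"
  shows "T (a \<bullet> b) = a1 \<bullet> b1 + a2 \<bullet> b2"
proof (rule weyl_eq_slice)
  fix m
  have "slice m (T (a \<bullet> b)) = (\<Sum>k\<le>m. wsc (circ_coeff k) (slice (m - k) (T (muP k a b))))"
    by (simp add: circ_slice assms(1) lin_sum lin_wsc flip: lin_slice)
  then show "slice m (T (a \<bullet> b)) = slice m (a1 \<bullet> b1 + a2 \<bullet> b2)"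
    by (simp add: assms(2) slice.add wsc.scale_right_distrib sum.distrib circ_slice)
qed

lemma circ_lin1:
  assumes "lin T" "\<And>k. T (muP k a b) = muP k a1 b1"
  shows "T (a \<bullet> b) = a1 \<bullet> b1"
proof (rule weyl_eq_slice)
  fix m
  have "slice m (T (a \<bullet> b)) = (\<Sum>k\<le>m. wsc (circ_coeff k) (slice (m - k) (T (muP k a b))))"
    by (simp add: circ_slice assms(1) lin_sum lin_wsc flip: lin_slice)
  then show "slice m (T (a \<bullet> b)) = slice m (a1 \<bullet> b1)"
    by (simp add: assms(2) circ_slice)
qed

lemma circ_add_left: "(a + a') \<bullet> b = a \<bullet> b + a' \<bullet> b"
  using circ_lin2[OF lin_id, of "a + a'" b a b a' b] by (simp add: muP_add_left)

lemma circ_add_right: "a \<bullet> (b + b') = a \<bullet> b + a \<bullet> b'"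
  using circ_lin2[OF lin_id, of a "b + b'" a b a b'] by (simp add: muP_add_right)

lemma additive_circ_left: "additive (\<lambda>a. a \<bullet> b)"
  and additive_circ_right: "additive (\<lambda>b. a \<bullet> b)"
  by (simp_all add: additive_def circ_add_left circ_add_right)

lemmas circ_sum_left = additive.sum[OF additive_circ_left]
lemmas circ_sum_right = additive.sum[OF additive_circ_right]
lemmas circ_zero_left = additive.zero[OF additive_circ_left]
lemmas circ_zero_right = additive.zero[OF additive_circ_right]
lemmas circ_minus_left = additive.minus[OF additive_circ_left]
lemmas circ_diff_left = additive.diff[OF additive_circ_left]
lemmas circ_diff_right = additive.diff[OF additive_circ_right]

lemma circ_wsc_left: "wsc c a \<bullet> b = wsc c (a \<bullet> b)"
  by (rule circ_lin1[symmetric]) (auto simp: muP_wsc_left)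

lemma circ_wsc_right: "a \<bullet> wsc c b = wsc c (a \<bullet> b)"
  by (rule circ_lin1[symmetric]) (auto simp: muP_wsc_right)

lemma circ_alt_mul_left: "alt_mul i a \<bullet> b = alt_mul i (a \<bullet> b)"
  by (rule circ_lin1[symmetric]) (auto simp: muP_alt_mul_left)

lemma circ_alt_mul_right: "a \<bullet> alt_mul i b = alt_mul i (gam a \<bullet> b)"
  by (rule circ_lin1[symmetric]) (auto simp: muP_alt_mul_right)

lemma circ_alt_ins: "alt_ins i (a \<bullet> b) = alt_ins i a \<bullet> b + gam a \<bullet> alt_ins i b"
  by (rule circ_lin2[OF lin_alt_ins muP_alt_ins])

lemma circ_sym_ins: "sym_ins i (a \<bullet> b) = sym_ins i a \<bullet> b + a \<bullet> sym_ins i b"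
  by (rule circ_lin2[OF lin_sym_ins muP_sym_ins])

lemma gam_circ: "gam (a \<bullet> b) = gam a \<bullet> gam b"
  by (rule circ_lin1) (auto simp: gam_muP)

lemma teq_wsc: "teq N a b \<Longrightarrow> teq N (wsc c a) (wsc c b)"
  by (simp add: teq_def wsc_nth)

lemma teq_muP: "teq N a a' \<Longrightarrow> teq N b b' \<Longrightarrow> teq N (muP k a b) (muP k a' b')"
proof (induction k arbitrary: a a' b b')
  case 0
  then show ?case by (simp add: teq_mu)
next
  case (Suc k)
  show ?case
    unfolding mu_P.simps by (intro teq_sum teq_wsc Suc.IH teq_sym_ins Suc.prems)
qed

lemma teq_circ: "teq N (a \<bullet> b) (\<Sum>k\<le>N. wsc (circ_coeff k) (tpow k (muP k a b)))"
  unfolding teq_def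
proof (intro allI impI)
  fix M J m assume "m \<le> N"
  have "(\<Sum>k\<le>N. wsc (circ_coeff k) (tpow k (muP k a b))) M J $ m =
    (\<Sum>k\<le>N. if k \<le> m then sc (circ_coeff k) (muP k a b M J $ (m - k)) else 0)"
    by (simp add: fun_additive_sum fps_sum_nth wsc_nth tpow_nth if_distrib not_le[symmetric] cong: if_cong)
      (auto intro!: sum.cong)
  also have "\<dots> = (\<Sum>k\<le>m. sc (circ_coeff k) (muP k a b M J $ (m - k)))"
    using \<open>m \<le> N\<close> by (intro sum.mono_neutral_cong_right) auto
  finally show "(a \<bullet> b) M J $ m = (\<Sum>k\<le>N. wsc (circ_coeff k) (tpow k (muP k a b))) M J $ m"
    by (simp add: circ_nth)
qed

lemma circ_tpow_left: "tpow j a \<bullet> b = tpow j (a \<bullet> b)"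
proof (rule teq_all)
  fix N
  have "teq N (tpow j a \<bullet> b) (\<Sum>k\<le>N. wsc (circ_coeff k) (tpow k (muP k (tpow j a) b)))"
    by (rule teq_circ)
  also have "(\<Sum>k\<le>N. wsc (circ_coeff k) (tpow k (muP k (tpow j a) b))) =
    tpow j (\<Sum>k\<le>N. wsc (circ_coeff k) (tpow k (muP k a b)))"
    by (simp add: muP_tpow_left tpow_tpow tpow.sum lin_tpow[OF lin_wsc'] add.commute)
  also have "teq N \<dots> (tpow j (a \<bullet> b))" by (intro teq_tpow teq_sym[OF teq_circ])
  finally show "teq N (tpow j a \<bullet> b) (tpow j (a \<bullet> b))" .
qed

lemma circ_tpow_right: "a \<bullet> tpow j b = tpow j (a \<bullet> b)"
proof (rule teq_all)
  fix N
  have "teq N (a \<bullet> tpow j b) (\<Sum>k\<le>N. wsc (circ_coeff k) (tpow k (muP k a (tpow j b))))"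
    by (rule teq_circ)
  also have "(\<Sum>k\<le>N. wsc (circ_coeff k) (tpow k (muP k a (tpow j b)))) =
    tpow j (\<Sum>k\<le>N. wsc (circ_coeff k) (tpow k (muP k a b)))"
    by (simp add: muP_tpow_right tpow_tpow tpow.sum lin_tpow[OF lin_wsc'] add.commute)
  also have "teq N \<dots> (tpow j (a \<bullet> b))" by (intro teq_tpow teq_sym[OF teq_circ])
  finally show "teq N (a \<bullet> tpow j b) (tpow j (a \<bullet> b))" .
qed

text \<open>The factor \<open>2 * Suc s\<close> is split as \<open>2 * k + 2 * (Suc s - k)\<close>.
  This is differentiation of a product of two exponential series: each half lowers one coefficient
  by \<open>circ_coeff_Suc\<close>.\<close>

lemma convolution_Suc:
  fixes f :: "nat \<Rightarrow> nat \<Rightarrow> 'v weyl"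
  shows "wsc (of_nat (2 * Suc s)) (\<Sum>k\<le>Suc s. wsc (circ_coeff k * circ_coeff (Suc s - k)) (f k (Suc s - k))) =
    (\<Sum>k\<le>s. wsc (circ_coeff k * circ_coeff (s - k)) (f (Suc k) (s - k) + f k (Suc (s - k))))"
proof -
  let ?c = "circ_coeff :: nat \<Rightarrow> 'r"
  have "wsc (of_nat (2 * Suc s)) (\<Sum>k\<le>Suc s. wsc (?c k * ?c (Suc s - k)) (f k (Suc s - k))) =
    (\<Sum>k\<le>Suc s. wsc (of_nat (2 * k) * ?c k * ?c (Suc s - k)) (f k (Suc s - k))) +
    (\<Sum>k\<le>Suc s. wsc (?c k * (of_nat (2 * (Suc s - k)) * ?c (Suc s - k))) (f k (Suc s - k)))"
    unfolding wsc.scale_sum_right sum.distrib[symmetric] wsc.scale_left_distrib[symmetric] wsc.scale_scale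
  proof (rule sum.cong[OF refl])
    fix k assume "k \<in> {..Suc s}"
    then have "2 * Suc s = 2 * k + 2 * (Suc s - k)" by auto
    then have "(of_nat (2 * Suc s) :: 'r) = of_nat (2 * k) + of_nat (2 * (Suc s - k))"
      by (metis of_nat_add)
    then show "wsc (of_nat (2 * Suc s) * (?c k * ?c (Suc s - k))) (f k (Suc s - k)) =
         wsc (of_nat (2 * k) * ?c k * ?c (Suc s - k) + ?c k * (of_nat (2 * (Suc s - k)) * ?c (Suc s - k)))
          (f k (Suc s - k))"
      by (simp only: algebra_simps)
  qed
  also have "(\<Sum>k\<le>Suc s. wsc (of_nat (2 * k) * ?c k * ?c (Suc s - k)) (f k (Suc s - k))) =
    (\<Sum>k\<le>s. wsc (?c k * ?c (s - k)) (f (Suc k) (s - k)))"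
    unfolding sum.atMost_Suc_shift circ_coeff_Suc by simp
  also have "(\<Sum>k\<le>Suc s. wsc (?c k * (of_nat (2 * (Suc s - k)) * ?c (Suc s - k))) (f k (Suc s - k))) =
    (\<Sum>k\<le>s. wsc (?c k * ?c (s - k)) (f k (Suc (s - k))))"
  proof -
    have "(\<Sum>k\<le>Suc s. wsc (?c k * (of_nat (2 * (Suc s - k)) * ?c (Suc s - k))) (f k (Suc s - k))) =
      (\<Sum>k\<le>s. wsc (?c k * (of_nat (2 * (Suc s - k)) * ?c (Suc s - k))) (f k (Suc s - k)))"
      by simp
    also have "\<dots> = (\<Sum>k\<le>s. wsc (?c k * ?c (s - k)) (f k (Suc (s - k))))"
      by (rule sum.cong[OF refl]) (simp only: atMost_iff Suc_diff_le circ_coeff_Suc)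
    finally show ?thesis .
  qed
  finally show ?thesis by (simp only: wsc.scale_right_distrib sum.distrib)
qed

lemma sum_wsc_push:
  "(\<Sum>k\<in>K. wsc (x k) (\<Sum>i<n. \<Sum>j<n. wsc (\<pi> i j) (g k i j))) =
    (\<Sum>i<n. \<Sum>j<n. wsc (\<pi> i j) (\<Sum>k\<in>K. wsc (x k) (g k i j)))"
proof -
  have "(\<Sum>k\<in>K. wsc (x k) (\<Sum>i<n. \<Sum>j<n. wsc (\<pi> i j) (g k i j))) =
    (\<Sum>k\<in>K. \<Sum>i<n. \<Sum>j<n. wsc (\<pi> i j) (wsc (x k) (g k i j)))"
    by (simp add: wsc.scale_sum_right mult.commute)
  also have "\<dots> = (\<Sum>i<n. \<Sum>j<n. \<Sum>k\<in>K. wsc (\<pi> i j) (wsc (x k) (g k i j)))"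
    by (subst sum.swap, rule sum.cong[OF refl], subst sum.swap, rule refl)
  finally show ?thesis by (simp add: wsc.scale_sum_right)
qed

definition assoc1 :: "nat \<Rightarrow> 'v weyl \<Rightarrow> 'v weyl \<Rightarrow> 'v weyl \<Rightarrow> 'v weyl" where
  "assoc1 s a b c = (\<Sum>k\<le>s. wsc (circ_coeff k * circ_coeff (s - k)) (muP k (muP (s - k) a b) c))"

definition assoc2 :: "nat \<Rightarrow> 'v weyl \<Rightarrow> 'v weyl \<Rightarrow> 'v weyl \<Rightarrow> 'v weyl" where
  "assoc2 s a b c = (\<Sum>k\<le>s. wsc (circ_coeff k * circ_coeff (s - k)) (muP k a (muP (s - k) b c)))"

lemma assoc1_Suc: "wsc (of_nat (2 * Suc s)) (assoc1 (Suc s) a b c) =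
  (\<Sum>i<n. \<Sum>j<n. wsc (\<pi> i j) (assoc1 s (sym_ins i a) b (sym_ins j c) +
    assoc1 s a (sym_ins i b) (sym_ins j c) + assoc1 s (sym_ins i a) (sym_ins j b) c))"
proof -
  have *: "muP (Suc k) (muP l a b) c + muP k (muP (Suc l) a b) c =
    (\<Sum>i<n. \<Sum>j<n. wsc (\<pi> i j) (muP k (muP l (sym_ins i a) b) (sym_ins j c) +
      muP k (muP l a (sym_ins i b)) (sym_ins j c) + muP k (muP l (sym_ins i a) (sym_ins j b)) c))" for k l
    by (simp add: muP_sym_ins muP_add_left muP_sum_left muP_wsc_left wsc.scale_right_distrib sum.distrib)
  show ?thesis
    unfolding assoc1_def convolution_Suc[where f = "\<lambda>k l. muP k (muP l a b) c"] * sum_wsc_push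
    by (simp only: wsc.scale_right_distrib sum.distrib)
qed

lemma assoc2_Suc: "wsc (of_nat (2 * Suc s)) (assoc2 (Suc s) a b c) =
  (\<Sum>i<n. \<Sum>j<n. wsc (\<pi> i j) (assoc2 s (sym_ins i a) b (sym_ins j c) +
    assoc2 s a (sym_ins i b) (sym_ins j c) + assoc2 s (sym_ins i a) (sym_ins j b) c))"
proof -
  have *: "muP (Suc k) a (muP l b c) + muP k a (muP (Suc l) b c) =
    (\<Sum>i<n. \<Sum>j<n. wsc (\<pi> i j) (muP k (sym_ins i a) (muP l b (sym_ins j c)) +
      muP k a (muP l (sym_ins i b) (sym_ins j c)) + muP k (sym_ins i a) (muP l (sym_ins j b) c)))" for k l
    by (simp add: muP_sym_ins muP_add_right muP_sum_right muP_wsc_right wsc.scale_right_distrib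
        sum.distrib algebra_simps)
  show ?thesis
    unfolding assoc2_def convolution_Suc[where f = "\<lambda>k l. muP k a (muP l b c)"] * sum_wsc_push
    by (simp only: wsc.scale_right_distrib sum.distrib)
qed

lemma wsc_of_nat_cancel:
  assumes "wsc (of_nat k) a = wsc (of_nat k) b" "k > 0" shows "a = b"
proof -
  have "wsc (rat_const (1 / of_nat k)) (wsc (of_nat k) a) = wsc (rat_const (1 / of_nat k)) (wsc (of_nat k) b)"
    using assms(1) by (simp only:)
  then show ?thesis using rat_const_inverse_nat[OF assms(2), where 'a = 'r] by simp
qed

text \<open>The coefficients of \<open>t\<^sup>s\<close> in both associators obey the same recursion in \<open>s\<close>, in which the
  bivector is distributed over the three pairs of factors.\<close>

lemma assoc1_eq_assoc2: "assoc1 s a b c = assoc2 s a b c"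
proof (induction s arbitrary: a b c)
  case 0
  then show ?case by (simp add: assoc1_def assoc2_def mu_assoc)
next
  case (Suc s)
  have "wsc (of_nat (2 * Suc s)) (assoc1 (Suc s) a b c) = wsc (of_nat (2 * Suc s)) (assoc2 (Suc s) a b c)"
    unfolding assoc1_Suc assoc2_Suc Suc.IH ..
  then show ?case by (rule wsc_of_nat_cancel) simp
qed

text \<open>The pairs with \<open>k + l > N\<close> carry a power of \<open>t\<close> that vanishes
  modulo \<open>t^(N+1)\<close>, so the square of indices shrinks to a triangle.\<close>

lemma sum_triangle:
  "teq N (\<Sum>k\<le>N. \<Sum>l\<le>N. tpow (k + l) (g k l)) (\<Sum>s\<le>N. tpow s (\<Sum>k\<le>s. g k (s - k) :: 'v weyl))"
proof -
  have "teq N (\<Sum>k\<le>N. \<Sum>l\<le>N. tpow (k + l) (g k l)) (\<Sum>k\<le>N. \<Sum>l\<le>N. if k + l \<le> N then tpow (k + l) (g k l) else 0)"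
    by (intro teq_sum) (auto simp: teq_def tpow_nth)
  also have "(\<Sum>k\<le>N. \<Sum>l\<le>N. if k + l \<le> N then tpow (k + l) (g k l) else 0) =
    (\<Sum>(k, l)\<in>{..N} \<times> {..N}. if k + l \<le> N then tpow (k + l) (g k l) else 0)"
    by (simp add: sum.cartesian_product)
  also have "\<dots> = (\<Sum>(k, l)\<in>{(i, j). i + j \<le> N}. tpow (k + l) (g k l))"
    by (rule sum.mono_neutral_cong_right) auto
  also have "\<dots> = (\<Sum>s\<le>N. \<Sum>k\<le>s. tpow s (g k (s - k)))"
    by (subst sum.triangle_reindex_eq) (auto intro!: sum.cong)
  finally show ?thesis by (simp add: tpow.sum)
qed

theorem circ_assoc: "a \<bullet> b \<bullet> c = a \<bullet> (b \<bullet> c)"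
proof (rule teq_all)
  fix N
  let ?c = "circ_coeff :: nat \<Rightarrow> 'r"
  have "teq N (a \<bullet> b \<bullet> c) (\<Sum>k\<le>N. wsc (?c k) (tpow k (muP k (a \<bullet> b) c)))" by (rule teq_circ)
  also have "teq N \<dots> (\<Sum>k\<le>N. wsc (?c k) (tpow k (muP k (\<Sum>l\<le>N. wsc (?c l) (tpow l (muP l a b))) c)))"
    by (intro teq_sum teq_wsc teq_tpow teq_muP teq_circ teq_refl)
  also have "\<dots> = (\<Sum>k\<le>N. \<Sum>l\<le>N. tpow (k + l) (wsc (?c k * ?c l) (muP k (muP l a b) c)))"
    by (simp add: muP_sum_left muP_wsc_left muP_tpow_left tpow.sum wsc.scale_sum_right
        lin_tpow[OF lin_wsc'] tpow_tpow flip: wsc.scale_scale)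
  also have "teq N \<dots> (\<Sum>s\<le>N. tpow s (assoc1 s a b c))"
    unfolding assoc1_def by (rule sum_triangle)
  finally have 1: "teq N (a \<bullet> b \<bullet> c) (\<Sum>s\<le>N. tpow s (assoc1 s a b c))" .
  have "teq N (a \<bullet> (b \<bullet> c)) (\<Sum>k\<le>N. wsc (?c k) (tpow k (muP k a (b \<bullet> c))))" by (rule teq_circ)
  also have "teq N \<dots> (\<Sum>k\<le>N. wsc (?c k) (tpow k (muP k a (\<Sum>l\<le>N. wsc (?c l) (tpow l (muP l b c))))))"
    by (intro teq_sum teq_wsc teq_tpow teq_muP teq_circ teq_refl)
  also have "\<dots> = (\<Sum>k\<le>N. \<Sum>l\<le>N. tpow (k + l) (wsc (?c k * ?c l) (muP k a (muP l b c))))"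
    by (simp add: muP_sum_right muP_wsc_right muP_tpow_right tpow.sum wsc.scale_sum_right
        lin_tpow[OF lin_wsc'] tpow_tpow flip: wsc.scale_scale)
  also have "teq N \<dots> (\<Sum>s\<le>N. tpow s (assoc2 s a b c))"
    unfolding assoc2_def by (rule sum_triangle)
  finally show "teq N (a \<bullet> b \<bullet> c) (a \<bullet> (b \<bullet> c))"
    using 1 unfolding assoc1_eq_assoc2 by (blast intro: teq_trans teq_sym)
qed

lemma circ_nth_0: "(a \<bullet> b) M J $ 0 = mu a b M J $ 0"
  by (simp add: circ_nth)

text \<open>\<open>weyl_divide_t\<close> is a shift that drops the constant term; it is division
  only when that term vanishes, whence the recurring condition on \<open>$ 0\<close>.\<close>

lemma circ_divide_left: "(\<And>M J. a M J $ 0 = 0) \<Longrightarrow> weyl_divide_t a \<bullet> b = weyl_divide_t (a \<bullet> b)"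
  using circ_tpow_left[of 1 "weyl_divide_t a" b] tpow_divide[of a] divide_tpow by metis

lemma circ_divide_right: "(\<And>M J. b M J $ 0 = 0) \<Longrightarrow> a \<bullet> weyl_divide_t b = weyl_divide_t (a \<bullet> b)"
  using circ_tpow_right[of a 1 "weyl_divide_t b"] tpow_divide[of b] divide_tpow by metis

end

section \<open>The connection\<close>

lemma sum_rotate3: "(\<Sum>p\<in>A. \<Sum>q\<in>A. \<Sum>j\<in>A. f p q j) = (\<Sum>p\<in>A. \<Sum>q\<in>A. \<Sum>j\<in>A. f q j p :: 'b::comm_monoid_add)"
proof -
  have "(\<Sum>p\<in>A. \<Sum>q\<in>A. \<Sum>j\<in>A. f p q j) = (\<Sum>p\<in>A. \<Sum>j\<in>A. \<Sum>q\<in>A. f p q j)"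
    by (rule sum.cong[OF refl], rule sum.swap)
  also have "\<dots> = (\<Sum>j\<in>A. \<Sum>p\<in>A. \<Sum>q\<in>A. f p q j)" by (rule sum.swap)
  finally show ?thesis .
qed

text \<open>A two-form with coefficients \<open>f i j\<close>, summed over ordered pairs. Only the
  antisymmetric part of \<open>f\<close> matters, so such forms are best compared after
  doubling.\<close>

definition eps2 :: "nat \<Rightarrow> (nat \<Rightarrow> nat \<Rightarrow> 'v::ring_1 weyl) \<Rightarrow> 'v weyl" where
  "eps2 n f = (\<Sum>i<n. \<Sum>j<n. alt_mul i (alt_mul j (f i j)))"

lemma eps2_add: "eps2 n (\<lambda>i j. f i j + g i j) = eps2 n f + eps2 n g"
  and eps2_diff: "eps2 n (\<lambda>i j. f i j - g i j) = eps2 n f - eps2 n g"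
  by (simp_all add: eps2_def alt_mul.add alt_mul.diff alt_mul.minus sum.distrib sum_subtractf sum_negf)

lemma eps2_cong: "(\<And>i j. i < n \<Longrightarrow> j < n \<Longrightarrow> f i j = g i j) \<Longrightarrow> eps2 n f = eps2 n g"
  by (simp add: eps2_def)

lemma eps2_swap: "eps2 n (\<lambda>i j. f j i) = - eps2 n f"
proof -
  have "eps2 n (\<lambda>i j. f j i) = (\<Sum>i<n. \<Sum>j<n. alt_mul j (alt_mul i (f i j)))"
    unfolding eps2_def by (rule sum.swap)
  also have "\<dots> = (\<Sum>i<n. \<Sum>j<n. - alt_mul i (alt_mul j (f i j)))"
    by (intro sum.cong refl) (rule alt_mul_anticommute)
  finally show ?thesis by (simp add: eps2_def sum_negf)
qed

lemma eps2_double: "eps2 n f + eps2 n f = eps2 n (\<lambda>i j. f i j - f j i)"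
  unfolding eps2_diff eps2_swap[of n f] by simp

lemma alt_mul_eps2: "alt_mul k (eps2 n f) = eps2 n (\<lambda>i j. alt_mul k (f i j))"
proof -
  have "alt_mul k (alt_mul i (alt_mul j b)) = alt_mul i (alt_mul j (alt_mul k b))" for i j and b :: "'a weyl"
    by (simp add: alt_mul_anticommute[of k] alt_mul.minus)
  then show ?thesis by (simp add: eps2_def alt_mul.sum)
qed

context alg
begin

lemma eps2_sym: "(\<And>i j. i < n \<Longrightarrow> j < n \<Longrightarrow> f i j = f j i) \<Longrightarrow> eps2 n f = (0 :: 'v weyl)"
proof (rule weyl_double_eq_0)
  assume *: "\<And>i j. i < n \<Longrightarrow> j < n \<Longrightarrow> f i j = f j i"
  have "eps2 n (\<lambda>i j. f i j - f j i) = eps2 n (\<lambda>i j. 0 :: 'v weyl)"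
  proof (rule eps2_cong)
    fix i j assume "i < n" "j < n"
    then show "f i j - f j i = 0" using * by simp
  qed
  then show "eps2 n f + eps2 n f = 0"
    unfolding eps2_double by (simp add: eps2_def alt_mul.zero)
qed

lemma lin_eps2: "(\<And>i j. lin (f i j)) \<Longrightarrow> lin (\<lambda>a. eps2 n (\<lambda>i j. f i j a))"
  unfolding eps2_def by (intro lin_setsum lin_comp[OF lin_alt_mul])

lemma wsc_eps2: "wsc c (eps2 n f) = eps2 n (\<lambda>i j. wsc c (f i j))"
  by (simp add: eps2_def wsc.scale_sum_right lin_wsc[OF lin_alt_mul])

end

text \<open>The coordinate form of the geometry, together with a Lie algebra action by derivations
  on the coefficients. \<open>parallel\<close> says that the matrices \<open>\<Gamma> i\<close>
  preserve the bivector \<open>\<pi>\<close>.\<close>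

locale connection = moyal sc n \<pi>
  for sc :: "'r::ring_containing_rat \<Rightarrow> 'v::ring_1 \<Rightarrow> 'v" and n \<pi> +
  fixes C \<Gamma> :: "nat \<Rightarrow> nat \<Rightarrow> nat \<Rightarrow> 'r"
    and act :: "nat \<Rightarrow> 'v \<Rightarrow> 'v"
  assumes C_antisym: "i < n \<Longrightarrow> j < n \<Longrightarrow> k < n \<Longrightarrow> C i j k = - C j i k"
    and torsion: "i < n \<Longrightarrow> j < n \<Longrightarrow> k < n \<Longrightarrow> \<Gamma> i j k - \<Gamma> j i k = C i j k"
    and jacobi: "i < n \<Longrightarrow> j < n \<Longrightarrow> k < n \<Longrightarrow> l < n \<Longrightarrow>
      (\<Sum>m<n. C i j m * C m k l + C j k m * C m i l + C k i m * C m j l) = 0"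
    and parallel: "i < n \<Longrightarrow> k < n \<Longrightarrow> l < n \<Longrightarrow> (\<Sum>m<n. \<pi> m l * \<Gamma> i m k + \<pi> k m * \<Gamma> i m l) = 0"
    and act_add: "act i (x + y) = act i x + act i y"
    and act_sc: "act i (sc c x) = sc c (act i x)"
    and act_mult: "act i (x * y) = act i x * y + x * act i y"
    and act_commutator: "i < n \<Longrightarrow> j < n \<Longrightarrow> act i (act j x) - act j (act i x) = (\<Sum>k<n. sc (C i j k) (act k x))"
begin

sublocale act: additive "act i" for i
  by unfold_locales (rule act_add)

definition wact :: "nat \<Rightarrow> 'v weyl \<Rightarrow> 'v weyl" where
  "wact i a = (\<lambda>M J. fps_map (act i) (a M J))"

lemma wact_nth: "wact i a M J $ m = act i (a M J $ m)"
  by (simp add: wact_def fps_map_def)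

lemma act_of_nat: "act i (of_nat k * x) = of_nat k * act i x"
  by (simp add: act_sc flip: sc_of_nat)

lemma lin_wact [intro!]: "lin (wact i)"
  unfolding lin_def
  by (intro conjI allI ext fps_ext) (simp_all add: wact_nth slice_def wsc_nth act.add act_sc act.zero)

lemma wact_sym_mul: "wact i (sym_mul j a) = sym_mul j (wact i a)"
  by (intro ext fps_ext) (simp add: wact_nth sym_mul_def act.zero)

lemma wact_sym_ins: "wact i (sym_ins j a) = sym_ins j (wact i a)"
  by (intro ext fps_ext) (simp add: wact_nth sym_ins_def fps_nth_of_nat_mult act_of_nat del: of_nat_Suc of_nat_add)

lemma wact_alt_mul: "wact i (alt_mul j a) = alt_mul j (wact i a)"
  by (intro ext fps_ext) (simp add: wact_nth alt_mul_apply alt_sign_def act.zero act.minus)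

lemma wact_alt_ins: "wact i (alt_ins j a) = alt_ins j (wact i a)"
  by (intro ext fps_ext) (simp add: wact_nth alt_ins_apply alt_sign_def act.zero act.minus)

lemma wact_mu: "wact i (mu a b) = mu (wact i a) b + mu a (wact i b)"
proof (intro ext)
  fix M J
  have fps: "fps_map (act i) (f * g) = fps_map (act i) f * g + f * fps_map (act i) g" for f g
    by (rule fps_ext) (simp add: fps_map_def fps_mult_nth act.sum act_mult sum.distrib)
  have add: "fps_map (act i) (f + g) = fps_map (act i) f + fps_map (act i) g"
    "fps_map (act i) (- f) = - fps_map (act i) f" "fps_map (act i) 0 = 0" for f g
    by (rule fps_ext; simp add: fps_map_def act.add act.minus act.zero)+
  have sum: "fps_map (act i) (sum h A) = (\<Sum>x\<in>A. fps_map (act i) (h x))" for h and A :: "'z set"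
    by (induction A rule: infinite_finite_induct) (simp_all add: add)
  show "wact i (mu a b) M J = (mu (wact i a) b + mu a (wact i b)) M J"
    by (simp add: wact_def mu_wedge wedge_def sum sum.distrib[symmetric])
      (auto intro!: sum.cong simp: alt_sign_def fps add)
qed

lemma wact_commutator:
  assumes "i < n" "j < n"
  shows "wact i (wact j a) - wact j (wact i a) = (\<Sum>k<n. wsc (C i j k) (wact k a))"
  by (intro ext fps_ext)
    (simp add: wact_nth fun_additive_sum fps_sum_nth wsc_nth act_commutator[OF assms])

text \<open>The derivation of the symmetric algebra induced by the matrix \<open>G\<close>; for
  these operators commutators reduce to matrix commutators.\<close>

definition Xop :: "(nat \<Rightarrow> nat \<Rightarrow> 'r) \<Rightarrow> 'v weyl \<Rightarrow> 'v weyl" where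
  "Xop G a = (\<Sum>j<n. \<Sum>k<n. wsc (G j k) (sym_mul j (sym_ins k a)))"

lemma lin_Xop [intro!]: "lin (Xop G)"
proof -
  have "lin (\<lambda>a. \<Sum>j<n. \<Sum>k<n. wsc (G j k) (sym_mul j (sym_ins k a)))"
    by (intro lin_setsum lin_comp[OF lin_wsc'] lin_comp[OF lin_sym_mul] lin_sym_ins)
  then show ?thesis by (simp add: Xop_def[abs_def])
qed

lemma Xop_alt_mul: "Xop G (alt_mul i a) = alt_mul i (Xop G a)"
  by (simp add: Xop_def sym_ins_alt_mul sym_mul_alt_mul alt_mul.sum lin_wsc[OF lin_alt_mul])

lemma Xop_alt_ins: "Xop G (alt_ins i a) = alt_ins i (Xop G a)"
  by (simp add: Xop_def sym_ins_alt_ins sym_mul_alt_ins alt_ins.sum lin_wsc[OF lin_alt_ins])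

lemma Xop_wact: "wact i (Xop G a) = Xop G (wact i a)"
  by (simp add: Xop_def wact_sym_mul wact_sym_ins lin_sum[OF lin_wact] lin_wsc[OF lin_wact])

lemma Xop_mu: "Xop G (mu a b) = mu (Xop G a) b + mu a (Xop G b)"
proof -
  have add: "additive (\<lambda>a. mu a b)" "additive (mu a)" for a b :: "'v weyl"
    by (simp_all add: additive_def mu_add_left mu_add_right)
  show ?thesis
    by (simp add: Xop_def mu_sym_ins sym_mul.add mu_sym_mul_left mu_sym_mul_right wsc.scale_right_distrib
        sum.distrib additive.sum[OF add(1)] additive.sum[OF add(2)] mu_wsc_left mu_wsc_right)
qed

lemma sym_ins_Xop:
  assumes "i < n"
  shows "sym_ins i (Xop G a) = Xop G (sym_ins i a) + (\<Sum>k<n. wsc (G i k) (sym_ins k a))"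
proof -
  have "sym_ins i (Xop G a) = (\<Sum>j<n. \<Sum>k<n. wsc (G j k) (sym_mul j (sym_ins k (sym_ins i a))) +
      (if i = j then wsc (G j k) (sym_ins k a) else 0))"
    unfolding Xop_def sym_ins.sum lin_wsc[OF lin_sym_ins] sym_ins_sym_mul
    by (intro sum.cong refl) (simp add: wsc.scale_right_distrib sym_ins_commute[of i])
  also have "\<dots> = Xop G (sym_ins i a) + (\<Sum>j<n. if i = j then \<Sum>k<n. wsc (G j k) (sym_ins k a) else 0)"
    unfolding sum.distrib Xop_def by (intro arg_cong2[of _ _ _ _ "(+)"] refl sum.cong) simp
  finally show ?thesis using assms by simp
qed

lemma Xop_add: "Xop (\<lambda>i j. G i j + H i j) a = Xop G a + Xop H a"
  and Xop_diff: "Xop (\<lambda>i j. G i j - H i j) a = Xop G a - Xop H a"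
  by (simp_all add: Xop_def wsc.scale_left_distrib wsc.scale_left_diff_distrib sum.distrib sum_subtractf sum_negf)

lemma Xop_wsc: "Xop (\<lambda>i j. c * G i j) a = wsc c (Xop G a)"
  by (simp add: Xop_def wsc.scale_sum_right)

lemma Xop_sum: "Xop (\<lambda>i j. \<Sum>k\<in>A. G k i j) a = (\<Sum>k\<in>A. Xop (G k) a)"
  by (induction A rule: infinite_finite_induct) (simp_all add: Xop_add, simp_all add: Xop_def)

definition commutator :: "(nat \<Rightarrow> nat \<Rightarrow> 'r) \<Rightarrow> (nat \<Rightarrow> nat \<Rightarrow> 'r) \<Rightarrow> nat \<Rightarrow> nat \<Rightarrow> 'r" where
  "commutator G H i j = (\<Sum>m<n. G i m * H m j - H i m * G m j)"

lemma Xop_commutator: "Xop G (Xop H a) - Xop H (Xop G a) = Xop (commutator G H) a"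
proof -
  \<comment> \<open>The second-order part of the composition. It is symmetric in \<open>G\<close>
    and \<open>H\<close> and drops out of the commutator.\<close>
  define Y where "Y = (\<lambda>G H. \<Sum>j<n. \<Sum>k<n. \<Sum>l<n. \<Sum>m<n.
    wsc (G j k * H l m) (sym_mul j (sym_mul l (sym_ins k (sym_ins m a)))))"
  have 1: "Xop G (Xop H a) = Y G H + Xop (\<lambda>i j. \<Sum>m<n. G i m * H m j) a" for G H
  proof -
    have *: "wsc (G j k) (sym_mul j (sym_ins k (Xop H a))) =
      (\<Sum>l<n. \<Sum>m<n. wsc (G j k * H l m) (sym_mul j (sym_mul l (sym_ins k (sym_ins m a))))) +
      (\<Sum>m<n. wsc (G j k * H k m) (sym_mul j (sym_ins m a)))" if "k < n" for j k
      by (subst sym_ins_Xop[OF that]) (simp add: sym_mul.add wsc.scale_right_distrib Xop_def sym_mul.sum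
          lin_wsc[OF lin_sym_mul] wsc.scale_sum_right sym_ins_commute[of k])
    have "Xop G (Xop H a) = (\<Sum>j<n. \<Sum>k<n.
      (\<Sum>l<n. \<Sum>m<n. wsc (G j k * H l m) (sym_mul j (sym_mul l (sym_ins k (sym_ins m a))))) +
      (\<Sum>m<n. wsc (G j k * H k m) (sym_mul j (sym_ins m a))))"
      unfolding Xop_def[of G] by (intro sum.cong refl *) simp
    also have "\<dots> = Y G H + (\<Sum>j<n. \<Sum>k<n. \<Sum>m<n. wsc (G j k * H k m) (sym_mul j (sym_ins m a)))"
      by (simp add: Y_def sum.distrib)
    also have "(\<Sum>j<n. \<Sum>k<n. \<Sum>m<n. wsc (G j k * H k m) (sym_mul j (sym_ins m a))) =
      Xop (\<lambda>i j. \<Sum>m<n. G i m * H m j) a"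
      unfolding Xop_def wsc.scale_sum_left by (intro sum.cong refl sum.swap)
    finally show ?thesis .
  qed
  have "Y H G = (\<Sum>j<n. \<Sum>l<n. \<Sum>k<n. \<Sum>m<n.
    wsc (H j k * G l m) (sym_mul j (sym_mul l (sym_ins k (sym_ins m a)))))"
    unfolding Y_def by (rule sum.cong[OF refl], rule sum.swap)
  also have "\<dots> = (\<Sum>l<n. \<Sum>j<n. \<Sum>m<n. \<Sum>k<n.
    wsc (H j k * G l m) (sym_mul j (sym_mul l (sym_ins k (sym_ins m a)))))"
    by (rule trans[OF sum.swap], rule sum.cong[OF refl], rule sum.cong[OF refl], rule sum.swap)
  also have "\<dots> = (\<Sum>l<n. \<Sum>j<n. \<Sum>m<n. \<Sum>k<n.
    wsc (G l m * H j k) (sym_mul l (sym_mul j (sym_ins m (sym_ins k a)))))"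
    by (intro sum.cong refl) (metis mult.commute sym_mul_commute sym_ins_commute)
  also have "\<dots> = Y G H"
    unfolding Y_def by (rule sum.cong[OF refl], rule sum.swap)
  finally show ?thesis
    unfolding 1 commutator_def sum_subtractf Xop_diff by simp
qed

text \<open>The covariant derivative along \<open>e i\<close> with the action on coefficients
  included; the minus sign is that of the dual representation.\<close>

definition Kop :: "nat \<Rightarrow> 'v weyl \<Rightarrow> 'v weyl" where
  "Kop i a = wact i a - Xop (\<Gamma> i) a"

lemma lin_Kop [intro!]: "lin (Kop i)"
proof -
  have "lin (\<lambda>a. wact i a - Xop (\<Gamma> i) a)" by (intro lin_minus' lin_wact lin_Xop)
  then show ?thesis by (simp add: Kop_def[abs_def])
qed

lemma Kop_alt_mul: "Kop i (alt_mul j a) = alt_mul j (Kop i a)"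
  and Kop_alt_ins: "Kop i (alt_ins j a) = alt_ins j (Kop i a)"
  by (simp_all add: Kop_def Xop_alt_mul Xop_alt_ins wact_alt_mul wact_alt_ins alt_mul.diff alt_ins.diff)

lemma sym_ins_Kop:
  "l < n \<Longrightarrow> sym_ins l (Kop i a) = Kop i (sym_ins l a) + (\<Sum>k<n. wsc (- \<Gamma> i l k) (sym_ins k a))"
  by (simp add: Kop_def sym_ins.diff sym_ins_Xop wact_sym_ins sum_negf)

lemma Kop_mu: "Kop i (mu a b) = mu (Kop i a) b + mu a (Kop i b)"
proof -
  have add: "additive (\<lambda>a. mu a b)" "additive (mu a)" for a b :: "'v weyl"
    by (simp_all add: additive_def mu_add_left mu_add_right)
  show ?thesis
    unfolding Kop_def wact_mu Xop_mu additive.diff[OF add(1)] additive.diff[OF add(2)] by simp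
qed

text \<open>Here the parallel bivector enters: \<open>parallel\<close> is the hypothesis
  \<open>inv\<close> of \<open>muP_derivation\<close> for the matrix \<open>- \<Gamma> i\<close>
  supplied by \<open>sym_ins_Kop\<close>.\<close>

lemma Kop_circ: "i < n \<Longrightarrow> Kop i (a \<bullet> b) = Kop i a \<bullet> b + a \<bullet> Kop i b"
proof (rule circ_lin2[OF lin_Kop], rule muP_derivation[OF lin_Kop Kop_mu sym_ins_Kop])
  fix l j assume "i < n" "l < n" "j < n"
  then show "(\<Sum>k<n. \<pi> k j * - \<Gamma> i k l + \<pi> l k * - \<Gamma> i k j) = 0"
    using parallel[of i l j] by (simp add: sum_negf sum.distrib sum_subtractf) (simp add: eq_neg_iff_add_eq_0 neg_eq_iff_add_eq_0 add.commute)
qed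

lemma Kop_commutator:
  assumes "i < n" "j < n"
  shows "Kop i (Kop j a) - Kop j (Kop i a) - (\<Sum>k<n. wsc (C i j k) (Kop k a)) =
    Xop (\<lambda>p q. commutator (\<Gamma> i) (\<Gamma> j) p q + (\<Sum>k<n. C i j k * \<Gamma> k p q)) a"
proof -
  have "Kop i (Kop j a) - Kop j (Kop i a) =
    (wact i (wact j a) - wact j (wact i a)) + (Xop (\<Gamma> i) (Xop (\<Gamma> j) a) - Xop (\<Gamma> j) (Xop (\<Gamma> i) a))"
    by (simp add: Kop_def Xop_wact lin_diff[OF lin_wact] lin_diff[OF lin_Xop])
  also have "\<dots> = (\<Sum>k<n. wsc (C i j k) (wact k a)) + Xop (commutator (\<Gamma> i) (\<Gamma> j)) a"
    unfolding wact_commutator[OF assms] Xop_commutator ..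
  finally show ?thesis
    by (simp add: Kop_def wsc.scale_right_diff_distrib sum_subtractf Xop_add Xop_sum Xop_wsc)
qed

text \<open>Multiplication by minus the Chevalley-Eilenberg differential of the dual basis form with
  index \<open>k\<close>.\<close>

definition theta :: "nat \<Rightarrow> 'v weyl \<Rightarrow> 'v weyl" where
  "theta k a = eps2 n (\<lambda>i j. wsc (rat_const (1/2) * C i j k) a)"

lemma lin_theta [intro!]: "lin (theta k)"
proof -
  have "lin (\<lambda>a. eps2 n (\<lambda>i j. wsc (rat_const (1/2) * C i j k) a))" by (intro lin_eps2 lin_wsc')
  then show ?thesis by (simp add: theta_def[abs_def])
qed

lemma theta_alt_mul: "theta k (alt_mul j a) = alt_mul j (theta k a)"
  by (simp add: theta_def alt_mul_eps2 lin_wsc[OF lin_alt_mul])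

lemma theta_lin:
  assumes "lin T" "\<And>i a. T (alt_mul i a) = alt_mul i (T a)"
  shows "T (theta k a) = theta k (T a)"
  by (simp add: theta_def eps2_def lin_sum[OF assms(1)] lin_wsc[OF assms(1)] assms(2))

text \<open>This is \<open>D + L\<close>, as \<open>weyl_D_plus_L\<close> confirms. Joining the two
  lets the square be computed from commutators of the operators \<open>Kop i\<close>.\<close>

definition Dop :: "'v weyl \<Rightarrow> 'v weyl" where
  "Dop a = (\<Sum>i<n. alt_mul i (Kop i a)) - (\<Sum>k<n. theta k (alt_ins k a))"

lemma lin_Dop [intro!]: "lin Dop"
proof -
  have "lin (\<lambda>a. (\<Sum>i<n. alt_mul i (Kop i a)) - (\<Sum>k<n. theta k (alt_ins k a)))"
    by (intro lin_minus' lin_setsum lin_comp[OF lin_alt_mul] lin_comp[OF lin_theta] lin_Kop lin_alt_ins)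
  then show ?thesis by (simp add: Dop_def[abs_def])
qed

lemma theta_double: "theta k a + theta k a = eps2 n (\<lambda>i j. wsc (C i j k) a)"
proof -
  have "rat_const (1/2) * c + rat_const (1/2) * c = (c :: 'r)" for c
    by (metis distrib_right mult_1 rat_const_half)
  then show ?thesis
    unfolding theta_def eps2_add[symmetric] wsc.scale_left_distrib[symmetric] by simp
qed

text \<open>Insertion into either leg of the two-form gives the same term by antisymmetry of
  \<open>C\<close>, so the factor \<open>1/2\<close> disappears.\<close>

lemma alt_ins_theta:
  assumes "k < n" "l < n"
  shows "alt_ins k (theta l a) = (\<Sum>j<n. wsc (C k j l) (alt_mul j a)) + theta l (alt_ins k a)"
proof -
  let ?h = "rat_const (1/2) :: 'r"
  have "alt_ins k (theta l a) = (\<Sum>i<n. \<Sum>j<n. wsc (?h * C i j l) (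
      alt_mul i (alt_mul j (alt_ins k a)) - (if k = j then alt_mul i a else 0) + (if k = i then alt_mul j a else 0)))"
    unfolding theta_def eps2_def alt_ins.sum
    by (intro sum.cong refl) (simp add: lin_wsc[OF lin_alt_mul] lin_wsc[OF lin_alt_ins] alt_ins_alt_mul alt_mul.add
        alt_mul.minus alt_mul.zero alt_mul.diff wsc.scale_right_diff_distrib algebra_simps)
  also have "\<dots> = theta l (alt_ins k a)
    - (\<Sum>i<n. \<Sum>j<n. if k = j then wsc (?h * C i j l) (alt_mul i a) else 0)
    + (\<Sum>i<n. \<Sum>j<n. if k = i then wsc (?h * C i j l) (alt_mul j a) else 0)"
    unfolding theta_def eps2_def sum_subtractf[symmetric] sum.distrib[symmetric]
    by (intro sum.cong refl) (simp add: lin_wsc[OF lin_alt_mul] wsc.scale_right_distrib wsc.scale_right_diff_distrib)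
  also have "(\<Sum>i<n. \<Sum>j<n. if k = j then wsc (?h * C i j l) (alt_mul i a) else 0) =
    (\<Sum>i<n. wsc (?h * C i k l) (alt_mul i a))"
    using assms by simp
  also have "(\<Sum>i<n. \<Sum>j<n. if k = i then wsc (?h * C i j l) (alt_mul j a) else 0) =
    (\<Sum>i<n. if k = i then \<Sum>j<n. wsc (?h * C i j l) (alt_mul j a) else 0)"
    by (intro sum.cong refl) simp
  also have "\<dots> = (\<Sum>j<n. wsc (?h * C k j l) (alt_mul j a))"
    using assms by simp
  also have "(\<Sum>i<n. wsc (?h * C i k l) (alt_mul i a)) = - (\<Sum>j<n. wsc (?h * C k j l) (alt_mul j a))"
    unfolding sum_negf[symmetric] using assms by (intro sum.cong refl) (simp add: C_antisym[of _ k l])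
  finally have 1: "alt_ins k (theta l a) = theta l (alt_ins k a) -
    - (\<Sum>j<n. wsc (?h * C k j l) (alt_mul j a)) + (\<Sum>j<n. wsc (?h * C k j l) (alt_mul j a))" .
  have "?h * c + ?h * c = c" for c
    by (metis distrib_right mult_1 rat_const_half)
  then have 2: "(\<Sum>j<n. wsc (?h * C k j l) (alt_mul j a)) + (\<Sum>j<n. wsc (?h * C k j l) (alt_mul j a)) =
    (\<Sum>j<n. wsc (C k j l) (alt_mul j a))"
    unfolding sum.distrib[symmetric] wsc.scale_left_distrib[symmetric] by simp
  show ?thesis
    unfolding 1 2[symmetric] by (simp only: diff_minus_eq_add ac_simps)
qed

lemma theta_ins_square: "(\<Sum>k<n. theta k (alt_ins k (\<Sum>l<n. theta l (alt_ins l a)))) = 0"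
proof -
  have theta_sum: "theta k (sum f A) = (\<Sum>x\<in>A. theta k (f x))" for k f and A :: "nat set"
    by (rule lin_sum[OF lin_theta])
  have "theta k (alt_ins k (\<Sum>l<n. theta l (alt_ins l a))) =
     (\<Sum>l<n. \<Sum>j<n. wsc (C k j l) (theta k (alt_mul j (alt_ins l a)))) +
     (\<Sum>l<n. theta k (theta l (alt_ins k (alt_ins l a))))" if "k < n" for k
    by (simp add: alt_ins.sum alt_ins_theta[OF that] theta_sum lin_add[OF lin_theta] lin_wsc[OF lin_theta] sum.distrib)
  then have "(\<Sum>k<n. theta k (alt_ins k (\<Sum>l<n. theta l (alt_ins l a)))) =
     (\<Sum>k<n. \<Sum>l<n. \<Sum>j<n. wsc (C k j l) (theta k (alt_mul j (alt_ins l a)))) +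
     (\<Sum>k<n. \<Sum>l<n. theta k (theta l (alt_ins k (alt_ins l a))))"
    by (simp add: sum.distrib)
  \<comment> \<open>Under exchange of \<open>k\<close> and \<open>l\<close> the two-forms commute
    while the insertions anticommute, so the sum equals its negative.\<close>
  also have "(\<Sum>k<n. \<Sum>l<n. theta k (theta l (alt_ins k (alt_ins l a)))) = 0" (is "?S = 0")
  proof (rule weyl_double_eq_0)
    have "?S = (\<Sum>l<n. \<Sum>k<n. theta k (theta l (alt_ins k (alt_ins l a))))" by (rule sum.swap)
    also have "\<dots> = (\<Sum>l<n. \<Sum>k<n. - theta l (theta k (alt_ins l (alt_ins k a))))"
    proof (intro sum.cong refl)
      fix l k
      have "theta k (theta l b) = theta l (theta k b)" for b
        by (rule theta_lin) (auto simp: theta_alt_mul)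
      then show "theta k (theta l (alt_ins k (alt_ins l a))) = - theta l (theta k (alt_ins l (alt_ins k a)))"
        by (metis alt_ins_anticommute lin_minus[OF lin_theta])
    qed
    finally show "?S + ?S = 0" by (simp only: sum_negf eq_neg_iff_add_eq_0)
  qed
  also have "(\<Sum>k<n. \<Sum>l<n. \<Sum>j<n. wsc (C k j l) (theta k (alt_mul j (alt_ins l a)))) =
    (\<Sum>l<n. \<Sum>k<n. \<Sum>j<n. wsc (C k j l) (theta k (alt_mul j (alt_ins l a))))"
    by (rule sum.swap)
  also have "\<dots> = 0"
  proof (rule sum.neutral, rule ballI)
    fix l assume l: "l \<in> {..<n}"
    define b where "b = alt_ins l a"
    define c where "c = (\<lambda>p q j. \<Sum>k<n. C p q k * C k j l)"
    define E where "E = (\<lambda>p q j. alt_mul p (alt_mul q (alt_mul j b)))"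
    let ?S = "\<Sum>k<n. \<Sum>j<n. wsc (C k j l) (theta k (alt_mul j b))"
    have "?S + ?S = (\<Sum>k<n. \<Sum>j<n. \<Sum>p<n. \<Sum>q<n. wsc (C p q k * C k j l) (E p q j))"
      unfolding sum.distrib[symmetric] wsc.scale_right_distrib[symmetric] theta_double eps2_def
      by (simp add: wsc.scale_sum_right lin_wsc[OF lin_alt_mul] E_def mult.commute)
    also have "\<dots> = (\<Sum>k<n. \<Sum>p<n. \<Sum>q<n. \<Sum>j<n. wsc (C p q k * C k j l) (E p q j))"
      by (rule sum.cong[OF refl], subst sum_rotate3) (rule refl)
    also have "\<dots> = (\<Sum>p<n. \<Sum>q<n. \<Sum>j<n. wsc (c p q j) (E p q j))"
      unfolding c_def wsc.scale_sum_left
      by (subst sum.swap, rule sum.cong[OF refl], subst sum.swap, rule sum.cong[OF refl], rule sum.swap)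
    finally have S: "?S + ?S = (\<Sum>p<n. \<Sum>q<n. \<Sum>j<n. wsc (c p q j) (E p q j))" .
    have E: "E q j p = E p q j" for p q j
      unfolding E_def by (metis alt_mul_anticommute alt_mul.minus minus_minus)
    \<comment> \<open>\<open>E p q j\<close> is invariant under cyclic rotation of its indices.
      Hence three times the sum has the cyclic sum of the \<open>c p q j\<close> as coefficients,
      and this is the Jacobi expression.\<close>
    let ?T = "\<Sum>p<n. \<Sum>q<n. \<Sum>j<n. wsc (c p q j) (E p q j)"
    have T1: "?T = (\<Sum>p<n. \<Sum>q<n. \<Sum>j<n. wsc (c q j p) (E p q j))"
      by (subst sum_rotate3) (simp only: E)
    have T2: "?T = (\<Sum>p<n. \<Sum>q<n. \<Sum>j<n. wsc (c j p q) (E p q j))"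
      unfolding T1 by (subst sum_rotate3) (simp only: E)
    have "?T + (?T + ?T) = ?T + ((\<Sum>p<n. \<Sum>q<n. \<Sum>j<n. wsc (c q j p) (E p q j)) +
      (\<Sum>p<n. \<Sum>q<n. \<Sum>j<n. wsc (c j p q) (E p q j)))"
      using T1 T2 by simp
    also have "\<dots> = (\<Sum>p<n. \<Sum>q<n. \<Sum>j<n. wsc (c p q j + (c q j p + c j p q)) (E p q j))"
      by (simp add: wsc.scale_left_distrib sum.distrib)
    also have "\<dots> = (\<Sum>p<n. \<Sum>q<n. \<Sum>j<n. 0)"
    proof (intro sum.cong refl)
      fix p q j assume "p \<in> {..<n}" "q \<in> {..<n}" "j \<in> {..<n}"
      then have "c p q j + (c q j p + c j p q) = 0"
        using jacobi[of p q j l] l by (simp add: c_def sum.distrib add.assoc)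
      then show "wsc (c p q j + (c q j p + c j p q)) (E p q j) = 0" by simp
    qed
    finally have "?T + (?T + ?T) = 0" by simp
    then have "wsc (of_nat 3) ?T = wsc (of_nat 3) 0"
      by (simp add: wsc.scale_left_distrib[of 1 2, simplified] wsc.scale_left_distrib[of 1 1, simplified])
    then have "?T = 0" by (rule wsc_of_nat_cancel) simp
    then have "?S + ?S = 0" unfolding S .
    then show "(\<Sum>k<n. \<Sum>j<n. wsc (C k j l) (theta k (alt_mul j (alt_ins l a)))) = 0"
      unfolding b_def by (rule weyl_double_eq_0)
  qed
  finally show ?thesis by (simp only: add_0_left)
qed

text \<open>Twice the square, which avoids a factor \<open>1/2\<close>.\<close>

lemma Dop_square: "Dop (Dop a) + Dop (Dop a) =
  eps2 n (\<lambda>i j. Kop i (Kop j a) - Kop j (Kop i a) - (\<Sum>k<n. wsc (C i j k) (Kop k a)))"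
proof -
  let ?K = "\<Sum>i<n. alt_mul i (Kop i a)"
  let ?t = "\<Sum>k<n. theta k (alt_ins k a)"
  have 1: "(\<Sum>i<n. alt_mul i (Kop i ?K)) = eps2 n (\<lambda>i j. Kop i (Kop j a))"
    by (simp add: eps2_def lin_sum[OF lin_Kop] Kop_alt_mul alt_mul.sum)
  have 2: "(\<Sum>i<n. alt_mul i (Kop i ?t)) = (\<Sum>i<n. \<Sum>k<n. alt_mul i (theta k (alt_ins k (Kop i a))))"
    by (simp add: lin_sum[OF lin_Kop] Kop_alt_ins alt_mul.sum theta_lin[OF lin_Kop Kop_alt_mul])
  have "(\<Sum>k<n. theta k (alt_ins k ?K)) =
    (\<Sum>k<n. \<Sum>i<n. (if k = i then theta k (Kop i a) else 0) - alt_mul i (theta k (alt_ins k (Kop i a))))"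
    unfolding alt_ins.sum lin_sum[OF lin_theta] alt_ins_alt_mul
    by (intro sum.cong refl) (simp add: lin_add[OF lin_theta] lin_minus[OF lin_theta] lin_zero[OF lin_theta] lin_diff[OF lin_theta] theta_alt_mul)
  also have "\<dots> = (\<Sum>k<n. theta k (Kop k a)) - (\<Sum>k<n. \<Sum>i<n. alt_mul i (theta k (alt_ins k (Kop i a))))"
    by (simp add: sum_subtractf)
  also have "(\<Sum>k<n. \<Sum>i<n. alt_mul i (theta k (alt_ins k (Kop i a)))) =
    (\<Sum>i<n. \<Sum>k<n. alt_mul i (theta k (alt_ins k (Kop i a))))" by (rule sum.swap)
  finally have 3: "(\<Sum>k<n. theta k (alt_ins k ?K)) = (\<Sum>k<n. theta k (Kop k a)) -
    (\<Sum>i<n. \<Sum>k<n. alt_mul i (theta k (alt_ins k (Kop i a))))" .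
  have "Dop (Dop a) = (\<Sum>i<n. alt_mul i (Kop i ?K)) - (\<Sum>i<n. alt_mul i (Kop i ?t)) -
     ((\<Sum>k<n. theta k (alt_ins k ?K)) - (\<Sum>k<n. theta k (alt_ins k ?t)))"
    unfolding Dop_def by (simp add: lin_diff[OF lin_Kop] alt_mul.diff alt_ins.diff lin_diff[OF lin_theta] sum_subtractf)
  then have D: "Dop (Dop a) = eps2 n (\<lambda>i j. Kop i (Kop j a)) - (\<Sum>k<n. theta k (Kop k a))"
    unfolding 1 2 3 theta_ins_square by simp
  have 4: "(\<Sum>k<n. theta k (Kop k a)) + (\<Sum>k<n. theta k (Kop k a)) =
    eps2 n (\<lambda>i j. \<Sum>k<n. wsc (C i j k) (Kop k a))"
    unfolding sum.distrib[symmetric] theta_double eps2_def alt_mul.sum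
    by (subst sum.swap, rule sum.cong[OF refl], rule sum.swap)
  have "Dop (Dop a) + Dop (Dop a) = (eps2 n (\<lambda>i j. Kop i (Kop j a)) + eps2 n (\<lambda>i j. Kop i (Kop j a))) -
    ((\<Sum>k<n. theta k (Kop k a)) + (\<Sum>k<n. theta k (Kop k a)))"
    unfolding D by (simp add: algebra_simps)
  then show ?thesis unfolding 4 eps2_double eps2_diff by simp
qed

section \<open>The Koszul differential against \<open>D + L\<close>\<close>

abbreviation del :: "'v weyl \<Rightarrow> 'v weyl" where
  "del \<equiv> delta n"

lemma lin_del [intro!]: "lin del"
proof -
  have "lin (\<lambda>a. \<Sum>i<n. alt_mul i (sym_ins i a))"
    by (intro lin_setsum lin_comp[OF lin_alt_mul] lin_sym_ins)
  then show ?thesis by (simp add: delta_def[abs_def])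
qed

lemma del_del: "del (del a) = 0"
proof -
  have "del (del a) = eps2 n (\<lambda>i j. sym_ins i (sym_ins j a))"
    by (simp add: delta_def eps2_def sym_ins.sum sym_ins_alt_mul alt_mul.sum)
  also have "\<dots> = 0" by (rule eps2_sym) (rule sym_ins_commute)
  finally show ?thesis .
qed

text \<open>The antisymmetrized Christoffel terms \<open>Q\<close> must cancel the term
  \<open>?S\<close> that arises when an insertion meets the new one-form. By torsion-freeness they
  are equal.\<close>

lemma del_Dop: "del (Dop a) = - Dop (del a)"
proof -
  define P where "P = eps2 n (\<lambda>l i. Kop i (sym_ins l a))"
  define Q where "Q = eps2 n (\<lambda>l i. \<Sum>k<n. wsc (- \<Gamma> i l k) (sym_ins k a))"
  define Z where "Z = (\<Sum>l<n. \<Sum>k<n. alt_mul l (theta k (alt_ins k (sym_ins l a))))"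
  have "(\<Sum>l<n. alt_mul l (sym_ins l (\<Sum>i<n. alt_mul i (Kop i a)))) =
    eps2 n (\<lambda>l i. Kop i (sym_ins l a) + (\<Sum>k<n. wsc (- \<Gamma> i l k) (sym_ins k a)))"
    unfolding eps2_def sym_ins.sum alt_mul.sum sym_ins_alt_mul
    by (intro sum.cong refl) (simp add: sym_ins_Kop)
  moreover have "(\<Sum>l<n. alt_mul l (sym_ins l (\<Sum>k<n. theta k (alt_ins k a)))) = Z"
    by (simp add: Z_def sym_ins.sum alt_mul.sum theta_lin[OF lin_sym_ins sym_ins_alt_mul] sym_ins_alt_ins)
  ultimately have 1: "del (Dop a) = P + Q - Z"
    unfolding delta_def Dop_def sym_ins.diff alt_mul.diff sum_subtractf P_def Q_def eps2_add by simp
  have 2: "(\<Sum>i<n. alt_mul i (Kop i (del a))) = - P"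
    unfolding P_def eps2_swap[of n "\<lambda>l i. Kop i (sym_ins l a)", symmetric]
    by (simp add: eps2_def delta_def lin_sum[OF lin_Kop] Kop_alt_mul alt_mul.sum)
  have "(\<Sum>k<n. theta k (alt_ins k (del a))) =
    (\<Sum>k<n. \<Sum>i<n. (if k = i then theta k (sym_ins i a) else 0) - alt_mul i (theta k (alt_ins k (sym_ins i a))))"
    unfolding delta_def alt_ins.sum lin_sum[OF lin_theta] alt_ins_alt_mul
    by (intro sum.cong refl) (simp add: lin_add[OF lin_theta] lin_minus[OF lin_theta] lin_zero[OF lin_theta] lin_diff[OF lin_theta] theta_alt_mul)
  also have "\<dots> = (\<Sum>k<n. theta k (sym_ins k a)) - (\<Sum>k<n. \<Sum>i<n. alt_mul i (theta k (alt_ins k (sym_ins i a))))"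
    by (simp add: sum_subtractf)
  also have "(\<Sum>k<n. \<Sum>i<n. alt_mul i (theta k (alt_ins k (sym_ins i a)))) = Z"
    unfolding Z_def by (rule sum.swap)
  finally have 3: "(\<Sum>k<n. theta k (alt_ins k (del a))) = (\<Sum>k<n. theta k (sym_ins k a)) - Z" .
  let ?S = "\<Sum>k<n. theta k (sym_ins k a)"
  have 4: "?S + ?S = eps2 n (\<lambda>i j. \<Sum>k<n. wsc (C i j k) (sym_ins k a))"
    unfolding sum.distrib[symmetric] theta_double eps2_def alt_mul.sum
    by (subst sum.swap, rule sum.cong[OF refl], rule sum.swap)
  have 5: "Q + Q = eps2 n (\<lambda>i j. \<Sum>k<n. wsc (C i j k) (sym_ins k a))"
    unfolding Q_def eps2_double
  proof (rule eps2_cong)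
    fix i j assume "i < n" "j < n"
    then show "(\<Sum>k<n. wsc (- \<Gamma> j i k) (sym_ins k a)) - (\<Sum>k<n. wsc (- \<Gamma> i j k) (sym_ins k a)) =
      (\<Sum>k<n. wsc (C i j k) (sym_ins k a))"
      unfolding sum_subtractf[symmetric] wsc.scale_left_diff_distrib[symmetric]
      by (intro sum.cong refl arg_cong2[of _ _ _ _ wsc]) (simp add: torsion[of i j, symmetric])
  qed
  have "(Q - ?S) + (Q - ?S) = 0"
    unfolding add_diff_add[symmetric] 4 5 by (rule diff_self)
  then have Q: "Q = ?S" using weyl_double_eq_0 right_minus_eq by blast
  have 6: "Dop (del a) = - P - (?S - Z)" unfolding Dop_def[of "del a"] 2 3 ..
  show ?thesis unfolding 1 6 Q by (simp only: minus_diff_eq diff_minus_eq_add) (simp only: algebra_simps)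
qed

lemma Dop_circ: "Dop (a \<bullet> b) = Dop a \<bullet> b + gam a \<bullet> Dop b"
proof -
  have "(\<Sum>i<n. alt_mul i (Kop i (a \<bullet> b))) =
    (\<Sum>i<n. alt_mul i (Kop i a)) \<bullet> b + gam a \<bullet> (\<Sum>i<n. alt_mul i (Kop i b))"
    by (simp add: Kop_circ alt_mul.add sum.distrib circ_sum_left circ_sum_right circ_alt_mul_left circ_alt_mul_right)
  moreover have "theta k (alt_ins k (a \<bullet> b)) = theta k (alt_ins k a) \<bullet> b + gam a \<bullet> theta k (alt_ins k b)" for k
    unfolding circ_alt_ins lin_add[OF lin_theta]
    by (simp add: theta_def eps2_def circ_sum_left circ_sum_right circ_alt_mul_left circ_alt_mul_right
        circ_wsc_left circ_wsc_right)
  ultimately show ?thesis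
    by (simp add: Dop_def sum.distrib circ_diff_left circ_diff_right circ_sum_left circ_sum_right)
qed

lemma del_circ: "del (a \<bullet> b) = del a \<bullet> b + gam a \<bullet> del b"
  by (simp add: delta_def circ_sym_ins alt_mul.add sum.distrib circ_sum_left circ_sum_right
      circ_alt_mul_left circ_alt_mul_right)

lemma weyl_D_plus_L: "weyl_D n C \<Gamma> sc a + weyl_L n act a = Dop a"
proof -
  have "(\<lambda>M. chevalley_eilenberg n C (fps_scale sc) (a M)) =
    - (\<Sum>i<n. \<Sum>j<n. \<Sum>k<n. wsc (rat_const (1/2) * C i j k) (alt_mul i (alt_mul j (alt_ins k a))))"
    by (simp add: fun_eq_iff chevalley_eilenberg_def fun_additive_sum ext_scale_def weyl_scale_def
        alt_mul_def alt_ins_def)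
  also have "(\<Sum>i<n. \<Sum>j<n. \<Sum>k<n. wsc (rat_const (1/2) * C i j k) (alt_mul i (alt_mul j (alt_ins k a)))) =
    (\<Sum>k<n. theta k (alt_ins k a))"
    unfolding theta_def eps2_def lin_wsc[OF lin_alt_mul]
    by (subst sum_rotate3[symmetric]) (rule refl)
  finally show ?thesis
    unfolding weyl_D_def weyl_L_def nabla_sym_def Dop_def Kop_def Xop_def wact_def alt_mul.diff alt_mul.minus
      sum_subtractf sum_negf
    by (simp only: diff_conv_add_uminus ac_simps)
qed

end

section \<open>The filtration by total degree\<close>

lemma weyl_spaceI:
  "(\<And>M J m. a M J $ m \<noteq> 0 \<Longrightarrow> set_mset M \<subseteq> {..<n} \<and> J \<subseteq> {..<n} \<and> card J = l \<and> k \<le> size M + 2 * m) \<Longrightarrow>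
    a \<in> weyl_space n k l"
  by (simp add: weyl_space_def)

lemma weyl_spaceD:
  assumes "a \<in> weyl_space n k l" "a M J $ m \<noteq> 0"
  shows "set_mset M \<subseteq> {..<n}" "J \<subseteq> {..<n}" "card J = l" "k \<le> size M + 2 * m"
  using assms by (simp_all add: weyl_space_def)

lemma weyl_space_mono: "a \<in> weyl_space n k l \<Longrightarrow> k' \<le> k \<Longrightarrow> a \<in> weyl_space n k' l"
  unfolding weyl_space_def by fastforce

lemma weyl_space_0 [simp]: "0 \<in> weyl_space n k l"
  by (simp add: weyl_space_def)

lemma weyl_space_add:
  fixes a b :: "'v::ring_1 weyl"
  assumes a: "a \<in> weyl_space n k l" and b: "b \<in> weyl_space n k l"
  shows "a + b \<in> weyl_space n k l"
proof (rule weyl_spaceI)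
  fix M J m assume "(a + b) M J $ m \<noteq> 0"
  then have "a M J $ m \<noteq> 0 \<or> b M J $ m \<noteq> 0" by auto
  then show "set_mset M \<subseteq> {..<n} \<and> J \<subseteq> {..<n} \<and> card J = l \<and> k \<le> size M + 2 * m"
    using assms unfolding weyl_space_def by blast
qed

lemma weyl_space_minus: "a \<in> weyl_space n k l \<Longrightarrow> - a \<in> weyl_space n k (l :: nat)" for a :: "'v::ring_1 weyl"
  by (simp add: weyl_space_def)

lemma weyl_space_diff: "a \<in> weyl_space n k l \<Longrightarrow> b \<in> weyl_space n k l \<Longrightarrow> a - b \<in> weyl_space n k l"
  for a b :: "'v::ring_1 weyl"
  using weyl_space_add[of a n k l "- b"] by (simp only: weyl_space_minus add_uminus_conv_diff)

lemma weyl_space_sum: "(\<And>i. i \<in> A \<Longrightarrow> f i \<in> weyl_space n k l) \<Longrightarrow> sum f A \<in> weyl_space n k l"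
  for f :: "'i \<Rightarrow> 'v::ring_1 weyl"
  by (induction A rule: infinite_finite_induct) (simp_all add: weyl_space_add)

lemma weyl_space_Inter:
  assumes "\<And>k. a \<in> weyl_space n k l" shows "a = 0"
proof (intro ext fps_ext)
  fix M J m
  show "a M J $ m = 0 M J $ m"
    using weyl_spaceD(4)[OF assms, of M J m "Suc (size M + 2 * m)"] by auto
qed

lemma weyl_space_infinite: "a \<in> weyl_space n k l \<Longrightarrow> infinite J \<Longrightarrow> a M J = 0"
  by (rule fps_ext) (metis finite_lessThan finite_subset fps_zero_nth weyl_spaceD(2))

lemma weyl_space_card_gt:
  assumes "a \<in> weyl_space n k l" "n < l" shows "a = 0"
proof (intro ext fps_ext)
  fix M J m
  show "a M J $ m = 0 M J $ m"
  proof (rule ccontr)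
    assume "a M J $ m \<noteq> 0 M J $ m"
    then have "J \<subseteq> {..<n}" "card J = l" using weyl_spaceD[OF assms(1), of M J m] by auto
    then show False using assms(2) card_mono[of "{..<n}" J] by simp
  qed
qed

lemma gam_weyl_space: "a \<in> weyl_space n k l \<Longrightarrow> gam a = (if even l then a else - a)" for a :: "'v::ring_1 weyl"
proof -
  assume a: "a \<in> weyl_space n k l"
  have "alt_sign (card J) (a M J) $ m = (if even l then a else - a) M J $ m" for M J m
    using weyl_spaceD(3)[OF a, of M J m] by (cases "a M J $ m = 0") (auto simp: alt_sign_def)
  then show ?thesis unfolding gam_def by (intro ext fps_ext)
qed

lemma weyl_space_sym_ins:
  "a \<in> weyl_space n k l \<Longrightarrow> sym_ins i a \<in> weyl_space n (k - 1) l" for a :: "'v::ring_1 weyl"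
proof (rule weyl_spaceI)
  fix M J m assume a: "a \<in> weyl_space n k l" and "sym_ins i a M J $ m \<noteq> 0"
  then have "a (add_mset i M) J $ m \<noteq> 0"
    by (auto simp: sym_ins_def fps_nth_of_nat_mult simp del: of_nat_add of_nat_Suc)
  from weyl_spaceD[OF a this] show "set_mset M \<subseteq> {..<n} \<and> J \<subseteq> {..<n} \<and> card J = l \<and> k - 1 \<le> size M + 2 * m"
    by auto
qed

lemma weyl_space_sym_mul:
  "a \<in> weyl_space n k l \<Longrightarrow> i < n \<Longrightarrow> sym_mul i a \<in> weyl_space n (Suc k) l" for a :: "'v::ring_1 weyl"
proof (rule weyl_spaceI)
  fix M J m assume a: "a \<in> weyl_space n k l" and i: "i < n" and nz: "sym_mul i a M J $ m \<noteq> 0"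
  then have iM: "i \<in># M" and nz': "a (M - {#i#}) J $ m \<noteq> 0"
    by (auto simp: sym_mul_def split: if_splits)
  from iM obtain N where M: "M = add_mset i N" by (blast dest: multi_member_split)
  from weyl_spaceD[OF a nz'] show "set_mset M \<subseteq> {..<n} \<and> J \<subseteq> {..<n} \<and> card J = l \<and> Suc k \<le> size M + 2 * m"
    using i unfolding M by auto
qed

lemma weyl_space_alt_mul:
  "a \<in> weyl_space n k l \<Longrightarrow> i < n \<Longrightarrow> alt_mul i a \<in> weyl_space n k (Suc l)" for a :: "'v::ring_1 weyl"
proof (rule weyl_spaceI)
  fix M J m assume a: "a \<in> weyl_space n k l" and i: "i < n" and nz: "alt_mul i a M J $ m \<noteq> 0"
  then have iJ: "i \<in> J" and nz': "a M (J - {i}) $ m \<noteq> 0"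
    by (auto simp: alt_mul_apply alt_sign_def split: if_splits)
  note * = weyl_spaceD[OF a nz']
  have J: "J \<subseteq> {..<n}" using *(2) i by auto
  then have "finite J" using finite_subset by blast
  then have "card J = Suc (card (J - {i}))" using iJ by (metis card_Suc_Diff1)
  with * J show "set_mset M \<subseteq> {..<n} \<and> J \<subseteq> {..<n} \<and> card J = Suc l \<and> k \<le> size M + 2 * m" by simp
qed

lemma weyl_space_alt_ins:
  "a \<in> weyl_space n k (Suc l) \<Longrightarrow> alt_ins i a \<in> weyl_space n k l" for a :: "'v::ring_1 weyl"
proof (rule weyl_spaceI)
  fix M J m assume a: "a \<in> weyl_space n k (Suc l)" and nz: "alt_ins i a M J $ m \<noteq> 0"
  then have iJ: "i \<notin> J" and nz': "a M (insert i J) $ m \<noteq> 0"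
    by (auto simp: alt_ins_apply alt_sign_def split: if_splits)
  note * = weyl_spaceD[OF a nz']
  have "finite J" using *(2) finite_subset by (metis finite_insert finite_lessThan)
  with * iJ show "set_mset M \<subseteq> {..<n} \<and> J \<subseteq> {..<n} \<and> card J = l \<and> k \<le> size M + 2 * m" by simp
qed

lemma alt_ins_weyl_space_0:
  assumes a: "a \<in> weyl_space n k 0" shows "alt_ins i a = (0 :: 'v::ring_1 weyl)"
proof (intro ext)
  fix M J
  have "a M (insert i J) = 0"
  proof (rule ccontr)
    assume "a M (insert i J) \<noteq> 0"
    then obtain m where nz: "a M (insert i J) $ m \<noteq> 0" by (metis fps_ext fps_zero_nth)
    have "finite (insert i J)" using weyl_spaceD(2)[OF a nz] by (rule finite_subset) simp
    then show False using weyl_spaceD(3)[OF a nz] by simp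
  qed
  then show "alt_ins i a M J = 0 M J" by (simp only: alt_ins_apply alt_sign.zero zero_fun_apply if_cancel)
qed

lemma weyl_space_mu:
  fixes a b :: "'v::ring_1 weyl"
  assumes a: "a \<in> weyl_space n p l" and b: "b \<in> weyl_space n q l'"
  shows "mu a b \<in> weyl_space n (p + q) (l + l')"
proof (rule weyl_spaceI)
  fix M J m assume nz: "mu a b M J $ m \<noteq> 0"
  then have "(\<Sum>N | N \<subseteq># M. wedge (a N) (b (M - N)) J $ m) \<noteq> 0"
    unfolding mu_wedge fps_sum_nth .
  then obtain N where N': "N \<in> {N. N \<subseteq># M}" and "wedge (a N) (b (M - N)) J $ m \<noteq> 0"
    by (rule sum.not_neutral_contains_not_neutral)
  then have "(\<Sum>K\<in>Pow J. alt_sign (inversions K (J - K)) (a N K * b (M - N) (J - K)) $ m) \<noteq> 0"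
    unfolding wedge_def fps_sum_nth by simp
  then obtain K where K': "K \<in> Pow J"
    and "alt_sign (inversions K (J - K)) (a N K * b (M - N) (J - K)) $ m \<noteq> 0"
    by (rule sum.not_neutral_contains_not_neutral)
  then have "(\<Sum>i=0..m. a N K $ i * b (M - N) (J - K) $ (m - i)) \<noteq> 0"
    unfolding fps_mult_nth[symmetric] by (auto simp: alt_sign_def split: if_splits)
  then obtain i where i: "i \<in> {0..m}" and nz'': "a N K $ i * b (M - N) (J - K) $ (m - i) \<noteq> 0"
    by (rule sum.not_neutral_contains_not_neutral)
  have N: "N \<subseteq># M" and K: "K \<subseteq> J" using N' K' by auto
  have "a N K $ i \<noteq> 0" "b (M - N) (J - K) $ (m - i) \<noteq> 0" using nz'' by auto
  note A = weyl_spaceD[OF a this(1)] and B = weyl_spaceD[OF b this(2)]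
  have M: "M = N + (M - N)" using N by simp
  have J: "K \<union> (J - K) = J" using K by auto
  have sM: "set_mset M = set_mset N \<union> set_mset (M - N)"
    using arg_cong[OF M, of set_mset] unfolding set_mset_union .
  have "set_mset M \<subseteq> {..<n}" using A(1) B(1) sM by blast
  moreover have Jn: "J \<subseteq> {..<n}" using A(2) B(2) by auto
  moreover have "card J = l + l'"
  proof -
    have "finite J" using Jn finite_subset by blast
    then have "card J = card K + card (J - K)"
      using K card_Un_disjoint[of K "J - K"] finite_subset[OF K] J by simp
    then show ?thesis using A(3) B(3) by simp
  qed
  moreover have "size M = size N + size (M - N)"
    using arg_cong[OF M, of size] unfolding size_union .
  ultimately show "set_mset M \<subseteq> {..<n} \<and> J \<subseteq> {..<n} \<and> card J = l + l' \<and> p + q \<le> size M + 2 * m"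
    using A(4) B(4) i by auto
qed

lemma weyl_space_divide: "a \<in> weyl_space n k l \<Longrightarrow> weyl_divide_t a \<in> weyl_space n (k - 2) l"
  by (rule weyl_spaceI) (auto simp: weyl_divide_t_def dest: weyl_spaceD)

lemma weyl_space_embed: "weyl_embed \<xi> \<in> weyl_space n 0 0"
  by (auto simp: weyl_space_def weyl_embed_def split: if_splits)

context alg
begin

lemma weyl_space_wsc: "a \<in> weyl_space n k l \<Longrightarrow> wsc c a \<in> weyl_space n k l"
  by (rule weyl_spaceI) (metis scale_zero_right weyl_spaceD wsc_nth)

lemma mu_one [simp]:
  assumes "a \<in> weyl_space n k l"
  shows "mu (weyl_embed 1) a = a" "mu a (weyl_embed 1) = (a :: 'v weyl)"
proof -
  have *: "mu (weyl_embed 1) a M J = a M J" "mu a (weyl_embed 1) M J = a M J" for M J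
    using mu_one_left[of J a M] mu_one_right[of J a M] weyl_space_infinite[OF assms, of J M]
    by (cases "finite J"; simp add: mu_infinite)+
  show "mu (weyl_embed 1) a = a" "mu a (weyl_embed 1) = a" by (intro ext; simp add: *)+
qed

lemma sym_ins_embed [simp]: "sym_ins i (weyl_embed \<xi>) = (0 :: 'v weyl)"
  by (intro ext) (simp add: sym_ins_def weyl_embed_def)

end

context moyal
begin

lemma weyl_space_muP:
  "a \<in> weyl_space n p l \<Longrightarrow> b \<in> weyl_space n q l' \<Longrightarrow> muP k a b \<in> weyl_space n (p + q - 2 * k) (l + l')"
proof (induction k arbitrary: a b p q)
  case 0
  then show ?case by (simp add: weyl_space_mu)
next
  case (Suc k)
  have "muP k (sym_ins i a) (sym_ins j b) \<in> weyl_space n (p - 1 + (q - 1) - 2 * k) (l + l')" for i j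
    by (intro Suc.IH weyl_space_sym_ins Suc.prems)
  then have "muP k (sym_ins i a) (sym_ins j b) \<in> weyl_space n (p + q - 2 * Suc k) (l + l')" for i j
    by (rule weyl_space_mono) simp
  then show ?case unfolding mu_P.simps by (intro weyl_space_sum weyl_space_wsc)
qed

text \<open>\<open>muP k\<close> can lower the symmetric degree by \<open>2 * k\<close>, and the
  accompanying \<open>t^k\<close> restores exactly this. The weight 2 of \<open>t\<close> in the
  total degree is made for that purpose.\<close>

lemma weyl_space_circ:
  assumes "a \<in> weyl_space n p l" "b \<in> weyl_space n q l'"
  shows "a \<bullet> b \<in> weyl_space n (p + q) (l + l')"
proof (rule weyl_spaceI)
  fix M J m assume "(a \<bullet> b) M J $ m \<noteq> 0"
  then have "(\<Sum>k\<le>m. sc (circ_coeff k) (muP k a b M J $ (m - k))) \<noteq> 0" unfolding circ_nth .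
  then obtain k where k: "k \<in> {..m}" and "sc (circ_coeff k) (muP k a b M J $ (m - k)) \<noteq> 0"
    by (rule sum.not_neutral_contains_not_neutral)
  then have "muP k a b M J $ (m - k) \<noteq> 0" by auto
  from weyl_spaceD[OF weyl_space_muP[OF assms] this] k
  show "set_mset M \<subseteq> {..<n} \<and> J \<subseteq> {..<n} \<and> card J = l + l' \<and> p + q \<le> size M + 2 * m"
    by auto
qed

lemma circ_finite:
  assumes "\<And>k. K < k \<Longrightarrow> muP k a b = 0"
  shows "a \<bullet> b = (\<Sum>k\<le>K. wsc (circ_coeff k) (tpow k (muP k a b)))"
proof (rule teq_all)
  fix N
  let ?f = "\<lambda>k. wsc (circ_coeff k) (tpow k (muP k a b))"
  have z: "?f k = 0" if "K < k" for k using assms[OF that] by (simp add: tpow.zero)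
  have "teq N (a \<bullet> b) (\<Sum>k\<le>N. ?f k)" by (rule teq_circ)
  also have "teq N (\<Sum>k\<le>N. ?f k) (\<Sum>k\<le>max N K. ?f k)"
  proof -
    have "teq N (\<Sum>k\<le>max N K. ?f k) (\<Sum>k\<le>max N K. if k \<le> N then ?f k else 0)"
      by (intro teq_sum) (auto simp: teq_def wsc_nth tpow_nth)
    also have "(\<Sum>k\<le>max N K. if k \<le> N then ?f k else 0) = (\<Sum>k\<le>N. ?f k)"
      by (rule sum.mono_neutral_cong_right) auto
    finally show ?thesis by (rule teq_sym)
  qed
  also have "(\<Sum>k\<le>max N K. ?f k) = (\<Sum>k\<le>K. ?f k)"
    by (rule sum.mono_neutral_right) (auto simp: z)
  finally show "teq N (a \<bullet> b) (\<Sum>k\<le>K. ?f k)" .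
qed

lemma circ_const_left:
  assumes "\<And>i. i < n \<Longrightarrow> sym_ins i a = 0" shows "a \<bullet> b = mu a b"
proof -
  have "muP k a b = 0" if "0 < k" for k
    using that by (cases k) (simp_all add: assms muP_zero_left)
  then show ?thesis using circ_finite[of 0 a b] by (simp add: tpow_def)
qed

lemma circ_const_right:
  assumes "\<And>i. i < n \<Longrightarrow> sym_ins i b = 0" shows "a \<bullet> b = mu a b"
proof -
  have "muP k a b = 0" if "0 < k" for k
    using that by (cases k) (simp_all add: assms muP_zero_right)
  then show ?thesis using circ_finite[of 0 a b] by (simp add: tpow_def)
qed

end

context connection
begin

lemma weyl_space_eps2:
  "(\<And>i j. i < n \<Longrightarrow> j < n \<Longrightarrow> f i j \<in> weyl_space n k l) \<Longrightarrow> eps2 n f \<in> weyl_space n k (Suc (Suc l))"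
  for f :: "nat \<Rightarrow> nat \<Rightarrow> 'v weyl"
  unfolding eps2_def by (intro weyl_space_sum weyl_space_alt_mul) auto

lemma weyl_space_Xop: "a \<in> weyl_space n k l \<Longrightarrow> Xop G a \<in> weyl_space n k l"
proof -
  assume a: "a \<in> weyl_space n k l"
  have "sym_mul i (sym_ins j a) \<in> weyl_space n k l" if "i < n" for i j
    using weyl_space_sym_mul[OF weyl_space_sym_ins[OF a] that] by (rule weyl_space_mono) simp
  then show ?thesis unfolding Xop_def by (intro weyl_space_sum weyl_space_wsc) simp
qed

lemma weyl_space_wact: "a \<in> weyl_space n k l \<Longrightarrow> wact i a \<in> weyl_space n k l"
  by (rule weyl_spaceI) (metis act.zero weyl_spaceD wact_nth)

lemma weyl_space_Kop: "a \<in> weyl_space n k l \<Longrightarrow> Kop i a \<in> weyl_space n k l"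
  unfolding Kop_def by (intro weyl_space_diff weyl_space_Xop weyl_space_wact)

lemma weyl_space_theta: "a \<in> weyl_space n k l \<Longrightarrow> theta i a \<in> weyl_space n k (Suc (Suc l))"
  unfolding theta_def by (intro weyl_space_eps2 weyl_space_wsc)

lemma weyl_space_Dop: "a \<in> weyl_space n k l \<Longrightarrow> Dop a \<in> weyl_space n k (Suc l)"
proof -
  assume a: "a \<in> weyl_space n k l"
  have "theta i (alt_ins i a) \<in> weyl_space n k (Suc l)" for i
  proof (cases l)
    case 0
    then show ?thesis using a by (simp add: alt_ins_weyl_space_0 lin_zero[OF lin_theta])
  next
    case (Suc l')
    then show ?thesis using a weyl_space_theta weyl_space_alt_ins by blast
  qed
  then show ?thesis
    unfolding Dop_def using a by (intro weyl_space_diff weyl_space_sum weyl_space_alt_mul weyl_space_Kop) auto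
qed

lemma weyl_space_del: "a \<in> weyl_space n k l \<Longrightarrow> del a \<in> weyl_space n (k - 1) (Suc l)"
  unfolding delta_def by (intro weyl_space_sum weyl_space_alt_mul weyl_space_sym_ins) auto

section \<open>The homotopy for the Koszul differential\<close>

text \<open>The numerator of the homotopy \<open>\<delta>\<^sup>-\<^sup>1\<close>, without the factor \<open>1/(k + l)\<close>.\<close>

definition koszul :: "'v weyl \<Rightarrow> 'v weyl" where
  "koszul a = (\<Sum>i<n. sym_mul i (alt_ins i a))"

definition weight :: "(nat \<Rightarrow> 'r) \<Rightarrow> 'v weyl \<Rightarrow> 'v weyl" where
  "weight f a = (\<lambda>M J. fps_scale sc (f (size M + card J)) (a M J))"

abbreviation inv_degree :: "nat \<Rightarrow> 'r" where
  "inv_degree k \<equiv> (if k = 0 then 0 else rat_const (1 / of_nat k))"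

abbreviation dinv :: "'v weyl \<Rightarrow> 'v weyl" where
  "dinv \<equiv> delta_inv n sc"

lemma weight_nth: "weight f a M J $ m = sc (f (size M + card J)) (a M J $ m)"
  by (simp add: weight_def fps_scale_def fps_map_def)

lemma dinv_weight: "dinv a = weight inv_degree (koszul a)"
  by (intro ext fps_ext) (simp add: weight_nth delta_inv_def koszul_def fps_scale_def fps_map_def)

lemma lin_koszul [intro!]: "lin koszul"
proof -
  have "lin (\<lambda>a. \<Sum>i<n. sym_mul i (alt_ins i a))" by (intro lin_setsum lin_comp[OF lin_sym_mul] lin_alt_ins)
  then show ?thesis by (simp add: koszul_def[abs_def])
qed

lemma lin_weight [intro!]: "lin (weight f)"
  unfolding lin_def
  by (intro conjI allI ext fps_ext) (simp_all add: weight_nth wsc_nth slice_def scale_right_distrib mult.commute)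

lemma lin_dinv [intro!]: "lin dinv"
proof -
  have "lin (\<lambda>a. weight inv_degree (koszul a))" by (intro lin_comp[OF lin_weight] lin_koszul)
  then show ?thesis by (simp add: dinv_weight[abs_def])
qed

lemma weyl_space_weight: "a \<in> weyl_space n k l \<Longrightarrow> weight f a \<in> weyl_space n k l"
  by (rule weyl_spaceI) (metis scale_zero_right weyl_spaceD weight_nth)

lemma weyl_space_koszul: "a \<in> weyl_space n k (Suc l) \<Longrightarrow> koszul a \<in> weyl_space n (Suc k) l"
  unfolding koszul_def by (intro weyl_space_sum weyl_space_sym_mul weyl_space_alt_ins) auto

lemma weyl_space_dinv: "a \<in> weyl_space n k (Suc l) \<Longrightarrow> dinv a \<in> weyl_space n (Suc k) l"
  unfolding dinv_weight by (intro weyl_space_weight weyl_space_koszul)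

lemma dinv_weyl_space_0: "a \<in> weyl_space n k 0 \<Longrightarrow> dinv a = 0"
proof -
  assume "a \<in> weyl_space n k 0"
  then have "koszul a = 0" by (simp add: koszul_def alt_ins_weyl_space_0 sym_mul.zero)
  then show ?thesis by (simp only: dinv_weight lin_zero[OF lin_weight])
qed

text \<open>\<open>del\<close> trades a symmetric factor for an antisymmetric one and so preserves
  the sum of the two degrees. Membership in a \<open>weyl_space\<close> excludes infinite
  \<open>J\<close>, for which \<open>card\<close> would be 0.\<close>

lemma weight_del: "a \<in> weyl_space n k l \<Longrightarrow> weight f (del a) = del (weight f a)"
proof -
  assume a: "a \<in> weyl_space n k l"
  have "weight f (alt_mul i (sym_ins i a)) = alt_mul i (sym_ins i (weight f a))" for i
  proof (intro ext fps_ext)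
    fix M J m
    show "weight f (alt_mul i (sym_ins i a)) M J $ m = alt_mul i (sym_ins i (weight f a)) M J $ m"
    proof (cases "finite J \<and> i \<in> J")
      case True
      then have "size M + card J = size (add_mset i M) + card (J - {i})"
        by (simp add: card_Diff_singleton card_gt_0_iff) (metis Suc_pred card_gt_0_iff empty_iff add_Suc_right)
      then show ?thesis using True
        by (simp add: weight_nth alt_mul_apply sym_ins_def fps_nth_of_nat_mult sc_mult_right alt_sign_def
            del: of_nat_add of_nat_Suc)
    next
      case False
      then have "i \<notin> J \<or> infinite (J - {i})" by auto
      then show ?thesis
        using weyl_space_infinite[OF a] by (auto simp: weight_nth alt_mul_apply sym_ins_def alt_sign_def
            fps_nth_of_nat_mult simp del: of_nat_add of_nat_Suc)
    qed
  qed
  then show ?thesis by (simp add: delta_def lin_sum[OF lin_weight])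
qed

lemma weight_koszul: "a \<in> weyl_space n k l \<Longrightarrow> weight f (koszul a) = koszul (weight f a)"
proof -
  assume a: "a \<in> weyl_space n k l"
  have "weight f (sym_mul i (alt_ins i a)) = sym_mul i (alt_ins i (weight f a))" for i
  proof (intro ext fps_ext)
    fix M J m
    show "weight f (sym_mul i (alt_ins i a)) M J $ m = sym_mul i (alt_ins i (weight f a)) M J $ m"
    proof (cases "finite J \<and> i \<notin> J \<and> i \<in># M")
      case True
      then obtain N where M: "M = add_mset i N" by (blast dest: multi_member_split)
      from True show ?thesis unfolding M
        by (simp add: weight_nth sym_mul_def alt_ins_apply alt_sign_def)
    next
      case False
      then have "i \<notin># M \<or> i \<in> J \<or> infinite (insert i J)" by auto
      then show ?thesis
        using weyl_space_infinite[OF a] by (auto simp: weight_nth sym_mul_def alt_ins_apply alt_sign_def)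
    qed
  qed
  then show ?thesis by (simp add: koszul_def lin_sum[OF lin_weight])
qed

lemma koszul_koszul: "koszul (koszul a) = 0"
proof (rule weyl_double_eq_0)
  have 1: "koszul (koszul a) = (\<Sum>i<n. \<Sum>j<n. sym_mul i (sym_mul j (alt_ins i (alt_ins j a))))"
    by (simp add: koszul_def alt_ins.sum sym_mul.sum sym_mul_alt_ins)
  also have "\<dots> = (\<Sum>j<n. \<Sum>i<n. sym_mul i (sym_mul j (alt_ins i (alt_ins j a))))" by (rule sum.swap)
  also have "\<dots> = (\<Sum>j<n. \<Sum>i<n. - sym_mul j (sym_mul i (alt_ins j (alt_ins i a))))"
  proof (intro sum.cong refl)
    fix i j
    show "sym_mul i (sym_mul j (alt_ins i (alt_ins j a))) = - sym_mul j (sym_mul i (alt_ins j (alt_ins i a)))"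
      unfolding alt_ins_anticommute[of i j] sym_mul.minus sym_mul_commute[of i j] ..
  qed
  finally have "koszul (koszul a) = - koszul (koszul a)" unfolding 1 by (simp only: sum_negf)
  then show "koszul (koszul a) + koszul (koszul a) = 0" by (simp only: eq_neg_iff_add_eq_0)
qed

lemma dinv_dinv: "a \<in> weyl_space n k l \<Longrightarrow> dinv (dinv a) = 0"
proof (cases l)
  case (Suc l')
  assume a: "a \<in> weyl_space n k l"
  have "koszul (dinv a) = weight inv_degree (koszul (koszul a))"
    unfolding dinv_weight by (rule weight_koszul[OF weyl_space_koszul[OF a[unfolded Suc]], symmetric])
  then show ?thesis
    unfolding dinv_weight[of "dinv a"] by (simp only: koszul_koszul lin_zero[OF lin_weight])
next
  case 0
  assume a: "a \<in> weyl_space n k l"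
  then show ?thesis using 0 dinv_weyl_space_0 by (simp add: lin_zero[OF lin_dinv])
qed

text \<open>The mixed terms cancel because the antisymmetric operators anticommute; the diagonal
  terms left over form the number operator evaluated next.\<close>

lemma del_koszul: "del (koszul a) + koszul (del a) = (\<Sum>i<n. alt_mul i (alt_ins i a) + sym_mul i (sym_ins i a))"
proof -
  have "del (koszul a) = (\<Sum>i<n. \<Sum>j<n. alt_mul i (sym_mul j (sym_ins i (alt_ins j a))) +
      (if i = j then alt_mul i (alt_ins i a) else 0))"
    unfolding delta_def koszul_def sym_ins.sum alt_mul.sum sym_ins_sym_mul alt_mul.add
    by (intro sum.cong refl arg_cong2[of _ _ _ _ "(+)"]) (simp add: alt_mul.zero)
  also have "\<dots> = (\<Sum>i<n. \<Sum>j<n. alt_mul i (sym_mul j (sym_ins i (alt_ins j a)))) + (\<Sum>i<n. alt_mul i (alt_ins i a))"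
    unfolding sum.distrib by simp
  finally have 1: "del (koszul a) = (\<Sum>i<n. \<Sum>j<n. alt_mul i (sym_mul j (sym_ins i (alt_ins j a)))) +
    (\<Sum>i<n. alt_mul i (alt_ins i a))" .
  have "koszul (del a) = (\<Sum>j<n. \<Sum>i<n. - sym_mul j (alt_mul i (alt_ins j (sym_ins i a))) +
      (if j = i then sym_mul j (sym_ins i a) else 0))"
    unfolding delta_def koszul_def alt_ins.sum sym_mul.sum alt_ins_alt_mul sym_mul.add sym_mul.minus
    by (intro sum.cong refl arg_cong2[of _ _ _ _ "(+)"]) (simp add: sym_mul.zero)
  also have "\<dots> = - (\<Sum>j<n. \<Sum>i<n. sym_mul j (alt_mul i (alt_ins j (sym_ins i a)))) + (\<Sum>j<n. sym_mul j (sym_ins j a))"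
    unfolding sum.distrib sum_negf by simp
  also have "(\<Sum>j<n. \<Sum>i<n. sym_mul j (alt_mul i (alt_ins j (sym_ins i a)))) =
    (\<Sum>i<n. \<Sum>j<n. alt_mul i (sym_mul j (sym_ins i (alt_ins j a))))"
    by (subst sum.swap) (simp add: sym_mul_alt_mul sym_ins_alt_ins)
  finally have 2: "koszul (del a) = - (\<Sum>i<n. \<Sum>j<n. alt_mul i (sym_mul j (sym_ins i (alt_ins j a)))) +
    (\<Sum>j<n. sym_mul j (sym_ins j a))" .
  have "(x + y) + (- x + z) = y + z" for x y z :: "'v weyl"
    by (simp only: add.assoc add.left_commute[of y] add_minus_cancel)
  then show ?thesis unfolding 1 2 sum.distrib .
qed

lemma number_operator:
  assumes a: "a \<in> weyl_space n k l"
  shows "(\<Sum>i<n. alt_mul i (alt_ins i a) + sym_mul i (sym_ins i a)) M J = of_nat (size M + card J) * a M J"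
proof (cases "a M J = 0")
  case False
  then obtain m where nz: "a M J $ m \<noteq> 0" by (metis fps_ext fps_zero_nth)
  have Jn: "J \<subseteq> {..<n}" and Mn: "set_mset M \<subseteq> {..<n}"
    using weyl_spaceD[OF a nz] by auto
  have 1: "alt_mul i (alt_ins i a) M J = (if i \<in> J then a M J else 0)" for i
  proof -
    have "below i (J - {i}) = below i J" if "i \<in> J" using below_remove[of i J i] that by simp
    then show ?thesis by (auto simp: alt_mul_apply alt_ins_apply alt_sign_alt_sign insert_absorb alt_sign_def)
  qed
  have 2: "sym_mul i (sym_ins i a) M J = of_nat (count M i) * a M J" for i
  proof (cases "i \<in># M")
    case True
    then obtain N where "M = add_mset i N" by (blast dest: multi_member_split)
    then show ?thesis by (simp add: sym_mul_def sym_ins_def)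
  next
    case False
    then have "count M i = 0" by (simp add: not_in_iff)
    with False show ?thesis by (simp add: sym_mul_def)
  qed
  have "(\<Sum>i<n. alt_mul i (alt_ins i a) + sym_mul i (sym_ins i a)) M J =
    (\<Sum>i<n. if i \<in> J then a M J else 0) + (\<Sum>i<n. of_nat (count M i) * a M J)"
    by (simp only: fun_additive_sum plus_fun_apply 1 2 sum.distrib)
  also have "(\<Sum>i<n. if i \<in> J then a M J else 0) = of_nat (card J) * a M J"
    using Jn by (simp add: Int_absorb1 flip: sum.inter_restrict)
  also have "(\<Sum>i<n. of_nat (count M i) * a M J) = of_nat (\<Sum>i<n. count M i) * a M J"
    by (simp add: sum_distrib_right)
  also have "(\<Sum>i<n. count M i) = size M"
    unfolding size_multiset_overloaded_eq using Mn
    by (intro sum.mono_neutral_right) (auto simp: not_in_iff)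
  finally show ?thesis by (simp only: distrib_right of_nat_add add.commute)
next
  case True
  have 1: "alt_mul i (alt_ins i a) M J = 0" for i
    using True by (auto simp: alt_mul_apply alt_ins_apply insert_absorb)
  have 2: "sym_mul i (sym_ins i a) M J = 0" for i
    using True by (auto simp: sym_mul_def sym_ins_def)
  show ?thesis by (simp only: fun_additive_sum plus_fun_apply 1 2 True) simp
qed

lemma homotopy:
  assumes a: "a \<in> weyl_space n k l"
  shows "del (dinv a) + dinv (del a) = a - weyl_embed (weyl_proj a)"
proof -
  have "koszul a = 0 \<or> (\<exists>l'. koszul a \<in> weyl_space n (Suc k) l')"
  proof (cases l)
    case 0
    with a show ?thesis by (simp add: koszul_def alt_ins_weyl_space_0 sym_mul.zero)
  qed (use a weyl_space_koszul in blast)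
  then have "del (dinv a) = weight inv_degree (del (koszul a))"
  proof
    assume z: "koszul a = 0"
    show ?thesis unfolding dinv_weight z lin_zero[OF lin_weight] lin_zero[OF lin_del] ..
  qed (auto simp: dinv_weight weight_del)
  then have "del (dinv a) + dinv (del a) = weight inv_degree (del (koszul a) + koszul (del a))"
    unfolding dinv_weight[of "del a"] lin_add[OF lin_weight] by (simp only:)
  also have "\<dots> = a - weyl_embed (weyl_proj a)"
  proof (intro ext fps_ext)
    fix M :: "nat multiset" and J :: "nat set" and m
    let ?d = "size M + card J"
    have "weight inv_degree (del (koszul a) + koszul (del a)) M J $ m =
      sc (inv_degree ?d) (of_nat ?d * a M J $ m)"
      unfolding weight_nth del_koszul number_operator[OF a] fps_nth_of_nat_mult ..
    also have "\<dots> = (a - weyl_embed (weyl_proj a)) M J $ m"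
    proof (cases "?d = 0")
      case False
      then have "rat_const (1 / of_nat ?d) * of_nat ?d = (1 :: 'r)"
        by (intro rat_const_inverse_nat) (rule neq0_conv[THEN iffD1])
      then have "sc (inv_degree ?d) (of_nat ?d * a M J $ m) = a M J $ m"
        unfolding sc_of_nat[symmetric] scale_scale if_not_P[OF False] by (simp only: scale_one)
      moreover have "weyl_embed (weyl_proj a) M J = 0" using False by (auto simp: weyl_embed_def)
      ultimately show ?thesis by simp
    next
      \<comment> \<open>Total degree 0 leaves the empty monomial, but also infinite
        \<open>J\<close>, whose \<open>card\<close> is 0; there \<open>a\<close> vanishes.\<close>
      case True
      then have M: "M = {#}" and J: "J = {} \<or> infinite J" by auto
      have "a {#} J = 0" if "infinite J" using that weyl_space_infinite[OF a] by simp
      then show ?thesis using M J by (auto simp: weyl_embed_def weyl_proj_def)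
    qed
    finally show "weight inv_degree (del (koszul a) + koszul (del a)) M J $ m =
      (a - weyl_embed (weyl_proj a)) M J $ m" .
  qed
  finally show ?thesis .
qed

lemma homotopy_pos:
  assumes a: "a \<in> weyl_space n k (Suc l)"
  shows "del (dinv a) + dinv (del a) = a"
proof -
  have "weyl_proj a = 0"
    using weyl_spaceD(3)[OF a, of "{#}" "{}"] by (intro fps_ext) (auto simp: weyl_proj_def)
  then have "weyl_embed (weyl_proj a) = 0" by (intro ext) (simp add: weyl_embed_def)
  then show ?thesis using homotopy[OF a] by (simp only: diff_0_right)
qed

end

section \<open>Graded commutativity and limits\<close>

text \<open>Central coefficients of one factor suffice. So scalar forms commute in the graded sense
  with sections over a noncommutative coefficient ring.\<close>

lemma mu_swap:
  fixes x a :: "'v::ring_1 weyl"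
  assumes x: "x \<in> weyl_space n p l" and central: "\<And>M J f. x M J * f = f * x M J"
  shows "mu x a = mu (if even l then a else gam a) x"
proof (intro ext)
  fix M J
  show "mu x a M J = mu (if even l then a else gam a) x M J"
  proof (cases "finite J")
    case True
    have "wedge (x (M - N)) (a (M - (M - N))) J = wedge ((if even l then a else gam a) N) (x (M - N)) J"
      if N: "N \<subseteq># M" for N
    proof -
      have NM: "M - (M - N) = N" using N by (simp add: subset_mset.diff_diff_right)
      have "wedge (x (M - N)) (a N) J =
        (\<Sum>K\<in>Pow J. alt_sign (inversions (J - K) (J - (J - K))) (x (M - N) (J - K) * a N (J - (J - K))))"
        unfolding wedge_def by (rule sum.reindex_bij_witness[of _ "\<lambda>K. J - K" "\<lambda>K. J - K"]) (auto simp: double_diff)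
      also have "\<dots> = wedge ((if even l then a else gam a) N) (x (M - N)) J"
        unfolding wedge_def
      proof (rule sum.cong[OF refl])
        fix K assume "K \<in> Pow J"
        then have K: "K \<subseteq> J" by simp
        have JK: "J - (J - K) = K" using K by auto
        show "alt_sign (inversions (J - K) (J - (J - K))) (x (M - N) (J - K) * a N (J - (J - K))) =
          alt_sign (inversions K (J - K)) ((if even l then a else gam a) N K * x (M - N) (J - K))"
        proof (cases "x (M - N) (J - K) = 0")
          case False
          then obtain m where "x (M - N) (J - K) $ m \<noteq> 0" by (metis fps_ext fps_zero_nth)
          then have card: "card (J - K) = l" by (rule weyl_spaceD(3)[OF x])
          have "inversions K (J - K) + inversions (J - K) K = card K * card (J - K)"
            using True K by (intro inversions_swap) (auto intro: finite_subset)
          then have "even (inversions (J - K) K) = even (inversions K (J - K) + card K * l)"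
            unfolding card by presburger
          then have "alt_sign (inversions (J - K) K) z = alt_sign (inversions K (J - K) + card K * l) z" for z :: "'v fps"
            by (rule alt_sign_cong_parity)
          then show ?thesis
            unfolding JK central by (auto simp: gam_def alt_sign_def)
        qed (simp add: JK)
      qed
      finally show ?thesis unfolding NM .
    qed
    then have "(\<Sum>N | N \<subseteq># M. wedge (x (M - N)) (a (M - (M - N))) J) = mu (if even l then a else gam a) x M J"
      unfolding mu_wedge by (intro sum.cong) auto
    moreover have "mu x a M J = (\<Sum>N | N \<subseteq># M. wedge (x (M - N)) (a (M - (M - N))) J)"
      unfolding mu_wedge
      by (rule sum.reindex_bij_witness[of _ "\<lambda>N. M - N" "\<lambda>N. M - N"]) (auto simp: subset_mset.diff_diff_right)
    ultimately show ?thesis by simp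
  qed (simp add: mu_infinite)
qed

text \<open>Completeness for the total degree: at the monomial \<open>M\<close> and the power
  \<open>t^m\<close> the sequence is constant from index \<open>size M + 2 * m + 1\<close> on,
  because later corrections have higher total degree.\<close>

lemma weyl_limit:
  fixes s :: "nat \<Rightarrow> 'v::ring_1 weyl"
  assumes s: "\<And>k. s k \<in> weyl_space n p l" and diff: "\<And>k. s (Suc k) - s k \<in> weyl_space n k l"
  shows "\<exists>x\<in>weyl_space n p l. \<forall>k. x - s k \<in> weyl_space n k l"
proof -
  define x where "x = (\<lambda>M J. Abs_fps (\<lambda>m. s (Suc (size M + 2 * m)) M J $ m))"
  have stable: "s j M J $ m = s (Suc (size M + 2 * m)) M J $ m" if "Suc (size M + 2 * m) \<le> j" for j M J m
    using that
  proof (induction j rule: dec_induct)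
    case (step j)
    have "(s (Suc j) - s j) M J $ m = 0"
    proof (rule ccontr)
      assume "(s (Suc j) - s j) M J $ m \<noteq> 0"
      from weyl_spaceD(4)[OF diff this] step.hyps show False by simp
    qed
    then have "s (Suc j) M J $ m = s j M J $ m" by simp
    with step.IH show ?case by simp
  qed simp
  have "x \<in> weyl_space n p l"
  proof (rule weyl_spaceI)
    fix M J m assume "x M J $ m \<noteq> 0"
    then have nz: "s (Suc (size M + 2 * m)) M J $ m \<noteq> 0" by (simp add: x_def)
    show "set_mset M \<subseteq> {..<n} \<and> J \<subseteq> {..<n} \<and> card J = l \<and> p \<le> size M + 2 * m"
      using weyl_spaceD[OF s nz] by blast
  qed
  moreover have "x - s k \<in> weyl_space n k l" for k
  proof (rule weyl_spaceI)
    fix M J m assume nz: "(x - s k) M J $ m \<noteq> 0"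
    have mem: "x - s k \<in> weyl_space n p l" by (intro weyl_space_diff s) fact
    have "k \<le> size M + 2 * m"
    proof (rule ccontr)
      assume "\<not> k \<le> size M + 2 * m"
      then have "s k M J $ m = x M J $ m" using stable[of M m k J] by (simp add: x_def)
      with nz show False by simp
    qed
    then show "set_mset M \<subseteq> {..<n} \<and> J \<subseteq> {..<n} \<and> card J = l \<and> k \<le> size M + 2 * m"
      using weyl_spaceD[OF mem nz] by blast
  qed
  ultimately show ?thesis by blast
qed

lemma contraction_fixpoint_unique:
  fixes \<Phi> :: "'v::ring_1 weyl \<Rightarrow> 'v weyl"
  assumes contr: "\<And>a b k. a \<in> weyl_space n p l \<Longrightarrow> b \<in> weyl_space n p l \<Longrightarrow> a - b \<in> weyl_space n k l \<Longrightarrow>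
      \<Phi> a - \<Phi> b \<in> weyl_space n (Suc k) l"
    and x: "x \<in> weyl_space n p l" "\<Phi> x = x" and y: "y \<in> weyl_space n p l" "\<Phi> y = y"
  shows "x = y"
proof -
  have "x - y \<in> weyl_space n k l" for k
  proof (induction k)
    case 0
    show ?case by (rule weyl_space_mono[of _ _ p]) (intro weyl_space_diff x y, simp)
  next
    case (Suc k)
    from contr[OF x(1) y(1) Suc] show ?case by (simp only: x(2) y(2))
  qed
  then have "x - y = 0" by (rule weyl_space_Inter)
  then show ?thesis by (simp only: right_minus_eq)
qed

text \<open>Banach's fixed point argument, where contracting means raising the filtration degree of
  a difference by one.\<close>

lemma contraction_fixpoint:
  fixes \<Phi> :: "'v::ring_1 weyl \<Rightarrow> 'v weyl"
  assumes maps: "\<And>a. a \<in> weyl_space n p l \<Longrightarrow> \<Phi> a \<in> weyl_space n p l"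
    and contr: "\<And>a b k. a \<in> weyl_space n p l \<Longrightarrow> b \<in> weyl_space n p l \<Longrightarrow> a - b \<in> weyl_space n k l \<Longrightarrow>
      \<Phi> a - \<Phi> b \<in> weyl_space n (Suc k) l"
  obtains x where "x \<in> weyl_space n p l" "\<Phi> x = x"
proof -
  define s where "s = (\<lambda>k. (\<Phi> ^^ k) 0)"
  have s_Suc: "s (Suc k) = \<Phi> (s k)" for k by (simp add: s_def)
  have s: "s k \<in> weyl_space n p l" for k
  proof (induction k)
    case 0
    show ?case unfolding s_def by (simp only: funpow_0 weyl_space_0)
  next
    case (Suc k)
    then show ?case unfolding s_Suc by (rule maps)
  qed
  have "s (Suc k) - s k \<in> weyl_space n k l" for k
  proof (induction k)
    case 0
    show ?case by (rule weyl_space_mono[of _ _ p]) (intro weyl_space_diff s, simp)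
  next
    case (Suc k)
    from contr[OF s s Suc] show ?case by (simp only: s_Suc)
  qed
  from weyl_limit[of s, OF s this] obtain x where x: "x \<in> weyl_space n p l"
    and lim: "\<And>k. x - s k \<in> weyl_space n k l" by blast
  have "\<Phi> x - x \<in> weyl_space n k l" for k
  proof -
    have "(\<Phi> x - \<Phi> (s k)) - (x - s (Suc k)) \<in> weyl_space n (Suc k) l"
      by (intro weyl_space_diff contr x s lim)
    then have "\<Phi> x - x \<in> weyl_space n (Suc k) l" unfolding s_Suc by (simp only: diff_diff_eq2 diff_add_cancel)
    then show ?thesis by (rule weyl_space_mono) simp
  qed
  then have "\<Phi> x - x = 0" by (rule weyl_space_Inter)
  then have "\<Phi> x = x" by (simp only: right_minus_eq)
  with x show thesis by (rule that)
qed

lemma add_diff_add_cancel: "x + y - (z + u) = y - z \<Longrightarrow> x = (u :: 'b::ab_group_add)"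
  by (simp add: algebra_simps)

text \<open>\<open>a {#} = 0\<close> says that \<open>a\<close> has no component of symmetric degree
  0; \<open>central_zero\<close> will ask for this.\<close>

lemma alt_mul_empty: "a {#} = 0 \<Longrightarrow> alt_mul i a {#} = 0"
  and alt_ins_empty: "a {#} = 0 \<Longrightarrow> alt_ins i a {#} = (0 :: nat set \<Rightarrow> 'v::ring_1 fps)"
  by (intro ext; simp add: alt_mul_apply alt_ins_apply)+

lemma sym_mul_empty: "sym_mul i a {#} = 0"
  by (intro ext) (simp add: sym_mul_def)

lemma sum_empty: "(\<And>x. x \<in> A \<Longrightarrow> f x {#} = (0 :: 'b \<Rightarrow> 'c::comm_monoid_add)) \<Longrightarrow> (\<Sum>x\<in>A. f x) {#} = 0"
  by (subst fun_additive_sum) (rule sum.neutral, simp)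

section \<open>Curvature\<close>

text \<open>\<open>P i j\<close> is the matrix by which the curvature acts as a derivation, and
  \<open>Q i j\<close> is the curvature with an index lowered. \<open>r_Q\<close> raises it again,
  \<open>Q_sym\<close> is the symmetry of a symplectic curvature, and \<open>s_P\<close> says that
  the curvature annihilates \<open>s\<close>.\<close>

locale fedosov = connection sc n \<pi> C \<Gamma> act
  for sc :: "'r::ring_containing_rat \<Rightarrow> 'v::ring_1 \<Rightarrow> 'v" and n \<pi> C \<Gamma> act +
  fixes r s w :: "nat \<Rightarrow> nat \<Rightarrow> 'r" and Q P :: "nat \<Rightarrow> nat \<Rightarrow> nat \<Rightarrow> nat \<Rightarrow> 'r"
  assumes \<pi>: "i < n \<Longrightarrow> j < n \<Longrightarrow> \<pi> i j = r i j + s i j"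
    and r_antisym: "i < n \<Longrightarrow> j < n \<Longrightarrow> r i j = - r j i"
    and s_sym: "i < n \<Longrightarrow> j < n \<Longrightarrow> s i j = s j i"
    and r_w: "i < n \<Longrightarrow> k < n \<Longrightarrow> (\<Sum>j<n. r i j * w j k) = (if i = k then 1 else 0)"
    and P_def: "P i j p q = commutator (\<Gamma> i) (\<Gamma> j) p q + (\<Sum>k<n. C i j k * \<Gamma> k p q)"
    and Q_sym: "i < n \<Longrightarrow> j < n \<Longrightarrow> k < n \<Longrightarrow> l < n \<Longrightarrow> Q i j k l = Q i j l k"
    and r_Q: "i < n \<Longrightarrow> j < n \<Longrightarrow> l < n \<Longrightarrow> q < n \<Longrightarrow> (\<Sum>p<n. r p q * Q i j p l) = P i j l q"
    and s_P: "i < n \<Longrightarrow> j < n \<Longrightarrow> v < n \<Longrightarrow> q < n \<Longrightarrow> (\<Sum>u<n. s u v * P i j u q + s u q * P i j u v) = 0"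
begin

lemma Dop_square_P: "Dop (Dop a) + Dop (Dop a) = eps2 n (\<lambda>i j. Xop (P i j) a)"
  unfolding Dop_square
proof (rule eps2_cong)
  fix i j assume "i < n" "j < n"
  from Kop_commutator[OF this] show "Kop i (Kop j a) - Kop j (Kop i a) - (\<Sum>k<n. wsc (C i j k) (Kop k a)) = Xop (P i j) a"
    unfolding P_def[abs_def] .
qed

abbreviation unit :: "'v weyl" where
  "unit \<equiv> weyl_embed 1"

definition curv :: "'v weyl" where
  "curv = (\<Sum>i<n. \<Sum>j<n. \<Sum>k<n. \<Sum>l<n. wsc (rat_const (1/4) * Q i j k l)
      (sym_mul k (sym_mul l (alt_mul i (alt_mul j unit)))))"

text \<open>Multiplication by the two-form that accompanies the symmetric monomial of
  \<open>k\<close> and \<open>l\<close> in \<open>curv\<close>.\<close>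

definition smul :: "nat \<Rightarrow> nat \<Rightarrow> 'v weyl \<Rightarrow> 'v weyl" where
  "smul k l b = eps2 n (\<lambda>i j. wsc (rat_const (1/4) * Q i j k l) b)"

lemma lin_smul [intro!]: "lin (smul k l)"
proof -
  have "lin (\<lambda>a. eps2 n (\<lambda>i j. wsc (rat_const (1/4) * Q i j k l) a))" by (intro lin_eps2 lin_wsc')
  then show ?thesis by (simp add: smul_def[abs_def])
qed

lemma sym_ins_smul: "sym_ins i (smul k l a) = smul k l (sym_ins i a)"
  by (simp add: smul_def eps2_def sym_ins.sum sym_ins_alt_mul lin_wsc[OF lin_sym_ins])

lemma smul_sym: "k < n \<Longrightarrow> l < n \<Longrightarrow> smul k l a = smul l k a"
  unfolding smul_def by (rule eps2_cong) (simp add: Q_sym[of _ _ k l])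

lemma mu_eps2_left: "mu (eps2 n f) a = eps2 n (\<lambda>i j. mu (f i j) a)"
proof -
  have add: "additive (\<lambda>x. mu x a)" by (simp add: additive_def mu_add_left)
  show ?thesis by (simp add: eps2_def additive.sum[OF add] mu_alt_mul_left)
qed

lemma mu_eps2_right: "mu a (eps2 n f) = eps2 n (\<lambda>i j. mu a (f i j))"
proof -
  have add: "additive (mu a)" by (simp add: additive_def mu_add_right)
  show ?thesis by (simp add: eps2_def additive.sum[OF add] mu_alt_mul_right)
qed

lemma mu_smul:
  assumes "a \<in> weyl_space n p q"
  shows "mu (smul k l unit) a = smul k l a" "mu a (smul k l unit) = smul k l a"
  using mu_one[OF assms]
  by (simp_all add: smul_def mu_eps2_left mu_eps2_right mu_wsc_left mu_wsc_right)

lemma sum_4_swap: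
  "(\<Sum>i\<in>A. \<Sum>j\<in>A. \<Sum>k\<in>A. \<Sum>l\<in>A. f i j k l) = (\<Sum>k\<in>A. \<Sum>l\<in>A. \<Sum>i\<in>A. \<Sum>j\<in>A. f i j k l :: 'b::comm_monoid_add)"
proof -
  have "(\<Sum>i\<in>A. \<Sum>j\<in>A. \<Sum>k\<in>A. \<Sum>l\<in>A. f i j k l) = (\<Sum>i\<in>A. \<Sum>k\<in>A. \<Sum>l\<in>A. \<Sum>j\<in>A. f i j k l)"
    by (rule sum.cong[OF refl]) (rule trans[OF sum.swap], rule sum.cong[OF refl], rule sum.swap)
  also have "\<dots> = (\<Sum>k\<in>A. \<Sum>l\<in>A. \<Sum>i\<in>A. \<Sum>j\<in>A. f i j k l)"
    by (rule trans[OF sum.swap], rule sum.cong[OF refl], rule sum.swap)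
  finally show ?thesis .
qed

lemma curv_smul: "curv = (\<Sum>k<n. \<Sum>l<n. sym_mul k (sym_mul l (smul k l unit)))"
  unfolding curv_def smul_def eps2_def sym_mul.sum
  by (subst sum_4_swap) (simp only: sym_mul_alt_mul lin_wsc[OF lin_alt_mul] lin_wsc[OF lin_sym_mul])

text \<open>Half of the derivative of \<open>curv\<close> in direction \<open>p\<close>; the other
  half comes from the second factor of the quadratic form.\<close>

definition curv1 :: "nat \<Rightarrow> 'v weyl" where
  "curv1 p = (\<Sum>l<n. sym_mul l (smul p l unit))"

lemma smul_unit_ins [simp]: "sym_ins i (smul k l unit) = 0"
  by (simp add: sym_ins_smul lin_zero[OF lin_smul])

lemma sym_ins_curv: "p < n \<Longrightarrow> sym_ins p curv = curv1 p + curv1 p"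
proof -
  assume p: "p < n"
  have "sym_ins p curv = (\<Sum>k<n. \<Sum>l<n. (if p = l then sym_mul k (smul k l unit) else 0) +
      (if p = k then sym_mul l (smul k l unit) else 0))"
    unfolding curv_smul sym_ins.sum sym_ins_sym_mul smul_unit_ins sym_mul.zero add_0_left sym_mul.add
    by (intro sum.cong refl arg_cong2[of _ _ _ _ "(+)"]) (auto simp: sym_mul.zero)
  also have "\<dots> = (\<Sum>k<n. sym_mul k (smul k p unit)) + (\<Sum>k<n. if p = k then \<Sum>l<n. sym_mul l (smul k l unit) else 0)"
    unfolding sum.distrib using p by (intro arg_cong2[of _ _ _ _ "(+)"] sum.cong refl) auto
  also have "(\<Sum>k<n. sym_mul k (smul k p unit)) = curv1 p"
    unfolding curv1_def using p by (intro sum.cong refl) (simp add: smul_sym[of _ p])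
  also have "(\<Sum>k<n. if p = k then \<Sum>l<n. sym_mul l (smul k l unit) else 0) = curv1 p"
    using p by (simp add: curv1_def)
  finally show ?thesis .
qed

lemma sym_ins_curv1: "q < n \<Longrightarrow> sym_ins q (curv1 p) = smul p q unit"
proof -
  assume q: "q < n"
  have "sym_ins q (curv1 p) = (\<Sum>l<n. if q = l then smul p l unit else 0)"
    unfolding curv1_def sym_ins.sum sym_ins_sym_mul smul_unit_ins sym_mul.zero add_0_left ..
  then show ?thesis using q by simp
qed

definition cmul :: "nat \<Rightarrow> 'v weyl \<Rightarrow> 'v weyl" where
  "cmul p b = (\<Sum>l<n. sym_mul l (smul p l b))"

lemma mu_sums: "mu (\<Sum>x\<in>A. f x) a = (\<Sum>x\<in>A. mu (f x) a)" "mu a (\<Sum>x\<in>A. f x) = (\<Sum>x\<in>A. mu a (f x))"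
  for f :: "'i \<Rightarrow> 'v weyl"
proof -
  have add: "additive (\<lambda>x. mu x a)" "additive (mu a)" by (simp_all add: additive_def mu_add_left mu_add_right)
  show "mu (\<Sum>x\<in>A. f x) a = (\<Sum>x\<in>A. mu (f x) a)" by (rule additive.sum[OF add(1)])
  show "mu a (\<Sum>x\<in>A. f x) = (\<Sum>x\<in>A. mu a (f x))" by (rule additive.sum[OF add(2)])
qed

lemma mu_curv1:
  assumes "a \<in> weyl_space n p q"
  shows "mu (curv1 k) a = cmul k a" "mu a (curv1 k) = cmul k a"
  unfolding curv1_def cmul_def mu_sums mu_sym_mul_left mu_sym_mul_right mu_smul[OF assms] by (rule refl)+

lemma mu_curv:
  assumes "a \<in> weyl_space n p q"
  shows "mu curv a = mu a curv"
  unfolding curv_smul mu_sums mu_sym_mul_left mu_sym_mul_right mu_smul[OF assms] ..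

lemma quarter: "rat_const (1/4) * c * 4 = (c :: 'r)"
proof -
  have "rat_const (1/4) * 4 = (1 :: 'r)"
    using rat_const_inverse_nat[of 4, where 'a = 'r] by simp
  then have "c * (rat_const (1/4) * 4) = c" by simp
  then show ?thesis by (simp only: ac_simps)
qed

lemma smul_4: "wsc 4 (smul k l b) = eps2 n (\<lambda>i j. wsc (Q i j k l) b)"
  unfolding smul_def wsc_eps2 wsc.scale_scale
  by (rule eps2_cong) (metis mult.commute quarter)

lemma eps2_sum: "eps2 n (\<lambda>i j. \<Sum>x\<in>A. f x i j) = (\<Sum>x\<in>A. eps2 n (f x))"
  for f :: "'i \<Rightarrow> nat \<Rightarrow> nat \<Rightarrow> 'v weyl"
proof -
  have "eps2 n (\<lambda>i j. \<Sum>x\<in>A. f x i j) = (\<Sum>i<n. \<Sum>j<n. \<Sum>x\<in>A. alt_mul i (alt_mul j (f x i j)))"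
    by (simp add: eps2_def alt_mul.sum)
  also have "\<dots> = (\<Sum>i<n. \<Sum>x\<in>A. \<Sum>j<n. alt_mul i (alt_mul j (f x i j)))"
    by (rule sum.cong[OF refl], rule sum.swap)
  also have "\<dots> = (\<Sum>x\<in>A. \<Sum>i<n. \<Sum>j<n. alt_mul i (alt_mul j (f x i j)))" by (rule sum.swap)
  finally show ?thesis by (simp add: eps2_def)
qed

lemma sym_mul_eps2: "sym_mul k (eps2 n f) = eps2 n (\<lambda>i j. sym_mul k (f i j))"
  by (simp add: eps2_def sym_mul.sum sym_mul_alt_mul)

text \<open>The constants fit: the antisymmetric part of \<open>\<pi>\<close> doubles
  \<open>r\<close>, the derivative of a quadratic form brings another 2, and together they cancel
  the \<open>1/4\<close> in \<open>curv\<close>. Raising the index of \<open>Q\<close> by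
  \<open>r\<close> then produces \<open>P\<close>.\<close>

lemma muP_curv_1:
  assumes a: "a \<in> weyl_space n k0 l0"
  shows "muP 1 curv a - muP 1 a curv = Dop (Dop a) + Dop (Dop a)"
proof -
  have b: "sym_ins i a \<in> weyl_space n (k0 - 1) l0" for i by (rule weyl_space_sym_ins[OF a])
  have "muP 1 curv a = (\<Sum>p<n. \<Sum>q<n. wsc (\<pi> p q) (cmul p (sym_ins q a) + cmul p (sym_ins q a)))"
    by (simp add: sym_ins_curv mu_add_left mu_curv1[OF b])
  moreover have "muP 1 a curv = (\<Sum>q<n. \<Sum>p<n. wsc (\<pi> q p) (cmul p (sym_ins q a) + cmul p (sym_ins q a)))"
    by (simp add: sym_ins_curv mu_add_right mu_curv1[OF b])
  then have "muP 1 a curv = (\<Sum>p<n. \<Sum>q<n. wsc (\<pi> q p) (cmul p (sym_ins q a) + cmul p (sym_ins q a)))"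
    by (rule trans) (rule sum.swap)
  ultimately have "muP 1 curv a - muP 1 a curv =
    (\<Sum>p<n. \<Sum>q<n. wsc (\<pi> p q - \<pi> q p) (cmul p (sym_ins q a) + cmul p (sym_ins q a)))"
    by (simp only: sum_subtractf wsc.scale_left_diff_distrib)
  also have "\<dots> = (\<Sum>p<n. \<Sum>q<n. wsc (r p q) (wsc 4 (cmul p (sym_ins q a))))"
  proof (intro sum.cong refl)
    fix p q assume "p \<in> {..<n}" "q \<in> {..<n}"
    then have "\<pi> p q - \<pi> q p = r p q + r p q"
      using \<pi>[of p q] \<pi>[of q p] r_antisym[of q p] s_sym[of p q] by simp
    then have e: "\<pi> p q - \<pi> q p = 2 * r p q" by simp
    have "wsc (2 * c) (b + b) = wsc c (wsc 4 b)" for c b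
    proof -
      have "b + b = wsc 2 b" using wsc.scale_left_distrib[of 1 1 b] by simp
      then show ?thesis by (simp add: algebra_simps)
    qed
    then show "wsc (\<pi> p q - \<pi> q p) (cmul p (sym_ins q a) + cmul p (sym_ins q a)) =
      wsc (r p q) (wsc 4 (cmul p (sym_ins q a)))" unfolding e .
  qed
  also have "\<dots> = (\<Sum>p<n. \<Sum>q<n. \<Sum>l<n. eps2 n (\<lambda>i j. wsc (r p q * Q i j p l) (sym_mul l (sym_ins q a))))"
    by (simp only: cmul_def wsc.scale_sum_right lin_wsc[OF lin_sym_mul, symmetric] smul_4 wsc_eps2
        wsc.scale_scale sym_mul_eps2)
  also have "\<dots> = (\<Sum>l<n. \<Sum>q<n. \<Sum>p<n. eps2 n (\<lambda>i j. wsc (r p q * Q i j p l) (sym_mul l (sym_ins q a))))"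
  proof -
    have "(\<Sum>p<n. \<Sum>q<n. \<Sum>l<n. h p q l) = (\<Sum>l<n. \<Sum>q<n. \<Sum>p<n. h p q l)" for h :: "nat \<Rightarrow> nat \<Rightarrow> nat \<Rightarrow> 'v weyl"
      by (rule trans[OF sum_rotate3], rule sum.cong[OF refl], rule sum.swap)
    then show ?thesis .
  qed
  also have "\<dots> = (\<Sum>l<n. \<Sum>q<n. eps2 n (\<lambda>i j. wsc (P i j l q) (sym_mul l (sym_ins q a))))"
    unfolding eps2_sum[symmetric] wsc.scale_sum_left[symmetric]
    by (intro sum.cong refl eps2_cong) (simp add: r_Q)
  also have "\<dots> = eps2 n (\<lambda>i j. Xop (P i j) a)"
    unfolding Xop_def eps2_sum[symmetric] ..
  finally show ?thesis unfolding Dop_square_P .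
qed

lemma sum_4_transpose:
  "(\<Sum>p\<in>A. \<Sum>q\<in>A. \<Sum>u\<in>A. \<Sum>v\<in>A. f p q u v) = (\<Sum>p\<in>A. \<Sum>q\<in>A. \<Sum>u\<in>A. \<Sum>v\<in>A. f q p v u :: 'b::comm_monoid_add)"
proof -
  have "(\<Sum>p\<in>A. \<Sum>q\<in>A. \<Sum>u\<in>A. \<Sum>v\<in>A. f p q u v) = (\<Sum>p\<in>A. \<Sum>q\<in>A. \<Sum>u\<in>A. \<Sum>v\<in>A. f p q v u)"
    by (rule sum.cong[OF refl], rule sum.cong[OF refl], rule sum.swap)
  also have "\<dots> = (\<Sum>q\<in>A. \<Sum>p\<in>A. \<Sum>u\<in>A. \<Sum>v\<in>A. f p q v u)" by (rule sum.swap)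
  finally show ?thesis .
qed

text \<open>The terms of second order cancel because \<open>s\<close> is invariant under the curvature.\<close>

lemma muP_curv_2:
  assumes a: "a \<in> weyl_space n k0 l0"
  shows "muP (Suc (Suc 0)) curv a = muP (Suc (Suc 0)) a curv"
proof -
  define B where "B = (\<lambda>v q. sym_ins v (sym_ins q a))"
  have b: "sym_ins i (sym_ins j a) \<in> weyl_space n (k0 - 1 - 1) l0" for i j
    by (intro weyl_space_sym_ins a)
  have 1: "muP (Suc (Suc 0)) curv a =
    (\<Sum>p<n. \<Sum>q<n. \<Sum>u<n. \<Sum>v<n. wsc (\<pi> p q * \<pi> u v) (smul p u (B v q) + smul p u (B v q)))"
    unfolding mu_P.simps wsc.scale_sum_right wsc.scale_scale
  proof (intro sum.cong refl)
    fix p q u v assume "p \<in> {..<n}" "q \<in> {..<n}" "u \<in> {..<n}" "v \<in> {..<n}"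
    then show "wsc (\<pi> p q * \<pi> u v) (mu (sym_ins u (sym_ins p curv)) (sym_ins v (sym_ins q a))) =
      wsc (\<pi> p q * \<pi> u v) (smul p u (B v q) + smul p u (B v q))"
      by (simp add: sym_ins_curv sym_ins.add sym_ins_curv1 mu_add_left mu_smul[OF b] B_def)
  qed
  have "muP (Suc (Suc 0)) a curv =
    (\<Sum>p<n. \<Sum>q<n. \<Sum>u<n. \<Sum>v<n. wsc (\<pi> p q * \<pi> u v) (smul q v (B u p) + smul q v (B u p)))"
    unfolding mu_P.simps wsc.scale_sum_right wsc.scale_scale
  proof (intro sum.cong refl)
    fix p q u v assume "p \<in> {..<n}" "q \<in> {..<n}" "u \<in> {..<n}" "v \<in> {..<n}"
    then show "wsc (\<pi> p q * \<pi> u v) (mu (sym_ins u (sym_ins p a)) (sym_ins v (sym_ins q curv))) =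
      wsc (\<pi> p q * \<pi> u v) (smul q v (B u p) + smul q v (B u p))"
      by (simp add: sym_ins_curv sym_ins.add sym_ins_curv1 mu_add_right mu_smul[OF b] B_def)
  qed
  also have "\<dots> = (\<Sum>p<n. \<Sum>q<n. \<Sum>u<n. \<Sum>v<n. wsc (\<pi> q p * \<pi> v u) (smul p u (B v q) + smul p u (B v q)))"
    by (rule sum_4_transpose)
  finally have 2: "muP (Suc (Suc 0)) a curv =
    (\<Sum>p<n. \<Sum>q<n. \<Sum>u<n. \<Sum>v<n. wsc (\<pi> q p * \<pi> v u) (smul p u (B v q) + smul p u (B v q)))" .
  let ?X = "muP (Suc (Suc 0)) curv a - muP (Suc (Suc 0)) a curv"
  let ?c = "\<lambda>p q u v. \<pi> p q * \<pi> u v - \<pi> q p * \<pi> v u"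
  have "?X = (\<Sum>p<n. \<Sum>q<n. \<Sum>u<n. \<Sum>v<n. wsc (?c p q u v) (smul p u (B v q) + smul p u (B v q)))"
    unfolding 1 2 by (simp only: sum_subtractf wsc.scale_left_diff_distrib)
  then have "wsc 2 ?X = (\<Sum>p<n. \<Sum>q<n. \<Sum>u<n. \<Sum>v<n. wsc 2 (wsc (?c p q u v) (smul p u (B v q) + smul p u (B v q))))"
    by (simp only: wsc.scale_sum_right)
  also have "\<dots> = (\<Sum>p<n. \<Sum>q<n. \<Sum>u<n. \<Sum>v<n. eps2 n (\<lambda>i j. wsc (?c p q u v * Q i j p u) (B v q)))"
  proof (intro sum.cong refl)
    fix p q u v
    have *: "wsc 2 (wsc c (b + b)) = wsc c (wsc 4 b)" for c b
    proof -
      have "b + b = wsc 2 b" using wsc.scale_left_distrib[of 1 1 b] by simp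
      then show ?thesis by (simp add: algebra_simps)
    qed
    show "wsc 2 (wsc (?c p q u v) (smul p u (B v q) + smul p u (B v q))) =
      eps2 n (\<lambda>i j. wsc (?c p q u v * Q i j p u) (B v q))"
      unfolding * by (simp only: smul_4 wsc_eps2 wsc.scale_scale)
  qed
  also have "\<dots> = (\<Sum>q<n. \<Sum>v<n. \<Sum>p<n. \<Sum>u<n. eps2 n (\<lambda>i j. wsc (?c p q u v * Q i j p u) (B v q)))"
  proof -
    have "(\<Sum>p<n. \<Sum>q<n. \<Sum>u<n. \<Sum>v<n. h p q u v) = (\<Sum>q<n. \<Sum>v<n. \<Sum>p<n. \<Sum>u<n. h p q u v)"
      for h :: "nat \<Rightarrow> nat \<Rightarrow> nat \<Rightarrow> nat \<Rightarrow> 'v weyl"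
      by (rule trans[OF sum.swap], rule sum.cong[OF refl], rule trans[OF sum_rotate3], rule trans[OF sum_rotate3],
          rule trans[OF sum_rotate3], subst sum_rotate3, rule refl)
    then show ?thesis .
  qed
  also have "\<dots> = (\<Sum>q<n. \<Sum>v<n. eps2 n (\<lambda>i j. wsc (\<Sum>p<n. \<Sum>u<n. ?c p q u v * Q i j p u) (B v q)))"
    by (simp only: eps2_sum wsc.scale_sum_left)
  also have "\<dots> = (\<Sum>q<n. \<Sum>v<n. eps2 n (\<lambda>i j. 0))"
  proof (intro sum.cong refl eps2_cong)
    fix q v i j assume "q \<in> {..<n}" "v \<in> {..<n}" and ij: "i < n" "j < n"
    then have qv: "q < n" "v < n" by auto
    \<comment> \<open>Transposing \<open>\<pi> = r + s\<close> flips the sign of \<open>r\<close>,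
      so the products \<open>r r\<close> and \<open>s s\<close> cancel and only twice the mixed
      products survive.\<close>
    have "(\<Sum>p<n. \<Sum>u<n. ?c p q u v * Q i j p u) =
      (\<Sum>p<n. \<Sum>u<n. 2 * (s u v * (r p q * Q i j p u)) + 2 * (s p q * (r u v * Q i j u p)))"
    proof (intro sum.cong refl)
      fix p u assume "p \<in> {..<n}" "u \<in> {..<n}"
      then have pu: "p < n" "u < n" by auto
      have e: "\<pi> p q = r p q + s p q" "\<pi> q p = - r p q + s p q" "\<pi> u v = r u v + s u v" "\<pi> v u = - r u v + s u v"
        using \<pi>[OF pu(1) qv(1)] \<pi>[OF qv(1) pu(1)] \<pi>[OF pu(2) qv(2)] \<pi>[OF qv(2) pu(2)]
          r_antisym[OF qv(1) pu(1)] r_antisym[OF qv(2) pu(2)] s_sym[OF qv(1) pu(1)] s_sym[OF qv(2) pu(2)] by auto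
      show "?c p q u v * Q i j p u = 2 * (s u v * (r p q * Q i j p u)) + 2 * (s p q * (r u v * Q i j u p))"
        unfolding e Q_sym[OF ij pu(2) pu(1)] by (simp add: algebra_simps)
    qed
    also have "\<dots> = 2 * ((\<Sum>p<n. \<Sum>u<n. s u v * (r p q * Q i j p u)) + (\<Sum>p<n. \<Sum>u<n. s p q * (r u v * Q i j u p)))"
      by (simp add: sum.distrib sum_distrib_left distrib_left)
    also have "(\<Sum>p<n. \<Sum>u<n. s u v * (r p q * Q i j p u)) = (\<Sum>u<n. \<Sum>p<n. s u v * (r p q * Q i j p u))"
      by (rule sum.swap)
    also have "\<dots> = (\<Sum>u<n. s u v * P i j u q)"
      unfolding sum_distrib_left[symmetric] using ij qv by (intro sum.cong refl) (simp add: r_Q)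
    also have "(\<Sum>p<n. \<Sum>u<n. s p q * (r u v * Q i j u p)) = (\<Sum>p<n. s p q * P i j p v)"
      unfolding sum_distrib_left[symmetric] using ij qv by (intro sum.cong refl) (simp add: r_Q)
    also have "(\<Sum>u<n. s u v * P i j u q) + (\<Sum>p<n. s p q * P i j p v) = 0"
      using s_P[OF ij qv(2) qv(1)] by (simp add: sum.distrib)
    finally have "(\<Sum>p<n. \<Sum>u<n. ?c p q u v * Q i j p u) = 0" by simp
    then show "wsc (\<Sum>p<n. \<Sum>u<n. ?c p q u v * Q i j p u) (B v q) = 0" by (simp only: wsc.scale_zero_left)
  qed
  also have "\<dots> = 0" by (simp only: eps2_def alt_mul.zero sum.neutral_const)
  finally have "wsc (of_nat 2) ?X = wsc (of_nat 2) 0" by simp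
  then have "?X = 0" by (rule wsc_of_nat_cancel) simp
  then show ?thesis by (simp only: right_minus_eq)
qed

lemma muP_curv_ge_3:
  assumes "2 < k" shows "muP k curv a = 0" "muP k a curv = 0"
proof -
  obtain m where k: "k = Suc (Suc (Suc m))"
    using assms less_imp_Suc_add[of 2 k] by (auto simp: numeral_2_eq_2)
  have z: "sym_ins i (sym_ins j (sym_ins l curv)) = 0" if "i < n" "j < n" "l < n" for i j l
    using that by (simp add: sym_ins_curv sym_ins.add sym_ins_curv1)
  show "muP k curv a = 0" unfolding k
    by (simp add: z muP_zero_left)
  show "muP k a curv = 0" unfolding k
    by (simp add: z muP_zero_right)
qed

lemma half_circ_coeff: "2 * circ_coeff 1 = (1 :: 'r)"
  using circ_coeff_Suc[of 0, where 'a = 'r] by simp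

text \<open>Order 0 vanishes because \<open>curv\<close> is even with scalar coefficients, order 2
  by invariance of \<open>s\<close>, and from order 3 on the quadratic \<open>curv\<close> is
  differentiated away. Order 1 alone remains.\<close>

lemma curv_commutator:
  assumes a: "a \<in> weyl_space n k l"
  shows "curv \<bullet> a - a \<bullet> curv = tpow 1 (Dop (Dop a))"
proof -
  have e: "{..2::nat} = {0, 1, Suc (Suc 0)}" by auto
  have "curv \<bullet> a - a \<bullet> curv = (\<Sum>k\<le>2. wsc (circ_coeff k) (tpow k (muP k curv a - muP k a curv)))"
  proof -
    have 1: "curv \<bullet> a = (\<Sum>k\<le>2. wsc (circ_coeff k) (tpow k (muP k curv a)))"
      by (rule circ_finite) (rule muP_curv_ge_3)
    have 2: "a \<bullet> curv = (\<Sum>k\<le>2. wsc (circ_coeff k) (tpow k (muP k a curv)))"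
      by (rule circ_finite) (rule muP_curv_ge_3)
    show ?thesis by (simp only: 1 2 sum_subtractf tpow.diff wsc.scale_right_diff_distrib)
  qed
  also have "\<dots> = wsc (circ_coeff 1) (tpow 1 (Dop (Dop a) + Dop (Dop a)))"
    unfolding e using muP_curv_1[OF a] muP_curv_2[OF a] mu_curv[OF a]
    by (simp add: tpow.zero del: mu_P.simps(2))
  also have "\<dots> = tpow 1 (Dop (Dop a))"
  proof -
    have "wsc c (x + x) = wsc (2 * c) x" for c and x :: "'v weyl"
      using wsc.scale_left_distrib[of c c x] wsc.scale_right_distrib[of c x x] by simp
    then show ?thesis unfolding tpow.add by (simp only: half_circ_coeff wsc.scale_one)
  qed
  finally show ?thesis .
qed

lemma weyl_space_smul: "a \<in> weyl_space n k l \<Longrightarrow> smul p q a \<in> weyl_space n k (Suc (Suc l))"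
  unfolding smul_def by (intro weyl_space_eps2 weyl_space_wsc)

lemma curv_weyl_space: "curv \<in> weyl_space n 2 2"
proof -
  have "smul p q unit \<in> weyl_space n 0 2" for p q
    using weyl_space_smul[OF weyl_space_embed] by (simp add: numeral_2_eq_2)
  then have "sym_mul k (sym_mul l (smul k l unit)) \<in> weyl_space n (Suc (Suc 0)) 2" if "k < n" "l < n" for k l
    using that by (intro weyl_space_sym_mul)
  then show ?thesis unfolding curv_smul by (intro weyl_space_sum) (simp add: numeral_2_eq_2)
qed

section \<open>Bianchi identities from non-degeneracy\<close>

text \<open>The commutator of \<open>c\<close> with the generator of index \<open>k\<close> is
  \<open>t\<close> times the sum over \<open>i\<close> of \<open>r i k\<close> times
  \<open>sym_ins i c\<close>, in which \<open>s\<close> has dropped out. Contracting with the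
  inverse \<open>w\<close> isolates each derivative.\<close>

lemma central_sym_ins:
  assumes c: "c \<in> weyl_space n p l"
    and comm: "\<And>k. k < n \<Longrightarrow> c \<bullet> sym_mul k unit = sym_mul k unit \<bullet> c"
    and q: "q < n"
  shows "sym_ins q c = 0"
proof -
  have x: "sym_ins i (sym_mul k unit) = (if i = k then unit else 0)" for i k
    by (simp add: sym_ins_sym_mul sym_mul.zero)
  have xx: "sym_ins j (sym_ins i (sym_mul k unit)) = 0" for i j k
    by (simp add: x sym_ins.zero)
  have b: "sym_ins i c \<in> weyl_space n (p - 1) l" for i by (rule weyl_space_sym_ins[OF c])
  have mu_z: "mu a 0 = 0" "mu 0 a = 0" for a :: "'v weyl"
    using muP_zero_right[of 0 a] muP_zero_left[of 0 a] by (simp_all only: mu_P.simps)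
  have big: "muP k c (sym_mul j unit) = 0" "muP k (sym_mul j unit) c = 0" if k1: "1 < k" for k j
  proof -
    obtain m where k: "k = Suc (Suc m)" using k1 less_imp_Suc_add[of 1 k] by auto
    show "muP k c (sym_mul j unit) = 0" "muP k (sym_mul j unit) c = 0"
      unfolding k by (simp_all add: xx muP_zero_left muP_zero_right)
  qed
  have *: "(\<Sum>i<n. wsc (r i k) (sym_ins i c)) = 0" if k: "k < n" for k
  proof -
    have 1: "muP 1 c (sym_mul k unit) = (\<Sum>i<n. wsc (\<pi> i k) (sym_ins i c))"
    proof -
      have "muP 1 c (sym_mul k unit) = (\<Sum>i<n. \<Sum>j<n. if j = k then wsc (\<pi> i j) (sym_ins i c) else 0)"
        unfolding One_nat_def mu_P.simps x by (intro sum.cong refl) (simp add: mu_one[OF b] mu_z)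
      then show ?thesis using k by simp
    qed
    have 2: "muP 1 (sym_mul k unit) c = (\<Sum>i<n. wsc (\<pi> k i) (sym_ins i c))"
    proof -
      have "muP 1 (sym_mul k unit) c = (\<Sum>j<n. \<Sum>i<n. if j = k then wsc (\<pi> j i) (sym_ins i c) else 0)"
        unfolding One_nat_def mu_P.simps x by (intro sum.cong refl) (simp add: mu_one[OF b] mu_z)
      also have "\<dots> = (\<Sum>j<n. if j = k then \<Sum>i<n. wsc (\<pi> j i) (sym_ins i c) else 0)"
        by (intro sum.cong refl) simp
      finally show ?thesis using k by simp
    qed
    have 0: "muP 0 c (sym_mul k unit) = muP 0 (sym_mul k unit) c"
      by (simp add: mu_sym_mul_left mu_sym_mul_right mu_one[OF c])
    have e: "{..1::nat} = {0, 1}" by auto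
    have "c \<bullet> sym_mul k unit - sym_mul k unit \<bullet> c =
      (\<Sum>j\<le>1. wsc (circ_coeff j) (tpow j (muP j c (sym_mul k unit) - muP j (sym_mul k unit) c)))"
    proof -
      have 1: "c \<bullet> sym_mul k unit = (\<Sum>j\<le>1. wsc (circ_coeff j) (tpow j (muP j c (sym_mul k unit))))"
        by (rule circ_finite) (rule big)
      have 2: "sym_mul k unit \<bullet> c = (\<Sum>j\<le>1. wsc (circ_coeff j) (tpow j (muP j (sym_mul k unit) c)))"
        by (rule circ_finite) (rule big)
      show ?thesis by (simp only: 1 2 sum_subtractf tpow.diff wsc.scale_right_diff_distrib)
    qed
    also have "\<dots> = wsc (circ_coeff 1) (tpow 1 (muP 1 c (sym_mul k unit) - muP 1 (sym_mul k unit) c))"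
      unfolding e using 0 by (simp add: tpow.zero del: mu_P.simps)
    finally have z: "wsc (circ_coeff 1) (tpow 1 (muP 1 c (sym_mul k unit) - muP 1 (sym_mul k unit) c)) = 0"
      using comm[OF k] by simp
    have "muP 1 c (sym_mul k unit) - muP 1 (sym_mul k unit) c = wsc 2 (\<Sum>i<n. wsc (r i k) (sym_ins i c))"
      unfolding 1 2 sum_subtractf[symmetric] wsc.scale_left_diff_distrib[symmetric] wsc.scale_sum_right wsc.scale_scale
    proof (intro sum.cong refl arg_cong2[of _ _ _ _ wsc])
      fix i assume "i \<in> {..<n}"
      then show "\<pi> i k - \<pi> k i = 2 * r i k"
        using k \<pi>[of i k] \<pi>[of k i] r_antisym[of k i] s_sym[of i k] by simp
    qed
    then have "wsc (2 * circ_coeff 1) (tpow 1 (\<Sum>i<n. wsc (r i k) (sym_ins i c))) = 0"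
      using z by (simp only: lin_tpow[OF lin_wsc', symmetric] wsc.scale_scale mult.commute[of 2])
    then show ?thesis unfolding half_circ_coeff wsc.scale_one
      by (metis divide_tpow divide_t.zero)
  qed
  have "(\<Sum>k<n. wsc (w k q) (\<Sum>i<n. wsc (r i k) (sym_ins i c))) = 0"
    using * by (intro sum.neutral) (simp add: wsc.scale_zero_right)
  also have "(\<Sum>k<n. wsc (w k q) (\<Sum>i<n. wsc (r i k) (sym_ins i c))) =
    (\<Sum>i<n. wsc (\<Sum>k<n. r i k * w k q) (sym_ins i c))"
    unfolding wsc.scale_sum_right wsc.scale_sum_left wsc.scale_scale
    by (subst sum.swap) (simp only: mult.commute)
  also have "\<dots> = (\<Sum>i<n. if i = q then sym_ins i c else 0)"
    using q by (intro sum.cong refl) (simp add: r_w)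
  also have "\<dots> = sym_ins q c" using q by simp
  finally show ?thesis .
qed

lemma central_zero:
  assumes c: "c \<in> weyl_space n p l"
    and comm: "\<And>k. k < n \<Longrightarrow> c \<bullet> sym_mul k unit = sym_mul k unit \<bullet> c"
    and empty: "c {#} = 0"
  shows "c = 0"
proof (intro ext)
  fix M J
  show "c M J = 0 M J"
  proof (cases M)
    case empty
    then show ?thesis using assms(3) by simp
  next
    case (add i N)
    show ?thesis
    proof (cases "i < n")
      case True
      then have "sym_ins i c N J = sym_ins i 0 N J"
        using central_sym_ins[OF c comm] by (simp add: sym_ins.zero)
      then show ?thesis unfolding add by (rule sym_ins_cancel)
    next
      case False
      have "c M J $ m = 0" for m
        using weyl_spaceD(1)[OF c, of M J m] False add by auto
      then show ?thesis by (intro fps_ext) simp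
    qed
  qed
qed

lemma sym_mul_unit_space: "k < n \<Longrightarrow> sym_mul k unit \<in> weyl_space n 1 0"
  using weyl_space_sym_mul[OF weyl_space_embed] by simp

lemma gam_x: "k < n \<Longrightarrow> gam (sym_mul k unit) = sym_mul k unit"
  using gam_weyl_space[OF sym_mul_unit_space] by simp

lemma gam_curv: "gam curv = curv"
  using gam_weyl_space[OF curv_weyl_space] by simp

lemma curv1_empty: "curv1 p {#} = 0"
  unfolding curv1_def by (intro sum_empty sym_mul_empty)

lemma curv_empty: "curv {#} = 0"
  unfolding curv_smul by (intro sum_empty sym_mul_empty)

lemma wsc_empty: "a {#} = 0 \<Longrightarrow> wsc c a {#} = 0"
  by (intro ext fps_ext) (simp add: wsc_nth)

lemma Dop_empty: "a {#} = 0 \<Longrightarrow> Dop a {#} = 0"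
proof -
  assume a: "a {#} = 0"
  have X: "Xop G a {#} = 0" for G
    unfolding Xop_def by (intro sum_empty wsc_empty sym_mul_empty)
  have "wact i a {#} = 0" for i
    by (intro ext fps_ext) (simp add: wact_nth a act.zero)
  with X have K: "Kop i a {#} = 0" for i
    unfolding Kop_def by (simp add: fun_eq_iff)
  have "(\<Sum>i<n. alt_mul i (Kop i a)) {#} = 0"
    by (intro sum_empty alt_mul_empty K)
  moreover have "(\<Sum>k<n. theta k (alt_ins k a)) {#} = 0"
    unfolding theta_def eps2_def by (intro sum_empty alt_mul_empty wsc_empty alt_ins_empty a)
  ultimately show ?thesis unfolding Dop_def by (simp add: fun_eq_iff)
qed

text \<open>Both Bianchi identities follow from \<open>D\<^sup>2 = (1/t) ad(curv)\<close>: the form in question commutes with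
  the generators \<open>x\<^sup>k\<close> of the Weyl algebra, and by non-degeneracy of \<open>r\<close> only elements of symmetric
  degree 0 do.\<close>

lemma del_curv: "del curv = 0"
proof (rule central_zero)
  show "del curv \<in> weyl_space n (2 - 1) (Suc 2)" by (rule weyl_space_del[OF curv_weyl_space])
  show "del curv {#} = 0"
    unfolding delta_def using curv1_empty
    by (intro sum_empty alt_mul_empty) (simp add: sym_ins_curv)
  fix k assume k: "k < n"
  let ?x = "sym_mul k unit"
  \<comment> \<open>\<open>del\<close> anticommutes with \<open>Dop\<close>, hence commutes with its
    square, and \<open>curv_commutator\<close> applies to \<open>del ?x\<close> as well. Comparing
    the two leaves only the terms with \<open>del curv\<close>.\<close>
  have "del (curv \<bullet> ?x - ?x \<bullet> curv) = tpow 1 (Dop (Dop (del ?x)))"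
    unfolding curv_commutator[OF sym_mul_unit_space[OF k]] lin_tpow[OF lin_del] del_Dop lin_minus[OF lin_Dop] minus_minus ..
  also have "\<dots> = curv \<bullet> del ?x - del ?x \<bullet> curv"
    by (rule curv_commutator[OF weyl_space_del[OF sym_mul_unit_space[OF k]], symmetric])
  finally have "del curv \<bullet> ?x + curv \<bullet> del ?x - (del ?x \<bullet> curv + ?x \<bullet> del curv) = curv \<bullet> del ?x - del ?x \<bullet> curv"
    unfolding lin_diff[OF lin_del] del_circ gam_x[OF k] gam_curv .
  then show "del curv \<bullet> ?x = ?x \<bullet> del curv" by (rule add_diff_add_cancel)
qed

lemma Dop_curv: "Dop curv = 0"
proof (rule central_zero)
  show "Dop curv \<in> weyl_space n 2 (Suc 2)" by (rule weyl_space_Dop[OF curv_weyl_space])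
  show "Dop curv {#} = 0" by (rule Dop_empty) (rule curv_empty)
  fix k assume k: "k < n"
  let ?x = "sym_mul k unit"
  have "Dop (curv \<bullet> ?x - ?x \<bullet> curv) = tpow 1 (Dop (Dop (Dop ?x)))"
    unfolding curv_commutator[OF sym_mul_unit_space[OF k]] lin_tpow[OF lin_Dop] ..
  also have "\<dots> = curv \<bullet> Dop ?x - Dop ?x \<bullet> curv"
    by (rule curv_commutator[OF weyl_space_Dop[OF sym_mul_unit_space[OF k]], symmetric])
  finally have "Dop curv \<bullet> ?x + curv \<bullet> Dop ?x - (Dop ?x \<bullet> curv + ?x \<bullet> Dop curv) = curv \<bullet> Dop ?x - Dop ?x \<bullet> curv"
    unfolding lin_diff[OF lin_Dop] Dop_circ gam_x[OF k] gam_curv .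
  then show "Dop curv \<bullet> ?x = ?x \<bullet> Dop curv" by (rule add_diff_add_cancel)
qed

end

section \<open>Flat sections\<close>

lemma below_self: "below i {i} = 0" "below i {} = 0"
  by (auto simp: below_def card_eq_0_iff)

lemma antiderivation_cancel: "(p + - q) - (s + u) + (q - - s) = p - (u :: 'b::ab_group_add)"
  by (simp add: algebra_simps)

context connection
begin

lemma act_1: "act i 1 = 0"
  using act_mult[of i 1 1] by simp

lemma Kop_embed: "Kop i (weyl_embed \<xi>) = weyl_embed (fps_map (act i) \<xi>)"
proof -
  have "Xop G (weyl_embed \<xi>) = 0" for G
    by (simp add: Xop_def sym_mul.zero)
  moreover have "wact i (weyl_embed \<xi>) = weyl_embed (fps_map (act i) \<xi>)"
    by (intro ext fps_ext) (simp add: wact_nth weyl_embed_def fps_map_def act.zero)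
  ultimately show ?thesis unfolding Kop_def by (simp only: diff_0_right)
qed

lemma Dop_embed: "Dop (weyl_embed \<xi>) = (\<Sum>i<n. alt_mul i (weyl_embed (fps_map (act i) \<xi>)))"
proof -
  have "theta k (alt_ins k (weyl_embed \<xi>)) = 0" for k
    by (simp add: alt_ins_weyl_space_0[OF weyl_space_embed] lin_zero[OF lin_theta])
  then show ?thesis unfolding Dop_def Kop_embed by (simp only: sum.neutral_const diff_0_right)
qed

lemma del_embed: "del (weyl_embed \<xi>) = 0"
  unfolding delta_def sym_ins_embed alt_mul.zero by (rule sum.neutral_const)

lemma del_eq_0: "(\<And>i. i < n \<Longrightarrow> sym_ins i a = 0) \<Longrightarrow> del a = 0"
  unfolding delta_def by (rule sum.neutral) (simp add: alt_mul.zero)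

lemma dinv_empty: "dinv a {#} = 0"
proof -
  have "koszul a {#} = 0" unfolding koszul_def by (intro sum_empty sym_mul_empty)
  then show ?thesis
    by (intro ext fps_ext) (simp add: dinv_weight weight_nth)
qed

end

text \<open>\<open>Om\<close> stands for the closed form \<Omega> with coefficients in the algebra.
  As its symmetric degree is 0, total degree at least 2 encodes that it is divisible by
  \<open>t\<close>.\<close>

locale fedosov_form = fedosov sc n \<pi> C \<Gamma> act r s w Q P
  for sc :: "'r::ring_containing_rat \<Rightarrow> 'v::ring_1 \<Rightarrow> 'v" and n \<pi> C \<Gamma> act r s w Q P +
  fixes Om :: "'v weyl"
  assumes Om_space: "Om \<in> weyl_space n 2 2"
    and sym_ins_Om: "i < n \<Longrightarrow> sym_ins i Om = 0"
    and Dop_Om: "Dop Om = 0"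
    and Om_central: "Om M J * f = f * Om M J"
begin

lemma Om_comm: "a \<in> weyl_space n k l \<Longrightarrow> Om \<bullet> a = a \<bullet> Om"
  using mu_swap[OF Om_space Om_central, of a] circ_const_left[OF sym_ins_Om] circ_const_right[OF sym_ins_Om]
  by simp

lemma del_Om: "del Om = 0"
  by (rule del_eq_0) (rule sym_ins_Om)

section \<open>Solving the equation for \<rho>\<close>

definition fedosov_eq :: "'v weyl \<Rightarrow> bool" where
  "fedosov_eq \<rho> \<longleftrightarrow> del \<rho> = curv + Dop \<rho> + weyl_divide_t (\<rho> \<bullet> \<rho>) + Om"

text \<open>Makes the deformed square of such an element divisible by \<open>t\<close>, so that the
  quadratic term of the equation is a genuine quotient.\<close>

lemma mu_self_odd:
  assumes a: "(a :: 'v weyl) \<in> weyl_space n k 1" and central: "\<And>M J f. a M J * f = f * a M J"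
  shows "mu a a = 0"
proof (rule weyl_double_eq_0)
  have g: "gam a = - a" using gam_weyl_space[OF a] by simp
  have "additive (\<lambda>x. mu x a)" by (simp add: additive_def mu_add_left)
  then have "mu (- a) a = - mu a a" by (rule additive.minus)
  moreover have "mu a a = mu (gam a) a" using mu_swap[OF a central, of a] by simp
  ultimately have "mu a a = - mu a a" unfolding g by (simp only:)
  then show "mu a a + mu a a = 0" by (simp only: eq_neg_iff_add_eq_0)
qed

lemma circ_self_nth_0:
  assumes "a \<in> weyl_space n k 1" "\<And>M J f. a M J * f = f * a M J"
  shows "(a \<bullet> a) M J $ 0 = 0"
  unfolding circ_nth_0 mu_self_odd[OF assms] by simp

definition rho_rhs :: "'v weyl \<Rightarrow> 'v weyl" where
  "rho_rhs a = curv + Dop a + weyl_divide_t (a \<bullet> a) + Om"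

lemma weyl_space_rho_rhs: "a \<in> weyl_space n 2 1 \<Longrightarrow> rho_rhs a \<in> weyl_space n 2 2"
proof -
  assume a: "a \<in> weyl_space n 2 1"
  have "weyl_divide_t (a \<bullet> a) \<in> weyl_space n 2 2"
    using weyl_space_divide[OF weyl_space_circ[OF a a]] by (simp add: numeral_eq_Suc)
  moreover have "Dop a \<in> weyl_space n 2 2" using weyl_space_Dop[OF a] by (simp add: numeral_2_eq_2)
  ultimately show ?thesis
    unfolding rho_rhs_def by (intro weyl_space_add curv_weyl_space Om_space)
qed

text \<open>The difference of the quadratic terms contains \<open>a - b\<close> next to a factor of
  degree at least 2, which pays for the division by \<open>t\<close>. Then \<open>dinv\<close> gains
  one degree.\<close>

lemma rho_contraction:
  assumes a: "a \<in> weyl_space n 2 1" and b: "b \<in> weyl_space n 2 1" and ab: "a - b \<in> weyl_space n k 1"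
  shows "dinv (rho_rhs a) - dinv (rho_rhs b) \<in> weyl_space n (Suc k) 1"
proof -
  have "rho_rhs a - rho_rhs b = Dop (a - b) + weyl_divide_t ((a - b) \<bullet> a + b \<bullet> (a - b))"
    unfolding rho_rhs_def lin_diff[OF lin_Dop] circ_diff_left circ_diff_right divide_t.add divide_t.diff
    by (simp only: algebra_simps)
  moreover have "(a - b) \<bullet> a + b \<bullet> (a - b) \<in> weyl_space n (k + 2) (1 + 1)"
    using weyl_space_circ[OF ab a] weyl_space_circ[OF b ab] by (intro weyl_space_add) (simp_all add: add.commute)
  then have "weyl_divide_t ((a - b) \<bullet> a + b \<bullet> (a - b)) \<in> weyl_space n k (Suc 1)"
    using weyl_space_divide by fastforce
  ultimately have "rho_rhs a - rho_rhs b \<in> weyl_space n k (Suc 1)"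
    using weyl_space_Dop[OF ab] by (simp only: weyl_space_add)
  then show ?thesis unfolding lin_diff[OF lin_dinv, symmetric] by (rule weyl_space_dinv)
qed

text \<open>A fixed point of \<open>dinv\<close> after \<open>rho_rhs\<close> solves the equation
  only up to a defect \<open>b\<close> with \<open>dinv b = 0\<close>. The Bianchi identities give a
  homogeneous linear equation for \<open>b\<close>, which forces it into every filtration
  step.\<close>

lemma rho_ex1:
  assumes comm: "\<And>x y :: 'v. x * y = y * x"
  shows "\<exists>!\<rho>. \<rho> \<in> weyl_space n 2 1 \<and> fedosov_eq \<rho> \<and> dinv \<rho> = 0"
proof -
  have central: "f * g = g * f" for f g :: "'v fps"
  proof (rule fps_ext)
    fix m
    have "(f * g) $ m = (\<Sum>i=0..m. g $ (m - i) * f $ i)" unfolding fps_mult_nth by (simp only: comm)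
    also have "\<dots> = (g * f) $ m"
      unfolding fps_mult_nth by (rule sum.reindex_bij_witness[of _ "\<lambda>i. m - i" "\<lambda>i. m - i"]) auto
    finally show "(f * g) $ m = (g * f) $ m" .
  qed
  have maps: "dinv (rho_rhs a) \<in> weyl_space n 2 1" if "a \<in> weyl_space n 2 1" for a
    using weyl_space_dinv[of "rho_rhs a" 2 1] weyl_space_rho_rhs[OF that] weyl_space_mono[of _ n 3 1 2]
    by (simp add: numeral_eq_Suc)
  obtain \<rho> where \<rho>: "\<rho> \<in> weyl_space n 2 1" and fix_\<rho>: "dinv (rho_rhs \<rho>) = \<rho>"
    by (rule contraction_fixpoint[where \<Phi> = "\<lambda>a. dinv (rho_rhs a)", OF maps rho_contraction])
  have dinv_\<rho>: "dinv \<rho> = 0"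
    by (subst fix_\<rho>[symmetric]) (rule dinv_dinv[OF weyl_space_rho_rhs[OF \<rho>]])
  define b where "b = del \<rho> - rho_rhs \<rho>"
  have del_\<rho>: "del \<rho> = b + rho_rhs \<rho>" unfolding b_def by (simp only: diff_add_cancel)
  have g: "gam \<rho> = - \<rho>" using gam_weyl_space[OF \<rho>] by simp
  have \<rho>\<rho>0: "(\<rho> \<bullet> \<rho>) M J $ 0 = 0" for M J using \<rho> central by (rule circ_self_nth_0)
  have b: "b \<in> weyl_space n 1 2"
    unfolding b_def using weyl_space_del[OF \<rho>] weyl_space_mono[OF weyl_space_rho_rhs[OF \<rho>], of 1]
    by (intro weyl_space_diff) (simp_all add: numeral_2_eq_2)
  have dinv_b: "dinv b = 0"
  proof -
    have "dinv (del \<rho>) = \<rho>"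
      using homotopy_pos[of \<rho> 2 0] \<rho> unfolding dinv_\<rho> lin_zero[OF lin_del] by simp
    then show ?thesis unfolding b_def lin_diff[OF lin_dinv] fix_\<rho> by (simp only: diff_self)
  qed
  define X where "X = rho_rhs \<rho>"
  \<comment> \<open>\<open>Dop (Dop \<rho>)\<close> is the commutator with \<open>curv\<close> and
    cancels the one from \<open>X\<close>; the terms with \<open>Dop \<rho>\<close> cancel in pairs,
    and the cubic terms cancel by associativity.\<close>
  have "Dop X + weyl_divide_t (\<rho> \<bullet> X - X \<bullet> \<rho>) = 0"
  proof -
    have DX: "Dop X = weyl_divide_t (curv \<bullet> \<rho> - \<rho> \<bullet> curv) + weyl_divide_t (Dop \<rho> \<bullet> \<rho> - \<rho> \<bullet> Dop \<rho>)"
      unfolding X_def rho_rhs_def lin_add[OF lin_Dop] Dop_curv Dop_Om lin_divide_t[OF lin_Dop] Dop_circ g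
        curv_commutator[OF \<rho>] divide_tpow circ_minus_left
      by (simp only: add_0_left add_0_right diff_conv_add_uminus)
    have "\<rho> \<bullet> weyl_divide_t (\<rho> \<bullet> \<rho>) = weyl_divide_t (\<rho> \<bullet> \<rho>) \<bullet> \<rho>"
      unfolding circ_divide_left[OF \<rho>\<rho>0] circ_divide_right[OF \<rho>\<rho>0] circ_assoc ..
    then have XX: "\<rho> \<bullet> X - X \<bullet> \<rho> = (\<rho> \<bullet> curv - curv \<bullet> \<rho>) + (\<rho> \<bullet> Dop \<rho> - Dop \<rho> \<bullet> \<rho>)"
      unfolding X_def rho_rhs_def circ_add_left circ_add_right Om_comm[OF \<rho>] by (simp only: algebra_simps)
    show ?thesis unfolding DX XX divide_t.add divide_t.diff by (simp only: algebra_simps add_0_left)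
  qed
  note X = this
  have "del b = Dop b + weyl_divide_t (\<rho> \<bullet> b - b \<bullet> \<rho>)"
  proof -
    have "del b = Dop (del \<rho>) - weyl_divide_t (del \<rho> \<bullet> \<rho> - \<rho> \<bullet> del \<rho>)"
      unfolding b_def rho_rhs_def lin_diff[OF lin_del] lin_add[OF lin_del] del_del del_curv del_Om del_Dop
        lin_divide_t[OF lin_del] del_circ g circ_minus_left
      by (simp only: diff_conv_add_uminus add_0_left add_0_right minus_add minus_minus minus_zero)
        (simp only: add.commute)
    also have "\<dots> = (Dop b + weyl_divide_t (\<rho> \<bullet> b - b \<bullet> \<rho>)) + (Dop X + weyl_divide_t (\<rho> \<bullet> X - X \<bullet> \<rho>))"
      unfolding del_\<rho> X_def lin_add[OF lin_Dop] circ_add_left circ_add_right divide_t.add divide_t.diff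
      by (simp only: algebra_simps)
    finally show ?thesis unfolding X by (simp only: add_0_right)
  qed
  note del_b = this
  \<comment> \<open>Since \<open>dinv b = 0\<close>, the homotopy gives
    \<open>b = dinv (del b)\<close>. Inserting \<open>del_b\<close> raises the known degree of
    \<open>b\<close> by one.\<close>
  have "b \<in> weyl_space n k 2" for k
  proof (induction k)
    case 0
    show ?case using b by (rule weyl_space_mono) simp
  next
    case (Suc k)
    have "\<rho> \<bullet> b - b \<bullet> \<rho> \<in> weyl_space n (k + 2) (Suc 2)"
      using weyl_space_circ[OF \<rho> Suc] weyl_space_circ[OF Suc \<rho>] by (intro weyl_space_diff) (simp_all add: add.commute numeral_eq_Suc)
    then have "weyl_divide_t (\<rho> \<bullet> b - b \<bullet> \<rho>) \<in> weyl_space n k (Suc 2)"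
      using weyl_space_divide by fastforce
    then have "del b \<in> weyl_space n k (Suc 2)"
      unfolding del_b by (intro weyl_space_add weyl_space_Dop Suc)
    then have "dinv (del b) \<in> weyl_space n (Suc k) 2" by (rule weyl_space_dinv)
    moreover have "dinv (del b) = b"
      using homotopy_pos[of b 1 1] b unfolding dinv_b lin_zero[OF lin_del] by (simp add: numeral_2_eq_2)
    ultimately show ?case by (simp only:)
  qed
  then have "b = 0" by (rule weyl_space_Inter)
  then have "fedosov_eq \<rho>"
    unfolding fedosov_eq_def using del_\<rho> unfolding rho_rhs_def by (simp only: add_0_left)
  show ?thesis
  proof (rule ex1I[of _ \<rho>])
    show "\<rho> \<in> weyl_space n 2 1 \<and> fedosov_eq \<rho> \<and> dinv \<rho> = 0"
      using \<rho> \<open>fedosov_eq \<rho>\<close> dinv_\<rho> by blast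
    fix \<rho>' assume *: "\<rho>' \<in> weyl_space n 2 1 \<and> fedosov_eq \<rho>' \<and> dinv \<rho>' = 0"
    then have \<rho>': "\<rho>' \<in> weyl_space n 2 1" "dinv \<rho>' = 0" "del \<rho>' = rho_rhs \<rho>'"
      by (simp_all only: fedosov_eq_def rho_rhs_def)
    have "dinv (rho_rhs \<rho>') = \<rho>'"
      using homotopy_pos[of \<rho>' 2 0] \<rho>'(1) unfolding \<rho>'(2,3) lin_zero[OF lin_del] by simp
    then show "\<rho>' = \<rho>"
      using contraction_fixpoint_unique[where \<Phi> = "\<lambda>a. dinv (rho_rhs a)", OF rho_contraction \<rho>'(1) _ \<rho> fix_\<rho>] by blast
  qed
qed

end

locale fedosov_solution = fedosov_form sc n \<pi> C \<Gamma> act r s w Q P Om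
  for sc :: "'r::ring_containing_rat \<Rightarrow> 'v::ring_1 \<Rightarrow> 'v" and n \<pi> C \<Gamma> act r s w Q P Om +
  fixes \<rho> :: "'v weyl"
  assumes \<rho>: "\<rho> \<in> weyl_space n 2 1"
    and \<rho>_eq: "fedosov_eq \<rho>"
    and \<rho>_central: "\<rho> M J * f = f * \<rho> M J"
begin

text \<open>The graded commutator with the odd element \<rho>; the sign is put into
  \<open>gam\<close>, so no decomposition into degrees is needed.\<close>

definition ad\<rho> :: "'v weyl \<Rightarrow> 'v weyl" where
  "ad\<rho> a = \<rho> \<bullet> a - gam a \<bullet> \<rho>"

definition op :: "'v weyl \<Rightarrow> 'v weyl" where
  "op a = Dop a + weyl_divide_t (ad\<rho> a)"

definition FD :: "'v weyl \<Rightarrow> 'v weyl" where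
  "FD a = op a - del a"

lemma gam_\<rho>: "gam \<rho> = - \<rho>"
  using gam_weyl_space[OF \<rho>] by simp

lemma \<rho>\<rho>_nth_0: "(\<rho> \<bullet> \<rho>) M J $ 0 = 0"
  using \<rho> \<rho>_central by (rule circ_self_nth_0)

text \<open>At \<open>t = 0\<close> the product is graded commutative against central coefficients,
  so every commutator with \<rho> is divisible by \<open>t\<close>.\<close>

lemma ad\<rho>_nth_0: "ad\<rho> a M J $ 0 = 0"
  using mu_swap[OF \<rho> \<rho>_central, of a] by (simp add: ad\<rho>_def circ_nth_0)

lemma ad\<rho>_add: "ad\<rho> (a + b) = ad\<rho> a + ad\<rho> b"
  unfolding ad\<rho>_def gam.add circ_add_left circ_add_right by (simp only: algebra_simps)

lemma op_add: "op (a + b) = op a + op b"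
  unfolding op_def ad\<rho>_add divide_t.add lin_add[OF lin_Dop] by (simp only: algebra_simps)

sublocale op: additive op by unfold_locales (rule op_add)

lemma FD_add: "FD (a + b) = FD a + FD b"
  unfolding FD_def op_add lin_add[OF lin_del] by (simp only: algebra_simps)

sublocale FD: additive FD by unfold_locales (rule FD_add)

lemma divide_tpow_commute:
  assumes "\<And>M J. a M J $ 0 = 0"
  shows "weyl_divide_t (tpow k a) = tpow k (weyl_divide_t (a :: 'v weyl))"
proof -
  have "tpow k a = tpow 1 (tpow k (weyl_divide_t a))"
    unfolding tpow_tpow add.commute[of 1] by (simp only: tpow_tpow[symmetric] tpow_divide[OF assms])
  then show ?thesis by (simp only: divide_tpow)
qed

lemma gam_tpow: "gam (tpow k a) = tpow k (gam (a :: 'v weyl))"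
  by (rule lin_tpow[OF lin_gam])

lemma FD_tpow: "FD (tpow k a) = tpow k (FD a)"
proof -
  have "ad\<rho> (tpow k a) = tpow k (ad\<rho> a)"
    unfolding ad\<rho>_def gam_tpow circ_tpow_left circ_tpow_right tpow.diff ..
  then show ?thesis
    unfolding FD_def op_def lin_tpow[OF lin_Dop] lin_tpow[OF lin_del] tpow.diff tpow.add
      divide_tpow_commute[OF ad\<rho>_nth_0, symmetric] by (simp only:)
qed

lemma weyl_space_op: "a \<in> weyl_space n k l \<Longrightarrow> op a \<in> weyl_space n k (Suc l)"
proof -
  assume a: "a \<in> weyl_space n k l"
  have ga: "gam a \<in> weyl_space n k l"
    using a unfolding gam_weyl_space[OF a] by (simp add: weyl_space_minus)
  have "ad\<rho> a \<in> weyl_space n (k + 2) (Suc l)"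
    unfolding ad\<rho>_def using weyl_space_circ[OF \<rho> a] weyl_space_circ[OF ga \<rho>]
    by (intro weyl_space_diff) (simp_all add: add.commute)
  then have "weyl_divide_t (ad\<rho> a) \<in> weyl_space n k (Suc l)"
    using weyl_space_divide by fastforce
  then show ?thesis unfolding op_def by (intro weyl_space_add weyl_space_Dop a)
qed

text \<open>The square is \<open>1/t\<close> times the commutator with \<open>curv + Dop \<rho> +
  weyl_divide_t (\<rho> \<bullet> \<rho>) - del \<rho>\<close>. By the equation for \<rho> this
  element is \<open>- Om\<close>, which commutes with everything in question.\<close>

lemma FD_FD:
  assumes a: "a \<in> weyl_space n k 0"
  shows "FD (FD a) = 0"
proof -
  have ga: "gam a = a" using gam_weyl_space[OF a] by simp
  have gD: "gam (Dop a) = - Dop a" using gam_weyl_space[OF weyl_space_Dop[OF a]] by simp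
  have gd: "gam (del a) = - del a" using gam_weyl_space[OF weyl_space_del[OF a]] by simp
  let ?y = "weyl_divide_t (ad\<rho> a)"
  have "?y = op a - Dop a" unfolding op_def by (simp only: add_diff_cancel_left')
  then have "?y \<in> weyl_space n k (Suc 0)"
    using weyl_space_op[OF a] weyl_space_Dop[OF a] by (simp only: weyl_space_diff)
  then have gy: "gam ?y = - ?y" using gam_weyl_space by fastforce
  have ada: "ad\<rho> a = \<rho> \<bullet> a - a \<bullet> \<rho>" unfolding ad\<rho>_def ga ..
  have e1: "Dop (ad\<rho> a) + ad\<rho> (Dop a) = Dop \<rho> \<bullet> a - a \<bullet> Dop \<rho>"
    unfolding ada unfolding ad\<rho>_def gD lin_diff[OF lin_Dop] Dop_circ gam_\<rho> ga circ_minus_left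
    by (rule antiderivation_cancel)
  have e2: "del (ad\<rho> a) + ad\<rho> (del a) = del \<rho> \<bullet> a - a \<bullet> del \<rho>"
    unfolding ada unfolding ad\<rho>_def gd lin_diff[OF lin_del] del_circ gam_\<rho> ga circ_minus_left
    by (rule antiderivation_cancel)
  have e3: "ad\<rho> ?y = weyl_divide_t (\<rho> \<bullet> \<rho>) \<bullet> a - a \<bullet> weyl_divide_t (\<rho> \<bullet> \<rho>)"
  proof -
    have "ad\<rho> ?y = weyl_divide_t (\<rho> \<bullet> ad\<rho> a + ad\<rho> a \<bullet> \<rho>)"
      unfolding ad\<rho>_def[of ?y] gy circ_minus_left circ_divide_left[OF ad\<rho>_nth_0] circ_divide_right[OF ad\<rho>_nth_0]
        divide_t.add by (simp only: diff_minus_eq_add)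
    also have "\<rho> \<bullet> ad\<rho> a + ad\<rho> a \<bullet> \<rho> = (\<rho> \<bullet> \<rho>) \<bullet> a - a \<bullet> (\<rho> \<bullet> \<rho>)"
      unfolding ada circ_diff_left circ_diff_right circ_assoc by (simp only: algebra_simps)
    finally show ?thesis
      unfolding circ_divide_left[OF \<rho>\<rho>_nth_0] circ_divide_right[OF \<rho>\<rho>_nth_0] divide_t.diff .
  qed
  have "FD (FD a) = Dop (Dop a) + weyl_divide_t (Dop (ad\<rho> a) + ad\<rho> (Dop a)) + weyl_divide_t (ad\<rho> ?y)
    - weyl_divide_t (del (ad\<rho> a) + ad\<rho> (del a)) - (Dop (del a) + del (Dop a)) + del (del a)"
    unfolding FD_def op.diff lin_diff[OF lin_del]
    unfolding op_def lin_add[OF lin_Dop] lin_add[OF lin_del] ad\<rho>_add divide_t.add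
      lin_divide_t[OF lin_Dop] lin_divide_t[OF lin_del]
    by (simp only: algebra_simps)
  also have "\<dots> = weyl_divide_t ((curv \<bullet> a - a \<bullet> curv) + (Dop \<rho> \<bullet> a - a \<bullet> Dop \<rho>) +
     (weyl_divide_t (\<rho> \<bullet> \<rho>) \<bullet> a - a \<bullet> weyl_divide_t (\<rho> \<bullet> \<rho>)) - (del \<rho> \<bullet> a - a \<bullet> del \<rho>))"
    unfolding e1 e2 e3 del_del del_Dop curv_commutator[OF a] divide_t.diff[of "_ + _"] divide_t.add divide_tpow
    by (simp only: add.right_inverse diff_0_right add_0_right)
  also have "(curv \<bullet> a - a \<bullet> curv) + (Dop \<rho> \<bullet> a - a \<bullet> Dop \<rho>) +
     (weyl_divide_t (\<rho> \<bullet> \<rho>) \<bullet> a - a \<bullet> weyl_divide_t (\<rho> \<bullet> \<rho>)) - (del \<rho> \<bullet> a - a \<bullet> del \<rho>) = 0"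
    unfolding \<rho>_eq[unfolded fedosov_eq_def] circ_add_left circ_add_right Om_comm[OF a]
    by (simp only: algebra_simps add_0_left)
  finally show ?thesis unfolding divide_t.zero .
qed

lemma FD_circ:
  assumes a: "a \<in> weyl_space n k 0" and b: "b \<in> weyl_space n l 0"
  shows "FD (a \<bullet> b) = FD a \<bullet> b + a \<bullet> FD b"
proof -
  have g: "gam a = a" "gam b = b" using gam_weyl_space[OF a] gam_weyl_space[OF b] by simp_all
  have "ad\<rho> (a \<bullet> b) = ad\<rho> a \<bullet> b + a \<bullet> ad\<rho> b"
    unfolding ad\<rho>_def gam_circ g circ_diff_left circ_diff_right circ_assoc by (simp only: algebra_simps)
  then have "weyl_divide_t (ad\<rho> (a \<bullet> b)) = weyl_divide_t (ad\<rho> a) \<bullet> b + a \<bullet> weyl_divide_t (ad\<rho> b)"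
    unfolding circ_divide_left[OF ad\<rho>_nth_0] circ_divide_right[OF ad\<rho>_nth_0] divide_t.add[symmetric] by (simp only:)
  then show ?thesis
    unfolding FD_def op_def Dop_circ del_circ g circ_add_left circ_add_right circ_diff_left circ_diff_right
    by (simp only: algebra_simps)
qed

text \<open>In antisymmetric degree 0 \<open>dinv\<close> vanishes, so one half of the
  anticommutator in the definition of \<tau> drops out; see \<open>tau_iterate_eq\<close>.\<close>

definition tau_step :: "'v weyl \<Rightarrow> 'v weyl" where
  "tau_step a = dinv (op a)"

lemma tau_step_add: "tau_step (a + b) = tau_step a + tau_step b"
  unfolding tau_step_def op_add lin_add[OF lin_dinv] ..

sublocale tau_step: additive tau_step by unfold_locales (rule tau_step_add)

lemma weyl_space_tau_step: "a \<in> weyl_space n k l \<Longrightarrow> tau_step a \<in> weyl_space n (Suc k) l"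
  unfolding tau_step_def by (intro weyl_space_dinv weyl_space_op)

lemma proj_embed [simp]: "weyl_proj (weyl_embed \<xi>) = \<xi>"
  by (simp add: weyl_proj_def weyl_embed_def)

lemma proj_add: "weyl_proj (a + b) = weyl_proj a + weyl_proj (b :: 'v weyl)"
  by (simp add: weyl_proj_def)

lemma proj_tau_step: "weyl_proj (tau_step a) = 0"
  unfolding weyl_proj_def tau_step_def dinv_empty by simp

lemma flat_imp_fixpoint:
  assumes a: "a \<in> weyl_space n k 0" and flat: "FD a = 0"
  shows "a = weyl_embed (weyl_proj a) + tau_step a"
proof -
  have "op a = del a" using flat unfolding FD_def by (simp only: right_minus_eq)
  then have "tau_step a = a - weyl_embed (weyl_proj a)"
    using homotopy[OF a] unfolding tau_step_def dinv_weyl_space_0[OF a] lin_zero[OF lin_del] add_0_left by (simp only:)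
  then show ?thesis by (simp only: add_diff_cancel_left' add_diff_eq)
qed

text \<open>The defect \<open>b = FD a\<close> satisfies \<open>FD b = 0\<close> and
  \<open>dinv b = 0\<close>. By the homotopy it is a fixed point of \<open>tau_step\<close>, which
  raises the degree, so it is 0.\<close>

lemma fixpoint_imp_flat:
  assumes a: "a \<in> weyl_space n 0 0" and fixp: "a = weyl_embed \<xi> + tau_step a"
  shows "FD a = 0" "weyl_proj a = \<xi>"
proof -
  show proj: "weyl_proj a = \<xi>"
    by (subst fixp) (simp only: proj_add proj_embed proj_tau_step add_0_right)
  define b where "b = FD a"
  have b: "b \<in> weyl_space n 0 (Suc 0)"
    unfolding b_def FD_def using weyl_space_op[OF a] weyl_space_del[OF a] by (simp add: weyl_space_diff)
  have "dinv (del a) = tau_step a"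
  proof -
    have "dinv (del a) = a - weyl_embed \<xi>"
      using homotopy[OF a] unfolding dinv_weyl_space_0[OF a] lin_zero[OF lin_del] add_0_left proj .
    also have "\<dots> = tau_step a" by (subst (1) fixp) (simp only: add_diff_cancel_left')
    finally show ?thesis .
  qed
  then have dinv_b: "dinv b = 0"
    unfolding b_def FD_def lin_diff[OF lin_dinv] tau_step_def by (simp only: diff_self)
  have "FD b = 0" unfolding b_def by (rule FD_FD[OF a])
  then have "op b = del b" unfolding FD_def by (simp only: right_minus_eq)
  then have fixb: "b = tau_step b"
    using homotopy_pos[OF b] unfolding dinv_b lin_zero[OF lin_del] add_0_left tau_step_def by (simp only:)
  have "b \<in> weyl_space n k (Suc 0)" for k
  proof (induction k)
    case (Suc k)
    show ?case by (subst fixb) (rule weyl_space_tau_step[OF Suc])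
  qed (rule b)
  then have "b = 0" by (rule weyl_space_Inter)
  then show "FD a = 0" unfolding b_def .
qed

lemma flat_unique:
  assumes a: "a \<in> weyl_space n 0 0" "FD a = 0" and b: "b \<in> weyl_space n 0 0" "FD b = 0"
    and proj: "weyl_proj a = weyl_proj b"
  shows "a = b"
proof -
  have "a - b \<in> weyl_space n k 0" for k
  proof (induction k)
    case (Suc k)
    have "a - b = tau_step (a - b)"
      unfolding tau_step.diff
      by (subst flat_imp_fixpoint[OF a], subst flat_imp_fixpoint[OF b]) (simp only: proj add_diff_cancel_left)
    then show ?case using weyl_space_tau_step[OF Suc] by (simp only:)
  qed (intro weyl_space_diff a b)
  then have "a - b = 0" by (rule weyl_space_Inter)
  then show ?thesis by (simp only: right_minus_eq)
qed

lemma tau_step_power_space: "(tau_step ^^ k) (weyl_embed \<xi>) \<in> weyl_space n k 0"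
proof (induction k)
  case 0
  show ?case unfolding funpow_0 by (rule weyl_space_embed)
next
  case (Suc k)
  show ?case unfolding funpow.simps comp_def by (rule weyl_space_tau_step[OF Suc])
qed

text \<open>The iterate with index \<open>k\<close> has total degree at least \<open>k\<close>, so
  cutting the sum at \<open>size M + 2 * m\<close> loses nothing.\<close>

definition tau :: "'v fps \<Rightarrow> 'v weyl" where
  "tau \<xi> = (\<lambda>M J. Abs_fps (\<lambda>m. \<Sum>k\<le>size M + 2 * m. (tau_step ^^ k) (weyl_embed \<xi>) M J $ m))"

lemma tau_step_power_nth:
  assumes "size M + 2 * m < k" shows "(tau_step ^^ k) (weyl_embed \<xi>) M J $ m = 0"
  using weyl_spaceD(4)[OF tau_step_power_space, of k \<xi> M J m] assms by fastforce

lemma tau_approx: "tau \<xi> - (\<Sum>k\<le>N. (tau_step ^^ k) (weyl_embed \<xi>)) \<in> weyl_space n (Suc N) 0"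
proof (rule weyl_spaceI)
  fix M J m
  let ?s = "\<lambda>k. (tau_step ^^ k) (weyl_embed \<xi>)"
  assume nz: "(tau \<xi> - (\<Sum>k\<le>N. ?s k)) M J $ m \<noteq> 0"
  have eq: "(tau \<xi> - (\<Sum>k\<le>N. ?s k)) M J $ m = (\<Sum>k\<le>size M + 2 * m. ?s k M J $ m) - (\<Sum>k\<le>N. ?s k M J $ m)"
    by (simp add: tau_def fun_additive_sum fps_sum_nth)
  have "\<exists>k. ?s k M J $ m \<noteq> 0"
  proof (rule ccontr)
    assume "\<nexists>k. ?s k M J $ m \<noteq> 0"
    then have "?s k M J $ m = 0" for k by blast
    with nz eq show False by simp
  qed
  then obtain k where k: "?s k M J $ m \<noteq> 0" ..
  have "Suc N \<le> size M + 2 * m"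
  proof (rule ccontr)
    assume "\<not> Suc N \<le> size M + 2 * m"
    then have "(\<Sum>k\<le>N. ?s k M J $ m) = (\<Sum>k\<le>size M + 2 * m. ?s k M J $ m)"
      by (intro sum.mono_neutral_right) (auto intro: tau_step_power_nth)
    with nz eq show False by simp
  qed
  then show "set_mset M \<subseteq> {..<n} \<and> J \<subseteq> {..<n} \<and> card J = 0 \<and> Suc N \<le> size M + 2 * m"
    using weyl_spaceD[OF tau_step_power_space k] by blast
qed

lemma weyl_space_tau: "tau \<xi> \<in> weyl_space n 0 0"
proof -
  have "(\<Sum>k\<le>0. (tau_step ^^ k) (weyl_embed \<xi>)) = weyl_embed \<xi>" by simp
  moreover have "tau \<xi> - (\<Sum>k\<le>0. (tau_step ^^ k) (weyl_embed \<xi>)) \<in> weyl_space n 0 0"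
    by (rule weyl_space_mono[OF tau_approx]) simp
  ultimately have "tau \<xi> - weyl_embed \<xi> \<in> weyl_space n 0 0" by (simp only:)
  from weyl_space_add[OF this weyl_space_embed[of \<xi>]] show ?thesis by (simp only: diff_add_cancel)
qed

lemma tau_fixpoint: "tau \<xi> = weyl_embed \<xi> + tau_step (tau \<xi>)"
proof -
  let ?S = "\<lambda>N. \<Sum>k\<le>N. (tau_step ^^ k) (weyl_embed \<xi>)"
  have S: "?S (Suc N) = weyl_embed \<xi> + tau_step (?S N)" for N
    by (simp only: sum.atMost_Suc_shift tau_step.sum funpow.simps comp_def id_apply)
  have "tau \<xi> - (weyl_embed \<xi> + tau_step (tau \<xi>)) \<in> weyl_space n k 0" for k
  proof -
    have "(tau \<xi> - ?S (Suc k)) - tau_step (tau \<xi> - ?S k) \<in> weyl_space n (Suc (Suc k)) 0"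
      by (intro weyl_space_diff tau_approx weyl_space_tau_step)
    moreover have "(tau \<xi> - ?S (Suc k)) - tau_step (tau \<xi> - ?S k) = tau \<xi> - (weyl_embed \<xi> + tau_step (tau \<xi>))"
      unfolding S tau_step.diff by (simp only: algebra_simps)
    ultimately have "tau \<xi> - (weyl_embed \<xi> + tau_step (tau \<xi>)) \<in> weyl_space n (Suc (Suc k)) 0" by (simp only:)
    then show ?thesis by (rule weyl_space_mono) simp
  qed
  then have "tau \<xi> - (weyl_embed \<xi> + tau_step (tau \<xi>)) = 0" by (rule weyl_space_Inter)
  then show ?thesis by (simp only: right_minus_eq)
qed

lemma FD_tau: "FD (tau \<xi>) = 0" and proj_tau: "weyl_proj (tau \<xi>) = \<xi>"
  using fixpoint_imp_flat[OF weyl_space_tau tau_fixpoint] by auto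

lemma tau_unique: "a \<in> weyl_space n 0 0 \<Longrightarrow> FD a = 0 \<Longrightarrow> a = tau (weyl_proj a)"
  by (rule flat_unique[OF _ _ weyl_space_tau FD_tau]) (simp_all only: proj_tau)

lemma tau_add: "tau (\<xi> + \<eta>) = tau \<xi> + tau \<eta>"
proof -
  have "tau \<xi> + tau \<eta> = tau (weyl_proj (tau \<xi> + tau \<eta>))"
    by (rule tau_unique) (simp_all only: weyl_space_add weyl_space_tau FD_add FD_tau add_0_left)
  then show ?thesis unfolding proj_add proj_tau by (rule sym)
qed

lemma weyl_space_tpow: "a \<in> weyl_space n k l \<Longrightarrow> tpow m a \<in> weyl_space n k l" for a :: "'v weyl"
  by (rule weyl_spaceI) (auto simp: tpow_nth dest: weyl_spaceD split: if_splits)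

lemma proj_tpow: "weyl_proj (tpow k a) = fps_X ^ k * weyl_proj (a :: 'v weyl)"
  by (simp add: weyl_proj_def tpow_def)

lemma tau_power: "tau (fps_X ^ k * \<xi>) = tpow k (tau \<xi>)"
proof -
  have "tpow k (tau \<xi>) = tau (weyl_proj (tpow k (tau \<xi>)))"
    by (rule tau_unique) (simp_all only: weyl_space_tpow weyl_space_tau FD_tpow FD_tau tpow.zero)
  then show ?thesis unfolding proj_tpow proj_tau by (rule sym)
qed

section \<open>The star product and its first two coefficients\<close>

definition star :: "'v fps \<Rightarrow> 'v fps \<Rightarrow> 'v fps" where
  "star \<xi> \<eta> = weyl_proj (tau \<xi> \<bullet> tau \<eta>)"

lemma tau_star: "tau (star \<xi> \<eta>) = tau \<xi> \<bullet> tau \<eta>"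
proof -
  have "tau \<xi> \<bullet> tau \<eta> = tau (weyl_proj (tau \<xi> \<bullet> tau \<eta>))"
  proof (rule tau_unique)
    show "tau \<xi> \<bullet> tau \<eta> \<in> weyl_space n 0 0"
      using weyl_space_circ[OF weyl_space_tau weyl_space_tau] by simp
    show "FD (tau \<xi> \<bullet> tau \<eta>) = 0"
      unfolding FD_circ[OF weyl_space_tau weyl_space_tau] FD_tau circ_zero_left circ_zero_right by (rule add_0_left)
  qed
  then show ?thesis unfolding star_def by (rule sym)
qed

theorem star_assoc: "star (star \<xi> \<eta>) \<zeta> = star \<xi> (star \<eta> \<zeta>)"
  unfolding star_def[of "star \<xi> \<eta>"] star_def[of \<xi> "star \<eta> \<zeta>"] tau_star circ_assoc ..

lemma star_add_left: "star (\<xi> + \<xi>') \<eta> = star \<xi> \<eta> + star \<xi>' \<eta>"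
  and star_add_right: "star \<xi> (\<eta> + \<eta>') = star \<xi> \<eta> + star \<xi> \<eta>'"
  by (simp_all only: star_def tau_add circ_add_left circ_add_right proj_add)

lemma star_power_left: "star (fps_X ^ k * \<xi>) \<eta> = fps_X ^ k * star \<xi> \<eta>"
  and star_power_right: "star \<xi> (fps_X ^ k * \<eta>) = fps_X ^ k * star \<xi> \<eta>"
  by (simp_all only: star_def tau_power circ_tpow_left circ_tpow_right proj_tpow)

lemma star_nth:
  "star \<xi> \<eta> $ m = (\<Sum>i\<le>m. star (fps_const (\<xi> $ i)) \<eta> $ (m - i))"
  "star \<xi> \<eta> $ m = (\<Sum>i\<le>m. star \<xi> (fps_const (\<eta> $ i)) $ (m - i))"
proof -
  have trunc: "f = (\<Sum>i\<le>m. fps_X ^ i * fps_const (f $ i)) + fps_X ^ Suc m * fps_shift (Suc m) f" for f :: "'v fps"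
  proof (rule fps_ext)
    fix k
    have "(\<Sum>i\<le>m. (fps_X ^ i * fps_const (f $ i)) $ k) = (\<Sum>i\<le>m. if i = k then f $ k else 0)"
      by (intro sum.cong refl) (auto simp: fps_X_power_mult_nth)
    then show "f $ k = ((\<Sum>i\<le>m. fps_X ^ i * fps_const (f $ i)) + fps_X ^ Suc m * fps_shift (Suc m) f) $ k"
      by (auto simp add: fps_sum_nth fps_X_power_mult_nth simp del: power_Suc)
  qed
  have l: "additive (\<lambda>\<xi>. star \<xi> \<eta>)" and r: "additive (star \<xi>)"
    by (simp_all add: additive_def star_add_left star_add_right)
  have "star \<xi> \<eta> = (\<Sum>i\<le>m. fps_X ^ i * star (fps_const (\<xi> $ i)) \<eta>) + fps_X ^ Suc m * star (fps_shift (Suc m) \<xi>) \<eta>"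
    by (subst trunc[of \<xi>]) (simp only: star_add_left additive.sum[OF l] star_power_left)
  then show "star \<xi> \<eta> $ m = (\<Sum>i\<le>m. star (fps_const (\<xi> $ i)) \<eta> $ (m - i))"
    by (simp add: fps_sum_nth fps_X_power_mult_nth del: power_Suc)
  have "star \<xi> \<eta> = (\<Sum>i\<le>m. fps_X ^ i * star \<xi> (fps_const (\<eta> $ i))) + fps_X ^ Suc m * star \<xi> (fps_shift (Suc m) \<eta>)"
    by (subst trunc[of \<eta>]) (simp only: star_add_right additive.sum[OF r] star_power_right)
  then show "star \<xi> \<eta> $ m = (\<Sum>i\<le>m. star \<xi> (fps_const (\<eta> $ i)) $ (m - i))"
    by (simp add: fps_sum_nth fps_X_power_mult_nth del: power_Suc)
qed

lemma ad\<rho>_embed: "ad\<rho> (weyl_embed \<xi>) = 0"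
proof -
  have g: "gam (weyl_embed \<xi>) = weyl_embed \<xi>" using gam_weyl_space[OF weyl_space_embed] by simp
  have "\<rho> \<bullet> weyl_embed \<xi> = mu \<rho> (weyl_embed \<xi>)" "weyl_embed \<xi> \<bullet> \<rho> = mu (weyl_embed \<xi>) \<rho>"
    by (rule circ_const_right, rule sym_ins_embed, rule circ_const_left, rule sym_ins_embed)
  moreover have "mu \<rho> (weyl_embed \<xi>) = mu (weyl_embed \<xi>) \<rho>"
    using mu_swap[OF \<rho> \<rho>_central, of "weyl_embed \<xi>"] g by simp
  ultimately show ?thesis unfolding ad\<rho>_def g by (simp only: diff_self)
qed

text \<open>In total degree 1 a single step of the recursion is visible, and \<open>ad\<rho>\<close>
  vanishes on \<open>weyl_embed \<xi>\<close>, so only the action on coefficients is left.\<close>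

lemma tau_first_order:
  assumes i: "i < n"
  shows "tau \<xi> {#i#} {} $ 0 = act i (\<xi> $ 0)"
proof -
  have "op (tau \<xi>) = op (weyl_embed \<xi>) + op (tau_step (tau \<xi>))"
    by (subst tau_fixpoint) (rule op_add)
  moreover have "op (tau_step (tau \<xi>)) {#} {i} $ 0 = 0"
    using weyl_spaceD(4)[OF weyl_space_op[OF weyl_space_tau_step[OF weyl_space_tau]], of \<xi> "{#}" "{i}" 0]
    by fastforce
  moreover have "op (weyl_embed \<xi>) = (\<Sum>j<n. alt_mul j (weyl_embed (fps_map (act j) \<xi>)))"
    unfolding op_def Dop_embed ad\<rho>_embed divide_t.zero by (simp only: add_0_right)
  ultimately have "op (tau \<xi>) {#} {i} $ 0 = (\<Sum>j<n. alt_mul j (weyl_embed (fps_map (act j) \<xi>)) {#} {i} $ 0)"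
    by (simp add: fun_additive_sum fps_sum_nth)
  also have "\<dots> = (\<Sum>j<n. if j = i then act i (\<xi> $ 0) else 0)"
    by (intro sum.cong refl) (simp add: alt_mul_apply weyl_embed_def below_self fps_map_def)
  also have "\<dots> = act i (\<xi> $ 0)" using i by simp
  finally have op: "op (tau \<xi>) {#} {i} $ 0 = act i (\<xi> $ 0)" .
  have "koszul (op (tau \<xi>)) {#i#} {} $ 0 = (\<Sum>j<n. if j = i then op (tau \<xi>) {#} {i} $ 0 else 0)"
    unfolding koszul_def fun_additive_sum fps_sum_nth
    by (intro sum.cong refl) (simp add: sym_mul_def alt_ins_apply below_self)
  then have "koszul (op (tau \<xi>)) {#i#} {} $ 0 = act i (\<xi> $ 0)" using i op by simp
  then have "tau_step (tau \<xi>) {#i#} {} $ 0 = act i (\<xi> $ 0)"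
    unfolding tau_step_def dinv_weight weight_nth by simp
  moreover have "tau \<xi> {#i#} {} $ 0 = weyl_embed \<xi> {#i#} {} $ 0 + tau_step (tau \<xi>) {#i#} {} $ 0"
    by (subst tau_fixpoint) simp
  ultimately show ?thesis by (simp add: weyl_embed_def)
qed

lemma star_const_0: "star (fps_const a) (fps_const b) $ 0 = a * b"
  unfolding star_def weyl_proj_def circ_nth_0 mu_proj
  using proj_tau[of "fps_const a"] proj_tau[of "fps_const b"] by (simp add: weyl_proj_def)

text \<open>The term of order 0 contributes nothing to the coefficient of \<open>t\<close>, because
  \<tau> of a constant projects back to that constant. Order 1 pairs the first-order parts of the
  two sections.\<close>

lemma star_const_1:
  "star (fps_const a) (fps_const b) $ 1 = (\<Sum>i<n. \<Sum>j<n. sc (rat_const (1/2) * \<pi> i j) (act i a * act j b))"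
proof -
  have p: "tau (fps_const a) {#} {} = fps_const a" for a
    using proj_tau[of "fps_const a"] by (simp add: weyl_proj_def)
  have c: "circ_coeff 1 = (rat_const (1/2) :: 'r)" by (simp add: circ_coeff_def)
  have "{..1::nat} = {0, 1}" by auto
  then have "star (fps_const a) (fps_const b) $ 1 =
    sc (circ_coeff 1) (muP 1 (tau (fps_const a)) (tau (fps_const b)) {#} {} $ 0)"
    unfolding star_def weyl_proj_def circ_nth by (simp add: mu_proj p del: One_nat_def)
  also have "muP 1 (tau (fps_const a)) (tau (fps_const b)) {#} {} $ 0 =
    (\<Sum>i<n. \<Sum>j<n. sc (\<pi> i j) (act i a * act j b))"
    unfolding One_nat_def mu_P.simps fun_additive_sum fps_sum_nth wsc_nth mu_proj
    by (intro sum.cong refl) (simp add: sym_ins_def tau_first_order)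
  finally show ?thesis unfolding c scale_sum_right scale_scale .
qed

text \<open>This concerns the unit of the coefficient ring, which derivations kill. For
  \<open>A\<close> that is the empty tensor and not \<open>j 1\<close>.\<close>

lemma tau_one: "tau 1 = unit"
proof -
  have "fps_map (act i) 1 = 0" for i
    by (rule fps_ext) (simp add: fps_map_def act_1 act.zero)
  then have "Dop unit = 0"
    unfolding Dop_embed by (simp add: weyl_embed_def[abs_def] zero_fun_def[symmetric] alt_mul.zero cong: if_cong)
  then have "FD unit = 0"
    unfolding FD_def op_def using ad\<rho>_embed[of 1] by (simp add: del_embed divide_t.zero)
  from tau_unique[OF weyl_space_embed this] show ?thesis by simp
qed

end

section \<open>Linear maps out of quotients of free algebras\<close>

text \<open>The linear map with prescribed values on words. As multiplicativity is not asked for,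
  the target may be any module.\<close>

definition free_lift ::
  "('r::comm_ring_1 \<Rightarrow> 'm::ab_group_add \<Rightarrow> 'm) \<Rightarrow> ('x list \<Rightarrow> 'm) \<Rightarrow> ('x, 'r) free_alg \<Rightarrow> 'm" where
  "free_lift sc g p = (\<Sum>w\<in>Poly_Mapping.keys p. sc (Poly_Mapping.lookup p w) (g (letters w)))"

lemma free_eval_lift: "free_eval sc f = free_lift sc (\<lambda>w. prod_list (map f w))"
  by (simp add: fun_eq_iff free_eval_def free_lift_def)

context module
begin

lemma free_lift_add: "free_lift scale g (p + q) = free_lift scale g p + free_lift scale g q"
  unfolding free_lift_def
  by (rule setsum_keys_plus_distrib[where f = "\<lambda>w c. scale c (g (letters w))"]) (simp_all add: scale_left_distrib)

lemma additive_free_lift: "additive (free_lift scale g)"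
  by (simp add: additive_def free_lift_add)

lemma free_lift_single: "free_lift scale g (Poly_Mapping.single w c) = scale c (g (letters w))"
  by (cases "c = 0") (simp_all add: free_lift_def)

end

lemma sum_single_keys: "(\<Sum>w\<in>Poly_Mapping.keys p. Poly_Mapping.single w (Poly_Mapping.lookup p w)) = p"
proof (rule poly_mapping_eqI)
  fix k
  have "Poly_Mapping.lookup (\<Sum>w\<in>A. Poly_Mapping.single w (Poly_Mapping.lookup p w)) k =
    (\<Sum>w\<in>A. if w = k then Poly_Mapping.lookup p k else 0)" for A
    by (induction A rule: infinite_finite_induct) (auto simp: lookup_add lookup_single when_def)
  then show "Poly_Mapping.lookup (\<Sum>w\<in>Poly_Mapping.keys p. Poly_Mapping.single w (Poly_Mapping.lookup p w)) k =
    Poly_Mapping.lookup p k"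
    by (simp add: in_keys_iff)
qed

lemma free_alg_induct [case_names zero add single]:
  assumes "P 0" "\<And>p q. P p \<Longrightarrow> P q \<Longrightarrow> P (p + q)" "\<And>w c. P (Poly_Mapping.single w c)"
  shows "P (p :: ('x, 'r::comm_ring_1) free_alg)"
proof -
  have "P (\<Sum>w\<in>A. Poly_Mapping.single w (Poly_Mapping.lookup p w))" for A
    by (induction A rule: infinite_finite_induct) (simp_all add: assms)
  then show ?thesis using sum_single_keys[of p] by metis
qed

lemma (in module) free_lift_const_mult:
  "free_lift scale g (Poly_Mapping.single 0 c * p) = scale c (free_lift scale g p)"
proof (induction p rule: free_alg_induct)
  case zero
  show ?case by (simp add: additive.zero[OF additive_free_lift])
next
  case (add p q)
  then show ?case by (simp add: distrib_left free_lift_add scale_right_distrib)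
next
  case (single w d)
  show ?case by (simp add: mult_single free_lift_single)
qed

lemma single_mult_mult_single:
  fixes x :: "('x, 'r::comm_ring_1) free_alg"
  shows "Poly_Mapping.single u a * x * Poly_Mapping.single v b =
    Poly_Mapping.single 0 (a * b) * (Poly_Mapping.single u 1 * x * Poly_Mapping.single v 1)"
proof (induction x rule: free_alg_induct)
  case (single w c)
  show ?case by (simp add: mult_single ac_simps)
qed (simp_all add: distrib_left distrib_right)

text \<open>The map need not be multiplicative, so relations are tested between arbitrary words.
  Proving the claim for \<open>p * x * q\<close> lets the induction absorb the ideal steps into
  \<open>p\<close> and \<open>q\<close>.\<close>

lemma free_lift_ideal:
  assumes "module sc"
    and rel: "\<And>x u v. x \<in> Rel \<Longrightarrow>
      free_lift sc g (Poly_Mapping.single u 1 * x * Poly_Mapping.single v 1) = 0"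
    and x: "x \<in> ideal_generated Rel"
  shows "free_lift sc g x = 0"
proof -
  interpret module sc by fact
  interpret lift: additive "free_lift sc g" by (rule additive_free_lift)
  have "free_lift sc g (p * x * q) = 0" for p q
    using x
  proof (induction x arbitrary: p q)
    case (gen x)
    show ?case
    proof (induction p rule: free_alg_induct)
      case (single u a)
      show ?case
      proof (induction q rule: free_alg_induct)
        case (single v b)
        show ?case
          unfolding single_mult_mult_single[of u a x v b] free_lift_const_mult using rel[OF gen] by simp
      qed (simp_all add: lift.zero distrib_left lift.add)
    qed (simp_all add: lift.zero distrib_right lift.add)
  next
    case zero
    show ?case by (simp add: lift.zero)
  next
    case (add x y)
    then show ?case by (simp add: distrib_left distrib_right lift.add)
  next
    case (left x a)
    from left.IH[of "p * a" q] show ?case by (simp add: mult.assoc)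
  next
    case (right x a)
    from right.IH[of p "a * q"] show ?case by (simp add: mult.assoc)
  qed
  from this[of 1 1] show ?thesis by simp
qed

lemma quotient_lift:
  assumes quot: "is_quotient_of_free sc f Rel" and M: "module scM"
    and rel: "\<And>x u v. x \<in> Rel \<Longrightarrow>
      free_lift scM g (Poly_Mapping.single u 1 * x * Poly_Mapping.single v 1) = 0"
  obtains h where "module_hom sc scM h" "\<And>w. h (prod_list (map f w)) = g w"
proof -
  interpret M: module scM by fact
  have B: "module sc" using quot by (simp add: is_quotient_of_free_def assoc_algebra_def)
  interpret B: module sc by fact
  \<comment> \<open>A choice of representatives. The map \<open>h\<close> built from it does not
    depend on the choice, since the lift vanishes on the kernel.\<close>
  define s where "s = (\<lambda>b. SOME p. free_eval sc f p = b)"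
  have s: "free_eval sc f (s b) = b" for b
  proof -
    have "\<exists>p. free_eval sc f p = b"
      using quot unfolding is_quotient_of_free_def surj_def by metis
    then show ?thesis unfolding s_def by (rule someI_ex)
  qed
  interpret lift: additive "free_lift scM g" by (rule M.additive_free_lift)
  interpret eval: additive "free_eval sc f" unfolding free_eval_lift by (rule B.additive_free_lift)
  define h where "h = (\<lambda>b. free_lift scM g (s b))"
  have h: "h (free_eval sc f p) = free_lift scM g p" for p
  proof -
    have "free_eval sc f (s (free_eval sc f p) - p) = 0" by (simp add: eval.diff s)
    then have "s (free_eval sc f p) - p \<in> ideal_generated Rel"
      using quot unfolding is_quotient_of_free_def by blast
    from free_lift_ideal[OF M rel this] show ?thesis by (simp add: h_def lift.diff)
  qed
  show thesis
  proof (rule that)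
    show "module_hom sc scM h"
      unfolding module_hom_iff
    proof (intro conjI allI B M)
      fix x y c
      have "h (x + y) = h (free_eval sc f (s x + s y))" by (simp add: eval.add s)
      also have "\<dots> = h x + h y" unfolding h by (simp add: lift.add h_def)
      finally show "h (x + y) = h x + h y" .
      have "free_eval sc f (Poly_Mapping.single 0 c * s x) = sc c x"
        unfolding free_eval_lift B.free_lift_const_mult by (simp add: s flip: free_eval_lift)
      then have "h (sc c x) = h (free_eval sc f (Poly_Mapping.single 0 c * s x))" by simp
      also have "\<dots> = scM c (h x)" unfolding h M.free_lift_const_mult by (simp add: h_def)
      finally show "h (sc c x) = scM c (h x)" .
    qed
    fix w
    have "free_eval sc f (Poly_Mapping.single (FWord w) 1) = prod_list (map f w)"
      unfolding free_eval_lift B.free_lift_single by simp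
    then have "h (prod_list (map f w)) = h (free_eval sc f (Poly_Mapping.single (FWord w) 1))" by simp
    also have "\<dots> = g w" unfolding h M.free_lift_single by simp
    finally show "h (prod_list (map f w)) = g w" .
  qed
qed

lemma quotient_induct:
  assumes quot: "is_quotient_of_free sc f Rel"
    and P: "\<And>w. P (prod_list (map f w))" "\<And>x y. P x \<Longrightarrow> P y \<Longrightarrow> P (x + y)" "\<And>c x. P x \<Longrightarrow> P (sc c x)" "P 0"
  shows "P b"
proof -
  obtain p where p: "b = free_eval sc f p"
    using quot unfolding is_quotient_of_free_def surj_def by metis
  have "P (\<Sum>w\<in>A. sc (Poly_Mapping.lookup p w) (prod_list (map f (letters w))))" for A
    by (induction A rule: infinite_finite_induct) (simp_all add: P)
  then show ?thesis unfolding p free_eval_def .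
qed

text \<open>Linearity in each entry, for lists of every length, so that one function prescribes a
  map on all tensor degrees at once.\<close>

definition multilinear ::
  "('r::comm_ring_1 \<Rightarrow> 'x::ab_group_add \<Rightarrow> 'x) \<Rightarrow> ('r \<Rightarrow> 'm::ab_group_add \<Rightarrow> 'm) \<Rightarrow> ('x list \<Rightarrow> 'm) \<Rightarrow> bool" where
  "multilinear scX scM g \<longleftrightarrow>
     (\<forall>u v x y. g (u @ (x + y) # v) = g (u @ x # v) + g (u @ y # v)) \<and>
     (\<forall>u v c x. g (u @ scX c x # v) = scM c (g (u @ x # v)))"

lemma plus_fword: "FWord u + FWord v = FWord (u @ v)"
  by (simp add: plus_fword_def)

lemma free_lift_linearity_rels:
  assumes M: "module scM" and g: "multilinear scX scM g" and x: "x \<in> linearity_rels scX"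
  shows "free_lift scM g (Poly_Mapping.single u 1 * x * Poly_Mapping.single v 1) = 0"
proof -
  interpret module scM by fact
  interpret lift: additive "free_lift scM g" by (rule additive_free_lift)
  obtain us vs where uv: "u = FWord us" "v = FWord vs" by (meson fword.exhaust)
  from x consider a b where "x = free_gen (a + b) - free_gen a - free_gen b"
    | c a where "x = free_gen (scX c a) - free_const c * free_gen a"
    unfolding linearity_rels_def by blast
  then show ?thesis
  proof cases
    case 1
    show ?thesis unfolding 1 using g
      by (simp add: uv free_gen_def left_diff_distrib right_diff_distrib mult_single lift.diff free_lift_single
          plus_fword multilinear_def)
  next
    case 2
    show ?thesis unfolding 2 using g
      by (simp add: uv free_gen_def free_const_def left_diff_distrib right_diff_distrib mult_single lift.diff
          free_lift_single plus_fword zero_fword_def multilinear_def)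
  qed
qed

lemma tensor_lift:
  assumes "is_tensor_algebra scX sc f" "module scM" "multilinear scX scM g"
  obtains h where "module_hom sc scM h" "\<And>w. h (prod_list (map f w)) = g w"
  using assms unfolding is_tensor_algebra_def by (metis free_lift_linearity_rels quotient_lift)

lemma enveloping_lift:
  assumes env: "is_enveloping_algebra scX br sc f" and M: "module scM" and g: "multilinear scX scM g"
    and comm: "\<And>u v x y. g (u @ x # y # v) - g (u @ y # x # v) = g (u @ br x y # v)"
  obtains h where "module_hom sc scM h" "\<And>w. h (prod_list (map f w)) = g w"
proof (rule quotient_lift[OF env[unfolded is_enveloping_algebra_def] M])
  interpret module scM by fact
  interpret lift: additive "free_lift scM g" by (rule additive_free_lift)
  fix x u v
  assume "x \<in> linearity_rels scX \<union>
    {free_gen x * free_gen y - free_gen y * free_gen x - free_gen (br x y) |x y. True}"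
  then show "free_lift scM g (Poly_Mapping.single u 1 * x * Poly_Mapping.single v 1) = 0"
  proof
    assume "x \<in> linearity_rels scX"
    then show ?thesis by (rule free_lift_linearity_rels[OF M g])
  next
    assume "x \<in> {free_gen x * free_gen y - free_gen y * free_gen x - free_gen (br x y) |x y. True}"
    then obtain a b where x: "x = free_gen a * free_gen b - free_gen b * free_gen a - free_gen (br a b)" by blast
    obtain us vs where uv: "u = FWord us" "v = FWord vs" by (meson fword.exhaust)
    show ?thesis
      using comm[of us a b vs]
      by (simp add: x uv free_gen_def left_diff_distrib right_diff_distrib mult_single lift.diff free_lift_single
          plus_fword)
  qed
qed (rule that)

lemma quotient_relation:
  assumes "is_quotient_of_free sc f Rel" "x \<in> Rel"
  shows "free_eval sc f x = 0"
  using assms ideal_generated.gen[of x Rel] unfolding is_quotient_of_free_def by blast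

lemma tensor_hom:
  assumes "is_tensor_algebra scX sc f"
  shows "f (x + y) = f x + f y" "f (scX c x) = sc c (f x)"
proof -
  have quot: "is_quotient_of_free sc f (linearity_rels scX)" using assms by (simp add: is_tensor_algebra_def)
  interpret module sc using quot by (simp add: is_quotient_of_free_def assoc_algebra_def)
  interpret eval: additive "free_eval sc f" unfolding free_eval_lift by (rule additive_free_lift)
  have "free_eval sc f (free_gen (x + y) - free_gen x - free_gen y) = 0"
    by (rule quotient_relation[OF quot]) (auto simp: linearity_rels_def)
  then show "f (x + y) = f x + f y"
    unfolding eval.diff unfolding free_eval_lift free_gen_def free_lift_single by (simp add: algebra_simps)
  have "free_eval sc f (free_gen (scX c x) - free_const c * free_gen x) = 0"
    by (rule quotient_relation[OF quot]) (auto simp: linearity_rels_def)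
  then show "f (scX c x) = sc c (f x)"
    unfolding eval.diff unfolding free_eval_lift free_gen_def free_const_def mult_single free_lift_single
    by simp
qed

lemma enveloping_hom:
  assumes "is_enveloping_algebra scX br sc f"
  shows "f (x + y) = f x + f y" "f (scX c x) = sc c (f x)" "f x * f y - f y * f x = f (br x y)"
proof -
  let ?Rel = "linearity_rels scX \<union>
    {free_gen x * free_gen y - free_gen y * free_gen x - free_gen (br x y) |x y. True}"
  have quot: "is_quotient_of_free sc f ?Rel" using assms by (simp add: is_enveloping_algebra_def)
  interpret module sc using quot by (simp add: is_quotient_of_free_def assoc_algebra_def)
  interpret eval: additive "free_eval sc f" unfolding free_eval_lift by (rule additive_free_lift)
  have "free_eval sc f (free_gen (x + y) - free_gen x - free_gen y) = 0"
    by (rule quotient_relation[OF quot]) (auto simp: linearity_rels_def)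
  then show "f (x + y) = f x + f y"
    unfolding eval.diff unfolding free_eval_lift free_gen_def free_lift_single by (simp add: algebra_simps)
  have "free_eval sc f (free_gen (scX c x) - free_const c * free_gen x) = 0"
    by (rule quotient_relation[OF quot]) (auto simp: linearity_rels_def)
  then show "f (scX c x) = sc c (f x)"
    unfolding eval.diff unfolding free_eval_lift free_gen_def free_const_def mult_single free_lift_single
    by simp
  have "free_eval sc f (free_gen x * free_gen y - free_gen y * free_gen x - free_gen (br x y)) = 0"
    by (rule quotient_relation[OF quot]) blast
  then show "f x * f y - f y * f x = f (br x y)"
    unfolding eval.diff unfolding free_eval_lift free_gen_def mult_single free_lift_single
    by (simp add: plus_fword)
qed

section \<open>The tensor algebra of an enveloping algebra\<close>

locale tensor_env =
  fixes scG :: "'r::ring_containing_rat \<Rightarrow> 'g::ab_group_add \<Rightarrow> 'g"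
    and br :: "'g \<Rightarrow> 'g \<Rightarrow> 'g"
    and scU :: "'r \<Rightarrow> 'u::ring_1 \<Rightarrow> 'u"
    and \<iota> :: "'g \<Rightarrow> 'u"
    and scA :: "'r \<Rightarrow> 'a::ring_1 \<Rightarrow> 'a"
    and j :: "'u \<Rightarrow> 'a"
  assumes env: "is_enveloping_algebra scG br scU \<iota>" and tens: "is_tensor_algebra scU scA j"
begin

sublocale U: alg scU
  using env by unfold_locales (simp add: is_enveloping_algebra_def is_quotient_of_free_def)

sublocale A: alg scA
  using tens by unfold_locales (simp add: is_tensor_algebra_def is_quotient_of_free_def)

lemmas j_add = tensor_hom(1)[OF tens] and j_sc = tensor_hom(2)[OF tens]
lemmas \<iota>_add = enveloping_hom(1)[OF env] and \<iota>_sc = enveloping_hom(2)[OF env] and \<iota>_br = enveloping_hom(3)[OF env]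

lemma j_0: "j 0 = 0"
  using j_add[of 0 0] by simp

abbreviation pure :: "'u list \<Rightarrow> 'a" where
  "pure \<equiv> pure_tensor j"

lemma pure_simps [simp]: "pure [] = 1" "pure (u # us) = j u * pure us" "pure (us @ vs) = pure us * pure vs"
  by (simp_all add: pure_tensor_def)

lemma A_induct [case_names pure add scale zero]:
  assumes "\<And>us. P (pure us)" "\<And>x y. P x \<Longrightarrow> P y \<Longrightarrow> P (x + y)" "\<And>c x. P x \<Longrightarrow> P (scA c x)" "P 0"
  shows "P a"
  using quotient_induct[OF tens[unfolded is_tensor_algebra_def], of P] assms unfolding pure_tensor_def by blast

lemma U_induct [case_names one mult add scale zero]:
  assumes "P 1" "\<And>x u. P u \<Longrightarrow> P (\<iota> x * u)" "\<And>x y. P x \<Longrightarrow> P y \<Longrightarrow> P (x + y)" "\<And>c x. P x \<Longrightarrow> P (scU c x)" "P 0"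
  shows "P u"
proof -
  have "P (prod_list (map \<iota> w))" for w by (induction w) (simp_all add: assms)
  then show ?thesis using quotient_induct[OF env[unfolded is_enveloping_algebra_def], of P] assms by blast
qed

lemma A_lift:
  assumes "module scM" "multilinear scU scM g"
  obtains h where "module_hom scA scM h" "\<And>us. h (pure us) = g us"
  using tensor_lift[OF tens assms] unfolding pure_tensor_def by blast

lemma A_hom_eq:
  assumes h: "module_hom scA scM h" and h': "module_hom scA scM h'" and eq: "\<And>us. h (pure us) = h' (pure us)"
  shows "h = h'"
proof
  fix a show "h a = h' a"
  proof (induction a rule: A_induct)
    case zero
    show ?case using module_hom.zero[OF h] module_hom.zero[OF h'] by simp
  qed (use h h' eq in \<open>simp_all add: module_hom_iff\<close>)
qed

lemma A_bilinear_eq: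
  assumes h: "bilinear_map scA scA scM h" and h': "bilinear_map scA scA scM h'"
    and eq: "\<And>us vs. h (pure us) (pure vs) = h' (pure us) (pure vs)"
  shows "h = h'"
proof
  fix a
  have "h (pure us) = h' (pure us)" for us
    using A_hom_eq[of scM "h (pure us)" "h' (pure us)"] h h' eq by (simp add: bilinear_map_def)
  then have "(\<lambda>a. h a b) = (\<lambda>a. h' a b)" for b
    using A_hom_eq[of scM "\<lambda>a. h a b" "\<lambda>a. h' a b"] h h' by (simp add: bilinear_map_def)
  then show "h a = h' a" by (metis ext)
qed

section \<open>Derivations of the tensor algebra and the action of the Lie algebra\<close>

definition derivation :: "('a \<Rightarrow> 'a) \<Rightarrow> bool" where
  "derivation d \<longleftrightarrow> module_hom scA scA d \<and> (\<forall>a b. d (a * b) = d a * b + a * d b)"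

lemma derivation_add: "derivation d \<Longrightarrow> d (a + b) = d a + d b"
  and derivation_sc: "derivation d \<Longrightarrow> d (scA c a) = scA c (d a)"
  and derivation_mult: "derivation d \<Longrightarrow> d (a * b) = d a * b + a * d b"
  by (simp_all add: derivation_def module_hom_iff)

lemma derivation_eq:
  assumes d: "derivation d" and d': "derivation d'" and eq: "\<And>u. d (j u) = d' (j u)"
  shows "d = d'"
proof (rule A_hom_eq)
  show "module_hom scA scA d" "module_hom scA scA d'" using d d' by (simp_all add: derivation_def)
  fix us
  have "d 1 = 0" "d' 1 = 0" using derivation_mult[OF d, of 1 1] derivation_mult[OF d', of 1 1] by simp_all
  then show "d (pure us) = d' (pure us)"
    by (induction us) (simp_all add: derivation_mult[OF d] derivation_mult[OF d'] eq)
qed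

primrec left_pure :: "'g \<Rightarrow> 'u list \<Rightarrow> 'a" where
  "left_pure x [] = 0"
| "left_pure x (u # us) = j (\<iota> x * u) * pure us + j u * left_pure x us"

lemma left_pure_append: "left_pure x (us @ vs) = left_pure x us * pure vs + pure us * left_pure x vs"
  by (induction us) (simp_all add: algebra_simps)

lemma multilinear_left_pure: "multilinear scU scA (left_pure x)"
  unfolding multilinear_def
  by (simp add: left_pure_append j_add j_sc algebra_simps A.sc_mult_left A.sc_mult_right U.sc_mult_right)

abbreviation LA :: "'g \<Rightarrow> 'a \<Rightarrow> 'a" where
  "LA \<equiv> left_action \<iota> scA j"

text \<open>\<open>left_action\<close> is a definite description: existence comes from lifting
  \<open>left_pure\<close>, uniqueness from the fact that a derivation is determined on the image of
  \<open>j\<close>.\<close>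

lemma LA: "derivation (LA x)" "LA x (j u) = j (\<iota> x * u)"
proof -
  obtain d where d: "module_hom scA scA d" "\<And>us. d (pure us) = left_pure x us"
    using A_lift[OF A.module_axioms multilinear_left_pure] by blast
  have mult: "bilinear_map scA scA scA (\<lambda>a b. d (a * b))" "bilinear_map scA scA scA (\<lambda>a b. d a * b + a * d b)"
    using d(1) by (auto simp: bilinear_map_def module_hom_iff A.sc_mult_left A.sc_mult_right algebra_simps
        A.scale_right_distrib)
  have "(\<lambda>a b. d (a * b)) = (\<lambda>a b. d a * b + a * d b)"
  proof (rule A_bilinear_eq[OF mult])
    fix us vs
    show "d (pure us * pure vs) = d (pure us) * pure vs + pure us * d (pure vs)"
      using d(2)[of "us @ vs"] by (simp add: d(2) left_pure_append)
  qed
  then have der: "derivation d" using d(1) by (simp add: derivation_def fun_eq_iff)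
  have dj: "d (j u) = j (\<iota> x * u)" for u using d(2)[of "[u]"] by simp
  let ?Q = "\<lambda>d. module_hom scA scA d \<and> (\<forall>a b. d (a * b) = d a * b + a * d b) \<and> (\<forall>u. d (j u) = j (\<iota> x * u))"
  have "?Q (LA x)"
    unfolding left_action_def
  proof (rule theI[of ?Q])
    show "?Q d" using der dj by (simp add: derivation_def)
    fix d' assume "?Q d'"
    then show "d' = d" using der dj by (intro derivation_eq) (simp_all add: derivation_def)
  qed
  then show "derivation (LA x)" "LA x (j u) = j (\<iota> x * u)" by (simp_all add: derivation_def)
qed

lemmas LA_add = derivation_add[OF LA(1)] and LA_sc = derivation_sc[OF LA(1)] and LA_mult = derivation_mult[OF LA(1)]

lemma LA_0: "LA x 0 = 0"
  using LA_add[of x 0 0] by simp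

lemma LA_minus: "LA x (- a) = - LA x a"
  using LA_add[of x a "- a"] by (simp add: LA_0 eq_neg_iff_add_eq_0 add.commute)

lemma LA_diff: "LA x (a - b) = LA x a - LA x b"
  using LA_add[of x a "- b"] by (simp add: LA_minus)

lemma LA_lie_add: "LA (x + y) a = LA x a + LA y a"
proof -
  have "LA (x + y) = (\<lambda>a. LA x a + LA y a)"
  proof (rule derivation_eq[OF LA(1)])
    show "derivation (\<lambda>a. LA x a + LA y a)"
      unfolding derivation_def module_hom_iff
      by (simp add: A.module_axioms LA_add LA_sc LA_mult algebra_simps A.scale_right_distrib)
  qed (simp add: LA(2) \<iota>_add distrib_right j_add)
  then show ?thesis by (simp add: fun_eq_iff)
qed

lemma LA_lie_sc: "LA (scG c x) a = scA c (LA x a)"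
proof -
  have "LA (scG c x) = (\<lambda>a. scA c (LA x a))"
  proof (rule derivation_eq[OF LA(1)])
    show "derivation (\<lambda>a. scA c (LA x a))"
      unfolding derivation_def module_hom_iff
      by (simp add: A.module_axioms LA_add LA_sc LA_mult A.scale_right_distrib A.sc_mult_left A.sc_mult_right mult.commute)
  qed (simp add: LA(2) \<iota>_sc U.sc_mult_left j_sc)
  then show ?thesis by (simp add: fun_eq_iff)
qed

text \<open>A commutator of derivations is a derivation, so it suffices to compare on
  \<open>j u\<close>, where the claim is the defining relation of \<open>U\<close>.\<close>

lemma LA_br: "LA x (LA y a) - LA y (LA x a) = LA (br x y) a"
proof -
  have "(\<lambda>a. LA x (LA y a) - LA y (LA x a)) = LA (br x y)"
  proof (rule derivation_eq[OF _ LA(1)])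
    show "derivation (\<lambda>a. LA x (LA y a) - LA y (LA x a))"
      unfolding derivation_def module_hom_iff
      by (simp add: A.module_axioms LA_add LA_sc LA_mult algebra_simps A.scale_right_diff_distrib)
    have "j u - j v = j (u - v)" for u v using j_add[of "u - v" v] by simp
    then show "LA x (LA y (j u)) - LA y (LA x (j u)) = LA (br x y) (j u)" for u
      by (simp add: LA(2) flip: mult.assoc left_diff_distrib \<iota>_br)
  qed
  then show ?thesis by (simp add: fun_eq_iff)
qed

lemma foldr_LA_add: "foldr LA xs (a + b) = foldr LA xs a + foldr LA xs b"
  and foldr_LA_sc: "foldr LA xs (scA c a) = scA c (foldr LA xs a)"
  and foldr_LA_diff: "foldr LA xs (a - b) = foldr LA xs a - foldr LA xs b"
  by (induction xs) (simp_all add: LA_add LA_sc LA_diff)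

text \<open>The map \<open>u \<mapsto> u a\<close>; the next lemma shows that the choice is not empty.\<close>

definition ev :: "'a \<Rightarrow> 'u \<Rightarrow> 'a" where
  "ev a = (SOME h. module_hom scU scA h \<and> (\<forall>xs. h (prod_list (map \<iota> xs)) = foldr LA xs a))"

lemma ev_hom: "module_hom scU scA (ev a)"
  and ev_prod: "ev a (prod_list (map \<iota> xs)) = foldr LA xs a"
proof -
  have "multilinear scG scA (\<lambda>xs. foldr LA xs a)"
    by (simp add: multilinear_def LA_lie_add LA_lie_sc foldr_LA_add foldr_LA_sc)
  moreover have "foldr LA (u @ x # y # v) a - foldr LA (u @ y # x # v) a = foldr LA (u @ br x y # v) a" for u v x y
    by (simp add: LA_br flip: foldr_LA_diff)
  ultimately obtain h where "module_hom scU scA h" "\<And>xs. h (prod_list (map \<iota> xs)) = foldr LA xs a"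
    using enveloping_lift[OF env A.module_axioms] by metis
  then have "\<exists>h. module_hom scU scA h \<and> (\<forall>xs. h (prod_list (map \<iota> xs)) = foldr LA xs a)" by blast
  from someI_ex[OF this] show "module_hom scU scA (ev a)" "ev a (prod_list (map \<iota> xs)) = foldr LA xs a"
    unfolding ev_def by simp_all
qed

lemma ev_add: "ev a (u + v) = ev a u + ev a v" and ev_sc: "ev a (scU c u) = scA c (ev a u)" and ev_0: "ev a 0 = 0"
  using ev_hom[of a] module_hom.zero[OF ev_hom[of a]] by (simp_all add: module_hom_iff)

lemma ev_1: "ev a 1 = a"
  using ev_prod[of a "[]"] by simp

lemma ev_\<iota>: "ev a (\<iota> x * u) = LA x (ev a u)"
proof -
  have "ev a (\<iota> x * u) = LA x (ev a u)" for u
  proof (rule quotient_induct[OF env[unfolded is_enveloping_algebra_def], of "\<lambda>u. ev a (\<iota> x * u) = LA x (ev a u)"])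
    fix w show "ev a (\<iota> x * prod_list (map \<iota> w)) = LA x (ev a (prod_list (map \<iota> w)))"
      using ev_prod[of a "x # w"] ev_prod[of a w] by simp
  qed (simp_all add: distrib_left ev_add LA_add U.sc_mult_right ev_sc LA_sc ev_0 LA_0)
  then show ?thesis .
qed

lemma ev_j: "ev (j v) u = j (u * v)"
  by (induction u rule: U_induct)
    (simp_all add: ev_1 ev_\<iota> LA(2) mult.assoc ev_add distrib_right j_add ev_sc U.sc_mult_left j_sc ev_0 j_0)

lemma ev_mult: "ev a (u * v) = ev (ev a v) u"
  by (induction u rule: U_induct)
    (simp_all add: ev_1 ev_\<iota> mult.assoc distrib_right ev_add U.sc_mult_left ev_sc ev_0)

abbreviation T :: "nat \<Rightarrow> 'a set" where
  "T \<equiv> tensor_power scA j"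

lemma T_induct [consumes 1, case_names pure add scale zero]:
  assumes "a \<in> T k" "\<And>us. length us = k \<Longrightarrow> P (pure us)" "\<And>x y. P x \<Longrightarrow> P y \<Longrightarrow> P (x + y)"
    "\<And>c x. P x \<Longrightarrow> P (scA c x)" "P 0"
  shows "P a"
  using assms(1) unfolding tensor_power_def
  by (induction rule: A.span_induct) (auto simp: A.subspace_def assms)

lemma T_pure: "length us = k \<Longrightarrow> pure us \<in> T k"
  and T_add: "a \<in> T k \<Longrightarrow> b \<in> T k \<Longrightarrow> a + b \<in> T k"
  and T_sc: "a \<in> T k \<Longrightarrow> scA c a \<in> T k"
  and T_0: "0 \<in> T k"
  and T_sum: "(\<And>i. i \<in> I \<Longrightarrow> f i \<in> T k) \<Longrightarrow> sum f I \<in> T k"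
  unfolding tensor_power_def
  by (auto intro: A.span_base A.span_add A.span_scale A.span_zero A.span_sum)

lemma length_2_cases: "length us = 2 \<longleftrightarrow> (\<exists>a b. us = [a, b])"
  by (auto simp: length_Suc_conv numeral_2_eq_2)

lemma T2_jj: "j u * j v \<in> T 2"
  using T_pure[of "[u, v]" 2] by simp

lemma T2_induct [consumes 1, case_names jj add scale zero]:
  assumes "a \<in> T 2" "\<And>u v. P (j u * j v)" "\<And>x y. P x \<Longrightarrow> P y \<Longrightarrow> P (x + y)"
    "\<And>c x. P x \<Longrightarrow> P (scA c x)" "P 0"
  shows "P a"
  using assms(1)
proof (induction rule: T_induct)
  case (pure us)
  then obtain u v where "us = [u, v]" by (auto simp: length_2_cases)
  then show ?case using assms(2) by simp
qed (simp_all add: assms)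

text \<open>The right factor is the first argument: the product is lifted in one variable at a time,
  the left factor first.\<close>

definition fw_pure :: "'u list \<Rightarrow> 'u list \<Rightarrow> 'a" where
  "fw_pure vs us = (if length us = length vs then pure (map2 (*) us vs) else 0)"

lemma multilinear_fw_left: "multilinear scU scA (fw_pure vs)"
proof -
  have "\<exists>p y q. vs = p @ y # q \<and> length p = length u" if "length vs = Suc (length u + length v)" for u v :: "'u list"
  proof -
    have "vs = take (length u) vs @ vs ! length u # drop (Suc (length u)) vs"
      using that by (simp add: id_take_nth_drop)
    then show ?thesis using that by (metis length_take min.absorb2 le_Suc_eq le_add1 trans_le_add1)
  qed
  \<comment> \<open>Either the fixed list splits at the same position as the varying one, or the
    lengths differ and everything vanishes.\<close>
  then have *: "(\<exists>p y q. vs = p @ y # q \<and> length p = length u \<and> length q = length v) \<or>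
     (\<forall>x. fw_pure vs (u @ x # v) = 0)" for u v
    by (cases "length vs = Suc (length u + length v)") (fastforce simp: fw_pure_def)+
  show ?thesis
    unfolding multilinear_def
  proof (intro conjI allI)
    fix u v x y c
    show "fw_pure vs (u @ (x + y) # v) = fw_pure vs (u @ x # v) + fw_pure vs (u @ y # v)"
      using *[of u v] by (auto simp: fw_pure_def distrib_right distrib_left j_add)
    show "fw_pure vs (u @ scU c x # v) = scA c (fw_pure vs (u @ x # v))"
      using *[of u v] by (auto simp: fw_pure_def U.sc_mult_left A.sc_mult_left A.sc_mult_right j_sc)
  qed
qed

lemma multilinear_fw_right: "multilinear scU scA (\<lambda>vs. fw_pure vs us)"
proof -
  have "\<exists>p y q. us = p @ y # q \<and> length p = length u" if "length us = Suc (length u + length v)" for u v :: "'u list"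
  proof -
    have "us = take (length u) us @ us ! length u # drop (Suc (length u)) us"
      using that by (simp add: id_take_nth_drop)
    then show ?thesis using that by (metis length_take min.absorb2 le_Suc_eq le_add1 trans_le_add1)
  qed
  then have *: "(\<exists>p y q. us = p @ y # q \<and> length p = length u \<and> length q = length v) \<or>
     (\<forall>x. fw_pure (u @ x # v) us = 0)" for u v
    by (cases "length us = Suc (length u + length v)") (fastforce simp: fw_pure_def)+
  show ?thesis
    unfolding multilinear_def
  proof (intro conjI allI)
    fix u v x y c
    show "fw_pure (u @ (x + y) # v) us = fw_pure (u @ x # v) us + fw_pure (u @ y # v) us"
      using *[of u v] by (auto simp: fw_pure_def distrib_right distrib_left j_add)
    show "fw_pure (u @ scU c x # v) us = scA c (fw_pure (u @ x # v) us)"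
      using *[of u v] by (auto simp: fw_pure_def U.sc_mult_right A.sc_mult_left A.sc_mult_right j_sc)
  qed
qed

abbreviation fm :: "'a \<Rightarrow> 'a \<Rightarrow> 'a" where
  "fm \<equiv> factorwise_mult scA j"

text \<open>Lifting in the left factor gives a linear map \<open>H vs\<close> for each list on the
  right. As \<open>H\<close> is multilinear into functions with pointwise operations, a second lift
  handles the right factor.\<close>

lemma fm: "bilinear_map scA scA scA fm"
  "fm (pure us) (pure vs) = (if length us = length vs then pure (map2 (*) us vs) else 0)"
proof -
  have "\<exists>h. module_hom scA scA h \<and> (\<forall>us. h (pure us) = fw_pure vs us)" for vs
    using A_lift[OF A.module_axioms multilinear_fw_left] by metis
  then obtain H where H: "\<And>vs. module_hom scA scA (H vs)" "\<And>vs us. H vs (pure us) = fw_pure vs us" by metis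
  define scF where "scF = (\<lambda>c (f :: 'a \<Rightarrow> 'a) x. scA c (f x))"
  have F: "module scF"
    by unfold_locales (auto simp: scF_def fun_eq_iff A.scale_right_distrib A.scale_left_distrib)
  have hom_add: "module_hom scA scA (\<lambda>x. f x + g x)" if "module_hom scA scA f" "module_hom scA scA g" for f g
    using that by (simp add: module_hom_iff A.scale_right_distrib algebra_simps)
  have hom_sc: "module_hom scA scA (\<lambda>x. scA c (f x))" if "module_hom scA scA f" for f c
    using that by (simp add: module_hom_iff A.scale_right_distrib mult.commute)
  have "multilinear scU scF H"
    unfolding multilinear_def
  proof (intro conjI allI)
    fix u v x y c
    have "H (u @ (x + y) # v) = (\<lambda>a. H (u @ x # v) a + H (u @ y # v) a)"
    proof (rule A_hom_eq[OF H(1) hom_add[OF H(1) H(1)]])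
      show "H (u @ (x + y) # v) (pure us) = H (u @ x # v) (pure us) + H (u @ y # v) (pure us)" for us
        unfolding H(2) using multilinear_fw_right[of us] by (simp add: multilinear_def)
    qed
    then show "H (u @ (x + y) # v) = H (u @ x # v) + H (u @ y # v)" by (simp add: fun_eq_iff)
    have "H (u @ scU c x # v) = (\<lambda>a. scA c (H (u @ x # v) a))"
    proof (rule A_hom_eq[OF H(1) hom_sc[OF H(1)]])
      show "H (u @ scU c x # v) (pure us) = scA c (H (u @ x # v) (pure us))" for us
        unfolding H(2) using multilinear_fw_right[of us] by (simp add: multilinear_def)
    qed
    then show "H (u @ scU c x # v) = scF c (H (u @ x # v))" by (simp add: scF_def)
  qed
  from A_lift[OF F this] obtain m where m: "module_hom scA scF m" "\<And>vs. m (pure vs) = H vs" by metis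
  have m_hom: "module_hom scA scA (m b)" for b
  proof (induction b rule: A_induct)
    case (pure us)
    show ?case unfolding m(2) by (rule H(1))
  next
    case (add x y)
    have "m (x + y) = (\<lambda>a. m x a + m y a)" using m(1) by (simp add: module_hom_iff fun_eq_iff)
    then show ?case using hom_add[OF add] by simp
  next
    case (scale c x)
    have "m (scA c x) = (\<lambda>a. scA c (m x a))" using m(1) by (simp add: module_hom_iff scF_def)
    then show ?case using hom_sc[OF scale] by simp
  next
    case zero
    have "m 0 = (\<lambda>a. 0)" using module_hom.zero[OF m(1)] by (simp add: fun_eq_iff)
    then show ?case by (simp add: module_hom_iff A.module_axioms)
  qed
  let ?Q = "\<lambda>m. bilinear_map scA scA scA m \<and>
     (\<forall>us vs. m (pure us) (pure vs) = (if length us = length vs then pure (map2 (*) us vs) else 0))"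
  have Q: "?Q (\<lambda>a b. m b a)"
  proof (intro conjI allI)
    have "module_hom scA scA (\<lambda>b. m b a)" for a
      using m(1) A.module_axioms by (simp add: module_hom_iff scF_def)
    then show "bilinear_map scA scA scA (\<lambda>a b. m b a)" using m_hom by (simp add: bilinear_map_def)
  qed (simp add: m(2) H(2) fw_pure_def)
  have "?Q fm"
    unfolding factorwise_mult_def
  proof (rule theI[of ?Q, OF Q])
    fix m' assume m': "?Q m'"
    show "m' = (\<lambda>a b. m b a)"
      by (rule A_bilinear_eq[where scM = scA]) (use m' Q in \<open>simp_all\<close>)
  qed
  then show "bilinear_map scA scA scA fm"
    "fm (pure us) (pure vs) = (if length us = length vs then pure (map2 (*) us vs) else 0)" by blast+
qed

lemma fm_add_left: "fm (a + b) c = fm a c + fm b c" and fm_add_right: "fm c (a + b) = fm c a + fm c b"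
  and fm_sc_left: "fm (scA k a) c = scA k (fm a c)" and fm_sc_right: "fm c (scA k a) = scA k (fm c a)"
  using fm(1) by (simp_all add: bilinear_map_def module_hom_iff)

lemma fm_0: "fm 0 a = 0" "fm a 0 = 0"
  using fm_add_left[of 0 0 a] fm_add_right[of a 0 0] by simp_all

lemma additive_fm: "additive (\<lambda>a. fm a c)" "additive (fm c)"
  by (simp_all add: additive_def fm_add_left fm_add_right)

lemmas fm_sum_left = additive.sum[OF additive_fm(1)] and fm_sum_right = additive.sum[OF additive_fm(2)]

lemma fm_jj: "fm (j a * j b) (j c * j d) = j (a * c) * j (b * d)"
  using fm(2)[of "[a, b]" "[c, d]"] by simp

lemma fm_one: "a \<in> T 2 \<Longrightarrow> fm (j 1 * j 1) a = a" "a \<in> T 2 \<Longrightarrow> fm a (j 1 * j 1) = a"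
  by (induction a rule: T2_induct; simp add: fm_jj fm_add_right fm_add_left fm_sc_left fm_sc_right fm_0)+

lemma T2_fm: "a \<in> T 2 \<Longrightarrow> b \<in> T 2 \<Longrightarrow> fm a b \<in> T 2"
proof (induction a rule: T2_induct)
  case (jj u v)
  then show ?case
    by (induction b rule: T2_induct) (simp_all add: fm_jj T2_jj fm_add_right T_add fm_sc_right T_sc fm_0 T_0)
qed (simp_all add: fm_add_left T_add fm_sc_left T_sc fm_0 T_0)

lemma fm_assoc: "a \<in> T 2 \<Longrightarrow> b \<in> T 2 \<Longrightarrow> c \<in> T 2 \<Longrightarrow> fm (fm a b) c = fm a (fm b c)"
proof (induction a rule: T2_induct)
  case (jj u v)
  then show ?case
  proof (induction b rule: T2_induct)
    case (jj u' v')
    then show ?case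
      by (induction c rule: T2_induct) (simp_all add: fm_jj fm_add_right fm_sc_right fm_0 mult.assoc)
  qed (simp_all add: fm_add_left fm_sc_left fm_add_right fm_sc_right fm_0)
qed (simp_all add: fm_add_left fm_sc_left fm_0)

lemma fm_concat_right:
  "s \<in> T 2 \<Longrightarrow> a \<in> T 2 \<Longrightarrow> fm (s * j v) (a * j w) = fm s a * j (v * w)"
proof (induction s rule: T2_induct)
  case (jj b c)
  then show ?case
  proof (induction a rule: T2_induct)
    case (jj d e)
    show ?case using fm(2)[of "[b, c, v]" "[d, e, w]"] by (simp add: fm_jj mult.assoc)
  qed (simp_all add: distrib_right fm_add_right fm_sc_right A.sc_mult_left fm_0)
qed (simp_all add: distrib_right fm_add_left fm_sc_left A.sc_mult_left fm_0)

lemma fm_concat_left: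
  "s \<in> T 2 \<Longrightarrow> a \<in> T 2 \<Longrightarrow> fm (j v * s) (j w * a) = j (v * w) * fm s a"
proof (induction s rule: T2_induct)
  case (jj b c)
  then show ?case
  proof (induction a rule: T2_induct)
    case (jj d e)
    show ?case using fm(2)[of "[v, b, c]" "[w, d, e]"] by (simp add: fm_jj mult.assoc)
  qed (simp_all add: distrib_left fm_add_right fm_sc_right A.sc_mult_right fm_0)
qed (simp_all add: distrib_left fm_add_left fm_sc_left A.sc_mult_right fm_0)

lemma on_tensors2:
  assumes b: "bilinear_map scU scU scA b"
  shows "module_hom scA scA (on_tensors2 scA j b)" "on_tensors2 scA j b (j u * j v) = b u v"
    "length us \<noteq> 2 \<Longrightarrow> on_tensors2 scA j b (pure us) = 0"
proof -
  let ?g = "\<lambda>us. if length us = 2 then b (us ! 0) (us ! 1) else 0"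
  have "multilinear scU scA ?g"
    unfolding multilinear_def
  proof (intro conjI allI)
    fix u v :: "'u list" and x y :: 'u and c
    have b': "b (x + x') y = b x y + b x' y" "b x (y + y') = b x y + b x y'"
      "b (scU c x) y = scA c (b x y)" "b x (scU c y) = scA c (b x y)" for x x' y y' c
      using b by (simp_all add: bilinear_map_def module_hom_iff)
    consider y where "u = []" "v = [y]" | y where "u = [y]" "v = []" | "length u + length v \<noteq> 1"
      by (cases u; cases v) (auto simp: length_Suc_conv)
    then have "?g (u @ (x + y) # v) = ?g (u @ x # v) + ?g (u @ y # v) \<and> ?g (u @ scU c x # v) = scA c (?g (u @ x # v))"
      by cases (auto simp: b')
    then show "?g (u @ (x + y) # v) = ?g (u @ x # v) + ?g (u @ y # v)" "?g (u @ scU c x # v) = scA c (?g (u @ x # v))"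
      by blast+
  qed
  from A_lift[OF A.module_axioms this] obtain h where h: "module_hom scA scA h" "\<And>us. h (pure us) = ?g us" by blast
  let ?Q = "\<lambda>h. module_hom scA scA h \<and> (\<forall>us. h (pure us) = ?g us)"
  have Q: "?Q (on_tensors2 scA j b)"
    unfolding on_tensors2_def
  proof (rule theI[of ?Q])
    show "?Q h" using h by blast
    show "h' = h" if "?Q h'" for h' using that h by (intro A_hom_eq[of scA]) simp_all
  qed
  then show "module_hom scA scA (on_tensors2 scA j b)" by blast
  from Q show "length us \<noteq> 2 \<Longrightarrow> on_tensors2 scA j b (pure us) = 0" by simp
  from Q have "on_tensors2 scA j b (pure [u, v]) = ?g [u, v]" by blast
  then show "on_tensors2 scA j b (j u * j v) = b u v" by simp
qed

lemma LA_T2: "a \<in> T 2 \<Longrightarrow> LA x a \<in> T 2"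
  by (induction a rule: T2_induct) (simp_all add: LA_mult LA(2) T2_jj T_add LA_add LA_sc T_sc LA_0 T_0)

lemma ev_T2: "a \<in> T 2 \<Longrightarrow> ev a u \<in> T 2"
  by (induction u rule: U_induct) (simp_all add: ev_1 ev_\<iota> LA_T2 ev_add ev_sc ev_0 T_add T_sc T_0)

text \<open>On degree 2, \<open>LA x\<close> is factorwise left multiplication by the coproduct of
  \<open>\<iota> x\<close>, so it commutes with factorwise multiplication from the right.\<close>

lemma LA_fm: "s \<in> T 2 \<Longrightarrow> t \<in> T 2 \<Longrightarrow> fm (LA x s) t = LA x (fm s t)"
proof (induction s rule: T2_induct)
  case (jj a b)
  then show ?case
    by (induction t rule: T2_induct)
      (simp_all add: LA_mult LA(2) fm_jj fm_add_left fm_add_right LA_add fm_sc_right LA_sc fm_0 LA_0 mult.assoc)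
qed (simp_all add: LA_add fm_add_left LA_sc fm_sc_left LA_0 fm_0)

lemma ev_fm: "s \<in> T 2 \<Longrightarrow> t \<in> T 2 \<Longrightarrow> fm (ev s u) t = ev (fm s t) u"
  by (induction u rule: U_induct)
    (simp_all add: ev_1 ev_\<iota> LA_fm ev_T2 ev_add fm_add_left ev_sc fm_sc_left ev_0 fm_0)

text \<open>The action on \<open>j 1 * j 1\<close> meets the description of the coproduct,
  multiplicativity following from \<open>ev_fm\<close> and \<open>ev_mult\<close>. Uniqueness holds
  because the image of \<open>\<iota>\<close> generates \<open>U\<close>.\<close>

lemma coproduct_ev: "coproduct scU \<iota> scA j u = ev (j 1 * j 1) u"
proof -
  let ?Q = "\<lambda>d. module_hom scU scA d \<and> range d \<subseteq> T 2 \<and> d 1 = j 1 * j 1 \<and>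
    (\<forall>u v. d (u * v) = fm (d u) (d v)) \<and> (\<forall>x. d (\<iota> x) = j (\<iota> x) * j 1 + j 1 * j (\<iota> x))"
  have Q: "?Q (ev (j 1 * j 1))"
  proof (intro conjI allI)
    show "module_hom scU scA (ev (j 1 * j 1))" by (rule ev_hom)
    show "range (ev (j 1 * j 1)) \<subseteq> T 2" using ev_T2[OF T2_jj] by blast
    show "ev (j 1 * j 1) 1 = j 1 * j 1" by (rule ev_1)
    fix u v
    show "ev (j 1 * j 1) (u * v) = fm (ev (j 1 * j 1) u) (ev (j 1 * j 1) v)"
      by (simp add: ev_fm T2_jj ev_T2 fm_one ev_mult)
    fix x
    show "ev (j 1 * j 1) (\<iota> x) = j (\<iota> x) * j 1 + j 1 * j (\<iota> x)"
      using ev_\<iota>[of "j 1 * j 1" x 1] by (simp add: ev_1 LA_mult LA(2))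
  qed
  have "(THE d. ?Q d) = ev (j 1 * j 1)"
  proof (rule the_equality[where P = ?Q, OF Q])
    fix d assume d: "?Q d"
    show "d = ev (j 1 * j 1)"
    proof
      fix u
      have d0: "d 0 = 0" using d module_hom.zero by blast
      show "d u = ev (j 1 * j 1) u"
        by (induction u rule: U_induct) (use d Q d0 ev_0 in \<open>simp_all add: module_hom_iff\<close>)
    qed
  qed
  then show ?thesis unfolding coproduct_def by simp
qed

text \<open>The candidate is the lift of the function that is 1 on the empty word and 0 on all
  others.\<close>

lemma counit: "module_hom scU (*) (counit scU \<iota>)" "counit scU \<iota> 1 = 1" "counit scU \<iota> (u * v) = counit scU \<iota> u * counit scU \<iota> v"
  "counit scU \<iota> (\<iota> x) = 0"
proof -
  have R: "module ((*) :: 'r \<Rightarrow> 'r \<Rightarrow> 'r)" by unfold_locales (simp_all add: algebra_simps)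
  let ?g = "\<lambda>xs :: 'g list. if xs = [] then 1 else 0 :: 'r"
  have "multilinear scG (*) ?g" by (simp add: multilinear_def)
  then obtain h where h: "module_hom scU (*) h" "\<And>xs. h (prod_list (map \<iota> xs)) = ?g xs"
    using enveloping_lift[OF env R, of ?g] by auto
  have hl: "h (x + y) = h x + h y" "h (scU c x) = c * h x" "h 0 = 0" for x y c
    using h(1) module_hom.zero[OF h(1)] by (simp_all add: module_hom_iff)
  have h1: "h 1 = 1" using h(2)[of "[]"] by simp
  have h\<iota>: "h (\<iota> x * u) = 0" for x u
  proof -
    have "h (\<iota> x * u) = 0" for u
      by (rule quotient_induct[OF env[unfolded is_enveloping_algebra_def], of "\<lambda>u. h (\<iota> x * u) = 0"])
        (use h(2)[of "x # _"] in \<open>simp_all add: distrib_left hl U.sc_mult_right\<close>)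
    then show ?thesis .
  qed
  let ?Q = "\<lambda>c. module_hom scU (*) c \<and> c 1 = 1 \<and> (\<forall>u v. c (u * v) = c u * c v) \<and> (\<forall>x. c (\<iota> x) = 0)"
  have mult: "h (u * v) = h u * h v" for u v
    by (induction u rule: U_induct) (simp_all add: h1 h\<iota> mult.assoc distrib_right hl U.sc_mult_left)
  have Q: "?Q h" using h(1) h1 mult h\<iota>[of _ 1] by simp
  have "?Q (counit scU \<iota>)"
    unfolding counit_def
  proof (rule theI[of ?Q, OF Q])
    fix c assume c: "?Q c"
    show "c = h"
    proof
      fix u
      have c0: "c 0 = 0" using c module_hom.zero by blast
      show "c u = h u"
        by (induction u rule: U_induct) (use c Q c0 hl in \<open>simp_all add: module_hom_iff\<close>)
    qed
  qed
  then show "module_hom scU (*) (counit scU \<iota>)" "counit scU \<iota> 1 = 1" "counit scU \<iota> (u * v) = counit scU \<iota> u * counit scU \<iota> v"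
    "counit scU \<iota> (\<iota> x) = 0" by blast+
qed

end

section \<open>Naturality in the coefficients\<close>

definition wmap :: "('x \<Rightarrow> 'y) \<Rightarrow> 'x weyl \<Rightarrow> 'y weyl" where
  "wmap h a = (\<lambda>M J. fps_map h (a M J))"

lemma wmap_nth: "wmap h a M J $ m = h (a M J $ m)"
  by (simp add: wmap_def fps_map_def)

lemma wmap_ident [simp]: "wmap (\<lambda>x. x) a = a"
  by (intro ext fps_ext) (simp add: wmap_nth)

lemma wmap_wmap: "wmap h (wmap g a) = wmap (\<lambda>x. h (g x)) a"
  by (intro ext fps_ext) (simp add: wmap_nth)

locale additive_coeff = additive h for h :: "'x::ring_1 \<Rightarrow> 'y::ring_1"
begin

lemma of_nat_mult: "h (of_nat k * x) = of_nat k * h x"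
  by (induction k) (simp_all add: zero add distrib_right)

lemma wmap_add: "wmap h (a + b) = wmap h a + wmap h b"
  by (intro ext fps_ext) (simp add: wmap_nth add)

lemma additive_wmap: "additive (wmap h)"
  by (simp add: additive_def wmap_add)

lemmas wmap_zero = additive.zero[OF additive_wmap]
  and wmap_minus = additive.minus[OF additive_wmap]
  and wmap_diff = additive.diff[OF additive_wmap]
  and wmap_sum = additive.sum[OF additive_wmap]

lemma wmap_sym_mul: "wmap h (sym_mul i a) = sym_mul i (wmap h a)"
  by (intro ext fps_ext) (simp add: wmap_nth sym_mul_def zero)

lemma wmap_sym_ins: "wmap h (sym_ins i a) = sym_ins i (wmap h a)"
  by (intro ext fps_ext)
    (simp add: wmap_nth sym_ins_def fps_nth_of_nat_mult of_nat_mult del: of_nat_add of_nat_Suc)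

lemma wmap_alt_mul: "wmap h (alt_mul i a) = alt_mul i (wmap h a)"
  by (intro ext fps_ext) (simp add: wmap_nth alt_mul_apply alt_sign_def zero minus)

lemma wmap_alt_ins: "wmap h (alt_ins i a) = alt_ins i (wmap h a)"
  by (intro ext fps_ext) (simp add: wmap_nth alt_ins_apply alt_sign_def zero minus)

lemma wmap_alt_sign: "wmap h (alt_sign k a) = alt_sign k (wmap h a)"
  by (simp add: alt_sign_def wmap_minus)

lemma wmap_alt_part: "wmap h (alt_part l a) = alt_part l (wmap h a)"
  by (intro ext fps_ext) (simp add: wmap_nth alt_part_def zero)

lemma wmap_divide: "wmap h (weyl_divide_t a) = weyl_divide_t (wmap h a)"
  by (intro ext fps_ext) (simp add: wmap_nth weyl_divide_t_def)

lemma wmap_embed: "wmap h (weyl_embed \<xi>) = weyl_embed (fps_map h \<xi>)"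
  by (intro ext fps_ext) (simp add: wmap_nth weyl_embed_def fps_map_def zero)

lemma wmap_delta: "wmap h (delta n a) = delta n (wmap h a)"
  by (simp add: delta_def wmap_sum wmap_alt_mul wmap_sym_ins)

end

lemma wmap_weyl_mu:
  assumes k: "additive (k :: 'z::ring_1 \<Rightarrow> 'z'::ring_1)" and p: "\<And>x y. p' (h x) (g y) = k (p x y)"
  shows "weyl_mu p' (wmap h a) (wmap g b) = wmap k (weyl_mu p a b)"
proof (intro ext fps_ext)
  interpret k: additive k by fact
  fix M J m
  have bil: "fps_bilin p' (fps_map h f) (fps_map g f') $ m = k (fps_bilin p f f' $ m)" for f f'
    by (simp add: fps_bilin_def fps_map_def p k.sum)
  have sgn: "alt_sign l f $ m = alt_sign l (f $ m)" for l and f :: "'q::ab_group_add fps"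
    by (simp add: alt_sign_def)
  have ksgn: "k (alt_sign l x) = alt_sign l (k x)" for l x
    by (simp add: alt_sign_def k.minus)
  show "weyl_mu p' (wmap h a) (wmap g b) M J $ m = wmap k (weyl_mu p a b) M J $ m"
    unfolding wmap_nth
    by (simp add: weyl_mu_def fun_additive_sum ext_wedge_def fps_sum_nth sgn k.sum ksgn wmap_def bil)
qed

locale scaled_coeff = additive_coeff h
  for h :: "'x::ring_1 \<Rightarrow> 'y::ring_1" and sc :: "'r::ring_containing_rat \<Rightarrow> 'x \<Rightarrow> 'x" and sc' :: "'r \<Rightarrow> 'y \<Rightarrow> 'y" +
  assumes scale: "h (sc c x) = sc' c (h x)"
begin

lemma wmap_scale: "wmap h (weyl_scale sc c a) = weyl_scale sc' c (wmap h a)"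
  by (intro ext fps_ext) (simp add: wmap_nth weyl_scale_def fps_scale_def fps_map_def scale)

lemma wmap_mu_P:
  assumes "additive_coeff h1" "additive_coeff h2" and p: "\<And>x y. p' (h1 x) (h2 y) = h (p x y)"
  shows "mu_P n \<pi> p' sc' k (wmap h1 a) (wmap h2 b) = wmap h (mu_P n \<pi> p sc k a b)"
proof (induction k arbitrary: a b)
  case 0
  show ?case
    using wmap_weyl_mu[where k = h and p' = p' and p = p and h = h1 and g = h2, OF additive_axioms p] by simp
next
  case (Suc k)
  interpret h1: additive_coeff h1 by fact
  interpret h2: additive_coeff h2 by fact
  show ?case
    by (simp only: mu_P.simps h1.wmap_sym_ins[symmetric] h2.wmap_sym_ins[symmetric] Suc.IH wmap_sum wmap_scale)
qed

text \<open>Both factors and the product may have coefficients in different rings. This covers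
  scalars times sections as well as the pairing of \<open>u\<close> and \<open>v\<close> to
  \<open>j u * j v\<close>.\<close>

lemma wmap_circ:
  assumes "additive_coeff h1" "additive_coeff h2" and p: "\<And>x y. p' (h1 x) (h2 y) = h (p x y)"
  shows "weyl_circ n \<pi> p' sc' (wmap h1 a) (wmap h2 b) = wmap h (weyl_circ n \<pi> p sc a b)"
proof -
  have "mu_P n \<pi> p' sc' k (wmap h1 a) (wmap h2 b) = wmap h (mu_P n \<pi> p sc k a b)" for k
    by (rule wmap_mu_P[OF assms(1,2)]) (rule p)
  then show ?thesis
    by (intro ext fps_ext) (simp add: weyl_circ_def wmap_nth sum scale)
qed

lemma additive_coeff_ident: "additive_coeff (\<lambda>x :: 'b::ring_1. x)"
  by unfold_locales simp

lemma wmap_ad: "weyl_ad n \<pi> sc' \<rho> (wmap h a) = wmap h (weyl_ad n \<pi> sc \<rho> a)"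
proof -
  have l: "weyl_circ n \<pi> sc' sc' x (wmap h b) = wmap h (weyl_circ n \<pi> sc sc x b)" for x b
    using wmap_circ[OF additive_coeff_ident additive_coeff_axioms, of sc' sc n \<pi> x b] by (simp add: scale)
  have r: "weyl_circ n \<pi> (\<lambda>v c. sc' c v) sc' (wmap h b) x = wmap h (weyl_circ n \<pi> (\<lambda>v c. sc c v) sc b x)" for x b
    using wmap_circ[OF additive_coeff_axioms additive_coeff_ident, of "\<lambda>v c. sc' c v" "\<lambda>v c. sc c v" n \<pi> b x]
    by (simp add: scale)
  show ?thesis
    unfolding weyl_ad_def wmap_sum wmap_diff wmap_alt_sign wmap_alt_part[symmetric] l r ..
qed

lemma wmap_delta_inv: "delta_inv n sc' (wmap h a) = wmap h (delta_inv n sc a)"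
proof (intro ext fps_ext)
  fix M J m
  have "(\<Sum>i<n. sym_mul i (alt_ins i (wmap h a))) = wmap h (\<Sum>i<n. sym_mul i (alt_ins i a))"
    by (simp only: wmap_sum wmap_sym_mul wmap_alt_ins)
  then show "delta_inv n sc' (wmap h a) M J $ m = wmap h (delta_inv n sc a) M J $ m"
    by (simp add: delta_inv_def wmap_nth fps_scale_def fps_map_def scale zero)
qed

lemma wmap_D: "weyl_D n C \<Gamma> sc' (wmap h a) = wmap h (weyl_D n C \<Gamma> sc a)"
proof -
  have ce: "(\<lambda>M. chevalley_eilenberg n C (fps_scale sc'') (b M)) =
    - (\<Sum>i<n. \<Sum>j<n. \<Sum>k<n. weyl_scale sc'' (rat_const (1/2) * C i j k) (alt_mul i (alt_mul j (alt_ins k b))))"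
    for sc'' :: "'r \<Rightarrow> 'b::ring_1 \<Rightarrow> 'b" and b
    by (simp add: fun_eq_iff chevalley_eilenberg_def fun_additive_sum ext_scale_def weyl_scale_def
        alt_mul_def alt_ins_def)
  show ?thesis
    unfolding weyl_D_def nabla_sym_def ce wmap_add wmap_minus wmap_sum wmap_alt_mul wmap_scale wmap_sym_mul
      wmap_sym_ins wmap_alt_ins ..
qed

lemma wmap_L:
  assumes "\<And>i x. i < n \<Longrightarrow> h (act i x) = act' i (h x)"
  shows "weyl_L n act' (wmap h a) = wmap h (weyl_L n act a)"
proof -
  have "wmap h (\<lambda>M J. fps_map (act i) (a M J)) = (\<lambda>M J. fps_map (act' i) (wmap h a M J))" if "i < n" for i
    using assms[OF that] by (intro ext fps_ext) (simp add: wmap_nth fps_map_def)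
  then show ?thesis
    unfolding weyl_L_def wmap_sum wmap_alt_mul by (intro sum.cong refl) simp
qed

lemma wmap_op:
  assumes "\<And>i x. i < n \<Longrightarrow> h (act i x) = act' i (h x)"
  shows "fedosov_op n C \<Gamma> \<pi> sc' act' \<rho> (wmap h a) = wmap h (fedosov_op n C \<Gamma> \<pi> sc act \<rho> a)"
proof -
  have L: "weyl_L n act' (wmap h a) = wmap h (weyl_L n act a)"
    by (rule wmap_L) (rule assms)
  show ?thesis by (simp only: fedosov_op_def wmap_D L wmap_ad wmap_add wmap_divide)
qed

end

definition tau_iterate ::
  "nat \<Rightarrow> (nat \<Rightarrow> nat \<Rightarrow> nat \<Rightarrow> 'r::ring_containing_rat) \<Rightarrow> (nat \<Rightarrow> nat \<Rightarrow> nat \<Rightarrow> 'r) \<Rightarrow> (nat \<Rightarrow> nat \<Rightarrow> 'r) \<Rightarrow>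
    ('r \<Rightarrow> 'v \<Rightarrow> 'v) \<Rightarrow> (nat \<Rightarrow> 'v \<Rightarrow> 'v) \<Rightarrow> 'r weyl \<Rightarrow> 'v::ring_1 fps \<Rightarrow> nat \<Rightarrow> 'v weyl" where
  "tau_iterate n C \<Gamma> \<pi> sc act \<rho> \<xi> k =
    ((\<lambda>a. delta_inv n sc (fedosov_op n C \<Gamma> \<pi> sc act \<rho> a) +
      fedosov_op n C \<Gamma> \<pi> sc act \<rho> (delta_inv n sc a)) ^^ k) (weyl_embed \<xi>)"

text \<open>The section \<open>\<tau>\<close> with \<open>\<rho>\<close> kept scalar, so that it makes sense for an arbitrary module of coefficients.\<close>

definition tau_sum ::
  "nat \<Rightarrow> (nat \<Rightarrow> nat \<Rightarrow> nat \<Rightarrow> 'r::ring_containing_rat) \<Rightarrow> (nat \<Rightarrow> nat \<Rightarrow> nat \<Rightarrow> 'r) \<Rightarrow> (nat \<Rightarrow> nat \<Rightarrow> 'r) \<Rightarrow>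
    ('r \<Rightarrow> 'v \<Rightarrow> 'v) \<Rightarrow> (nat \<Rightarrow> 'v \<Rightarrow> 'v) \<Rightarrow> 'r weyl \<Rightarrow> 'v::ring_1 fps \<Rightarrow> 'v weyl" where
  "tau_sum n C \<Gamma> \<pi> sc act \<rho> \<xi> = (\<lambda>M J. Abs_fps (\<lambda>m.
    \<Sum>k\<le>size M + 2 * m. tau_iterate n C \<Gamma> \<pi> sc act \<rho> \<xi> k M J $ m))"

lemma (in scaled_coeff) wmap_tau_sum:
  assumes "\<And>i x. i < n \<Longrightarrow> h (act i x) = act' i (h x)"
  shows "wmap h (tau_sum n C \<Gamma> \<pi> sc act \<rho> \<xi>) = tau_sum n C \<Gamma> \<pi> sc' act' \<rho> (fps_map h \<xi>)"
proof -
  have it: "wmap h (tau_iterate n C \<Gamma> \<pi> sc act \<rho> \<xi> k) = tau_iterate n C \<Gamma> \<pi> sc' act' \<rho> (fps_map h \<xi>) k" for k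
  proof (induction k)
    case 0
    show ?case by (simp add: tau_iterate_def wmap_embed)
  next
    case (Suc k)
    have step: "tau_iterate n C \<Gamma> \<pi> sc'' act'' \<rho> \<zeta> (Suc k) =
      delta_inv n sc'' (fedosov_op n C \<Gamma> \<pi> sc'' act'' \<rho> (tau_iterate n C \<Gamma> \<pi> sc'' act'' \<rho> \<zeta> k)) +
      fedosov_op n C \<Gamma> \<pi> sc'' act'' \<rho> (delta_inv n sc'' (tau_iterate n C \<Gamma> \<pi> sc'' act'' \<rho> \<zeta> k))"
      for sc'' :: "'r \<Rightarrow> 'b::ring_1 \<Rightarrow> 'b" and act'' \<zeta>
      unfolding tau_iterate_def funpow.simps comp_def ..
    have op: "wmap h (fedosov_op n C \<Gamma> \<pi> sc act \<rho> x) = fedosov_op n C \<Gamma> \<pi> sc' act' \<rho> (wmap h x)" for x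
      by (rule wmap_op[symmetric]) (rule assms)
    show ?case by (simp only: step wmap_add wmap_delta_inv[symmetric] op Suc.IH)
  qed
  show ?thesis
    by (intro ext fps_ext) (simp add: wmap_nth tau_sum_def sum it[symmetric])
qed

text \<open>The definitions keep \<rho> scalar, while the theory of flat sections has it in the
  coefficient algebra. Here the two versions are identified.\<close>

locale fedosov_scalar = fedosov_solution sc n \<pi> C \<Gamma> act r s w Q P Om \<rho>
  for sc :: "'r::ring_containing_rat \<Rightarrow> 'v::ring_1 \<Rightarrow> 'v" and n \<pi> C \<Gamma> act r s w Q P Om \<rho> +
  fixes \<rho>0 :: "'r weyl"
  assumes \<rho>0: "\<rho>0 \<in> weyl_space n 2 1" and \<rho>_\<rho>0: "\<rho> = wmap (\<lambda>c. sc c 1) \<rho>0"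
begin

lemma alt_part_weyl_space: "a \<in> weyl_space n k l \<Longrightarrow> alt_part l' a = (if l' = l then a else 0)"
proof (intro ext fps_ext)
  fix M J m assume a: "a \<in> weyl_space n k l"
  show "alt_part l' a M J $ m = (if l' = l then a else 0) M J $ m"
    using weyl_spaceD(3)[OF a, of M J m] by (cases "a M J $ m = 0") (auto simp: alt_part_def)
qed

lemma weyl_circ_scalar:
  "weyl_circ n \<pi> sc sc x a = wmap (\<lambda>c. sc c 1) x \<bullet> a"
  "weyl_circ n \<pi> (\<lambda>v c. sc c v) sc a x = a \<bullet> wmap (\<lambda>c. sc c 1) x"
proof -
  interpret i: scaled_coeff "\<lambda>v. v" sc sc by unfold_locales simp_all
  have e: "additive_coeff (\<lambda>c. sc c 1)" by unfold_locales (simp add: scale_left_distrib)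
  show "weyl_circ n \<pi> sc sc x a = wmap (\<lambda>c. sc c 1) x \<bullet> a"
    using i.wmap_circ[OF e i.additive_coeff_axioms, of "(*)" sc n \<pi> x a] by (simp add: sc_mult_left)
  show "weyl_circ n \<pi> (\<lambda>v c. sc c v) sc a x = a \<bullet> wmap (\<lambda>c. sc c 1) x"
    using i.wmap_circ[OF i.additive_coeff_axioms e, of "(*)" "\<lambda>v c. sc c v" n \<pi> a x] by (simp add: sc_mult_right)
qed

text \<open>The double sum over degrees up to \<open>n\<close> meets degree 1 for \<rho> and degree
  \<open>l\<close> for \<open>a\<close>. If one of these exceeds \<open>n\<close>, the corresponding
  element is 0, since there are no forms above degree \<open>n\<close>.\<close>

lemma weyl_ad_eq:
  assumes a: "a \<in> weyl_space n k l"
  shows "weyl_ad n \<pi> sc \<rho>0 a = ad\<rho> a"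
proof (cases "1 \<le> n \<and> l \<le> n")
  case True
  interpret e: additive_coeff "\<lambda>c. sc c 1" by unfold_locales (simp add: scale_left_distrib)
  have "weyl_ad n \<pi> sc \<rho>0 a = (\<Sum>k'\<le>n. \<Sum>l'\<le>n. if k' = 1 then if l' = l then \<rho> \<bullet> a - alt_sign l (a \<bullet> \<rho>) else 0 else 0)"
    unfolding weyl_ad_def weyl_circ_scalar alt_part_weyl_space[OF \<rho>0] alt_part_weyl_space[OF a]
    by (intro sum.cong refl) (auto simp: \<rho>_\<rho>0 circ_zero_left circ_zero_right e.wmap_zero)
  also have "\<dots> = (\<Sum>k'\<le>n. if k' = 1 then \<Sum>l'\<le>n. if l' = l then \<rho> \<bullet> a - alt_sign l (a \<bullet> \<rho>) else 0 else 0)"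
    by (intro sum.cong refl) simp
  also have "\<dots> = \<rho> \<bullet> a - alt_sign l (a \<bullet> \<rho>)" using True by simp
  also have "\<dots> = ad\<rho> a"
    unfolding ad\<rho>_def gam_weyl_space[OF a] by (simp add: alt_sign_def circ_minus_left)
  finally show ?thesis .
next
  case False
  interpret e: additive_coeff "\<lambda>c. sc c 1" by unfold_locales (simp add: scale_left_distrib)
  have "\<rho>0 = 0 \<or> a = 0"
    using False weyl_space_card_gt[OF \<rho>0] weyl_space_card_gt[OF a] by (metis not_le)
  then show ?thesis
  proof
    assume z: "\<rho>0 = 0"
    then have r: "\<rho> = 0" unfolding \<rho>_\<rho>0 by (simp only: e.wmap_zero)
    have ap: "alt_part k' \<rho>0 = 0" for k' unfolding z by (intro ext) (simp add: alt_part_def)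
    show ?thesis
      unfolding weyl_ad_def ad\<rho>_def weyl_circ_scalar
      by (simp only: r ap e.wmap_zero circ_zero_left circ_zero_right alt_sign.zero diff_self sum.neutral_const)
  next
    assume z: "a = 0"
    have ap: "alt_part k' (0 :: 'v weyl) = 0" for k' by (intro ext) (simp add: alt_part_def)
    show ?thesis
      unfolding weyl_ad_def ad\<rho>_def weyl_circ_scalar z
      by (simp only: ap gam.zero circ_zero_left circ_zero_right alt_sign.zero diff_self sum.neutral_const)
  qed
qed

lemma fedosov_op_eq: "a \<in> weyl_space n k l \<Longrightarrow> fedosov_op n C \<Gamma> \<pi> sc act \<rho>0 a = op a"
  unfolding fedosov_op_def op_def weyl_D_plus_L[symmetric] by (simp only: weyl_ad_eq)

lemma tau_iterate_eq: "tau_iterate n C \<Gamma> \<pi> sc act \<rho>0 \<xi> k = (tau_step ^^ k) (weyl_embed \<xi>)"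
proof (induction k)
  case 0
  show ?case by (simp add: tau_iterate_def)
next
  case (Suc k)
  let ?s = "(tau_step ^^ k) (weyl_embed \<xi>)"
  note s = tau_step_power_space[of k \<xi>]
  have "tau_iterate n C \<Gamma> \<pi> sc act \<rho>0 \<xi> (Suc k) =
    dinv (fedosov_op n C \<Gamma> \<pi> sc act \<rho>0 ?s) + fedosov_op n C \<Gamma> \<pi> sc act \<rho>0 (dinv ?s)"
    unfolding Suc.IH[symmetric] unfolding tau_iterate_def funpow.simps comp_def ..
  also have "\<dots> = tau_step ?s"
    unfolding fedosov_op_eq[OF s] dinv_weyl_space_0[OF s] fedosov_op_eq[OF weyl_space_0] op.zero tau_step_def
    by (rule add_0_right)
  finally show ?case unfolding funpow.simps comp_def .
qed

lemma tau_sum_eq: "tau_sum n C \<Gamma> \<pi> sc act \<rho>0 \<xi> = tau \<xi>"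
  unfolding tau_sum_def tau_def tau_iterate_eq ..

lemma fedosov_tau_eq: "fedosov_tau n C \<Gamma> \<pi> sc act \<rho>0 \<xi> = tau \<xi>"
proof (intro ext fps_ext)
  fix M J m
  have "Sum_any (\<lambda>k. tau_iterate n C \<Gamma> \<pi> sc act \<rho>0 \<xi> k M J $ m) =
    (\<Sum>k\<le>size M + 2 * m. tau_iterate n C \<Gamma> \<pi> sc act \<rho>0 \<xi> k M J $ m)"
  proof (rule Sum_any.expand_superset)
    show "{k. tau_iterate n C \<Gamma> \<pi> sc act \<rho>0 \<xi> k M J $ m \<noteq> 0} \<subseteq> {..size M + 2 * m}"
    proof
      fix k assume k: "k \<in> {k. tau_iterate n C \<Gamma> \<pi> sc act \<rho>0 \<xi> k M J $ m \<noteq> 0}"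
      show "k \<in> {..size M + 2 * m}"
      proof (rule ccontr)
        assume "k \<notin> {..size M + 2 * m}"
        then have "tau_iterate n C \<Gamma> \<pi> sc act \<rho>0 \<xi> k M J $ m = 0"
          unfolding tau_iterate_eq by (intro tau_step_power_nth) simp
        with k show False by simp
      qed
    qed
  qed simp
  then show "fedosov_tau n C \<Gamma> \<pi> sc act \<rho>0 \<xi> M J $ m = tau \<xi> M J $ m"
    unfolding tau_sum_eq[symmetric] by (simp add: fedosov_tau_def tau_sum_def tau_iterate_def)
qed

lemma fedosov_star_eq: "fedosov_star n C \<Gamma> \<pi> sc act \<rho>0 \<xi> \<eta> = star \<xi> \<eta>"
  unfolding fedosov_star_def fedosov_tau_eq star_def ..

end

section \<open>The geometric data in coordinates\<close>

locale symplectic_data =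
  fixes scG :: "'r::ring_containing_rat \<Rightarrow> 'g::ab_group_add \<Rightarrow> 'g"
    and br :: "'g \<Rightarrow> 'g \<Rightarrow> 'g" and n :: nat and e :: "nat \<Rightarrow> 'g"
    and r \<omega> s :: "nat \<Rightarrow> nat \<Rightarrow> 'r" and nabla :: "'g \<Rightarrow> 'g \<Rightarrow> 'g" and \<Omega> :: "'r fps ext"
  assumes lie: "lie_algebra scG br"
    and basis: "is_basis scG n e"
    and r_antisym: "i < n \<Longrightarrow> j < n \<Longrightarrow> r i j = - r j i"
    and nondegenerate: "inverse_matrices n r \<omega>"
    and nabla_bilinear: "bilinear_map scG scG scG nabla"
    and nabla_torsion_free: "torsion_free br nabla"
    and nabla_symplectic: "nabla_form nabla x (two_form scG n e \<omega>) y z = 0"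
    and s_symmetric: "i < n \<Longrightarrow> j < n \<Longrightarrow> s i j = s j i"
    and s_parallel: "i < n \<Longrightarrow> k < n \<Longrightarrow> nabla_tensor scG n e nabla x s i k = 0"
    and Omega_form: "\<Omega> \<in> formal_forms n 2"
    and Omega_closed: "chevalley_eilenberg n (coeffs scG n e br) (fps_scale (*)) \<Omega> = 0"
begin

sublocale G: module scG
  using lie by (simp add: lie_algebra_def)

abbreviation db :: "nat \<Rightarrow> 'g \<Rightarrow> 'r" where "db \<equiv> dual_basis scG n e"
abbreviation C where "C \<equiv> coeffs scG n e br"
abbreviation \<Gamma> where "\<Gamma> \<equiv> coeffs scG n e nabla"
abbreviation \<pi> where "\<pi> \<equiv> (\<lambda>i k. r i k + s i k)"

lemma indep: "G.independent (e ` {..<n})" and span: "x \<in> G.span (e ` {..<n})" and inj: "inj_on e {..<n}"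
  using basis by (auto simp: is_basis_def)

lemma db_add: "db k (x + y) = db k x + db k y"
  by (simp add: dual_basis_def G.representation_add[OF indep span span])

lemma db_sc: "db k (scG c x) = c * db k x"
  by (simp add: dual_basis_def G.representation_scale[OF indep span])

sublocale db: additive "db k" for k
  by unfold_locales (rule db_add)

lemma db_e: "i < n \<Longrightarrow> k < n \<Longrightarrow> db k (e i) = (if i = k then 1 else 0)"
  using G.representation_basis[OF indep, of "e i"] inj by (auto simp: dual_basis_def inj_on_eq_iff)

lemma expand: "x = (\<Sum>k<n. scG (db k x) (e k))"
proof -
  have "(\<Sum>b\<in>e ` {..<n}. scG (G.representation (e ` {..<n}) x b) b) = x"
    by (rule G.sum_representation_eq[OF indep span]) auto
  then show ?thesis by (simp add: sum.reindex[OF inj] dual_basis_def)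
qed

lemma bilinear_db:
  assumes b: "bilinear_map scG scG scG b" and i: "i < n"
  shows "db l (b (e i) x) = (\<Sum>m<n. db m x * coeffs scG n e b i m l)"
    "db l (b x (e i)) = (\<Sum>m<n. db m x * coeffs scG n e b m i l)"
proof -
  have b': "additive (b y)" "b y (scG c z) = scG c (b y z)" "additive (\<lambda>x. b x y)" "b (scG c z) y = scG c (b z y)" for y z c
    using b by (simp_all add: bilinear_map_def module_hom_iff additive_def)
  have "b (e i) x = (\<Sum>m<n. scG (db m x) (b (e i) (e m)))"
    by (subst expand[of x]) (simp add: additive.sum[OF b'(1)] b'(2))
  then show "db l (b (e i) x) = (\<Sum>m<n. db m x * coeffs scG n e b i m l)"
    by (simp add: db.sum db_sc coeffs_def)
  have "b x (e i) = (\<Sum>m<n. scG (db m x) (b (e m) (e i)))"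
    by (subst expand[of x]) (simp add: additive.sum[OF b'(3)] b'(4))
  then show "db l (b x (e i)) = (\<Sum>m<n. db m x * coeffs scG n e b m i l)"
    by (simp add: db.sum db_sc coeffs_def)
qed

lemma br_bilinear: "bilinear_map scG scG scG br" and br_self: "br x x = 0"
  and br_jacobi: "br x (br y z) + br y (br z x) + br z (br x y) = 0"
  using lie by (auto simp: lie_algebra_def)

lemma br_antisym: "br x y = - br y x"
proof -
  have "br (x + y) (x + y) = br x x + br x y + (br y x + br y y)"
    using br_bilinear by (simp add: bilinear_map_def module_hom_iff algebra_simps)
  then show ?thesis by (simp add: br_self eq_neg_iff_add_eq_0)
qed

lemma C_antisym: "C i j k = - C j i k"
  unfolding coeffs_def by (subst br_antisym) (rule db.minus)

lemma torsion: "\<Gamma> i j k - \<Gamma> j i k = C i j k"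
  using nabla_torsion_free unfolding torsion_free_def coeffs_def db.diff[symmetric] by simp

lemma jacobi:
  assumes "i < n" "j < n" "k < n"
  shows "(\<Sum>m<n. C i j m * C m k l + C j k m * C m i l + C k i m * C m j l) = 0"
proof -
  have d: "db l (br (br (e p) (e q)) (e t)) = (\<Sum>m<n. C p q m * C m t l)" if "t < n" for p q t
    using bilinear_db(2)[OF br_bilinear that, of l "br (e p) (e q)"] by (simp only: coeffs_def)
  have "br (br x y) z + br (br y z) x + br (br z x) y = 0" for x y z
  proof -
    have "br (br x y) z + br (br y z) x + br (br z x) y = - (br x (br y z) + br y (br z x) + br z (br x y))"
      using br_antisym[of "br x y" z] br_antisym[of "br y z" x] br_antisym[of "br z x" y] by (simp add: algebra_simps)
    then show ?thesis by (simp add: br_jacobi)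
  qed
  then have "db l (br (br (e i) (e j)) (e k) + br (br (e j) (e k)) (e i) + br (br (e k) (e i)) (e j)) = 0"
    by (simp only: db.zero)
  then show ?thesis by (simp add: db_add d assms sum.distrib)
qed

lemma r_w: "i < n \<Longrightarrow> k < n \<Longrightarrow> (\<Sum>j<n. r i j * \<omega> j k) = (if i = k then 1 else 0)"
  and w_r: "i < n \<Longrightarrow> k < n \<Longrightarrow> (\<Sum>j<n. \<omega> i j * r j k) = (if i = k then 1 else 0)"
  using nondegenerate by (simp_all add: inverse_matrices_def)

text \<open>The product of \<open>\<omega>\<close>, \<open>r\<close> and the transpose of
  \<open>\<omega>\<close> is evaluated from both ends, once after using the antisymmetry of
  \<open>r\<close>.\<close>

lemma \<omega>_antisym:
  assumes "i < n" "k < n" shows "\<omega> i k = - \<omega> k i"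
proof -
  have "(\<Sum>a<n. \<Sum>b<n. \<omega> i a * r a b * \<omega> k b) = (\<Sum>b<n. (\<Sum>a<n. \<omega> i a * r a b) * \<omega> k b)"
    by (subst sum.swap) (simp add: sum_distrib_right)
  also have "\<dots> = (\<Sum>b<n. if i = b then \<omega> k b else 0)"
    using assms by (intro sum.cong refl) (simp add: w_r)
  also have "\<dots> = \<omega> k i" using assms by simp
  finally have 1: "(\<Sum>a<n. \<Sum>b<n. \<omega> i a * r a b * \<omega> k b) = \<omega> k i" .
  have "(\<Sum>a<n. \<Sum>b<n. \<omega> i a * r a b * \<omega> k b) = (\<Sum>a<n. - (\<omega> i a * (\<Sum>b<n. \<omega> k b * r b a)))"
    unfolding sum_distrib_left sum_negf[symmetric]
  proof (intro sum.cong refl)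
    fix a b assume "a \<in> {..<n}" "b \<in> {..<n}"
    then show "\<omega> i a * r a b * \<omega> k b = - (\<omega> i a * (\<omega> k b * r b a))"
      using r_antisym[of a b] by (simp add: algebra_simps)
  qed
  also have "\<dots> = (\<Sum>a<n. if k = a then - \<omega> i a else 0)"
    using assms by (intro sum.cong refl) (simp add: w_r)
  also have "\<dots> = - \<omega> i k" using assms by simp
  finally show ?thesis using 1 by simp
qed

abbreviation om :: "'g \<Rightarrow> 'g \<Rightarrow> 'r" where "om \<equiv> two_form scG n e \<omega>"

lemma om_add: "om (x + x') y = om x y + om x' y" "om x (y + y') = om x y + om x y'"
  by (simp_all add: two_form_def db_add algebra_simps sum.distrib)

lemma om_diff: "om (x - x') y = om x y - om x' y" "om x (y - y') = om x y - om x y'"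
  using om_add(1)[of "x - x'" x' y] apply simp
  using om_add(2)[of x "y - y'" y'] apply simp
  done

lemma om_antisym: "om x y = - om y x"
proof -
  have "om y x = (\<Sum>j<n. \<Sum>i<n. \<omega> i j * db i y * db j x)" unfolding two_form_def by (rule sum.swap)
  also have "\<dots> = (\<Sum>j<n. \<Sum>i<n. - (\<omega> j i * db j x * db i y))"
  proof (intro sum.cong refl)
    fix k i assume "k \<in> {..<n}" "i \<in> {..<n}"
    then have "\<omega> i k = - \<omega> k i" by (intro \<omega>_antisym) simp_all
    then show "\<omega> i k * db i y * db k x = - (\<omega> k i * db k x * db i y)" by (simp add: ac_simps)
  qed
  finally show ?thesis by (simp add: two_form_def sum_negf)
qed

lemma om_e: "i < n \<Longrightarrow> om (e i) y = (\<Sum>m<n. \<omega> i m * db m y)"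
proof -
  assume i: "i < n"
  have "om (e i) y = (\<Sum>k<n. if i = k then \<Sum>m<n. \<omega> k m * db m y else 0)"
    unfolding two_form_def using i by (intro sum.cong refl) (simp add: db_e)
  then show ?thesis using i by simp
qed

lemma om_nabla: "om (nabla x y) z = - om y (nabla x z)"
proof -
  have "- om (nabla x y) z = om y (nabla x z)"
    using nabla_symplectic[of x y z] unfolding nabla_form_def by (simp only: right_minus_eq)
  then have "- (- om (nabla x y) z) = - om y (nabla x z)" by (simp only:)
  then show ?thesis by simp
qed

section \<open>Curvature and infinitesimal symmetries in coordinates\<close>

definition Q :: "nat \<Rightarrow> nat \<Rightarrow> nat \<Rightarrow> nat \<Rightarrow> 'r" where
  "Q i j k l = om (e k) (curvature br nabla (e i) (e j) (e l))"

text \<open>Minus the curvature matrix by \<open>curvature_P\<close>; the sign reflects the action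
  on the dual space.\<close>

definition P :: "nat \<Rightarrow> nat \<Rightarrow> nat \<Rightarrow> nat \<Rightarrow> 'r" where
  "P i j p q = (\<Sum>m<n. \<Gamma> i p m * \<Gamma> j m q - \<Gamma> j p m * \<Gamma> i m q) + (\<Sum>k<n. C i j k * \<Gamma> k p q)"

text \<open>Each covariant derivative is skew for \<open>om\<close>, and commutators of skew maps
  are skew. So the curvature takes values in the symplectic Lie algebra, which makes
  \<open>Q\<close> symmetric in its last two indices.\<close>

lemma om_curvature: "om (curvature br nabla x y z) u = - om z (curvature br nabla x y u)"
  unfolding curvature_def by (simp add: om_diff om_nabla)

lemma Q_sym: "Q i j k l = Q i j l k"
proof -
  have "Q i j k l = - om (curvature br nabla (e i) (e j) (e l)) (e k)"
    unfolding Q_def by (rule om_antisym)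
  then show ?thesis unfolding om_curvature Q_def by simp
qed

lemma curvature_P:
  assumes "i < n" "j < n" "l < n" "q < n"
  shows "db q (curvature br nabla (e i) (e j) (e l)) = - P i j l q"
proof -
  have d: "db q (nabla (e a) (nabla (e b) (e l))) = (\<Sum>m<n. \<Gamma> b l m * \<Gamma> a m q)" if "a < n" for a b
    using bilinear_db(1)[OF nabla_bilinear that, of q "nabla (e b) (e l)"] by (simp only: coeffs_def)
  have "db q (nabla (br (e i) (e j)) (e l)) = (\<Sum>m<n. C i j m * \<Gamma> m l q)"
    using bilinear_db(2)[OF nabla_bilinear assms(3), of q "br (e i) (e j)"] by (simp only: coeffs_def)
  then show ?thesis
    unfolding curvature_def db.diff using d[OF assms(1)] d[OF assms(2)]
    by (simp add: P_def sum_subtractf)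
qed

lemma r_Q:
  assumes "i < n" "j < n" "l < n" "q < n"
  shows "(\<Sum>p<n. r p q * Q i j p l) = P i j l q"
proof -
  have "(\<Sum>p<n. r p q * Q i j p l) = (\<Sum>p<n. \<Sum>m<n. r q p * \<omega> p m * P i j l m)"
  proof (intro sum.cong refl)
    fix p assume "p \<in> {..<n}"
    then have p: "p < n" by simp
    show "r p q * Q i j p l = (\<Sum>m<n. r q p * \<omega> p m * P i j l m)"
      unfolding Q_def om_e[OF p] sum_distrib_left r_antisym[OF p assms(4)]
      using assms by (intro sum.cong refl) (simp add: curvature_P mult.assoc)
  qed
  also have "\<dots> = (\<Sum>m<n. (\<Sum>p<n. r q p * \<omega> p m) * P i j l m)"
    by (subst sum.swap) (simp add: sum_distrib_right)
  also have "\<dots> = (\<Sum>m<n. if q = m then P i j l m else 0)"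
    using assms by (intro sum.cong refl) (simp add: r_w)
  finally show ?thesis using assms by simp
qed

text \<open>\<open>G\<close> is an infinitesimal symmetry of the tensor with coefficients
  \<open>t\<close>.\<close>

definition invariant :: "(nat \<Rightarrow> nat \<Rightarrow> 'r) \<Rightarrow> (nat \<Rightarrow> nat \<Rightarrow> 'r) \<Rightarrow> bool" where
  "invariant t G \<longleftrightarrow> (\<forall>k<n. \<forall>l<n. (\<Sum>m<n. t m l * G m k + t k m * G m l) = 0)"

lemma invariant_s: "i < n \<Longrightarrow> invariant s (\<Gamma> i)"
  using s_parallel[of _ _ "e i"] unfolding invariant_def nabla_tensor_def coeffs_def by blast

text \<open>The inverse of a parallel form is parallel: the invariance of \<open>\<omega>\<close> is
  sandwiched between two copies of \<open>r\<close>.\<close>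

lemma invariant_r:
  assumes i: "i < n" shows "invariant r (\<Gamma> i)"
proof -
  have N: "(\<Sum>m<n. \<Gamma> i a m * \<omega> m b) = - (\<Sum>m<n. \<omega> a m * \<Gamma> i b m)" if "a < n" "b < n" for a b
  proof -
    have "om (nabla (e i) (e a)) (e b) = (\<Sum>m<n. \<Gamma> i a m * \<omega> m b)"
      unfolding om_antisym[of _ "e b"] om_e[OF that(2)] sum_negf[symmetric]
      using \<omega>_antisym[OF that(2)] by (intro sum.cong refl) (simp add: coeffs_def)
    moreover have "om (e a) (nabla (e i) (e b)) = (\<Sum>m<n. \<omega> a m * \<Gamma> i b m)"
      unfolding om_e[OF that(1)] coeffs_def ..
    ultimately show ?thesis using om_nabla[of "e i" "e a" "e b"] by simp
  qed
  show ?thesis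
    unfolding invariant_def
  proof (intro allI impI)
    fix k l assume kl: "k < n" "l < n"
    have "(\<Sum>a<n. \<Sum>b<n. r k a * (\<Sum>m<n. \<Gamma> i a m * \<omega> m b) * r b l) =
      (\<Sum>a<n. \<Sum>m<n. r k a * \<Gamma> i a m * (\<Sum>b<n. \<omega> m b * r b l))"
    proof (rule sum.cong[OF refl])
      fix a
      show "(\<Sum>b<n. r k a * (\<Sum>m<n. \<Gamma> i a m * \<omega> m b) * r b l) = (\<Sum>m<n. r k a * \<Gamma> i a m * (\<Sum>b<n. \<omega> m b * r b l))"
        unfolding sum_distrib_left sum_distrib_right by (subst sum.swap) (simp add: mult.assoc)
    qed
    also have "\<dots> = (\<Sum>a<n. \<Sum>m<n. if m = l then r k a * \<Gamma> i a m else 0)"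
      using kl by (intro sum.cong refl) (simp add: w_r)
    also have "\<dots> = (\<Sum>a<n. r k a * \<Gamma> i a l)" using kl by simp
    finally have 1: "(\<Sum>a<n. \<Sum>b<n. r k a * (\<Sum>m<n. \<Gamma> i a m * \<omega> m b) * r b l) = (\<Sum>a<n. r k a * \<Gamma> i a l)" .
    have "(\<Sum>a<n. \<Sum>b<n. r k a * (\<Sum>m<n. \<omega> a m * \<Gamma> i b m) * r b l) =
      (\<Sum>b<n. \<Sum>m<n. (\<Sum>a<n. r k a * \<omega> a m) * \<Gamma> i b m * r b l)"
    proof -
      have "(\<Sum>a<n. \<Sum>b<n. r k a * (\<Sum>m<n. \<omega> a m * \<Gamma> i b m) * r b l) =
        (\<Sum>b<n. \<Sum>a<n. r k a * (\<Sum>m<n. \<omega> a m * \<Gamma> i b m) * r b l)" by (rule sum.swap)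
      also have "\<dots> = (\<Sum>b<n. \<Sum>m<n. (\<Sum>a<n. r k a * \<omega> a m) * \<Gamma> i b m * r b l)"
      proof (rule sum.cong[OF refl])
        fix b
        show "(\<Sum>a<n. r k a * (\<Sum>m<n. \<omega> a m * \<Gamma> i b m) * r b l) = (\<Sum>m<n. (\<Sum>a<n. r k a * \<omega> a m) * \<Gamma> i b m * r b l)"
          unfolding sum_distrib_left sum_distrib_right by (subst sum.swap) (simp add: mult.assoc)
      qed
      finally show ?thesis .
    qed
    also have "\<dots> = (\<Sum>b<n. \<Sum>m<n. if k = m then \<Gamma> i b m * r b l else 0)"
      using kl by (intro sum.cong refl) (simp add: r_w)
    also have "\<dots> = (\<Sum>b<n. \<Gamma> i b k * r b l)" using kl by simp
    finally have 2: "(\<Sum>a<n. \<Sum>b<n. r k a * (\<Sum>m<n. \<omega> a m * \<Gamma> i b m) * r b l) = (\<Sum>b<n. \<Gamma> i b k * r b l)" .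
    have "(\<Sum>a<n. \<Sum>b<n. r k a * (\<Sum>m<n. \<Gamma> i a m * \<omega> m b) * r b l) =
      - (\<Sum>a<n. \<Sum>b<n. r k a * (\<Sum>m<n. \<omega> a m * \<Gamma> i b m) * r b l)"
      unfolding sum_negf[symmetric] by (intro sum.cong refl) (simp add: N)
    then have "(\<Sum>a<n. r k a * \<Gamma> i a l) + (\<Sum>b<n. \<Gamma> i b k * r b l) = 0" unfolding 1 2 by simp
    then show "(\<Sum>m<n. r m l * \<Gamma> i m k + r k m * \<Gamma> i m l) = 0"
      by (simp add: sum.distrib mult.commute add.commute)
  qed
qed

text \<open>Infinitesimal symmetries form a Lie algebra: moving \<open>t\<close> past the first
  matrix of each product makes the terms cancel in pairs.\<close>

lemma invariant_commutator:
  assumes G: "invariant t G" and H: "invariant t H" and k: "k < n" and l: "l < n"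
  shows "(\<Sum>u<n. t u l * (\<Sum>m<n. G u m * H m k - H u m * G m k) + t k u * (\<Sum>m<n. G u m * H m l - H u m * G m l)) = 0"
proof -
  have I: "(\<Sum>u<n. t u l * F u k) = - (\<Sum>u<n. t k u * F u l)" if "invariant t F" "k < n" "l < n" for F k l
    using that unfolding invariant_def sum.distrib by (simp add: eq_neg_iff_add_eq_0)
  have A: "(\<Sum>u<n. t u l * (\<Sum>m<n. F u m * E m k)) = - (\<Sum>m<n. \<Sum>u<n. t m u * F u l * E m k)"
    if F: "invariant t F" and l: "l < n" for F E k l
  proof -
    have "(\<Sum>u<n. t u l * (\<Sum>m<n. F u m * E m k)) = (\<Sum>m<n. (\<Sum>u<n. t u l * F u m) * E m k)"
      unfolding sum_distrib_left sum_distrib_right by (subst sum.swap) (simp add: mult.assoc)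
    also have "\<dots> = (\<Sum>m<n. - (\<Sum>u<n. t m u * F u l) * E m k)"
      using I[OF F _ l] by (intro sum.cong refl) simp
    finally show ?thesis by (simp add: sum_negf sum_distrib_right)
  qed
  have B: "(\<Sum>u<n. t k u * (\<Sum>m<n. F u m * E m l)) = - (\<Sum>m<n. \<Sum>u<n. t u m * F u k * E m l)"
    if F: "invariant t F" and k: "k < n" for F E k l
  proof -
    have "(\<Sum>u<n. t k u * (\<Sum>m<n. F u m * E m l)) = (\<Sum>m<n. (\<Sum>u<n. t k u * F u m) * E m l)"
      unfolding sum_distrib_left sum_distrib_right by (subst sum.swap) (simp add: mult.assoc)
    also have "\<dots> = (\<Sum>m<n. - (\<Sum>u<n. t u m * F u k) * E m l)"
      using I[OF F k] by (intro sum.cong refl) simp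
    finally show ?thesis by (simp add: sum_negf sum_distrib_right)
  qed
  have "(\<Sum>m<n. \<Sum>u<n. t u m * F u k * E m l) = (\<Sum>m<n. \<Sum>u<n. t m u * E u l * F m k)" for F E k l
    by (subst sum.swap) (simp add: ac_simps)
  note S = this
  show ?thesis
    unfolding sum_subtractf right_diff_distrib sum.distrib A[OF G l] A[OF H l] B[OF G k] B[OF H k] S
    by simp
qed

text \<open>\<open>P i j\<close> is a commutator of Christoffel matrices plus a linear combination
  of such matrices, and all of these preserve \<open>s\<close>.\<close>

lemma s_P:
  assumes "i < n" "j < n" "v < n" "q < n"
  shows "(\<Sum>u<n. s u v * P i j u q + s u q * P i j u v) = 0"
proof -
  have s: "s u q = s q u" if "u < n" for u using s_symmetric[OF that assms(4)] .
  have "(\<Sum>u<n. s u v * P i j u q + s u q * P i j u v) = (\<Sum>u<n. s u v * P i j u q + s q u * P i j u v)"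
    by (intro sum.cong refl) (simp add: s)
  also have "\<dots> = (\<Sum>u<n. s u v * (\<Sum>m<n. \<Gamma> i u m * \<Gamma> j m q - \<Gamma> j u m * \<Gamma> i m q) +
      s q u * (\<Sum>m<n. \<Gamma> i u m * \<Gamma> j m v - \<Gamma> j u m * \<Gamma> i m v)) +
    (\<Sum>u<n. \<Sum>k<n. C i j k * (s u v * \<Gamma> k u q + s q u * \<Gamma> k u v))"
    unfolding sum.distrib[symmetric]
  proof (rule sum.cong[OF refl])
    fix u
    have "(\<Sum>k<n. C i j k * (s u v * \<Gamma> k u q + s q u * \<Gamma> k u v)) =
      s u v * (\<Sum>k<n. C i j k * \<Gamma> k u q) + s q u * (\<Sum>k<n. C i j k * \<Gamma> k u v)"
      by (simp add: sum_distrib_left sum.distrib distrib_left mult.left_commute)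
    then show "s u v * P i j u q + s q u * P i j u v = s u v * (\<Sum>m<n. \<Gamma> i u m * \<Gamma> j m q - \<Gamma> j u m * \<Gamma> i m q) +
      s q u * (\<Sum>m<n. \<Gamma> i u m * \<Gamma> j m v - \<Gamma> j u m * \<Gamma> i m v) +
      (\<Sum>k<n. C i j k * (s u v * \<Gamma> k u q + s q u * \<Gamma> k u v))"
      unfolding P_def distrib_left[of "s u v" "\<Sum>m<n. _ m"] distrib_left[of "s q u" "\<Sum>m<n. _ m"] by (simp only: add_ac)
  qed
  also have "(\<Sum>u<n. \<Sum>k<n. C i j k * (s u v * \<Gamma> k u q + s q u * \<Gamma> k u v)) =
    (\<Sum>k<n. C i j k * (\<Sum>u<n. s u v * \<Gamma> k u q + s q u * \<Gamma> k u v))"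
    unfolding sum_distrib_left by (rule sum.swap)
  also have "\<dots> = 0"
    using invariant_s assms by (intro sum.neutral) (simp add: invariant_def)
  finally show ?thesis
    using invariant_commutator[OF invariant_s invariant_s assms(4,3), OF assms(1,2)] by simp
qed

lemma parallel:
  assumes "i < n" "k < n" "l < n"
  shows "(\<Sum>m<n. \<pi> m l * \<Gamma> i m k + \<pi> k m * \<Gamma> i m l) = 0"
proof -
  have "(\<Sum>m<n. \<pi> m l * \<Gamma> i m k + \<pi> k m * \<Gamma> i m l) =
    (\<Sum>m<n. r m l * \<Gamma> i m k + r k m * \<Gamma> i m l) + (\<Sum>m<n. s m l * \<Gamma> i m k + s k m * \<Gamma> i m l)"
    unfolding sum.distrib[symmetric] by (intro sum.cong refl) (simp add: algebra_simps)
  then show ?thesis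
    using invariant_r[OF assms(1)] invariant_s[OF assms(1)] assms by (simp add: invariant_def)
qed

text \<open>The geometric conditions do not involve the coefficients, so they are checked once for
  all coefficient algebras.\<close>

lemma fedosov_intro:
  assumes alg: "assoc_algebra (sc :: 'r \<Rightarrow> 'v::ring_1 \<Rightarrow> 'v)"
    and act_add: "\<And>i x y. act i (x + y) = act i x + act i y"
    and act_sc: "\<And>i c x. act i (sc c x) = sc c (act i x)"
    and act_mult: "\<And>i x y. act i (x * y) = act i x * y + x * act i y"
    and act_commutator: "\<And>i j x. i < n \<Longrightarrow> j < n \<Longrightarrow>
      act i (act j x) - act j (act i x) = (\<Sum>k<n. sc (C i j k) (act k x))"
  shows "fedosov sc n \<pi> C \<Gamma> act r s \<omega> Q P"
proof -
  interpret alg sc using alg by unfold_locales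
  interpret connection sc n \<pi> C \<Gamma> act
    by unfold_locales (rule C_antisym torsion jacobi parallel act_add act_sc act_mult act_commutator; assumption)+
  show ?thesis
    by unfold_locales (rule r_antisym s_symmetric r_w Q_sym r_Q s_P | assumption | simp add: P_def commutator_def)+
qed

abbreviation Om :: "'r weyl" where "Om \<equiv> weyl_of_form \<Omega>"

lemma Om_space: "Om \<in> weyl_space n 2 2"
proof (rule weyl_spaceI)
  fix M J m assume nz: "Om M J $ m \<noteq> 0"
  then have M: "M = {#}" and J: "\<Omega> J $ m \<noteq> 0" by (auto simp: weyl_of_form_def split: if_splits)
  then have "\<Omega> J \<noteq> 0" by auto
  moreover have "m \<noteq> 0" using J Omega_form by (auto simp: formal_forms_def intro: gr0I)
  ultimately show "set_mset M \<subseteq> {..<n} \<and> J \<subseteq> {..<n} \<and> card J = 2 \<and> 2 \<le> size M + 2 * m"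
    using M Omega_form by (simp add: formal_forms_def)
qed

lemma sym_ins_Om: "sym_ins i Om = 0"
  by (intro ext) (simp add: sym_ins_def weyl_of_form_def)

lemma D_Om: "weyl_D n C \<Gamma> (*) Om = 0"
proof -
  have "nabla_sym n \<Gamma> (*) i Om = 0" for i
  proof -
    have "weyl_scale (*) c (sym_mul j 0) = (0 :: 'r weyl)" for c j
      by (intro ext fps_ext) (simp add: weyl_scale_def fps_scale_def fps_map_def sym_mul_def)
    then show ?thesis unfolding nabla_sym_def sym_ins_Om by (simp only: sum.neutral_const minus_zero)
  qed
  moreover have "chevalley_eilenberg n C (fps_scale (*)) (Om M) = 0" for M
  proof (cases "M = {#}")
    case True
    then have "Om M = \<Omega>" by (intro ext) (simp add: weyl_of_form_def)
    then show ?thesis by (simp only: Omega_closed)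
  next
    case False
    then have z: "Om M = 0" by (intro ext) (simp add: weyl_of_form_def)
    have "ext_ins k (0 :: 'r fps ext) = 0" "ext_mul k (0 :: 'r fps ext) = 0" for k
      by (intro ext; simp add: ext_ins_below ext_mul_below)+
    moreover have "ext_scale (fps_scale (*)) c (0 :: 'r fps ext) = 0" for c
      by (intro ext fps_ext) (simp add: ext_scale_def fps_scale_def fps_map_def)
    ultimately show ?thesis
      unfolding chevalley_eilenberg_def z by (simp only: sum.neutral_const minus_zero)
  qed
  ultimately show ?thesis
    unfolding weyl_D_def by (simp only: alt_mul.zero sum.neutral_const) (simp add: fun_eq_iff)
qed

end

section \<open>Inverses and bilinear maps on the tensor square\<close>

lemma assoc_algebra_times: "assoc_algebra ((*) :: 'r::comm_ring_1 \<Rightarrow> 'r \<Rightarrow> 'r)"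
  unfolding assoc_algebra_def module_def by (simp add: algebra_simps)

lemma fps_bilin_nth: "fps_bilin p f g $ m = (\<Sum>i\<le>m. p (f $ i) (g $ (m - i)))"
  by (simp add: fps_bilin_def)

lemma fps_map_nth: "fps_map h f $ m = h (f $ m)"
  by (simp add: fps_map_def)

context tensor_env
begin

abbreviation unit2 :: 'a where
  "unit2 \<equiv> j 1 * j 1"

lemma fps_bilin_fm_assoc:
  assumes F: "\<And>m. F $ m \<in> T 2" and G: "\<And>m. G $ m \<in> T 2" and H: "\<And>m. H $ m \<in> T 2"
  shows "fps_bilin fm (fps_bilin fm F G) H = fps_bilin fm F (fps_bilin fm G H)"
proof (rule fps_ext)
  fix m
  have "(\<Sum>k=0..m. \<Sum>i=0..k. fm (fm (F $ i) (G $ (k - i))) (H $ (m - k))) =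
    (\<Sum>k=0..m. \<Sum>i=0..m - k. fm (fm (F $ k) (G $ i)) (H $ (m - k - i)))"
    by (rule fps_mult_assoc_lemma)
  then show "fps_bilin fm (fps_bilin fm F G) H $ m = fps_bilin fm F (fps_bilin fm G H) $ m"
    by (simp add: fps_bilin_nth fm_sum_left fm_sum_right fm_assoc[OF F G H] atLeast0AtMost)
qed

text \<open>Course-of-values recursion by function update: since the leading coefficient of
  \<open>F\<close> is the unit, each new value solves the next convolution equation.\<close>

primrec inverse_seq :: "'a fps \<Rightarrow> nat \<Rightarrow> nat \<Rightarrow> 'a" where
  "inverse_seq F 0 = (\<lambda>_. unit2)"
| "inverse_seq F (Suc m) =
    (inverse_seq F m)(Suc m := - (\<Sum>i\<le>m. fm (F $ (Suc m - i)) (inverse_seq F m i)))"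

lemma inverse_seq_stable: "i \<le> m \<Longrightarrow> inverse_seq F m i = inverse_seq F i i"
proof (induction m)
  case (Suc m)
  then show ?case by (cases "i = Suc m") simp_all
qed simp

lemma right_inverse:
  assumes F: "\<And>m. F $ m \<in> T 2" and F0: "F $ 0 = unit2"
  obtains G where "\<And>m. G $ m \<in> T 2" "G $ 0 = unit2" "fps_bilin fm F G = fps_const unit2"
proof
  define G where "G = Abs_fps (\<lambda>m. inverse_seq F m m)"
  show G0: "G $ 0 = unit2" by (simp add: G_def)
  have GS: "G $ Suc m = - (\<Sum>i\<le>m. fm (F $ (Suc m - i)) (G $ i))" for m
  proof -
    have "(\<Sum>i\<le>m. fm (F $ (Suc m - i)) (inverse_seq F m i)) = (\<Sum>i\<le>m. fm (F $ (Suc m - i)) (inverse_seq F i i))"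
      by (rule sum.cong[OF refl]) (simp only: atMost_iff inverse_seq_stable[of _ m])
    then show ?thesis by (simp add: G_def del: inverse_seq.simps(1))
  qed
  have minus: "- a \<in> T 2" if "a \<in> T 2" for a
    using T_sc[OF that, of "- 1"] by (simp add: A.scale_minus_left)
  show G: "G $ m \<in> T 2" for m
  proof (induction m rule: less_induct)
    case (less m)
    then show ?case by (cases m) (auto simp: G0 GS T2_jj intro!: minus T_sum T2_fm F)
  qed
  show "fps_bilin fm F G = fps_const unit2"
  proof (rule fps_ext)
    fix m
    show "fps_bilin fm F G $ m = fps_const unit2 $ m"
    proof (cases m)
      case 0
      then show ?thesis by (simp add: fps_bilin_nth F0 G0 fm_one T2_jj)
    next
      case (Suc k)
      have "fps_bilin fm F G $ m = fm (F $ 0) (G $ Suc k) + (\<Sum>i\<le>k. fm (F $ Suc i) (G $ (k - i)))"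
        unfolding fps_bilin_nth Suc sum.atMost_Suc_shift by simp
      also have "(\<Sum>i\<le>k. fm (F $ Suc i) (G $ (k - i))) = (\<Sum>i\<le>k. fm (F $ (Suc k - i)) (G $ i))"
        by (rule sum.reindex_bij_witness[of _ "\<lambda>i. k - i" "\<lambda>i. k - i"]) (auto simp: Suc_diff_le)
      also have "fm (F $ 0) (G $ Suc k) = G $ Suc k" unfolding F0 by (rule fm_one(1)[OF G])
      finally show ?thesis by (simp add: GS Suc)
    qed
  qed
qed

text \<open>A right inverse \<open>G\<close> starts with the unit again and so has a right inverse
  \<open>H\<close> of its own; associativity gives \<open>H = F\<close>.\<close>

lemma inverse:
  assumes F: "\<And>m. F $ m \<in> T 2" and F0: "F $ 0 = unit2"
  shows "\<exists>G. (\<forall>m. G $ m \<in> T 2) \<and> fps_bilin fm F G = fps_const unit2 \<and> fps_bilin fm G F = fps_const unit2"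
proof -
  have one: "fps_bilin fm H (fps_const unit2) = H" "fps_bilin fm (fps_const unit2) H = H" if H: "\<And>m. H $ m \<in> T 2" for H
  proof -
    show "fps_bilin fm H (fps_const unit2) = H"
    proof (rule fps_ext)
      fix m
      have "fps_bilin fm H (fps_const unit2) $ m = (\<Sum>i\<le>m. if i = m then H $ m else 0)"
        unfolding fps_bilin_nth using fm_one(2)[OF H] by (intro sum.cong refl) (auto simp: fm_0)
      then show "fps_bilin fm H (fps_const unit2) $ m = H $ m" by simp
    qed
    show "fps_bilin fm (fps_const unit2) H = H"
    proof (rule fps_ext)
      fix m
      have "fps_bilin fm (fps_const unit2) H $ m = (\<Sum>i\<le>m. if i = 0 then H $ m else 0)"
        unfolding fps_bilin_nth using fm_one(1)[OF H] by (intro sum.cong refl) (auto simp: fm_0)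
      then show "fps_bilin fm (fps_const unit2) H $ m = H $ m" by simp
    qed
  qed
  obtain G where G: "\<And>m. G $ m \<in> T 2" "G $ 0 = unit2" and FG: "fps_bilin fm F G = fps_const unit2"
    using right_inverse[OF F F0] by blast
  obtain H where H: "\<And>m. H $ m \<in> T 2" and GH: "fps_bilin fm G H = fps_const unit2"
    using right_inverse[OF G] by blast
  have "H = fps_bilin fm (fps_bilin fm F G) H" unfolding FG by (rule one(2)[OF H, symmetric])
  also have "\<dots> = F" unfolding fps_bilin_fm_assoc[OF F G(1) H] GH by (rule one(1)[OF F])
  finally have "fps_bilin fm G F = fps_const unit2" using GH by simp
  with G(1) FG show ?thesis by blast
qed

lemma bilinear_mult:
  assumes "module_hom scU scA f" "module_hom scU scA g"
  shows "bilinear_map scU scU scA (\<lambda>u v. f u * g v)"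
  using assms by (simp add: bilinear_map_def module_hom_iff distrib_left distrib_right A.sc_mult_left A.sc_mult_right)

lemma j_hom: "module_hom scU scA j"
  by (simp add: module_hom_iff U.module_axioms A.module_axioms j_add j_sc)

lemma counit_hom: "module_hom scU scA (\<lambda>u. scA (counit scU \<iota> u) 1)"
  using counit(1) by (simp add: module_hom_iff A.module_axioms A.scale_left_distrib)

lemma coproduct_hom: "module_hom scU scA (coproduct scU \<iota> scA j)"
  unfolding coproduct_ev[abs_def] by (rule ev_hom)

lemma on2_add: "bilinear_map scU scU scA b \<Longrightarrow> on_tensors2 scA j b (x + y) = on_tensors2 scA j b x + on_tensors2 scA j b y"
  and on2_sc: "bilinear_map scU scU scA b \<Longrightarrow> on_tensors2 scA j b (scA c x) = scA c (on_tensors2 scA j b x)"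
  using on_tensors2(1) by (auto simp: module_hom_iff)

lemma on2_0: "bilinear_map scU scU scA b \<Longrightarrow> on_tensors2 scA j b 0 = 0"
  by (rule module_hom.zero) (rule on_tensors2(1))

text \<open>For this bilinear map \<open>on_tensors2\<close> is the projection of \<open>A\<close>
  onto its part of degree 2.\<close>

lemma on_tensors2_jj_T2: "on_tensors2 scA j (\<lambda>u v. j u * j v) a \<in> T 2"
proof (induction a rule: A_induct)
  case (pure us)
  note b = bilinear_mult[OF j_hom j_hom]
  show ?case
  proof (cases "length us = 2")
    case True
    then obtain u v where "us = [u, v]" by (auto simp: length_2_cases)
    then show ?thesis using on_tensors2(2)[OF b, of u v] T2_jj by simp
  qed (simp add: on_tensors2(3)[OF b] T_0)
qed (simp_all add: on2_add on2_sc on2_0 bilinear_mult[OF j_hom j_hom] T_add T_sc T_0)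

lemma ev_coproduct: "a \<in> T 2 \<Longrightarrow> fm (coproduct scU \<iota> scA j u) a = ev a u"
  by (simp add: coproduct_ev ev_fm T2_jj fm_one)

lemma coproduct_T2: "coproduct scU \<iota> scA j u \<in> T 2"
  unfolding coproduct_ev by (rule ev_T2[OF T2_jj])

text \<open>Factorwise multiplication by a coproduct becomes the action on \<open>a\<close>. This
  turns a side of the twist equation into a star product.\<close>

lemma on_tensors2_ev_left:
  assumes t: "t \<in> T 2" and a: "a \<in> T 2"
  shows "fm (on_tensors2 scA j (\<lambda>u v. coproduct scU \<iota> scA j u * j v) t) (a * j 1) =
    on_tensors2 scA j (\<lambda>u v. ev a u * j v) t"
proof -
  note b1 = bilinear_mult[OF coproduct_hom j_hom] and b2 = bilinear_mult[OF ev_hom[of a] j_hom]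
  from t show ?thesis
  proof (induction t rule: T2_induct)
    case (jj u v)
    show ?case
      unfolding on_tensors2(2)[OF b1] on_tensors2(2)[OF b2] fm_concat_right[OF coproduct_T2 a] ev_coproduct[OF a] by simp
  qed (simp_all add: on2_add[OF b1] on2_add[OF b2] on2_sc[OF b1] on2_sc[OF b2] on2_0[OF b1] on2_0[OF b2]
      fm_add_left fm_sc_left fm_0)
qed

lemma on_tensors2_ev_right:
  assumes t: "t \<in> T 2" and a: "a \<in> T 2"
  shows "fm (on_tensors2 scA j (\<lambda>u v. j u * coproduct scU \<iota> scA j v) t) (j 1 * a) =
    on_tensors2 scA j (\<lambda>u v. j u * ev a v) t"
proof -
  note b1 = bilinear_mult[OF j_hom coproduct_hom] and b2 = bilinear_mult[OF j_hom ev_hom[of a]]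
  from t show ?thesis
  proof (induction t rule: T2_induct)
    case (jj u v)
    show ?case
      unfolding on_tensors2(2)[OF b1] on_tensors2(2)[OF b2] fm_concat_left[OF coproduct_T2 a] ev_coproduct[OF a] by simp
  qed (simp_all add: on2_add[OF b1] on2_add[OF b2] on2_sc[OF b1] on2_sc[OF b2] on2_0[OF b1] on2_0[OF b2]
      fm_add_left fm_sc_left fm_0)
qed

end

lemma weyl_space_wmap: "a \<in> weyl_space n k l \<Longrightarrow> h 0 = 0 \<Longrightarrow> wmap h a \<in> weyl_space n k l"
  by (rule weyl_spaceI) (metis weyl_spaceD wmap_nth)

section \<open>The twist\<close>

locale twist_data = symplectic_data scG br n e r \<omega> s nabla \<Omega> + tensor_env scG br scU \<iota> scA j
  for scG :: "'r::ring_containing_rat \<Rightarrow> 'g::ab_group_add \<Rightarrow> 'g" and br n e r \<omega> s nabla \<Omega>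
    and scU :: "'r \<Rightarrow> 'u::ring_1 \<Rightarrow> 'u" and \<iota> and scA :: "'r \<Rightarrow> 'a::ring_1 \<Rightarrow> 'a" and j
begin

abbreviation actR :: "nat \<Rightarrow> 'r \<Rightarrow> 'r" where "actR \<equiv> (\<lambda>i x. 0)"
abbreviation actA :: "nat \<Rightarrow> 'a \<Rightarrow> 'a" where "actA \<equiv> (\<lambda>i. LA (e i))"
abbreviation actU :: "nat \<Rightarrow> 'u \<Rightarrow> 'u" where "actU \<equiv> (\<lambda>i u. \<iota> (e i) * u)"
abbreviation emb :: "'r \<Rightarrow> 'a" where "emb \<equiv> (\<lambda>c. scA c 1)"

lemma weyl_L_0: "weyl_L n actR a = 0"
proof -
  have "(\<lambda>M J. fps_map (\<lambda>x. 0) (a M J)) = (0 :: 'r weyl)" for a :: "'r weyl"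
    by (intro ext fps_ext) (simp add: fps_map_nth)
  then show ?thesis unfolding weyl_L_def by (simp only: alt_mul.zero sum.neutral_const)
qed

text \<open>Scalar coefficients with zero action: \<rho> is constructed here, and here the counit of
  \<open>tauU\<close> lands.\<close>

interpretation R: fedosov "(*)" n \<pi> C \<Gamma> actR r s \<omega> Q P
  by (rule fedosov_intro[OF assoc_algebra_times]) simp_all

lemma R_Dop: "R.Dop a = weyl_D n C \<Gamma> (*) a"
  unfolding R.weyl_D_plus_L[symmetric] weyl_L_0 by (rule add_0_right)

interpretation R: fedosov_form "(*)" n \<pi> C \<Gamma> actR r s \<omega> Q P Om
  by unfold_locales (simp_all only: Om_space sym_ins_Om R_Dop D_Om mult.commute)

definition \<rho>0 :: "'r weyl" where
  "\<rho>0 = fedosov_rho n C \<Gamma> \<pi> (weyl_curvature scG br n e nabla \<omega>) \<Omega>"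

lemma \<rho>0: "\<rho>0 \<in> weyl_space n 2 1 \<and> R.fedosov_eq \<rho>0 \<and> delta_inv n (*) \<rho>0 = 0"
proof -
  have curv: "R.curv = weyl_curvature scG br n e nabla \<omega>"
    unfolding R.curv_def weyl_curvature_def Q_def ..
  have "\<rho>0 = (THE \<rho>. \<rho> \<in> weyl_space n 2 1 \<and> R.fedosov_eq \<rho> \<and> delta_inv n (*) \<rho> = 0)"
    unfolding \<rho>0_def fedosov_rho_def R.fedosov_eq_def R_Dop curv ..
  then show ?thesis using theI'[OF R.rho_ex1[OF mult.commute]] by (simp only:)
qed

interpretation R: fedosov_scalar "(*)" n \<pi> C \<Gamma> actR r s \<omega> Q P Om \<rho>0 \<rho>0
  by unfold_locales (use \<rho>0 in \<open>simp_all add: mult.commute\<close>)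

interpretation E: scaled_coeff emb "(*)" scA
  by unfold_locales (simp_all add: A.scale_left_distrib)

lemma emb_mult: "emb x * emb y = emb (x * y)"
  by (simp add: A.sc_mult_left)

lemma emb_central: "wmap emb a M J * f = f * wmap emb a M J"
proof (rule fps_ext)
  fix m
  have "(f * wmap emb a M J) $ m = (\<Sum>i=0..m. wmap emb a M J $ (m - i) * f $ i)"
    by (simp add: fps_mult_nth wmap_nth A.sc_mult_left A.sc_mult_right)
  also have "\<dots> = (wmap emb a M J * f) $ m"
    unfolding fps_mult_nth by (rule sum.reindex_bij_witness[of _ "\<lambda>i. m - i" "\<lambda>i. m - i"]) auto
  finally show "(wmap emb a M J * f) $ m = (f * wmap emb a M J) $ m" by simp
qed

interpretation A: fedosov scA n \<pi> C \<Gamma> actA r s \<omega> Q P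
proof (rule fedosov_intro)
  show "assoc_algebra scA" by (rule A.assoc_algebra)
  fix i k x assume "i < n" "k < n"
  have add: "additive (\<lambda>x. LA x a)" for a by (simp add: additive_def LA_lie_add)
  show "LA (e i) (LA (e k) x) - LA (e k) (LA (e i) x) = (\<Sum>l<n. scA (C i k l) (LA (e l) x))"
    unfolding LA_br by (subst expand[of "br (e i) (e k)"]) (simp add: additive.sum[OF add] LA_lie_sc coeffs_def)
qed (simp_all add: LA_add LA_sc LA_mult)

lemma act_1: "actA i 1 = 0"
  by (rule A.act_1)

lemma A_Dop_emb: "A.Dop (wmap emb a) = wmap emb (weyl_D n C \<Gamma> (*) a)"
proof -
  have "weyl_L n actA (wmap emb a) = wmap emb (weyl_L n actR a)"
    by (rule E.wmap_L) (simp add: LA_sc act_1)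
  then show ?thesis
    unfolding A.weyl_D_plus_L[symmetric] weyl_L_0 E.wmap_zero E.wmap_D by (simp only: add_0_right)
qed

lemma emb_circ: "weyl_circ n \<pi> (*) scA (wmap emb a) (wmap emb b) = wmap emb (weyl_circ n \<pi> (*) (*) a b)"
  by (rule E.wmap_circ[OF E.additive_coeff_axioms E.additive_coeff_axioms]) (rule emb_mult)

lemma emb_curv: "wmap emb R.curv = A.curv"
proof -
  have "fps_map emb 1 = 1"
    by (rule fps_ext) (simp add: fps_map_nth)
  then show ?thesis
    unfolding R.curv_def A.curv_def E.wmap_sum E.wmap_scale E.wmap_sym_mul E.wmap_alt_mul E.wmap_embed by (simp only:)
qed

interpretation A: fedosov_form scA n \<pi> C \<Gamma> actA r s \<omega> Q P "wmap emb Om"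
proof unfold_locales
  show "wmap emb Om \<in> weyl_space n 2 2" by (rule weyl_space_wmap[OF Om_space]) simp
  show "sym_ins i (wmap emb Om) = 0" for i
    unfolding E.wmap_sym_ins[symmetric] sym_ins_Om by (rule E.wmap_zero)
  show "A.Dop (wmap emb Om) = 0"
    unfolding A_Dop_emb D_Om by (rule E.wmap_zero)
qed (rule emb_central)

interpretation A: fedosov_scalar scA n \<pi> C \<Gamma> actA r s \<omega> Q P "wmap emb Om" "wmap emb \<rho>0" \<rho>0
proof unfold_locales
  show "wmap emb \<rho>0 \<in> weyl_space n 2 1" by (rule weyl_space_wmap[OF \<rho>0[THEN conjunct1]]) simp
  have "delta n \<rho>0 = R.curv + weyl_D n C \<Gamma> (*) \<rho>0 + weyl_divide_t (weyl_circ n \<pi> (*) (*) \<rho>0 \<rho>0) + Om"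
    using \<rho>0 unfolding R.fedosov_eq_def R_Dop by blast
  then have "wmap emb (delta n \<rho>0) =
    wmap emb (R.curv + weyl_D n C \<Gamma> (*) \<rho>0 + weyl_divide_t (weyl_circ n \<pi> (*) (*) \<rho>0 \<rho>0) + Om)"
    by (simp only:)
  then show "A.fedosov_eq (wmap emb \<rho>0)"
    unfolding A.fedosov_eq_def A_Dop_emb emb_circ E.wmap_divide[symmetric] E.wmap_delta E.wmap_add emb_curv .
qed (use \<rho>0 in \<open>simp_all only: emb_central\<close>)

definition F :: "'a fps" where
  "F = A.star (fps_const (j 1)) (fps_const (j 1))"

lemma tensor_star_eq: "tensor_star scG br n e r \<omega> nabla s \<Omega> \<iota> scA j \<xi> \<eta> = A.star \<xi> \<eta>"
  unfolding tensor_star_def Let_def \<rho>0_def[symmetric] by (rule A.fedosov_star_eq)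

definition tauU :: "'u weyl" where
  "tauU = tau_sum n C \<Gamma> \<pi> scU actU \<rho>0 1"

lemma fps_map_one: "h 0 = 0 \<Longrightarrow> fps_map h 1 = fps_const (h 1)"
  by (rule fps_ext) (simp add: fps_map_nth)

lemma tau_ev: "A.tau (fps_const a) = wmap (ev a) tauU"
proof -
  interpret ev: scaled_coeff "ev a" scU scA
    by unfold_locales (simp_all add: ev_add ev_sc)
  have "wmap (ev a) tauU = tau_sum n C \<Gamma> \<pi> scA actA \<rho>0 (fps_map (ev a) 1)"
    unfolding tauU_def by (rule ev.wmap_tau_sum) (simp add: ev_\<iota>)
  also have "fps_map (ev a) 1 = fps_const a" by (simp add: fps_map_one ev_0 ev_1)
  finally show ?thesis by (simp only: A.tau_sum_eq)
qed

text \<open>The counit kills \<open>\<iota> (e i) * u\<close>, so it intertwines left multiplication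
  with the zero action, and naturality applies.\<close>

lemma tau_counit: "wmap (counit scU \<iota>) tauU = weyl_embed 1"
proof -
  interpret c: scaled_coeff "counit scU \<iota>" scU "(*)"
    using counit(1) by unfold_locales (simp_all add: module_hom_iff)
  have "wmap (counit scU \<iota>) tauU = tau_sum n C \<Gamma> \<pi> (*) actR \<rho>0 (fps_map (counit scU \<iota>) 1)"
    unfolding tauU_def by (rule c.wmap_tau_sum) (simp add: counit(3,4))
  also have "fps_map (counit scU \<iota>) 1 = 1" by (simp add: fps_map_one c.zero counit(2))
  finally show ?thesis by (simp only: R.tau_sum_eq R.tau_one)
qed

lemma ev_j_1: "ev (j 1) = j"
  by (rule ext) (simp add: ev_j)

abbreviation jj :: "'u \<Rightarrow> 'u \<Rightarrow> 'a" where "jj \<equiv> (\<lambda>u v. j u * j v)"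

lemma F_circ: "F = weyl_proj (weyl_circ n \<pi> jj scA tauU tauU)"
proof -
  interpret i: scaled_coeff "\<lambda>x :: 'a. x" scA scA by unfold_locales simp_all
  have j: "additive_coeff j" by unfold_locales (rule j_add)
  have "weyl_circ n \<pi> (*) scA (wmap j tauU) (wmap j tauU) = wmap (\<lambda>x. x) (weyl_circ n \<pi> jj scA tauU tauU)"
    by (rule i.wmap_circ[OF j j]) (rule refl)
  then show ?thesis unfolding F_def A.star_def tau_ev ev_j_1 by (simp only: wmap_ident)
qed

text \<open>The bilinear map \<open>b\<close> factors through \<open>j u * j v\<close>, so products
  of images of \<open>tauU\<close> are all images of the single series \<open>F\<close>.\<close>

lemma circ_on_tensors2:
  assumes b: "bilinear_map scU scU scA b" and h: "additive_coeff h1" "additive_coeff h2"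
    and eq: "\<And>u v. h1 u * h2 v = b u v"
  shows "weyl_proj (weyl_circ n \<pi> (*) scA (wmap h1 tauU) (wmap h2 tauU)) = fps_map (on_tensors2 scA j b) F"
proof -
  interpret k: scaled_coeff "on_tensors2 scA j b" scA scA
    by unfold_locales (simp_all add: on2_add[OF b] on2_sc[OF b])
  have "weyl_circ n \<pi> (*) scA (wmap h1 tauU) (wmap h2 tauU) =
    wmap (on_tensors2 scA j b) (weyl_circ n \<pi> jj scA tauU tauU)"
    by (rule k.wmap_circ[OF h]) (simp add: eq on_tensors2(2)[OF b])
  then show ?thesis unfolding F_circ by (simp add: weyl_proj_def wmap_def)
qed

lemma additive_ev: "additive_coeff (ev a)"
  by unfold_locales (rule ev_add)

lemma star_ev:
  "A.star (fps_const a) (fps_const b) = fps_map (on_tensors2 scA j (\<lambda>u v. ev a u * ev b v)) F"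
  unfolding A.star_def tau_ev
  by (rule circ_on_tensors2[OF bilinear_mult[OF ev_hom ev_hom] additive_ev additive_ev]) (rule refl)

text \<open>Since \<open>ev (j 1) = j\<close>, the series \<open>F\<close> is fixed by the
  projection onto degree 2.\<close>

lemma F_T2: "F $ m \<in> T 2"
proof -
  have "F = fps_map (on_tensors2 scA j jj) F"
    using star_ev[of "j 1" "j 1"] unfolding F_def[symmetric] ev_j_1 .
  then have "F $ m = on_tensors2 scA j jj (F $ m)" by (metis fps_map_nth)
  then show ?thesis using on_tensors2_jj_T2 by metis
qed

lemma F_0: "F $ 0 = unit2"
  unfolding F_def by (rule A.star_const_0)

lemma F_1: "F $ 1 = (\<Sum>i<n. \<Sum>k<n. scA (rat_const (1/2) * (r i k + s i k)) (j (\<iota> (e i)) * j (\<iota> (e k))))"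
  unfolding F_def A.star_const_1 LA(2) by simp

text \<open>By \<open>star_nth\<close> the argument \<open>F\<close> is replaced by its
  coefficients. These have degree 2, where the action is multiplication by the coproduct.\<close>

lemma twist_left:
  "fps_bilin fm (fps_map (on_tensors2 scA j (\<lambda>u v. coproduct scU \<iota> scA j u * j v)) F) (F * fps_const (j 1)) =
    A.star F (fps_const (j 1))"
proof (rule fps_ext)
  fix m
  have "A.star F (fps_const (j 1)) $ m =
    (\<Sum>i\<le>m. on_tensors2 scA j (\<lambda>u v. ev (F $ i) u * j v) (F $ (m - i)))"
    unfolding A.star_nth(1)[of F] star_ev ev_j_1 fps_map_nth ..
  also have "\<dots> = (\<Sum>i\<le>m. on_tensors2 scA j (\<lambda>u v. ev (F $ (m - i)) u * j v) (F $ i))"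
    by (rule sum.reindex_bij_witness[of _ "\<lambda>i. m - i" "\<lambda>i. m - i"]) auto
  finally show "fps_bilin fm (fps_map (on_tensors2 scA j (\<lambda>u v. coproduct scU \<iota> scA j u * j v)) F) (F * fps_const (j 1)) $ m =
    A.star F (fps_const (j 1)) $ m"
    by (simp add: fps_bilin_nth fps_map_nth on_tensors2_ev_left[OF F_T2 F_T2])
qed

lemma twist_right:
  "fps_bilin fm (fps_map (on_tensors2 scA j (\<lambda>u v. j u * coproduct scU \<iota> scA j v)) F) (fps_const (j 1) * F) =
    A.star (fps_const (j 1)) F"
proof (rule fps_ext)
  fix m
  have "A.star (fps_const (j 1)) F $ m =
    (\<Sum>i\<le>m. on_tensors2 scA j (\<lambda>u v. j u * ev (F $ i) v) (F $ (m - i)))"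
    unfolding A.star_nth(2)[of _ F] star_ev ev_j_1 fps_map_nth ..
  also have "\<dots> = (\<Sum>i\<le>m. on_tensors2 scA j (\<lambda>u v. j u * ev (F $ (m - i)) v) (F $ i))"
    by (rule sum.reindex_bij_witness[of _ "\<lambda>i. m - i" "\<lambda>i. m - i"]) auto
  finally show "fps_bilin fm (fps_map (on_tensors2 scA j (\<lambda>u v. j u * coproduct scU \<iota> scA j v)) F) (fps_const (j 1) * F) $ m =
    A.star (fps_const (j 1)) F $ m"
    by (simp add: fps_bilin_nth fps_map_nth on_tensors2_ev_right[OF F_T2 F_T2])
qed

lemma tau_counit_emb: "wmap (\<lambda>u. scA (counit scU \<iota> u) 1) tauU = weyl_embed 1"
proof -
  have "wmap (\<lambda>u. scA (counit scU \<iota> u) 1) tauU = wmap emb (weyl_embed 1)"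
    unfolding wmap_wmap[of emb "counit scU \<iota>", symmetric] tau_counit ..
  also have "\<dots> = weyl_embed 1"
    unfolding E.wmap_embed by (simp add: fps_map_one)
  finally show ?thesis .
qed

lemma proj_tauU: "weyl_proj (wmap j tauU) = fps_const (j 1)"
  using A.proj_tau[of "fps_const (j 1)"] unfolding tau_ev ev_j_1 .

lemma wmap_j_space: "wmap j tauU \<in> weyl_space n 0 0"
  using A.weyl_space_tau[of "fps_const (j 1)"] unfolding tau_ev ev_j_1 .

lemma additive_j: "additive_coeff j"
  by unfold_locales (rule j_add)

lemma additive_counit: "additive_coeff (\<lambda>u. scA (counit scU \<iota> u) 1)"
  using counit_hom by unfold_locales (simp add: module_hom_iff)

text \<open>The counit turns the first section into the constant 1, against which the deformed
  product is the undeformed one.\<close>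

lemma counit_left: "fps_map (on_tensors2 scA j (\<lambda>u v. j (scU (counit scU \<iota> u) v))) F = fps_const (j 1)"
proof -
  have e: "(\<lambda>u v. j (scU (counit scU \<iota> u) v)) = (\<lambda>u v. scA (counit scU \<iota> u) 1 * j v)"
    by (simp add: fun_eq_iff j_sc A.sc_mult_left)
  have "fps_map (on_tensors2 scA j (\<lambda>u v. j (scU (counit scU \<iota> u) v))) F =
    weyl_proj (weyl_circ n \<pi> (*) scA (weyl_embed 1) (wmap j tauU))"
    unfolding e tau_counit_emb[symmetric]
    by (rule circ_on_tensors2[OF bilinear_mult[OF counit_hom j_hom] additive_counit additive_j, symmetric]) (rule refl)
  also have "\<dots> = weyl_proj (wmap j tauU)"
    by (simp only: A.circ_const_left A.sym_ins_embed A.mu_one(1)[OF wmap_j_space])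
  finally show ?thesis unfolding proj_tauU .
qed

lemma counit_right: "fps_map (on_tensors2 scA j (\<lambda>u v. j (scU (counit scU \<iota> v) u))) F = fps_const (j 1)"
proof -
  have e: "(\<lambda>u v. j (scU (counit scU \<iota> v) u)) = (\<lambda>u v. j u * scA (counit scU \<iota> v) 1)"
    by (simp add: fun_eq_iff j_sc A.sc_mult_right)
  have "fps_map (on_tensors2 scA j (\<lambda>u v. j (scU (counit scU \<iota> v) u))) F =
    weyl_proj (weyl_circ n \<pi> (*) scA (wmap j tauU) (weyl_embed 1))"
    unfolding e tau_counit_emb[symmetric]
    by (rule circ_on_tensors2[OF bilinear_mult[OF j_hom counit_hom] additive_j additive_counit, symmetric]) (rule refl)
  also have "\<dots> = weyl_proj (wmap j tauU)"
    by (simp only: A.circ_const_right A.sym_ins_embed A.mu_one(2)[OF wmap_j_space])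
  finally show ?thesis unfolding proj_tauU .
qed

lemma F_is_twist: "is_twist scU \<iota> scA j F"
  unfolding is_twist_def
proof (intro conjI allI)
  show "F $ m \<in> T 2" for m by (rule F_T2)
  show "\<exists>G. (\<forall>m. G $ m \<in> T 2) \<and> fps_bilin fm F G = fps_const unit2 \<and> fps_bilin fm G F = fps_const unit2"
    by (rule inverse[OF F_T2 F_0])
  show "fps_bilin fm (fps_map (on_tensors2 scA j (\<lambda>u v. coproduct scU \<iota> scA j u * j v)) F) (F * fps_const (j 1)) =
    fps_bilin fm (fps_map (on_tensors2 scA j (\<lambda>u v. j u * coproduct scU \<iota> scA j v)) F) (fps_const (j 1) * F)"
    unfolding twist_left twist_right unfolding F_def by (rule A.star_assoc)
qed (rule counit_left counit_right F_0)+

lemma F_expansion: "F = fps_const unit2 + fps_X * fps_const (F $ 1) + fps_X ^ 2 * fps_shift 2 F"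
proof (rule fps_ext)
  fix m :: nat
  consider "m = 0" | "m = 1" | "2 \<le> m" by linarith
  then show "F $ m = (fps_const unit2 + fps_X * fps_const (F $ 1) + fps_X ^ 2 * fps_shift 2 F) $ m"
  proof cases
    case 3
    then obtain k where "m = 2 + k" using le_Suc_ex by blast
    then show ?thesis by (simp add: fps_X_power_mult_nth)
  qed (simp_all add: F_0 fps_X_power_mult_nth)
qed

lemma tensor_star_twist:
  "let F = tensor_star scG br n e r \<omega> nabla s \<Omega> \<iota> scA j (fps_const (j 1)) (fps_const (j 1))
    in is_twist scU \<iota> scA j F \<and>
       (\<exists>G. F = fps_const (j 1 * j 1) +
          fps_X * fps_const (\<Sum>i<n. \<Sum>k<n.
            scA (rat_const (1/2) * (r i k + s i k)) (j (\<iota> (e i)) * j (\<iota> (e k)))) +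
          fps_X ^ 2 * G)"
  unfolding Let_def tensor_star_eq F_def[symmetric] F_1[symmetric]
  by (rule conjI, rule F_is_twist, rule exI, rule F_expansion)

end

theorem theorem4p5:
  fixes scG :: "'r::ring_containing_rat \<Rightarrow> 'g::ab_group_add \<Rightarrow> 'g"
    and br :: "'g \<Rightarrow> 'g \<Rightarrow> 'g"
    and n :: nat
    and e :: "nat \<Rightarrow> 'g"
    and r \<omega> s :: "nat \<Rightarrow> nat \<Rightarrow> 'r"
    and nabla :: "'g \<Rightarrow> 'g \<Rightarrow> 'g"
    and \<Omega> :: "'r fps ext"
    and scU :: "'r \<Rightarrow> 'u::ring_1 \<Rightarrow> 'u"
    and \<iota> :: "'g \<Rightarrow> 'u"
    and scA :: "'r \<Rightarrow> 'a::ring_1 \<Rightarrow> 'a"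
    and j :: "'u \<Rightarrow> 'a"
  assumes lie: "lie_algebra scG br"
    and basis: "is_basis scG n e"
    and r_matrix: "classical_r_matrix scG br n e r"
    and nondegenerate: "inverse_matrices n r \<omega>"
    and nabla_bilinear: "bilinear_map scG scG scG nabla"
    and nabla_torsion_free: "torsion_free br nabla"
    and nabla_symplectic: "\<forall>x y z. nabla_form nabla x (two_form scG n e \<omega>) y z = 0"
    and s_symmetric: "\<forall>i<n. \<forall>k<n. s i k = s k i"
    and s_parallel: "\<forall>x. \<forall>i<n. \<forall>k<n. nabla_tensor scG n e nabla x s i k = 0"
    and Omega_form: "\<Omega> \<in> formal_forms n 2"
    and Omega_closed: "chevalley_eilenberg n (coeffs scG n e br) (fps_scale (*)) \<Omega> = 0"
    and enveloping: "is_enveloping_algebra scG br scU \<iota>"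
    and tensor: "is_tensor_algebra scU scA j"
  shows "let F = tensor_star scG br n e r \<omega> nabla s \<Omega> \<iota> scA j (fps_const (j 1)) (fps_const (j 1))
    in is_twist scU \<iota> scA j F \<and>
       (\<exists>G. F = fps_const (j 1 * j 1) +
          fps_X * fps_const (\<Sum>i<n. \<Sum>k<n.
            scA (rat_const (1/2) * (r i k + s i k)) (j (\<iota> (e i)) * j (\<iota> (e k)))) +
          fps_X ^ 2 * G)"
proof (rule twist_data.tensor_star_twist, rule twist_data.intro)
  show "symplectic_data scG br n e r \<omega> s nabla \<Omega>"
  proof (rule symplectic_data.intro)
    show "r i k = - r k i" if "i < n" "k < n" for i k
      using r_matrix that unfolding classical_r_matrix_def by blast
    show "nabla_form nabla x (two_form scG n e \<omega>) y z = 0" for x y z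
      using nabla_symplectic by blast
    show "s i k = s k i" if "i < n" "k < n" for i k
      using s_symmetric[rule_format, OF that] .
    show "nabla_tensor scG n e nabla x s i k = 0" if "i < n" "k < n" for i k x
      using s_parallel[rule_format, OF that] .
  qed (fact lie basis nondegenerate nabla_bilinear nabla_torsion_free Omega_form Omega_closed)+
  show "tensor_env scG br scU \<iota> scA j"
    by (rule tensor_env.intro) (fact enveloping tensor)+
qed

end
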